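(* Let $\mathcal{S}_1\xrightarrow{\phi_1}\mathcal{S}_2\xrightarrow{\phi_2}\mathcal{S}_3\xrightarrow{\phi_3}\cdots$ be an inductive system in the category $\mathbf{OS}$ of operator systems and unital completely positive maps such that each $\phi_k$ is a complete order embedding, and let $\mathcal{T}$ be an operator system. Assume that $\phi_k\otimes\mathrm{id}_{\mathcal{T}}$ is a complete order embedding of $\mathcal{S}_k\otimes_{\mathrm{c}}\mathcal{T}$ into $\mathcal{S}_{k+1}\otimes_{\mathrm{c}}\mathcal{T}$ for every $k\in\mathbb{N}$. Then $\varinjlim_{\mathbf{OS}}(\mathcal{S}_k\otimes_{\mathrm{c}}\mathcal{T})$ (with connecting maps $\phi_k\otimes\mathrm{id}_{\mathcal{T}}$) is unitally completely order isomorphic to $(\varinjlim_{\mathbf{OS}}\mathcal{S}_k)\otimes_{\mathrm{c}}\mathcal{T}$.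
   Context: An operator system (not assumed complete) is a matrix ordered $*$-vector space with an Archimedean matrix order unit. Inductive limits in $\mathbf{OS}$ (objects with compatible unital completely positive maps, universal with this property) exist and are unique up to unital complete order isomorphism. A complete order isomorphism is a linear bijection, completely positive with completely positive inverse; a complete order embedding is a complete order isomorphism onto its image. The universal C*-algebra $C_u^*(\mathcal{S})$ of an operator system $\mathcal{S}$ is a unital C*-algebra with a unital completely isometric embedding $\iota:\mathcal{S}\to C_u^*(\mathcal{S})$ whose image generates it, such that every unital completely positive map $\phi:\mathcal{S}\to\mathcal{A}$ into a C*-algebra extends to a $*$-homomorphism $\widetilde\phi:C_u^*(\mathcal{S})\to\mathcal{A}$ with $\widetilde\phi\circ\iota=\phi$. The commuting tensor product $\mathcal{S}\otimes_{\mathrm{c}}\mathcal{T}$ is the algebraic tensor product $\mathcal{S}\odot\mathcal{T}$ with the operator system structure inherited from its inclusion into the maximal tensor product $C_u^*(\mathcal{S})\otimes_{\max}C_u^*(\mathcal{T})$ of C*-algebras. It is functorial: tensor products of unital completely positive maps are unital completely positive. *)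

theory Defs
  imports
    "HOL-Analysis.Abstract_Metric_Spaces"
    "HOL-Algebra.Subrings"
    "HOL-Algebra.Algebraic_Closure_Type"
    "Jordan_Normal_Form.Matrix"
begin

no_notation eq_closure_of (\<open>closure'_of\<index>\<close>)
no_notation Polynomials.var (\<open>X\<index>\<close>)

section \<open>Vector spaces and the algebraic tensor product\<close>

abbreviation complex_space :: "(complex, 'u, 'm) module_scheme \<Rightarrow> bool" where
  "complex_space V \<equiv> Module.module (ring_of_type_algebra :: complex ring) V"

definition clinear :: "(complex, 'u, 'm) module_scheme \<Rightarrow> (complex, 'v, 'n) module_scheme
    \<Rightarrow> ('u \<Rightarrow> 'v) \<Rightarrow> bool" where
  "clinear V W f \<longleftrightarrow>
     f \<in> carrier V \<rightarrow> carrier W \<and>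
     (\<forall>x\<in>carrier V. \<forall>y\<in>carrier V. f (x \<oplus>\<^bsub>V\<^esub> y) = f x \<oplus>\<^bsub>W\<^esub> f y) \<and>
     (\<forall>c. \<forall>x\<in>carrier V. f (c \<odot>\<^bsub>V\<^esub> x) = c \<odot>\<^bsub>W\<^esub> f x)"

definition cbilinear :: "(complex, 'u, 'm) module_scheme \<Rightarrow> (complex, 'v, 'n) module_scheme
    \<Rightarrow> (complex, 'w, 'k) module_scheme \<Rightarrow> ('u \<Rightarrow> 'v \<Rightarrow> 'w) \<Rightarrow> bool" where
  "cbilinear V W Z b \<longleftrightarrow>
     (\<forall>v\<in>carrier V. clinear W Z (b v)) \<and> (\<forall>w\<in>carrier W. clinear V Z (\<lambda>v. b v w))"

definition cspan :: "(complex, 'u, 'm) module_scheme \<Rightarrow> 'u set \<Rightarrow> 'u set" where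
  "cspan V X = (\<lambda>H. submodule H (ring_of_type_algebra :: complex ring) V) hull X"

text \<open>The space \<open>P\<close> with the map \<open>\<theta>\<close>, read \<open>\<theta> v w = v \<otimes> w\<close>, is the algebraic tensor product
  of \<open>V\<close> and \<open>W\<close>. As in all universal properties below, the test objects have their carriers in the
  same type as the universal object; see the type \<open>univ\<close> at the end.\<close>

definition algebraic_tensor :: "(complex, 'u, 'm) module_scheme \<Rightarrow> (complex, 'u, 'n) module_scheme
    \<Rightarrow> (complex, 'u, 'k) module_scheme \<Rightarrow> ('u \<Rightarrow> 'u \<Rightarrow> 'u) \<Rightarrow> bool" where
  "algebraic_tensor V W P \<theta> \<longleftrightarrow>
     complex_space P \<and> cbilinear V W P \<theta> \<and>
     (\<forall>(Z :: (complex, 'u) module) b. complex_space Z \<and> cbilinear V W Z b \<longrightarrow>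
       (\<exists>f. clinear P Z f \<and> (\<forall>v\<in>carrier V. \<forall>w\<in>carrier W. f (\<theta> v w) = b v w) \<and>
         (\<forall>g. clinear P Z g \<and> (\<forall>v\<in>carrier V. \<forall>w\<in>carrier W. g (\<theta> v w) = b v w) \<longrightarrow>
            (\<forall>x\<in>carrier P. g x = f x))))"

text \<open>The linear map \<open>f = \<phi> \<otimes> \<psi>\<close> between two algebraic tensor products.\<close>

definition tensor_map :: "(complex, 'u, 'm) module_scheme \<Rightarrow> (complex, 'u, 'n) module_scheme
    \<Rightarrow> (complex, 'u, 'k) module_scheme \<Rightarrow> ('u \<Rightarrow> 'u \<Rightarrow> 'u)
    \<Rightarrow> (complex, 'u, 'l) module_scheme \<Rightarrow> ('u \<Rightarrow> 'u \<Rightarrow> 'u)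
    \<Rightarrow> ('u \<Rightarrow> 'u) \<Rightarrow> ('u \<Rightarrow> 'u) \<Rightarrow> ('u \<Rightarrow> 'u) \<Rightarrow> bool" where
  "tensor_map V W P \<theta> P' \<theta>' \<phi> \<psi> f \<longleftrightarrow>
     clinear P P' f \<and> (\<forall>v\<in>carrier V. \<forall>w\<in>carrier W. f (\<theta> v w) = \<theta>' (\<phi> v) (\<psi> w))"

section \<open>\<open>*\<close>-vector spaces and matrices over them\<close>

record 'u star_space = "(complex, 'u) module" +
  adj :: "'u \<Rightarrow> 'u"

definition star_vector_space :: "('u, 'm) star_space_scheme \<Rightarrow> bool" where
  "star_vector_space V \<longleftrightarrow>
     complex_space V \<and> adj V \<in> carrier V \<rightarrow> carrier V \<and>
     (\<forall>x\<in>carrier V. adj V (adj V x) = x) \<and>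
     (\<forall>x\<in>carrier V. \<forall>y\<in>carrier V. adj V (x \<oplus>\<^bsub>V\<^esub> y) = adj V x \<oplus>\<^bsub>V\<^esub> adj V y) \<and>
     (\<forall>c. \<forall>x\<in>carrier V. adj V (c \<odot>\<^bsub>V\<^esub> x) = cnj c \<odot>\<^bsub>V\<^esub> adj V x)"

definition mats :: "('u, 'm) star_space_scheme \<Rightarrow> nat \<Rightarrow> 'u mat set" where
  "mats V n = {X \<in> carrier_mat n n. elements_mat X \<subseteq> carrier V}"

definition mat_zero :: "('u, 'm) star_space_scheme \<Rightarrow> nat \<Rightarrow> 'u mat" where
  "mat_zero V n = mat n n (\<lambda>_. \<zero>\<^bsub>V\<^esub>)"

definition mat_unit :: "('u, 'm) star_space_scheme \<Rightarrow> nat \<Rightarrow> 'u mat" where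
  "mat_unit V n = mat n n (\<lambda>(i, j). if i = j then \<one>\<^bsub>V\<^esub> else \<zero>\<^bsub>V\<^esub>)"

definition mat_add :: "('u, 'm) star_space_scheme \<Rightarrow> 'u mat \<Rightarrow> 'u mat \<Rightarrow> 'u mat" where
  "mat_add V X Y = mat (dim_row X) (dim_col X) (\<lambda>ij. X $$ ij \<oplus>\<^bsub>V\<^esub> Y $$ ij)"

definition mat_smult :: "('u, 'm) star_space_scheme \<Rightarrow> complex \<Rightarrow> 'u mat \<Rightarrow> 'u mat" where
  "mat_smult V c X = map_mat (\<lambda>x. c \<odot>\<^bsub>V\<^esub> x) X"

definition mat_adj :: "('u, 'm) star_space_scheme \<Rightarrow> 'u mat \<Rightarrow> 'u mat" where
  "mat_adj V X = mat (dim_col X) (dim_row X) (\<lambda>(i, j). adj V (X $$ (j, i)))"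

definition mat_mult :: "('u, 'm) star_space_scheme \<Rightarrow> 'u mat \<Rightarrow> 'u mat \<Rightarrow> 'u mat" where
  "mat_mult V X Y = mat (dim_row X) (dim_col Y)
     (\<lambda>(i, j). finsum V (\<lambda>k. X $$ (i, k) \<otimes>\<^bsub>V\<^esub> Y $$ (k, j)) {..<dim_col X})"

text \<open>The matrix \<open>\<alpha>\<^sup>* X \<alpha>\<close> for a scalar matrix \<open>\<alpha>\<close>.\<close>

definition mat_compress :: "('u, 'm) star_space_scheme \<Rightarrow> complex mat \<Rightarrow> 'u mat \<Rightarrow> 'u mat" where
  "mat_compress V \<alpha> X = mat (dim_col \<alpha>) (dim_col \<alpha>)
     (\<lambda>(i, j). finsum V (\<lambda>(k, l). (cnj (\<alpha> $$ (k, i)) * \<alpha> $$ (l, j)) \<odot>\<^bsub>V\<^esub> X $$ (k, l))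
        ({..<dim_row X} \<times> {..<dim_col X}))"

section \<open>Operator systems\<close>

text \<open>The set \<open>pcone S\<close> holds the positive matrices of all sizes, so the cone of \<open>M\<^sub>n(S)\<close> is
  \<open>pcone S \<inter> mats S n\<close>; size \<open>0\<close> is allowed, where the axioms force the cone to be the one-point set.
  The field \<open>one\<close> is the order unit; the field \<open>mult\<close> plays no role for operator systems.\<close>

record 'u opsys = "'u star_space" +
  pcone :: "'u mat set"

definition matrix_ordered :: "'u opsys \<Rightarrow> bool" where
  "matrix_ordered S \<longleftrightarrow>
     star_vector_space S \<and>
     (\<forall>X\<in>pcone S. X \<in> mats S (dim_row X) \<and> mat_adj S X = X) \<and>
     (\<forall>n. \<forall>X\<in>pcone S \<inter> mats S n. \<forall>Y\<in>pcone S \<inter> mats S n. mat_add S X Y \<in> pcone S) \<and>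
     (\<forall>X\<in>pcone S. \<forall>r::real. r \<ge> 0 \<longrightarrow> mat_smult S (complex_of_real r) X \<in> pcone S) \<and>
     (\<forall>n. \<forall>X\<in>pcone S \<inter> mats S n. mat_smult S (-1) X \<in> pcone S \<longrightarrow> X = mat_zero S n) \<and>
     (\<forall>n m. \<forall>X\<in>pcone S \<inter> mats S n. \<forall>\<alpha>\<in>carrier_mat n m. mat_compress S \<alpha> X \<in> pcone S)"

definition archimedean_matrix_order_unit :: "'u opsys \<Rightarrow> bool" where
  "archimedean_matrix_order_unit S \<longleftrightarrow>
     \<one>\<^bsub>S\<^esub> \<in> carrier S \<and> adj S \<one>\<^bsub>S\<^esub> = \<one>\<^bsub>S\<^esub> \<and>
     (\<forall>n. \<forall>X\<in>mats S n. mat_adj S X = X \<longrightarrow>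
       (\<exists>r>0. mat_add S (mat_smult S (complex_of_real r) (mat_unit S n)) (mat_smult S (-1) X)
          \<in> pcone S)) \<and>
     (\<forall>n. \<forall>X\<in>mats S n. mat_adj S X = X \<longrightarrow>
       (\<forall>r>0. mat_add S (mat_smult S (complex_of_real r) (mat_unit S n)) X \<in> pcone S) \<longrightarrow>
       X \<in> pcone S)"

definition operator_system :: "'u opsys \<Rightarrow> bool" where
  "operator_system S \<longleftrightarrow> matrix_ordered S \<and> archimedean_matrix_order_unit S"

definition completely_positive :: "'u opsys \<Rightarrow> 'v opsys \<Rightarrow> ('u \<Rightarrow> 'v) \<Rightarrow> bool" where
  "completely_positive S R f \<longleftrightarrow> clinear S R f \<and> (\<forall>X\<in>pcone S. map_mat f X \<in> pcone R)"

definition ucp :: "'u opsys \<Rightarrow> 'v opsys \<Rightarrow> ('u \<Rightarrow> 'v) \<Rightarrow> bool" where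
  "ucp S R f \<longleftrightarrow> completely_positive S R f \<and> f \<one>\<^bsub>S\<^esub> = \<one>\<^bsub>R\<^esub>"

definition complete_order_isomorphism :: "'u opsys \<Rightarrow> 'v opsys \<Rightarrow> ('u \<Rightarrow> 'v) \<Rightarrow> bool" where
  "complete_order_isomorphism S R f \<longleftrightarrow>
     clinear S R f \<and> bij_betw f (carrier S) (carrier R) \<and>
     completely_positive S R f \<and> completely_positive R S (inv_into (carrier S) f)"

definition opsys_restrict :: "'u opsys \<Rightarrow> 'u set \<Rightarrow> 'u opsys" where
  "opsys_restrict R W = R\<lparr>carrier := W, pcone := {X \<in> pcone R. elements_mat X \<subseteq> W}\<rparr>"

definition complete_order_embedding :: "'u opsys \<Rightarrow> 'v opsys \<Rightarrow> ('u \<Rightarrow> 'v) \<Rightarrow> bool" where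
  "complete_order_embedding S R f \<longleftrightarrow>
     f \<in> carrier S \<rightarrow> carrier R \<and>
     complete_order_isomorphism S (opsys_restrict R (f ` carrier S)) f"

definition unitally_completely_order_isomorphic :: "'u opsys \<Rightarrow> 'v opsys \<Rightarrow> bool" where
  "unitally_completely_order_isomorphic S R \<longleftrightarrow>
     (\<exists>f. complete_order_isomorphism S R f \<and> f \<one>\<^bsub>S\<^esub> = \<one>\<^bsub>R\<^esub>)"

text \<open>The matrix norms of an operator system; for the operator system underlying a C*-algebra \<open>A\<close>
  (see \<open>cstar_opsys\<close> below) this is the C*-norm of \<open>M\<^sub>n(A)\<close>.\<close>

definition opsys_norm :: "'u opsys \<Rightarrow> 'u mat \<Rightarrow> real" where
  "opsys_norm S X = Inf {r. r \<ge> 0 \<and>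
     four_block_mat
       (mat_smult S (complex_of_real r) (mat_unit S (dim_row X))) X
       (mat_adj S X) (mat_smult S (complex_of_real r) (mat_unit S (dim_row X))) \<in> pcone S}"

definition completely_isometric :: "'u opsys \<Rightarrow> 'v opsys \<Rightarrow> ('u \<Rightarrow> 'v) \<Rightarrow> bool" where
  "completely_isometric S R f \<longleftrightarrow>
     clinear S R f \<and> (\<forall>n. \<forall>X\<in>mats S n. opsys_norm R (map_mat f X) = opsys_norm S X)"

section \<open>Inductive systems and limits of operator systems\<close>

definition inductive_system :: "(nat \<Rightarrow> 'u opsys) \<Rightarrow> (nat \<Rightarrow> 'u \<Rightarrow> 'u) \<Rightarrow> bool" where
  "inductive_system S \<phi> \<longleftrightarrow> (\<forall>k. operator_system (S k) \<and> ucp (S k) (S (Suc k)) (\<phi> k))"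

definition compatible_maps ::
    "(nat \<Rightarrow> 'u opsys) \<Rightarrow> (nat \<Rightarrow> 'u \<Rightarrow> 'u) \<Rightarrow> 'u opsys \<Rightarrow> (nat \<Rightarrow> 'u \<Rightarrow> 'u) \<Rightarrow> bool" where
  "compatible_maps S \<phi> R \<psi> \<longleftrightarrow>
     operator_system R \<and>
     (\<forall>k. ucp (S k) R (\<psi> k) \<and> (\<forall>s\<in>carrier (S k). \<psi> (Suc k) (\<phi> k s) = \<psi> k s))"

definition inductive_limit ::
    "(nat \<Rightarrow> 'u opsys) \<Rightarrow> (nat \<Rightarrow> 'u \<Rightarrow> 'u) \<Rightarrow> 'u opsys \<Rightarrow> (nat \<Rightarrow> 'u \<Rightarrow> 'u) \<Rightarrow> bool" where
  "inductive_limit S \<phi> L l \<longleftrightarrow>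
     compatible_maps S \<phi> L l \<and>
     (\<forall>R \<psi>. compatible_maps S \<phi> R \<psi> \<longrightarrow>
       (\<exists>\<mu>. ucp L R \<mu> \<and> (\<forall>k. \<forall>s\<in>carrier (S k). \<mu> (l k s) = \<psi> k s) \<and>
         (\<forall>\<nu>. ucp L R \<nu> \<and> (\<forall>k. \<forall>s\<in>carrier (S k). \<nu> (l k s) = \<psi> k s) \<longrightarrow>
            (\<forall>x\<in>carrier L. \<nu> x = \<mu> x))))"

section \<open>Unital C*-algebras\<close>

record 'u cstar = "'u star_space" +
  nrm :: "'u \<Rightarrow> real"

definition star_algebra :: "('u, 'm) star_space_scheme \<Rightarrow> bool" where
  "star_algebra A \<longleftrightarrow>
     ring A \<and> star_vector_space A \<and>
     (\<forall>c. \<forall>x\<in>carrier A. \<forall>y\<in>carrier A.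
        (c \<odot>\<^bsub>A\<^esub> x) \<otimes>\<^bsub>A\<^esub> y = c \<odot>\<^bsub>A\<^esub> (x \<otimes>\<^bsub>A\<^esub> y) \<and> x \<otimes>\<^bsub>A\<^esub> (c \<odot>\<^bsub>A\<^esub> y) = c \<odot>\<^bsub>A\<^esub> (x \<otimes>\<^bsub>A\<^esub> y)) \<and>
     (\<forall>x\<in>carrier A. \<forall>y\<in>carrier A. adj A (x \<otimes>\<^bsub>A\<^esub> y) = adj A y \<otimes>\<^bsub>A\<^esub> adj A x)"

text \<open>A C*-seminorm on the *-subalgebra with carrier \<open>B\<close> of \<open>A\<close>.\<close>

definition cstar_seminorm :: "('u, 'm) star_space_scheme \<Rightarrow> 'u set \<Rightarrow> ('u \<Rightarrow> real) \<Rightarrow> bool" where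
  "cstar_seminorm A B p \<longleftrightarrow>
     (\<forall>x\<in>B. p x \<ge> 0) \<and>
     (\<forall>x\<in>B. \<forall>y\<in>B. p (x \<oplus>\<^bsub>A\<^esub> y) \<le> p x + p y) \<and>
     (\<forall>c. \<forall>x\<in>B. p (c \<odot>\<^bsub>A\<^esub> x) = cmod c * p x) \<and>
     (\<forall>x\<in>B. \<forall>y\<in>B. p (x \<otimes>\<^bsub>A\<^esub> y) \<le> p x * p y) \<and>
     (\<forall>x\<in>B. p (adj A x \<otimes>\<^bsub>A\<^esub> x) = (p x)\<^sup>2)"

text \<open>The value off the carrier is only there because the locale \<open>Metric_space\<close> demands nonnegativity
  and symmetry on the whole type.\<close>

definition cstar_dist :: "'u cstar \<Rightarrow> 'u \<Rightarrow> 'u \<Rightarrow> real" where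
  "cstar_dist A x y = (if x \<in> carrier A \<and> y \<in> carrier A then nrm A (x \<ominus>\<^bsub>A\<^esub> y) else 0)"

definition cstar_topology :: "'u cstar \<Rightarrow> 'u topology" where
  "cstar_topology A = Metric_space.mtopology (carrier A) (cstar_dist A)"

definition cstar_algebra :: "'u cstar \<Rightarrow> bool" where
  "cstar_algebra A \<longleftrightarrow>
     star_algebra A \<and> cstar_seminorm A (carrier A) (nrm A) \<and>
     (\<forall>x\<in>carrier A. nrm A x = 0 \<longrightarrow> x = \<zero>\<^bsub>A\<^esub>) \<and>
     Metric_space.mcomplete (carrier A) (cstar_dist A)"

definition cstar_subalgebra :: "'u cstar \<Rightarrow> 'u set \<Rightarrow> bool" where
  "cstar_subalgebra A B \<longleftrightarrow>
     subring B A \<and> (\<forall>c. \<forall>x\<in>B. c \<odot>\<^bsub>A\<^esub> x \<in> B) \<and> (\<forall>x\<in>B. adj A x \<in> B) \<and>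
     closedin (cstar_topology A) B"

definition star_hom :: "'u cstar \<Rightarrow> 'v cstar \<Rightarrow> ('u \<Rightarrow> 'v) \<Rightarrow> bool" where
  "star_hom A B f \<longleftrightarrow>
     clinear A B f \<and>
     (\<forall>x\<in>carrier A. \<forall>y\<in>carrier A. f (x \<otimes>\<^bsub>A\<^esub> y) = f x \<otimes>\<^bsub>B\<^esub> f y) \<and>
     (\<forall>x\<in>carrier A. f (adj A x) = adj B (f x))"

text \<open>A C*-algebra as an operator system: a matrix is positive iff it is positive in the C*-algebra
  \<open>M\<^sub>n(A)\<close>, that is, of the form \<open>Y\<^sup>* Y\<close>.\<close>

definition cstar_opsys :: "'u cstar \<Rightarrow> 'u opsys" where
  "cstar_opsys A =
     \<lparr>carrier = carrier A, monoid.mult = monoid.mult A, one = \<one>\<^bsub>A\<^esub>, zero = \<zero>\<^bsub>A\<^esub>, add = add A,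
      module.smult = module.smult A, adj = adj A,
      pcone = {X. \<exists>n. \<exists>Y\<in>mats A n. X = mat_mult A (mat_adj A Y) Y}\<rparr>"

section \<open>The universal C*-algebra, the maximal and the commuting tensor product\<close>

text \<open>The *-homomorphism \<open>\<pi>\<close> is automatically unital, as \<open>\<iota>\<close> and \<open>f\<close> are.\<close>

definition universal_cstar_algebra :: "'u opsys \<Rightarrow> 'u cstar \<Rightarrow> ('u \<Rightarrow> 'u) \<Rightarrow> bool" where
  "universal_cstar_algebra S U \<iota> \<longleftrightarrow>
     cstar_algebra U \<and>
     completely_isometric S (cstar_opsys U) \<iota> \<and> \<iota> \<one>\<^bsub>S\<^esub> = \<one>\<^bsub>U\<^esub> \<and>
     cstar_subalgebra U hull (\<iota> ` carrier S) = carrier U \<and>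
     (\<forall>(A :: 'u cstar) f. cstar_algebra A \<and> ucp S (cstar_opsys A) f \<longrightarrow>
       (\<exists>\<pi>. star_hom U A \<pi> \<and> (\<forall>s\<in>carrier S. \<pi> (\<iota> s) = f s)))"

text \<open>\<open>M\<close> is the completion of the algebraic tensor product of \<open>A\<close> and \<open>B\<close>, as a *-algebra with
  elementary tensors \<open>\<tau> a b\<close>, in the largest C*-norm.\<close>

definition maximal_tensor :: "'u cstar \<Rightarrow> 'u cstar \<Rightarrow> 'u cstar \<Rightarrow> ('u \<Rightarrow> 'u \<Rightarrow> 'u) \<Rightarrow> bool" where
  "maximal_tensor A B M \<tau> \<longleftrightarrow>
     cstar_algebra M \<and> cbilinear A B M \<tau> \<and>
     (let D = cspan M {\<tau> a b | a b. a \<in> carrier A \<and> b \<in> carrier B} in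
       algebraic_tensor A B (M\<lparr>carrier := D\<rparr>) \<tau> \<and>
       (\<forall>a\<in>carrier A. \<forall>b\<in>carrier B. \<forall>a'\<in>carrier A. \<forall>b'\<in>carrier B.
          \<tau> a b \<otimes>\<^bsub>M\<^esub> \<tau> a' b' = \<tau> (a \<otimes>\<^bsub>A\<^esub> a') (b \<otimes>\<^bsub>B\<^esub> b')) \<and>
       (\<forall>a\<in>carrier A. \<forall>b\<in>carrier B. adj M (\<tau> a b) = \<tau> (adj A a) (adj B b)) \<and>
       \<tau> \<one>\<^bsub>A\<^esub> \<one>\<^bsub>B\<^esub> = \<one>\<^bsub>M\<^esub> \<and>
       cstar_topology M closure_of D = carrier M \<and>
       (\<forall>p. cstar_seminorm M D p \<longrightarrow> (\<forall>x\<in>D. p x \<le> nrm M x)))"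

text \<open>\<open>P\<close> is the algebraic tensor product of \<open>S\<close> and \<open>T\<close>, with the operator system structure inherited
  along its inclusion \<open>j\<close> into the maximal tensor product of the universal C*-algebras.\<close>

definition commuting_tensor :: "'u opsys \<Rightarrow> 'u opsys \<Rightarrow> 'u opsys \<Rightarrow> ('u \<Rightarrow> 'u \<Rightarrow> 'u) \<Rightarrow> bool" where
  "commuting_tensor S T P \<theta> \<longleftrightarrow>
     operator_system P \<and> algebraic_tensor S T P \<theta> \<and>
     (\<exists>U \<iota> W \<kappa> M \<tau> j.
        universal_cstar_algebra S U \<iota> \<and> universal_cstar_algebra T W \<kappa> \<and> maximal_tensor U W M \<tau> \<and>
        complete_order_embedding P (cstar_opsys M) j \<and> j \<one>\<^bsub>P\<^esub> = \<one>\<^bsub>M\<^esub> \<and>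
        (\<forall>s\<in>carrier S. \<forall>t\<in>carrier T. j (\<theta> s t) = \<tau> (\<iota> s) (\<kappa> t)))"

section \<open>The universe\<close>

text \<open>HOL cannot quantify over types inside a formula, so all objects are taken with carriers in one
  arbitrarily large type, which serves as a universe. Every type \<open>'w\<close> embeds into \<open>'w univ\<close>, and
  \<open>'w univ\<close> is in bijection with its sequences. Hence the constructions above do not lead
  out of the universe (up to isomorphism): the universal C*-algebra and the maximal tensor
  product have dense subsets whose elements are finite expressions in elements of the given objects
  and complex numbers, and a limit of operator systems is a quotient of a countable disjoint union.
  For the same reason, testing a universal property inside the universe is as strong as testing it
  on all objects.\<close>

type_synonym 'w univ = "nat \<Rightarrow> 'w"

end

theory Submission
  imports Defs
begin

text \<open>The maps \<open>S\<^sub>k \<otimes> T \<rightarrow> L \<otimes> T\<close> induce a ucp map from the limit of the \<open>S\<^sub>k \<otimes> T\<close> to \<open>L \<otimes> T\<close>. It is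
  surjective because \<open>L\<close> is the union of the ranges of the \<open>S\<^sub>k\<close>, and it remains to see that each
  \<open>S\<^sub>m \<otimes> T \<rightarrow> L \<otimes> T\<close> reflects positivity. Let \<open>M\<^sub>k\<close> be the maximal tensor product that contains
  \<open>S\<^sub>k \<otimes> T\<close>, and \<open>B\<close> the C*-algebra of bounded sequences in \<open>\<Prod>\<^sub>k M\<^sub>k\<close> modulo null sequences. The maps
  \<open>s \<mapsto> (\<phi>\<^sub>k\<^sub>-\<^sub>1 \<dots> \<phi>\<^sub>m s \<otimes> 1)\<^sub>k\<close> define a ucp map \<open>L \<rightarrow> B\<close> by the universal property, which commutes with
  \<open>t \<mapsto> (1 \<otimes> t)\<^sub>k\<close>; two commuting ucp maps give a ucp map \<open>L \<otimes> T \<rightarrow> B\<close>. Hence, if \<open>X\<close> in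
  \<open>M\<^sub>n(S\<^sub>m \<otimes> T)\<close> is positive in \<open>L \<otimes> T\<close>, its image in \<open>B\<close> is positive, so for every \<open>\<epsilon> > 0\<close> the element
  \<open>\<epsilon> + X\<close> is positive over \<open>M\<^sub>k\<close> for large \<open>k\<close>. As the connecting maps are complete order embeddings,
  \<open>\<epsilon> + X\<close> is positive in \<open>S\<^sub>m \<otimes> T\<close>, and so is \<open>X\<close>.\<close>

section \<open>Complex vector spaces\<close>

text \<open>The system supplies no maps from \<open>L\<close> back to a stage, so commuting pairs on
  a stage do not directly give pairs on \<open>L\<close>. Modulo null sequences, a family of maps
  defined only from some index on counts as a map, and compatibility along the system becomes an
  equality. The universal properties accept this quotient as a target only if it is complete and
  carried by the universe type; hence the diagonal argument and the coding of classes. A commuting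
  pair induces a map on the commuting tensor product because both maps extend to the universal
  C*-algebras, the extensions still commute, and the norm of their product is a C*-seminorm, hence
  below the maximal norm. Most of the length is C*-theory without spectra or Hilbert spaces: a
  self-adjoint h is positive if |r - h| <= r for some r >= 0, roots come from an iteration, and
  M_n(A) receives its norm from a cone of quadratic forms. The universal C*-algebra comes with a
  complete isometry only, so its complete positivity requires an argument with discs.\<close>

locale cspace =
  fixes V :: "(complex, 'u, 'm) module_scheme" (structure)
  assumes complex_space: "complex_space V"
begin

lemma is_abelian_group: "abelian_group V"
  using complex_space by (rule module.axioms)

end

sublocale cspace \<subseteq> abelian_group V
  by (rule is_abelian_group)

text \<open>Algebraic functionals, without continuity. Their values live in the type
  \<open>complex\<close> and not in a carrier, so that an identity becomes accessible to
  \<open>algebra_simps\<close> once a functional has been applied.\<close>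

definition linfun :: "(complex, 'u, 'm) module_scheme \<Rightarrow> ('u \<Rightarrow> complex) \<Rightarrow> bool" where
  "linfun V f \<longleftrightarrow>
     (\<forall>x\<in>carrier V. \<forall>y\<in>carrier V. f (x \<oplus>\<^bsub>V\<^esub> y) = f x + f y) \<and>
     (\<forall>c. \<forall>x\<in>carrier V. f (c \<odot>\<^bsub>V\<^esub> x) = c * f x)"

lemma complex_spaceI:
  assumes "abelian_group V"
    and "\<And>c x. x \<in> carrier V \<Longrightarrow> c \<odot>\<^bsub>V\<^esub> x \<in> carrier V"
    and "\<And>c d x. x \<in> carrier V \<Longrightarrow> (c + d) \<odot>\<^bsub>V\<^esub> x = c \<odot>\<^bsub>V\<^esub> x \<oplus>\<^bsub>V\<^esub> d \<odot>\<^bsub>V\<^esub> x"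
    and "\<And>c x y. \<lbrakk>x \<in> carrier V; y \<in> carrier V\<rbrakk> \<Longrightarrow> c \<odot>\<^bsub>V\<^esub> (x \<oplus>\<^bsub>V\<^esub> y) = c \<odot>\<^bsub>V\<^esub> x \<oplus>\<^bsub>V\<^esub> c \<odot>\<^bsub>V\<^esub> y"
    and "\<And>c d x. x \<in> carrier V \<Longrightarrow> (c * d) \<odot>\<^bsub>V\<^esub> x = c \<odot>\<^bsub>V\<^esub> (d \<odot>\<^bsub>V\<^esub> x)"
    and "\<And>x. x \<in> carrier V \<Longrightarrow> 1 \<odot>\<^bsub>V\<^esub> x = x"
  shows "complex_space V"
  using assms cring_from_type_algebra
  by (intro moduleI) (auto simp: ring_of_type_algebra_def)

context cspace
begin

lemma sm_closed [simp, intro]: "x \<in> carrier V \<Longrightarrow> c \<odot> x \<in> carrier V"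
  using module.smult_closed[OF complex_space] by (simp add: ring_of_type_algebra_def)

lemma sm_ldistr: "x \<in> carrier V \<Longrightarrow> (c + d) \<odot> x = c \<odot> x \<oplus> d \<odot> x"
  using module.smult_l_distr[OF complex_space] by (simp add: ring_of_type_algebra_def)

lemma sm_rdistr: "\<lbrakk>x \<in> carrier V; y \<in> carrier V\<rbrakk> \<Longrightarrow> c \<odot> (x \<oplus> y) = c \<odot> x \<oplus> c \<odot> y"
  using module.smult_r_distr[OF complex_space] by (simp add: ring_of_type_algebra_def)

lemma sm_assoc: "x \<in> carrier V \<Longrightarrow> (c * d) \<odot> x = c \<odot> (d \<odot> x)"
  using module.smult_assoc1[OF complex_space] by (simp add: ring_of_type_algebra_def)

lemma sm_one [simp]: "x \<in> carrier V \<Longrightarrow> 1 \<odot> x = x"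
  using module.smult_one[OF complex_space] by (simp add: ring_of_type_algebra_def)

lemma sm_zero [simp]: "x \<in> carrier V \<Longrightarrow> 0 \<odot> x = \<zero>"
  using module.smult_l_null[OF complex_space] by (simp add: ring_of_type_algebra_def)

lemma sm_null [simp]: "c \<odot> \<zero> = \<zero>"
  using module.smult_r_null[OF complex_space] by (simp add: ring_of_type_algebra_def)

lemma sm_minus_one: "x \<in> carrier V \<Longrightarrow> (-1) \<odot> x = \<ominus> x"
  using sm_ldistr[of x "-1" 1] by (simp add: minus_equality)

lemma linfun_add: "\<lbrakk>linfun V f; x \<in> carrier V; y \<in> carrier V\<rbrakk> \<Longrightarrow> f (x \<oplus> y) = f x + f y"
  by (simp add: linfun_def)

lemma linfun_sm: "\<lbrakk>linfun V f; x \<in> carrier V\<rbrakk> \<Longrightarrow> f (c \<odot> x) = c * f x"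
  by (simp add: linfun_def)

lemma linfun_zero: "linfun V f \<Longrightarrow> f \<zero> = 0"
  using linfun_sm[of f \<zero> 0] by simp

lemma linfun_uminus: "\<lbrakk>linfun V f; x \<in> carrier V\<rbrakk> \<Longrightarrow> f (\<ominus> x) = - f x"
  by (simp flip: sm_minus_one add: linfun_sm)

lemma linfun_diff: "\<lbrakk>linfun V f; x \<in> carrier V; y \<in> carrier V\<rbrakk> \<Longrightarrow> f (x \<ominus> y) = f x - f y"
  by (simp add: a_minus_def linfun_add linfun_uminus)

lemma linfun_finsum: "\<lbrakk>linfun V f; g \<in> I \<rightarrow> carrier V\<rbrakk> \<Longrightarrow> f (finsum V g I) = (\<Sum>i\<in>I. f (g i))"
proof (induction I rule: infinite_finite_induct)
  case (insert i I)
  then have "g \<in> I \<rightarrow> carrier V" "g i \<in> carrier V" by auto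
  with insert show ?case by (simp add: finsum_insert linfun_add)
qed (simp_all add: linfun_zero finsum_infinite)

lemmas linfun_simps = linfun_add linfun_sm linfun_zero linfun_uminus linfun_diff

lemma submoduleI':
  assumes "H \<subseteq> carrier V" "\<zero> \<in> H" "\<And>x y. \<lbrakk>x \<in> H; y \<in> H\<rbrakk> \<Longrightarrow> x \<oplus> y \<in> H"
    "\<And>c x. x \<in> H \<Longrightarrow> c \<odot> x \<in> H"
  shows "submodule H (ring_of_type_algebra :: complex ring) V"
proof (rule module.submoduleI[OF complex_space])
  fix a assume "a \<in> H"
  with assms show "\<ominus> a \<in> H" by (metis sm_minus_one subsetD)
qed (use assms in auto)

lemma submoduleD:
  assumes "submodule H (ring_of_type_algebra :: complex ring) V"
  shows "H \<subseteq> carrier V" "\<zero> \<in> H" "\<And>x y. \<lbrakk>x \<in> H; y \<in> H\<rbrakk> \<Longrightarrow> x \<oplus> y \<in> H"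
    "\<And>c x. x \<in> H \<Longrightarrow> c \<odot> x \<in> H"
proof -
  note E = module.submoduleE[OF complex_space assms]
  show *: "H \<subseteq> carrier V" "\<And>x y. \<lbrakk>x \<in> H; y \<in> H\<rbrakk> \<Longrightarrow> x \<oplus> y \<in> H"
    "\<And>c x. x \<in> H \<Longrightarrow> c \<odot> x \<in> H"
    using E(1,4,5) by (auto simp: ring_of_type_algebra_def)
  from E(2) obtain x where "x \<in> H" by auto
  with *(1) *(3)[of x 0] show "\<zero> \<in> H" by auto
qed

text \<open>A submodule that is maximal among those avoiding a nonzero vector has codimension one.\<close>

lemma exists_linfun_nonzero:
  assumes x: "x \<in> carrier V" "x \<noteq> \<zero>"
  shows "\<exists>f. linfun V f \<and> f x \<noteq> 0"
proof -
  let ?sub = "\<lambda>H. H \<subseteq> carrier V \<and> \<zero> \<in> H \<and> (\<forall>u\<in>H. \<forall>v\<in>H. u \<oplus> v \<in> H) \<and> (\<forall>c. \<forall>u\<in>H. c \<odot> u \<in> H) \<and> x \<notin> H"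
  have "\<exists>M\<in>Collect ?sub. \<forall>X\<in>Collect ?sub. M \<subseteq> X \<longrightarrow> X = M"
  proof (rule subset_Zorn_nonempty)
    have "?sub {\<zero>}" using x by auto
    then show "Collect ?sub \<noteq> {}" by blast
    fix C assume C: "C \<noteq> {}" "subset.chain (Collect ?sub) C"
    then have sub: "\<And>H. H \<in> C \<Longrightarrow> ?sub H" and tot: "\<And>H K. \<lbrakk>H \<in> C; K \<in> C\<rbrakk> \<Longrightarrow> H \<subseteq> K \<or> K \<subseteq> H"
      unfolding subset.chain_def by (auto simp: subset_iff_psubset_eq)
    have "u \<oplus> v \<in> \<Union>C" if "u \<in> \<Union>C" "v \<in> \<Union>C" for u v
    proof -
      from that obtain H K where HK: "H \<in> C" "u \<in> H" "K \<in> C" "v \<in> K" by auto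
      from tot[OF HK(1,3)] show ?thesis
      proof
        assume "H \<subseteq> K" then show ?thesis using HK sub[of K] by blast
      next
        assume "K \<subseteq> H" then show ?thesis using HK sub[of H] by blast
      qed
    qed
    moreover have "c \<odot> u \<in> \<Union>C" if "u \<in> \<Union>C" for c u using that sub by blast
    moreover have "\<Union>C \<subseteq> carrier V" "\<zero> \<in> \<Union>C" "x \<notin> \<Union>C" using sub C(1) by blast+
    ultimately show "\<Union>C \<in> Collect ?sub" by blast
  qed
  then obtain N where N: "?sub N" and max: "\<And>X. \<lbrakk>?sub X; N \<subseteq> X\<rbrakk> \<Longrightarrow> X = N" by auto
  have Nin: "\<And>u. u \<in> N \<Longrightarrow> u \<in> carrier V" and Nadd: "\<And>u v. \<lbrakk>u \<in> N; v \<in> N\<rbrakk> \<Longrightarrow> u \<oplus> v \<in> N"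
    and Nsm: "\<And>c u. u \<in> N \<Longrightarrow> c \<odot> u \<in> N" and xN: "x \<notin> N" and N0: "\<zero> \<in> N"
    using N by auto
  \<comment> \<open>\<open>N\<close> is the maximal subspace avoiding x. If y lies outside
    \<open>N\<close>, then the span of \<open>N\<close> and y must contain x, and that
    representation of x can be solved for y.\<close>
  have ex: "\<exists>c. \<exists>n\<in>N. y = n \<oplus> c \<odot> x" if y: "y \<in> carrier V" for y
  proof (cases "y \<in> N")
    case True
    then show ?thesis using y x by (intro exI[of _ 0] bexI[of _ y]) auto
  next
    case False
    define X where "X = {n \<oplus> c \<odot> y | n c. n \<in> N}"
    have "N \<subseteq> X"
    proof
      fix n assume "n \<in> N"
      then have "n = n \<oplus> 0 \<odot> y" using y Nin by auto
      then show "n \<in> X" using \<open>n \<in> N\<close> unfolding X_def by blast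
    qed
    moreover have "y \<in> X" unfolding X_def using y N0 by (intro CollectI exI[of _ \<zero>] exI[of _ 1]) auto
    ultimately have "\<not> ?sub X"
    proof (intro notI)
      assume "?sub X" "N \<subseteq> X" "y \<in> X"
      then have "X = N" by (intro max)
      with \<open>y \<in> X\<close> False show "False" by simp
    qed
    moreover have "u \<oplus> v \<in> X" if "u \<in> X" "v \<in> X" for u v
    proof -
      from that obtain n c m d where "n \<in> N" "u = n \<oplus> c \<odot> y" "m \<in> N" "v = m \<oplus> d \<odot> y" unfolding X_def by auto
      then have "u \<oplus> v = (n \<oplus> m) \<oplus> (c + d) \<odot> y" "n \<oplus> m \<in> N"
        using y Nin Nadd by (auto simp: sm_ldistr a_ac)
      then show ?thesis unfolding X_def by blast
    qed
    moreover have "d \<odot> u \<in> X" if "u \<in> X" for u d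
    proof -
      from that obtain n c where "n \<in> N" "u = n \<oplus> c \<odot> y" unfolding X_def by auto
      then have "d \<odot> u = d \<odot> n \<oplus> (d * c) \<odot> y" "d \<odot> n \<in> N"
        using y Nin Nsm by (auto simp: sm_rdistr sm_assoc)
      then show ?thesis unfolding X_def by blast
    qed
    moreover have "X \<subseteq> carrier V" unfolding X_def using Nin y by auto
    moreover have "\<zero> \<in> X" using \<open>N \<subseteq> X\<close> N0 by blast
    ultimately have "x \<in> X" by blast
    then obtain n c where nc: "n \<in> N" "x = n \<oplus> c \<odot> y" unfolding X_def by auto
    with xN y Nin have "c \<noteq> 0" by auto
    have "(1/c) \<odot> ((-1) \<odot> n) \<oplus> (1/c) \<odot> x = (1/c) \<odot> ((-1) \<odot> n \<oplus> n \<oplus> c \<odot> y)"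
      using nc y Nin by (simp add: sm_rdistr a_assoc)
    also have "(-1) \<odot> n \<oplus> n \<oplus> c \<odot> y = c \<odot> y" using nc y Nin by (simp add: sm_minus_one l_neg)
    also have "(1/c) \<odot> (c \<odot> y) = y" using y \<open>c \<noteq> 0\<close> by (simp flip: sm_assoc)
    finally have "y = (1/c) \<odot> ((-1) \<odot> n) \<oplus> (1/c) \<odot> x" ..
    then show ?thesis using nc Nsm by blast
  qed
  \<comment> \<open>Two different coefficients would put a nonzero multiple of x into
    \<open>N\<close>. Hence the coefficient of x is a well-defined functional, and it is the one
    that is wanted.\<close>
  have uniq: "c = d" if "n \<in> N" "m \<in> N" "n \<oplus> c \<odot> x = m \<oplus> d \<odot> x" for n m c d
  proof (rule ccontr)
    assume "c \<noteq> d"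
    have "(c - d) \<odot> x = c \<odot> x \<oplus> (-d) \<odot> x" using sm_ldistr[of x c "-d"] x by simp
    also have "c \<odot> x = (-1) \<odot> n \<oplus> (n \<oplus> c \<odot> x)"
      using x that(1) Nin by (simp add: sm_minus_one r_neg1)
    also have "\<dots> \<oplus> (-d) \<odot> x = (-1) \<odot> n \<oplus> (m \<oplus> d \<odot> x) \<oplus> (-d) \<odot> x"
      using that(3) by simp
    also have "\<dots> = (-1) \<odot> n \<oplus> m \<oplus> (d \<odot> x \<oplus> (-d) \<odot> x)"
      using x that Nin by (simp add: a_assoc)
    also have "d \<odot> x \<oplus> (-d) \<odot> x = \<zero>" using x by (simp flip: sm_ldistr)
    finally have "(c - d) \<odot> x \<in> N" using that Nin Nadd Nsm by simp
    then have "(1/(c-d)) \<odot> ((c - d) \<odot> x) \<in> N" by (rule Nsm)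
    with xN x \<open>c \<noteq> d\<close> show False by (simp flip: sm_assoc)
  qed
  define f where "f y = (THE c. \<exists>n\<in>N. y = n \<oplus> c \<odot> x)" for y
  have f: "f y = c" if "n \<in> N" "y = n \<oplus> c \<odot> x" for y n c
    unfolding f_def using that uniq by (intro the_equality) blast+
  have "f (u \<oplus> v) = f u + f v" if uv: "u \<in> carrier V" "v \<in> carrier V" for u v
  proof -
    from ex[OF uv(1)] ex[OF uv(2)] obtain c n d m where
      *: "n \<in> N" "u = n \<oplus> c \<odot> x" "m \<in> N" "v = m \<oplus> d \<odot> x" by blast
    then have "u \<oplus> v = (n \<oplus> m) \<oplus> (c + d) \<odot> x" "n \<oplus> m \<in> N"
        using x Nin Nadd by (auto simp: sm_ldistr a_ac)
    then show ?thesis using f * by metis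
  qed
  moreover have "f (d \<odot> u) = d * f u" if u: "u \<in> carrier V" for u d
  proof -
    from ex[OF u] obtain c n where *: "n \<in> N" "u = n \<oplus> c \<odot> x" by blast
    then have "d \<odot> u = d \<odot> n \<oplus> (d * c) \<odot> x" "d \<odot> n \<in> N"
        using x Nin Nsm by (auto simp: sm_rdistr sm_assoc)
    then show ?thesis using f * by metis
  qed
  moreover have "f x = 1" using f[OF N0, of x 1] x by simp
  ultimately show ?thesis unfolding linfun_def by (intro exI[of _ f]) auto
qed

text \<open>Linear identities in a complex vector space thereby reduce to identities between complex
  numbers, where the simplifier can normalise them.\<close>

lemma sep:
  assumes "x \<in> carrier V" "y \<in> carrier V" "\<And>f. linfun V f \<Longrightarrow> f x = f y"
  shows "x = y"
proof (rule ccontr)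
  assume "x \<noteq> y"
  then have "x \<ominus> y \<noteq> \<zero>" using assms(1,2) by (metis add.inv_solve_right' a_minus_def l_zero zero_closed)
  with exists_linfun_nonzero[of "x \<ominus> y"] assms show False
    by (auto simp: linfun_diff)
qed

end

section \<open>Star vector spaces and star algebras\<close>

locale star_space =
  fixes A :: "('u, 'm) star_space_scheme" (structure)
  assumes star_vs: "star_vector_space A"

sublocale star_space \<subseteq> cspace A
  using star_vs by (intro cspace.intro) (simp add: star_vector_space_def)

context star_space
begin

abbreviation star :: "'u \<Rightarrow> 'u" (\<open>_\<^sup>\<star>\<close> [1000] 1000) where "x\<^sup>\<star> \<equiv> adj A x"

lemma star_closed [simp, intro]: "x \<in> carrier A \<Longrightarrow> x\<^sup>\<star> \<in> carrier A"
  using star_vs by (auto simp: star_vector_space_def)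

lemma star_star [simp]: "x \<in> carrier A \<Longrightarrow> x\<^sup>\<star>\<^sup>\<star> = x"
  using star_vs by (auto simp: star_vector_space_def)

lemma star_add: "\<lbrakk>x \<in> carrier A; y \<in> carrier A\<rbrakk> \<Longrightarrow> (x \<oplus> y)\<^sup>\<star> = x\<^sup>\<star> \<oplus> y\<^sup>\<star>"
  using star_vs by (auto simp: star_vector_space_def)

lemma star_sm: "x \<in> carrier A \<Longrightarrow> (c \<odot> x)\<^sup>\<star> = cnj c \<odot> x\<^sup>\<star>"
  using star_vs by (auto simp: star_vector_space_def)

lemma star_zero [simp]: "\<zero>\<^sup>\<star> = \<zero>"
  using star_sm[of \<zero> 0] by simp

lemma star_uminus: "x \<in> carrier A \<Longrightarrow> (\<ominus> x)\<^sup>\<star> = \<ominus> x\<^sup>\<star>"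
  using star_sm[of x "-1"] by (simp add: sm_minus_one)

lemma star_minus: "\<lbrakk>x \<in> carrier A; y \<in> carrier A\<rbrakk> \<Longrightarrow> (x \<ominus> y)\<^sup>\<star> = x\<^sup>\<star> \<ominus> y\<^sup>\<star>"
  by (simp add: a_minus_def star_add star_uminus)

lemmas star_lin_simps = star_add star_sm star_uminus star_minus

definition sa :: "'u set" where "sa = {x \<in> carrier A. x\<^sup>\<star> = x}"

lemma sa_carrier: "x \<in> sa \<Longrightarrow> x \<in> carrier A"
  by (simp add: sa_def)

lemma sa_star: "x \<in> sa \<Longrightarrow> x\<^sup>\<star> = x"
  by (simp add: sa_def)

lemma saI: "\<lbrakk>x \<in> carrier A; x\<^sup>\<star> = x\<rbrakk> \<Longrightarrow> x \<in> sa"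
  by (simp add: sa_def)

declare sa_carrier [simp, dest]

lemma sa_zero [simp]: "\<zero> \<in> sa"
  by (auto intro: saI)

lemma sa_add [simp]: "\<lbrakk>x \<in> sa; y \<in> sa\<rbrakk> \<Longrightarrow> x \<oplus> y \<in> sa"
  and sa_minus [simp]: "\<lbrakk>x \<in> sa; y \<in> sa\<rbrakk> \<Longrightarrow> x \<ominus> y \<in> sa"
  and sa_sm [simp]: "x \<in> sa \<Longrightarrow> complex_of_real r \<odot> x \<in> sa"
  and sa_uminus [simp]: "x \<in> sa \<Longrightarrow> \<ominus> x \<in> sa"
  by (auto intro!: saI simp: star_lin_simps sa_star)

lemma sa_parts:
  assumes x: "x \<in> carrier A"
  obtains a b where "a \<in> sa" "b \<in> sa" "x = a \<oplus> \<i> \<odot> b" "x\<^sup>\<star> = a \<ominus> \<i> \<odot> b"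
proof
  let ?a = "(1/2) \<odot> (x \<oplus> x\<^sup>\<star>)" and ?b = "(- \<i> / 2) \<odot> (x \<ominus> x\<^sup>\<star>)"
  show "?a \<in> sa" using x by (intro saI) (auto simp: star_lin_simps a_comm)
  show "?b \<in> sa" using x by (intro saI sep) (auto simp: star_lin_simps linfun_simps algebra_simps)
  show "x = ?a \<oplus> \<i> \<odot> ?b" using x by (intro sep) (auto simp: star_lin_simps linfun_simps algebra_simps)
  show "x\<^sup>\<star> = ?a \<ominus> \<i> \<odot> ?b" using x by (intro sep) (auto simp: star_lin_simps linfun_simps algebra_simps)
qed

end

locale star_alg =
  fixes A :: "('u, 'm) star_space_scheme" (structure)
  assumes star_algebra: "star_algebra A"

sublocale star_alg \<subseteq> ring A
  using star_algebra by (simp add: star_algebra_def)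

sublocale star_alg \<subseteq> star_space A
  using star_algebra by (intro star_space.intro) (simp add: star_algebra_def)

context star_alg
begin

lemma star_mult: "\<lbrakk>x \<in> carrier A; y \<in> carrier A\<rbrakk> \<Longrightarrow> (x \<otimes> y)\<^sup>\<star> = y\<^sup>\<star> \<otimes> x\<^sup>\<star>"
  using star_algebra by (auto simp: star_algebra_def)

lemma sm_mult_l: "\<lbrakk>x \<in> carrier A; y \<in> carrier A\<rbrakk> \<Longrightarrow> (c \<odot> x) \<otimes> y = c \<odot> (x \<otimes> y)"
  using star_algebra by (auto simp: star_algebra_def)

lemma sm_mult_r: "\<lbrakk>x \<in> carrier A; y \<in> carrier A\<rbrakk> \<Longrightarrow> x \<otimes> (c \<odot> y) = c \<odot> (x \<otimes> y)"
  using star_algebra by (auto simp: star_algebra_def)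

lemma star_one [simp]: "\<one>\<^sup>\<star> = \<one>"
proof -
  have "\<one>\<^sup>\<star> = (\<one>\<^sup>\<star> \<otimes> \<one>)\<^sup>\<star>" by (subst star_mult) auto
  then show ?thesis by simp
qed

lemma minus_mult_l: "\<lbrakk>x \<in> carrier A; y \<in> carrier A; z \<in> carrier A\<rbrakk> \<Longrightarrow> (x \<ominus> y) \<otimes> z = x \<otimes> z \<ominus> y \<otimes> z"
  by (simp add: a_minus_def l_distr l_minus)

lemma minus_mult_r: "\<lbrakk>x \<in> carrier A; y \<in> carrier A; z \<in> carrier A\<rbrakk> \<Longrightarrow> z \<otimes> (x \<ominus> y) = z \<otimes> x \<ominus> z \<otimes> y"
  by (simp add: a_minus_def r_distr r_minus)

lemmas mult_simps = l_distr r_distr minus_mult_l minus_mult_r sm_mult_l sm_mult_r m_assoc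
lemmas star_simps = star_lin_simps star_mult
lemmas alg_simps = mult_simps star_simps linfun_simps

lemma sa_one [simp]: "\<one> \<in> sa"
  by (auto intro: saI)

lemma sa_square [simp]: "x \<in> carrier A \<Longrightarrow> x\<^sup>\<star> \<otimes> x \<in> sa"
  by (auto intro!: saI simp: star_simps sa_star)

lemma sa_mult: "\<lbrakk>x \<in> sa; y \<in> sa; x \<otimes> y = y \<otimes> x\<rbrakk> \<Longrightarrow> x \<otimes> y \<in> sa"
  by (auto intro!: saI simp: star_simps sa_star)

definition cm :: "complex \<Rightarrow> 'u" where "cm c = c \<odot> \<one>"

lemma cm_closed [simp]: "cm c \<in> carrier A" by (simp add: cm_def)

lemma cm_sa [simp]: "cm (complex_of_real r) \<in> sa" by (simp add: cm_def)

lemma cm_mult_l: "x \<in> carrier A \<Longrightarrow> cm c \<otimes> x = c \<odot> x"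
  and cm_mult_r: "x \<in> carrier A \<Longrightarrow> x \<otimes> cm c = c \<odot> x"
  by (simp_all add: cm_def mult_simps)

lemma cm_star: "(cm c)\<^sup>\<star> = cm (cnj c)" by (simp add: cm_def star_sm)

lemma linfun_cm: "linfun A f \<Longrightarrow> f (cm c) = c * f \<one>"
  by (simp add: cm_def linfun_sm)

lemma cm_0 [simp]: "cm 0 = \<zero>" and cm_1 [simp]: "cm 1 = \<one>" by (simp_all add: cm_def)

lemmas cm_simps = cm_mult_l cm_mult_r cm_star linfun_cm

text \<open>When k and m are self-adjoint, the left factor is the adjoint of u = k + i m, so this
  computes u* u and makes the C*-identity available for u.\<close>

lemma mult_comm_sq:
  assumes "k \<in> carrier A" "m \<in> carrier A" "k \<otimes> m = m \<otimes> k"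
  shows "(k \<ominus> \<i> \<odot> m) \<otimes> (k \<oplus> \<i> \<odot> m) = k \<otimes> k \<oplus> m \<otimes> m"
  using assms by (intro sep) (auto simp: alg_simps algebra_simps)

end

section \<open>C*-algebras\<close>

text \<open>Completeness is split off because for matrix algebras and quotients it is proved with
  the norm calculus of this locale already at hand.\<close>

locale pre_cstar_alg = star_alg A for A :: "'u cstar" (structure) +
  assumes seminorm: "cstar_seminorm A (carrier A) (nrm A)"
    and norm_definite: "\<And>x. \<lbrakk>x \<in> carrier A; nrm A x = 0\<rbrakk> \<Longrightarrow> x = \<zero>"
begin

lemma norm_nonneg [simp]: "x \<in> carrier A \<Longrightarrow> 0 \<le> nrm A x"
  using seminorm by (simp add: cstar_seminorm_def)

lemma norm_triangle: "\<lbrakk>x \<in> carrier A; y \<in> carrier A\<rbrakk> \<Longrightarrow> nrm A (x \<oplus> y) \<le> nrm A x + nrm A y"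
  using seminorm by (simp add: cstar_seminorm_def)

lemma norm_sm: "x \<in> carrier A \<Longrightarrow> nrm A (c \<odot> x) = cmod c * nrm A x"
  using seminorm by (simp add: cstar_seminorm_def)

lemma norm_mult: "\<lbrakk>x \<in> carrier A; y \<in> carrier A\<rbrakk> \<Longrightarrow> nrm A (x \<otimes> y) \<le> nrm A x * nrm A y"
  using seminorm by (simp add: cstar_seminorm_def)

lemma norm_cstar: "x \<in> carrier A \<Longrightarrow> nrm A (x\<^sup>\<star> \<otimes> x) = (nrm A x)\<^sup>2"
  using seminorm by (simp add: cstar_seminorm_def)

lemma norm_sa_sq: "x \<in> sa \<Longrightarrow> nrm A (x \<otimes> x) = (nrm A x)\<^sup>2"
  using norm_cstar[of x] by (simp add: sa_star)

lemma norm_zero [simp]: "nrm A \<zero> = 0"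
  using norm_sm[of \<zero> 0] by simp

lemma norm_eq_zero: "x \<in> carrier A \<Longrightarrow> nrm A x = 0 \<longleftrightarrow> x = \<zero>"
  using norm_definite by auto

lemma norm_uminus [simp]: "x \<in> carrier A \<Longrightarrow> nrm A (\<ominus> x) = nrm A x"
  using norm_sm[of x "-1"] by (simp add: sm_minus_one)

text \<open>Cancel one factor in |y|^2 = |y* y| <= |y*| |y|, for y = x and for y = x*.\<close>

lemma norm_star [simp]:
  assumes "x \<in> carrier A" shows "nrm A (x\<^sup>\<star>) = nrm A x"
proof -
  have *: "nrm A y \<le> nrm A (y\<^sup>\<star>)" if "y \<in> carrier A" for y
  proof (cases "nrm A y = 0")
    case False
    with that have "nrm A y > 0" using norm_nonneg[of y] by linarith
    moreover have "nrm A y * nrm A y \<le> nrm A (y\<^sup>\<star>) * nrm A y"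
      using norm_mult[of "y\<^sup>\<star>" y] norm_cstar[of y] that by (simp add: power2_eq_square)
    ultimately show ?thesis by simp
  qed (use that in simp)
  from *[of x] *[of "x\<^sup>\<star>"] assms show ?thesis by simp
qed

lemma norm_minus_le: "\<lbrakk>x \<in> carrier A; y \<in> carrier A\<rbrakk> \<Longrightarrow> nrm A (x \<ominus> y) \<le> nrm A x + nrm A y"
  using norm_triangle[of x "\<ominus> y"] by (simp add: a_minus_def)

lemma norm_minus_commute: "\<lbrakk>x \<in> carrier A; y \<in> carrier A\<rbrakk> \<Longrightarrow> nrm A (x \<ominus> y) = nrm A (y \<ominus> x)"
  using norm_uminus[of "x \<ominus> y"] by (simp add: a_minus_def minus_add a_comm)

lemma norm_diff_triangle:
  "\<lbrakk>x \<in> carrier A; y \<in> carrier A; z \<in> carrier A\<rbrakk> \<Longrightarrow> nrm A (x \<ominus> z) \<le> nrm A (x \<ominus> y) + nrm A (y \<ominus> z)"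
proof -
  assume *: "x \<in> carrier A" "y \<in> carrier A" "z \<in> carrier A"
  then have "x \<ominus> z = (x \<ominus> y) \<oplus> (y \<ominus> z)" by (intro sep) (auto simp: alg_simps)
  with * show ?thesis using norm_triangle[of "x \<ominus> y" "y \<ominus> z"] by simp
qed

lemma minus_self [simp]: "x \<in> carrier A \<Longrightarrow> x \<ominus> x = \<zero>"
  by (simp add: a_minus_def r_neg)

lemma norm_le_diff: "\<lbrakk>x \<in> carrier A; y \<in> carrier A\<rbrakk> \<Longrightarrow> nrm A x \<le> nrm A y + nrm A (x \<ominus> y)"
proof -
  assume *: "x \<in> carrier A" "y \<in> carrier A"
  then have "x = y \<oplus> (x \<ominus> y)" by (intro sep) (auto simp: alg_simps)
  with * show ?thesis using norm_triangle[of y "x \<ominus> y"] by simp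
qed

text \<open>Only an inequality, because in the zero algebra the unit has norm 0.\<close>

lemma norm_one_le: "nrm A \<one> \<le> 1"
proof -
  have "nrm A \<one> = (nrm A \<one>)\<^sup>2" using norm_cstar[of \<one>] by simp
  then have "nrm A \<one> * (1 - nrm A \<one>) = 0" by (simp add: power2_eq_square algebra_simps)
  then show ?thesis by auto
qed

lemma norm_cm_le: "nrm A (cm c) \<le> cmod c"
  using norm_one_le by (simp add: cm_def norm_sm mult_left_le)

lemma norm_minus_eq_zero: "\<lbrakk>x \<in> carrier A; y \<in> carrier A\<rbrakk> \<Longrightarrow> nrm A (x \<ominus> y) = 0 \<longleftrightarrow> x = y"
  by (simp add: norm_eq_zero)

section \<open>Norm convergence of sequences\<close>

lemma Metric: "Metric_space (carrier A) (cstar_dist A)"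
proof
  fix x y z
  show "0 \<le> cstar_dist A x y" by (simp add: cstar_dist_def)
  show "cstar_dist A x y = cstar_dist A y x" by (simp add: cstar_dist_def norm_minus_commute)
  show "cstar_dist A x y = 0 \<longleftrightarrow> x = y" if "x \<in> carrier A" "y \<in> carrier A"
    using that by (simp add: cstar_dist_def norm_minus_eq_zero)
  show "cstar_dist A x z \<le> cstar_dist A x y + cstar_dist A y z"
    if "x \<in> carrier A" "y \<in> carrier A" "z \<in> carrier A"
    using that by (simp add: cstar_dist_def norm_diff_triangle)
qed

text \<open>Sequences suffice in a metric topology: \<open>tends_limitin\<close>,
  \<open>closedin_iff\<close> and \<open>closure_tends\<close> translate limits, closed sets and
  closures of \<open>cstar_topology\<close> into this notion. The membership clauses keep side
  conditions out of the limit rules.\<close>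

definition tends :: "(nat \<Rightarrow> 'u) \<Rightarrow> 'u \<Rightarrow> bool" where
  "tends X x \<longleftrightarrow> (\<forall>n. X n \<in> carrier A) \<and> x \<in> carrier A \<and> (\<lambda>n. nrm A (X n \<ominus> x)) \<longlonglongrightarrow> 0"

lemma tends_limitin:
  "(\<And>n. X n \<in> carrier A) \<Longrightarrow>
    limitin (cstar_topology A) X x sequentially \<longleftrightarrow> tends X x"
  unfolding cstar_topology_def Metric_space.limitin_metric_dist_null[OF Metric] tends_def cstar_dist_def
  by (auto cong: conj_cong)

lemma closedin_iff:
  "closedin (cstar_topology A) B \<longleftrightarrow>
    B \<subseteq> carrier A \<and> (\<forall>X x. range X \<subseteq> B \<and> tends X x \<longrightarrow> x \<in> B)"
  unfolding cstar_topology_def Metric_space.metric_closedin_iff_sequentially_closed[OF Metric]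
  using tends_limitin unfolding cstar_topology_def
  by (intro conj_cong refl all_cong1) (metis UNIV_I image_subset_iff subsetD)

lemma tends_carrier: "tends X x \<Longrightarrow> X n \<in> carrier A" "tends X x \<Longrightarrow> x \<in> carrier A"
  by (auto simp: tends_def)

lemma tendsI_bound:
  assumes "\<And>n. X n \<in> carrier A" "x \<in> carrier A" "\<And>n. nrm A (X n \<ominus> x) \<le> b n" "b \<longlonglongrightarrow> 0"
  shows "tends X x"
proof -
  have "(\<lambda>n. nrm A (X n \<ominus> x)) \<longlonglongrightarrow> 0"
    by (rule tendsto_sandwich[OF _ _ tendsto_const assms(4)]) (use assms in auto)
  then show ?thesis using assms by (simp add: tends_def)
qed

lemma closure_tends:
  assumes "D \<subseteq> carrier A" "x \<in> cstar_topology A closure_of D"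
  shows "\<exists>X. range X \<subseteq> D \<and> tends X x"
proof -
  have x: "x \<in> carrier A" and *: "\<forall>r>0. \<exists>y\<in>D. y \<in> Metric_space.mball (carrier A) (cstar_dist A) x r"
    using assms(2) unfolding cstar_topology_def Metric_space.metric_closure_of[OF Metric] by auto
  have "\<exists>y\<in>D. nrm A (y \<ominus> x) < inverse (real (Suc n))" for n
    using *[rule_format, of "inverse (real (Suc n))"] assms(1) x norm_minus_commute
    by (force simp: Metric_space.in_mball[OF Metric] cstar_dist_def)
  then obtain X where X: "\<And>n. X n \<in> D" "\<And>n. nrm A (X n \<ominus> x) < inverse (real (Suc n))" by metis
  have "tends X x"
    using X x assms(1) by (intro tendsI_bound[OF _ _ _ LIMSEQ_inverse_real_of_nat] less_imp_le) auto
  with X show ?thesis by auto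
qed

lemma tends_const [simp]: "x \<in> carrier A \<Longrightarrow> tends (\<lambda>_. x) x"
  by (simp add: tends_def)

lemma tends_add:
  assumes "tends X x" "tends Z z" shows "tends (\<lambda>n. X n \<oplus> Z n) (x \<oplus> z)"
proof -
  note c = tends_carrier[OF assms(1)] tends_carrier[OF assms(2)]
  have "nrm A ((X n \<oplus> Z n) \<ominus> (x \<oplus> z)) \<le> nrm A (X n \<ominus> x) + nrm A (Z n \<ominus> z)" for n
  proof -
    have "(X n \<oplus> Z n) \<ominus> (x \<oplus> z) = (X n \<ominus> x) \<oplus> (Z n \<ominus> z)"
      using c by (intro sep) (auto simp: alg_simps)
    then show ?thesis using c norm_triangle by simp
  qed
  moreover have "(\<lambda>n. nrm A (X n \<ominus> x) + nrm A (Z n \<ominus> z)) \<longlonglongrightarrow> 0"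
    using assms tendsto_add[of _ 0 _ _ 0] unfolding tends_def by force
  ultimately show ?thesis using c by (intro tendsI_bound) auto
qed

lemma tends_sm:
  assumes "tends X x" shows "tends (\<lambda>n. c \<odot> X n) (c \<odot> x)"
proof -
  note t = tends_carrier[OF assms(1)]
  have "nrm A (c \<odot> X n \<ominus> c \<odot> x) \<le> cmod c * nrm A (X n \<ominus> x)" for n
  proof -
    have "c \<odot> X n \<ominus> c \<odot> x = c \<odot> (X n \<ominus> x)"
      using t by (intro sep) (auto simp: alg_simps algebra_simps)
    then show ?thesis using t norm_sm by simp
  qed
  moreover have "(\<lambda>n. cmod c * nrm A (X n \<ominus> x)) \<longlonglongrightarrow> 0"
    using assms tendsto_mult_right_zero unfolding tends_def by blast
  ultimately show ?thesis using t by (intro tendsI_bound) auto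
qed

lemma tends_star:
  assumes "tends X x" shows "tends (\<lambda>n. (X n)\<^sup>\<star>) (x\<^sup>\<star>)"
  using assms unfolding tends_def by (auto simp flip: star_minus)

lemma tends_norm: "tends X x \<Longrightarrow> (\<lambda>n. nrm A (X n)) \<longlonglongrightarrow> nrm A x"
proof -
  assume t: "tends X x"
  have "\<bar>nrm A (X n) - nrm A x\<bar> \<le> nrm A (X n \<ominus> x)" for n
    using norm_le_diff[of "X n" x] norm_le_diff[of x "X n"] tends_carrier[OF t]
      norm_minus_commute[of x "X n"] by auto
  then show ?thesis using t unfolding tends_def
    by (intro Lim_transform_bound[of "\<lambda>n. nrm A (X n) - nrm A x" "\<lambda>n. nrm A (X n \<ominus> x)", THEN LIM_zero_cancel]) auto
qed

lemma tends_mult: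
  assumes "tends X x" "tends Z z" shows "tends (\<lambda>n. X n \<otimes> Z n) (x \<otimes> z)"
proof -
  note c = tends_carrier[OF assms(1)] tends_carrier[OF assms(2)]
  let ?b = "\<lambda>n. nrm A (X n \<ominus> x) * nrm A (Z n) + nrm A x * nrm A (Z n \<ominus> z)"
  have "nrm A ((X n \<otimes> Z n) \<ominus> (x \<otimes> z)) \<le> ?b n" for n
  proof -
    have "(X n \<otimes> Z n) \<ominus> (x \<otimes> z) = (X n \<ominus> x) \<otimes> Z n \<oplus> x \<otimes> (Z n \<ominus> z)"
      using c by (intro sep) (auto simp: alg_simps)
    also have "nrm A \<dots> \<le> nrm A ((X n \<ominus> x) \<otimes> Z n) + nrm A (x \<otimes> (Z n \<ominus> z))"
      using c by (intro norm_triangle) auto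
    also have "\<dots> \<le> ?b n" using c by (intro add_mono norm_mult) auto
    finally show ?thesis .
  qed
  moreover have "?b \<longlonglongrightarrow> 0 * nrm A z + nrm A x * 0"
    using assms tends_norm[OF assms(2)] unfolding tends_def by (intro tendsto_intros) auto
  ultimately show ?thesis using c by (intro tendsI_bound) auto
qed

lemma tends_minus:
  assumes "tends X x" "tends Z z" shows "tends (\<lambda>n. X n \<ominus> Z n) (x \<ominus> z)"
  using tends_add[OF assms(1) tends_sm[OF assms(2), of "-1"]] tends_carrier[OF assms(1)] tends_carrier[OF assms(2)]
  by (simp add: sm_minus_one a_minus_def)

lemma tends_unique:
  assumes "tends X x" "tends X z" shows "x = z"
proof -
  have "(\<lambda>n. nrm A (X n \<ominus> X n)) \<longlonglongrightarrow> nrm A (x \<ominus> z)"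
    by (intro tends_norm tends_minus assms)
  then have "nrm A (x \<ominus> z) = 0"
    using tends_carrier[OF assms(1)] LIMSEQ_unique[OF tendsto_const, of 0] by (simp add: a_minus_def r_neg)
  then show ?thesis using norm_minus_eq_zero tends_carrier(2) assms by blast
qed

lemma tends_Suc: "tends X x \<Longrightarrow> tends (\<lambda>n. X (Suc n)) x"
  unfolding tends_def using LIMSEQ_Suc[of "\<lambda>n. nrm A (X n \<ominus> x)"] by auto

lemma tends_norm_le: "\<lbrakk>tends X x; \<And>n. nrm A (X n) \<le> b\<rbrakk> \<Longrightarrow> nrm A x \<le> b"
  using tends_norm LIMSEQ_le_const2 by blast

lemma cstar_algebraI:
  assumes "\<And>X. \<lbrakk>\<And>n. X n \<in> carrier A; \<And>e. e > 0 \<Longrightarrow> \<exists>N. \<forall>m\<ge>N. \<forall>n\<ge>N. nrm A (X m \<ominus> X n) < e\<rbrakk>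
    \<Longrightarrow> \<exists>x. tends X x"
  shows "cstar_algebra A"
proof -
  have "Metric_space.mcomplete (carrier A) (cstar_dist A)"
    unfolding Metric_space.mcomplete_def[OF Metric] Metric_space.MCauchy_def[OF Metric]
  proof (intro allI impI, elim conjE)
    fix X :: "nat \<Rightarrow> 'u" assume X: "range X \<subseteq> carrier A"
      and cau: "\<forall>e>0. \<exists>N. \<forall>n n'. N \<le> n \<longrightarrow> N \<le> n' \<longrightarrow> cstar_dist A (X n) (X n') < e"
    have Xc: "X n \<in> carrier A" for n using X by auto
    have "\<exists>x. tends X x"
      using cau Xc by (intro assms) (auto simp: cstar_dist_def)
    then show "\<exists>x. limitin (Metric_space.mtopology (carrier A) (cstar_dist A)) X x sequentially"
      using tends_limitin[OF Xc] by (auto simp: cstar_topology_def)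
  qed
  then show ?thesis
    using star_algebra seminorm norm_definite by (simp add: cstar_algebra_def)
qed

end

locale cstar_alg =
  fixes A :: "'u cstar" (structure)
  assumes cstar_algebra: "cstar_algebra A"

sublocale cstar_alg \<subseteq> pre_cstar_alg A
  using cstar_algebra
  by (intro pre_cstar_alg.intro star_alg.intro pre_cstar_alg_axioms.intro) (auto simp: cstar_algebra_def)

context cstar_alg
begin

lemma complete:
  assumes "\<And>n. X n \<in> carrier A"
    and "\<And>e. e > 0 \<Longrightarrow> \<exists>N. \<forall>m\<ge>N. \<forall>n\<ge>N. nrm A (X m \<ominus> X n) < e"
  shows "\<exists>x. tends X x"
proof -
  have "Metric_space.mcomplete (carrier A) (cstar_dist A)"
    using cstar_algebra by (simp add: cstar_algebra_def)
  moreover have "Metric_space.MCauchy (carrier A) (cstar_dist A) X"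
    unfolding Metric_space.MCauchy_def[OF Metric] using assms by (auto simp: cstar_dist_def)
  ultimately obtain x where "limitin (cstar_topology A) X x sequentially"
    unfolding Metric_space.mcomplete_def[OF Metric] cstar_topology_def by blast
  then show ?thesis using tends_limitin assms(1) by blast
qed

end

section \<open>Positive elements\<close>

primrec sqrt_majorant :: "nat \<Rightarrow> real" where
  "sqrt_majorant 0 = 0"
| "sqrt_majorant (Suc n) = (1 + (sqrt_majorant n)\<^sup>2) / 2"

lemma sqrt_majorant_bounds: "0 \<le> sqrt_majorant n \<and> sqrt_majorant n \<le> 1"
proof (induction n)
  case (Suc n)
  then have "(sqrt_majorant n)\<^sup>2 \<le> 1" by (simp add: power_le_one)
  then show ?case by simp
qed simp

lemma sqrt_majorant_mono: "sqrt_majorant n \<le> sqrt_majorant (Suc n)"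
proof -
  have "0 \<le> (1 - sqrt_majorant n)\<^sup>2" by simp
  then show ?thesis by (simp add: power2_eq_square algebra_simps)
qed

lemma sqrt_majorant_Cauchy: "Cauchy sqrt_majorant"
proof -
  have "incseq sqrt_majorant" using sqrt_majorant_mono by (rule incseq_SucI)
  then have "convergent sqrt_majorant"
    using incseq_convergent[of sqrt_majorant 1] sqrt_majorant_bounds unfolding convergent_def by metis
  then show ?thesis by (rule convergent_Cauchy)
qed

context cstar_alg
begin

text \<open>For \<open>\<parallel>x\<parallel> \<le> 1\<close> the iteration \<open>y \<mapsto> (x + y\<^sup>2) / 2\<close> converges to \<open>y = 1 - \<surd>(1 - x)\<close>;
  its increments are dominated by those of the same iteration for \<open>x = 1\<close>.\<close>

primrec sqrt_iter :: "'u \<Rightarrow> nat \<Rightarrow> 'u" where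
  "sqrt_iter x 0 = \<zero>"
| "sqrt_iter x (Suc n) = (1/2) \<odot> (x \<oplus> sqrt_iter x n \<otimes> sqrt_iter x n)"

lemma sqrt_iter_sa [simp]: "x \<in> sa \<Longrightarrow> sqrt_iter x n \<in> sa"
proof (induction n)
  case (Suc n)
  then show ?case
    using sa_sm[of "x \<oplus> sqrt_iter x n \<otimes> sqrt_iter x n" "1/2"] sa_mult by simp
qed simp

lemma sqrt_iter_comm:
  assumes x: "x \<in> sa" and z: "z \<in> carrier A" "z \<otimes> x = x \<otimes> z"
  shows "z \<otimes> sqrt_iter x n = sqrt_iter x n \<otimes> z"
proof (induction n)
  case (Suc n)
  have c: "sqrt_iter x n \<in> carrier A" "x \<in> carrier A" using x by auto
  have "z \<otimes> (sqrt_iter x n \<otimes> sqrt_iter x n) = sqrt_iter x n \<otimes> sqrt_iter x n \<otimes> z"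
    using Suc z c by (metis m_assoc)
  then show ?case using z c by (simp add: sm_mult_l sm_mult_r l_distr r_distr)
qed (use z in simp)

lemma sqrt_iter_norm:
  assumes x: "x \<in> sa" "nrm A x \<le> 1"
  shows "nrm A (sqrt_iter x n) \<le> sqrt_majorant n"
proof (induction n)
  case (Suc n)
  have c: "sqrt_iter x n \<in> carrier A" "x \<in> carrier A" using x by auto
  have "nrm A (x \<oplus> sqrt_iter x n \<otimes> sqrt_iter x n) \<le> nrm A x + nrm A (sqrt_iter x n \<otimes> sqrt_iter x n)"
    using c by (intro norm_triangle) auto
  also have "\<dots> \<le> 1 + (sqrt_majorant n)\<^sup>2"
    using Suc x c by (intro add_mono) (auto simp: norm_sa_sq intro!: power_mono)
  finally show ?case using c by (simp add: norm_sm)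
qed simp

lemma sqrt_iter_step:
  assumes x: "x \<in> sa" "nrm A x \<le> 1"
  shows "nrm A (sqrt_iter x (Suc n) \<ominus> sqrt_iter x n) \<le> sqrt_majorant (Suc n) - sqrt_majorant n"
proof (induction n)
  case 0
  then show ?case using x by (simp add: a_minus_def norm_sm)
next
  case (Suc n)
  let ?y = "sqrt_iter x n" and ?y' = "sqrt_iter x (Suc n)"
  let ?t = "sqrt_majorant n" and ?t' = "sqrt_majorant (Suc n)"
  have c: "?y \<in> carrier A" "?y' \<in> carrier A" "x \<in> carrier A" using x sqrt_iter_sa by blast+
  have comm: "?y \<otimes> ?y' = ?y' \<otimes> ?y"
    by (rule sqrt_iter_comm[OF x(1) c(1) sqrt_iter_comm[OF x(1) c(3) refl, symmetric]])
  \<comment> \<open>A difference of two squares, which factors because consecutive iterates commute.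
    The scalar recursion factors in the same way, so the bounds of the two factors multiply to the
    increment of \<open>sqrt_majorant\<close>.\<close>
  have "sqrt_iter x (Suc (Suc n)) \<ominus> ?y' = (1/2) \<odot> ((?y' \<ominus> ?y) \<otimes> (?y' \<oplus> ?y))"
  proof (rule sep)
    fix f assume f: "linfun A f"
    have "f ?y' = (f x + f (?y \<otimes> ?y)) / 2" using c f by (simp add: alg_simps)
    moreover have "sqrt_iter x (Suc (Suc n)) = (1/2) \<odot> (x \<oplus> ?y' \<otimes> ?y')" by (rule sqrt_iter.simps(2))
    ultimately show "f (sqrt_iter x (Suc (Suc n)) \<ominus> ?y') = f ((1/2) \<odot> ((?y' \<ominus> ?y) \<otimes> (?y' \<oplus> ?y)))"
      using c f comm by (simp del: sqrt_iter.simps add: alg_simps algebra_simps add_divide_distrib diff_divide_distrib)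
  qed (use c sqrt_iter_sa x in blast)+
  also have "nrm A \<dots> = (1/2) * nrm A ((?y' \<ominus> ?y) \<otimes> (?y' \<oplus> ?y))"
    using c by (simp del: sqrt_iter.simps add: norm_sm)
  also have "\<dots> \<le> (1/2) * ((?t' - ?t) * (?t' + ?t))"
  proof (intro mult_left_mono)
    have "nrm A (?y' \<oplus> ?y) \<le> ?t' + ?t"
      using norm_triangle[of ?y' ?y] sqrt_iter_norm[OF x, of n] sqrt_iter_norm[OF x, of "Suc n"] c
      by (simp del: sqrt_iter.simps sqrt_majorant.simps)
    then have "nrm A (?y' \<ominus> ?y) * nrm A (?y' \<oplus> ?y) \<le> (?t' - ?t) * (?t' + ?t)"
      using c sqrt_majorant_mono[of n]
      by (intro mult_mono Suc.IH) (simp_all del: sqrt_iter.simps sqrt_majorant.simps)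
    then show "nrm A ((?y' \<ominus> ?y) \<otimes> (?y' \<oplus> ?y)) \<le> (?t' - ?t) * (?t' + ?t)"
      using norm_mult[of "?y' \<ominus> ?y" "?y' \<oplus> ?y"] c by (simp del: sqrt_iter.simps)
  qed simp
  also have "\<dots> = sqrt_majorant (Suc (Suc n)) - ?t'"
    unfolding sqrt_majorant.simps(2)[of "Suc n"] by (simp add: power2_eq_square field_simps)
  finally show ?case .
qed

lemma sqrt_iter_diff:
  assumes x: "x \<in> sa" "nrm A x \<le> 1"
  shows "nrm A (sqrt_iter x (n + k) \<ominus> sqrt_iter x n) \<le> sqrt_majorant (n + k) - sqrt_majorant n"
proof (induction k)
  case 0
  have "sqrt_iter x n \<in> carrier A" using x by auto
  then show ?case by simp
next
  case (Suc k)
  have "sqrt_iter x m \<in> carrier A" for m using x by auto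
  then have "nrm A (sqrt_iter x (Suc (n + k)) \<ominus> sqrt_iter x n)
    \<le> nrm A (sqrt_iter x (Suc (n + k)) \<ominus> sqrt_iter x (n + k)) + nrm A (sqrt_iter x (n + k) \<ominus> sqrt_iter x n)"
    by (intro norm_diff_triangle)
  then show ?case using Suc sqrt_iter_step[OF x, of "n + k"] by simp
qed

lemma sqrt_iter_convergent:
  assumes x: "x \<in> sa" "nrm A x \<le> 1"
  shows "\<exists>y. tends (sqrt_iter x) y"
proof (rule complete)
  have c: "sqrt_iter x n \<in> carrier A" for n using x by auto
  then show "\<And>n. sqrt_iter x n \<in> carrier A" .
  fix e :: real assume "e > 0"
  then obtain N where N: "\<And>m n. \<lbrakk>m \<ge> N; n \<ge> N\<rbrakk> \<Longrightarrow> \<bar>sqrt_majorant m - sqrt_majorant n\<bar> < e"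
    using sqrt_majorant_Cauchy unfolding Cauchy_def dist_real_def by blast
  have *: "nrm A (sqrt_iter x m \<ominus> sqrt_iter x n) < e" if "m \<ge> N" "n \<ge> N" "n \<le> m" for m n
    using sqrt_iter_diff[OF x, of n "m - n"] N[of m n] that by simp
  have "nrm A (sqrt_iter x m \<ominus> sqrt_iter x n) < e" if "m \<ge> N" "n \<ge> N" for m n
    using *[of m n] *[of n m] that c norm_minus_commute[of "sqrt_iter x m" "sqrt_iter x n"]
    by (cases "n \<le> m") auto
  then show "\<exists>N. \<forall>m\<ge>N. \<forall>n\<ge>N. nrm A (sqrt_iter x m \<ominus> sqrt_iter x n) < e" by blast
qed

text \<open>The root is 1 - y, where y is the limit of the iteration started with x = 1 - h. Being a
  limit of polynomials in h, it commutes with whatever commutes with h; this clause stands in for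
  functional calculus. The norm clause allows the lemma to be applied to the root again.\<close>

lemma ex_sqrt:
  assumes h: "h \<in> sa" "nrm A (\<one> \<ominus> h) \<le> 1"
  obtains k where "k \<in> sa" "k \<otimes> k = h" "nrm A (\<one> \<ominus> k) \<le> 1"
    "\<And>z. \<lbrakk>z \<in> carrier A; z \<otimes> h = h \<otimes> z\<rbrakk> \<Longrightarrow> z \<otimes> k = k \<otimes> z"
proof -
  let ?x = "\<one> \<ominus> h"
  have x: "?x \<in> sa" "nrm A ?x \<le> 1" using h by auto
  then obtain y where y: "tends (sqrt_iter ?x) y" using sqrt_iter_convergent by blast
  note yc = tends_carrier(2)[OF y]
  have "tends (\<lambda>n. (sqrt_iter ?x n)\<^sup>\<star>) y" using y x by (simp add: sa_star)
  then have ysa: "y \<in> sa" using tends_star[OF y] tends_unique yc by (intro saI) auto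
  have "tends (\<lambda>n. (1/2) \<odot> (?x \<oplus> sqrt_iter ?x n \<otimes> sqrt_iter ?x n)) ((1/2) \<odot> (?x \<oplus> y \<otimes> y))"
    using h by (intro tends_sm tends_add tends_mult y) auto
  then have "tends (\<lambda>n. sqrt_iter ?x (Suc n)) ((1/2) \<odot> (?x \<oplus> y \<otimes> y))" by simp
  then have fix_eq: "y = (1/2) \<odot> (?x \<oplus> y \<otimes> y)" using tends_Suc[OF y] tends_unique by blast
  have sq: "(\<one> \<ominus> y) \<otimes> (\<one> \<ominus> y) = h"
  proof (rule sep)
    fix f assume f: "linfun A f"
    have "f y = f ((1/2) \<odot> (?x \<oplus> y \<otimes> y))" using fix_eq by simp
    also have "\<dots> = (f \<one> - f h + f (y \<otimes> y)) / 2" using f h yc by (simp add: alg_simps)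
    finally show "f ((\<one> \<ominus> y) \<otimes> (\<one> \<ominus> y)) = f h"
      using f h yc by (simp add: alg_simps field_simps)
  qed (use yc h in auto)
  have comm: "z \<otimes> y = y \<otimes> z" if z: "z \<in> carrier A" "z \<otimes> h = h \<otimes> z" for z
  proof -
    have "z \<otimes> ?x = ?x \<otimes> z" using z h by (simp add: minus_mult_l minus_mult_r)
    then have "z \<otimes> sqrt_iter ?x n = sqrt_iter ?x n \<otimes> z" for n using sqrt_iter_comm x z by blast
    moreover have "tends (\<lambda>n. z \<otimes> sqrt_iter ?x n) (z \<otimes> y)" "tends (\<lambda>n. sqrt_iter ?x n \<otimes> z) (y \<otimes> z)"
      using z by (intro tends_mult y tends_const; simp)+
    ultimately show ?thesis using tends_unique by simp
  qed
  have "nrm A y \<le> 1"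
    using tends_norm_le[OF y] sqrt_iter_norm[OF x] sqrt_majorant_bounds order_trans by blast
  moreover have "\<one> \<ominus> (\<one> \<ominus> y) = y" using yc by (intro sep) (auto simp: alg_simps)
  ultimately show thesis
    using that[of "\<one> \<ominus> y"] ysa sq comm yc by (simp add: minus_mult_l minus_mult_r)
qed

lemma norm_unitary_parts:
  assumes "k \<in> sa" "m \<in> sa" "k \<otimes> m = m \<otimes> k" "k \<otimes> k \<oplus> m \<otimes> m = cm (complex_of_real r)" "r \<ge> 0"
  shows "(nrm A k)\<^sup>2 \<le> r" "(nrm A m)\<^sup>2 \<le> r"
proof -
  let ?u = "k \<oplus> \<i> \<odot> m"
  have us: "?u\<^sup>\<star> = k \<ominus> \<i> \<odot> m" using assms by (intro sep) (auto simp: alg_simps sa_star)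
  have "?u\<^sup>\<star> \<otimes> ?u = cm (complex_of_real r)"
    unfolding us using mult_comm_sq[of k m] assms by auto
  then have "(nrm A ?u)\<^sup>2 \<le> r"
    using norm_cstar[of ?u] norm_cm_le[of "complex_of_real r"] assms by auto
  then have "nrm A ?u \<le> sqrt r" by (rule real_le_rsqrt)
  moreover have "k = (1/2) \<odot> (?u \<oplus> ?u\<^sup>\<star>)" "m = (- \<i> / 2) \<odot> (?u \<ominus> ?u\<^sup>\<star>)"
    unfolding us using assms(1,2) by (intro sep; auto simp: alg_simps algebra_simps)+
  moreover have "nrm A ((1/2) \<odot> (?u \<oplus> ?u\<^sup>\<star>)) \<le> nrm A ?u" "nrm A ((- \<i> / 2) \<odot> (?u \<ominus> ?u\<^sup>\<star>)) \<le> nrm A ?u"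
    using norm_triangle[of ?u "?u\<^sup>\<star>"] norm_minus_le[of ?u "?u\<^sup>\<star>"] assms(1,2) by (auto simp: norm_sm norm_divide)
  ultimately have "nrm A k \<le> sqrt r" "nrm A m \<le> sqrt r" by auto
  moreover have "0 \<le> nrm A k" "0 \<le> nrm A m" using assms(1,2) by auto
  ultimately show "(nrm A k)\<^sup>2 \<le> r" "(nrm A m)\<^sup>2 \<le> r"
    using assms(5) power_mono[of "nrm A k" "sqrt r" 2] power_mono[of "nrm A m" "sqrt r" 2] by auto
qed

text \<open>As in cos^2 + sin^2 = 1: a root m of 1 - k^2 commutes with k, so
  \<open>norm_unitary_parts\<close> bounds |m|, and |1 - k^2| = |m|^2.\<close>

lemma norm_compl_sq_one:
  assumes k: "k \<in> sa" "nrm A k \<le> 1"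
  shows "nrm A (\<one> \<ominus> k \<otimes> k) \<le> 1"
proof -
  have sq: "(nrm A k)\<^sup>2 \<le> 1" using k by (simp add: power_le_one)
  have h: "\<one> \<ominus> k \<otimes> k \<in> sa" using k sa_mult by simp
  have "\<one> \<ominus> (\<one> \<ominus> k \<otimes> k) = k \<otimes> k" using k by (intro sep) (auto simp: alg_simps)
  then have "nrm A (\<one> \<ominus> (\<one> \<ominus> k \<otimes> k)) \<le> 1" using norm_sa_sq k sq by simp
  then obtain m where m: "m \<in> sa" "m \<otimes> m = \<one> \<ominus> k \<otimes> k"
      and comm: "\<And>z. \<lbrakk>z \<in> carrier A; z \<otimes> (\<one> \<ominus> k \<otimes> k) = (\<one> \<ominus> k \<otimes> k) \<otimes> z\<rbrakk> \<Longrightarrow> z \<otimes> m = m \<otimes> z"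
    using ex_sqrt[OF h] by metis
  have "k \<otimes> m = m \<otimes> k" using k by (intro comm) (auto simp: mult_simps)
  moreover have "k \<otimes> k \<oplus> m \<otimes> m = cm (complex_of_real 1)"
    unfolding m(2) using k by (intro sep) (auto simp: alg_simps)
  ultimately have "(nrm A m)\<^sup>2 \<le> 1" using norm_unitary_parts(2)[of k m 1] k m by simp
  then show ?thesis using norm_sa_sq m by metis
qed

lemma norm_compl_sq:
  assumes k: "k \<in> sa" "(nrm A k)\<^sup>2 \<le> r"
  shows "nrm A (cm (complex_of_real r) \<ominus> k \<otimes> k) \<le> r"
proof (cases "r = 0")
  case True
  then have "k = \<zero>" using k norm_eq_zero[of k] by simp
  then show ?thesis using True by (simp add: a_minus_def)
next
  case False
  have "0 \<le> r" using k zero_le_power2 order_trans by blast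
  with False have r: "r > 0" by simp
  let ?c = "complex_of_real (1 / sqrt r)"
  have k': "?c \<odot> k \<in> sa" using k sa_sm by blast
  have "(nrm A k) \<le> sqrt r" using k by (simp add: real_le_rsqrt)
  then have "nrm A (?c \<odot> k) \<le> 1" using k r by (simp add: norm_sm norm_divide divide_simps)
  note * = norm_compl_sq_one[OF k' this]
  have "?c * ?c = 1 / complex_of_real r" using r by (simp flip: of_real_mult)
  then have "cm (complex_of_real r) \<ominus> k \<otimes> k = complex_of_real r \<odot> (\<one> \<ominus> (?c \<odot> k) \<otimes> (?c \<odot> k))"
    using k r by (intro sep) (auto simp: alg_simps linfun_cm algebra_simps simp flip: sm_assoc mult.assoc)
  also have "nrm A \<dots> = r * nrm A (\<one> \<ominus> (?c \<odot> k) \<otimes> (?c \<odot> k))"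
    using k r by (subst norm_sm) auto
  also have "\<dots> \<le> r * 1" using * r by (intro mult_left_mono) auto
  finally show ?thesis by simp
qed

text \<open>Positivity without spectrum: for self-adjoint h, the bound says that the spectrum lies
  between 0 and 2 r. That these are exactly the elements y* y is shown in
  \<open>pos_iff\<close>.\<close>

definition pos :: "'u set" where
  "pos = {h \<in> sa. \<exists>r\<ge>0. nrm A (cm (complex_of_real r) \<ominus> h) \<le> r}"

lemma pos_sa [dest]: "h \<in> pos \<Longrightarrow> h \<in> sa" by (simp add: pos_def)

lemma pos_carrier [simp]: "h \<in> pos \<Longrightarrow> h \<in> carrier A" by blast

lemma posI: "\<lbrakk>h \<in> sa; nrm A (cm (complex_of_real r) \<ominus> h) \<le> r\<rbrakk> \<Longrightarrow> h \<in> pos"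
  unfolding pos_def using order_trans[OF norm_nonneg[of "cm (complex_of_real r) \<ominus> h"]]
  by (auto intro!: exI[of _ r])

lemma pos_sq [simp]: "k \<in> sa \<Longrightarrow> k \<otimes> k \<in> pos"
  using norm_compl_sq[of k "(nrm A k)\<^sup>2"] sa_mult posI by blast

lemma pos_sm:
  assumes "h \<in> pos" "c \<ge> 0" shows "complex_of_real c \<odot> h \<in> pos"
proof -
  obtain r where r: "r \<ge> 0" "nrm A (cm (complex_of_real r) \<ominus> h) \<le> r" "h \<in> sa"
    using assms(1) by (auto simp: pos_def)
  have "cm (complex_of_real (c * r)) \<ominus> complex_of_real c \<odot> h = complex_of_real c \<odot> (cm (complex_of_real r) \<ominus> h)"
    using r(3) by (intro sep) (auto simp: alg_simps linfun_cm algebra_simps)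
  then have "nrm A (cm (complex_of_real (c * r)) \<ominus> complex_of_real c \<odot> h) = c * nrm A (cm (complex_of_real r) \<ominus> h)"
    using r(3) assms(2) by (simp add: norm_sm)
  also have "\<dots> \<le> c * r" using r assms by (intro mult_left_mono)
  finally have "nrm A (cm (complex_of_real (c * r)) \<ominus> complex_of_real c \<odot> h) \<le> c * r" .
  then show ?thesis by (rule posI[OF sa_sm[OF r(3)]])
qed

lemma pos_ex_sqrt:
  assumes "h \<in> pos"
  obtains k where "k \<in> sa" "k \<otimes> k = h"
    "\<And>z. \<lbrakk>z \<in> carrier A; z \<otimes> h = h \<otimes> z\<rbrakk> \<Longrightarrow> z \<otimes> k = k \<otimes> z"
proof -
  obtain r where r: "r \<ge> 0" "nrm A (cm (complex_of_real r) \<ominus> h) \<le> r" "h \<in> sa"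
    using assms(1) by (auto simp: pos_def)
  show thesis
  proof (cases "r = 0")
    case True
    then have "h = \<zero>" using r norm_eq_zero[of "\<zero> \<ominus> h"] by (simp add: a_minus_def order_antisym)
    then show ?thesis using that[of \<zero>] by simp
  next
    case False
    with r have r0: "r > 0" by simp
    let ?g = "complex_of_real (1/r) \<odot> h"
    have g: "?g \<in> sa" using r sa_sm by blast
    have "\<one> \<ominus> ?g = complex_of_real (1/r) \<odot> (cm (complex_of_real r) \<ominus> h)"
      using r(3) r0 by (intro sep) (auto simp: alg_simps linfun_cm algebra_simps)
    then have "nrm A (\<one> \<ominus> ?g) = nrm A (cm (complex_of_real r) \<ominus> h) / r"
      using r(3) r0 by (simp add: norm_sm norm_divide)
    then have "nrm A (\<one> \<ominus> ?g) \<le> 1" using r r0 by simp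
    then obtain k where k: "k \<in> sa" "k \<otimes> k = ?g"
        and comm: "\<And>z. \<lbrakk>z \<in> carrier A; z \<otimes> ?g = ?g \<otimes> z\<rbrakk> \<Longrightarrow> z \<otimes> k = k \<otimes> z"
      using ex_sqrt[OF g] by metis
    let ?c = "complex_of_real (sqrt r)"
    have cc: "?c * ?c = complex_of_real r" using r0 by (simp flip: of_real_mult)
    have "(?c \<odot> k) \<otimes> (?c \<odot> k) = (?c * ?c) \<odot> ?g"
      using k r(3) by (simp add: mult_simps flip: sm_assoc)
    also have "\<dots> = h" unfolding cc using r0 r(3) by (simp flip: sm_assoc of_real_mult)
    finally have sq: "(?c \<odot> k) \<otimes> (?c \<odot> k) = h" .
    have "z \<otimes> (?c \<odot> k) = (?c \<odot> k) \<otimes> z" if "z \<in> carrier A" "z \<otimes> h = h \<otimes> z" for z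
      using comm[of z] that r(3) k by (simp add: mult_simps)
    then show ?thesis using that[of "?c \<odot> k"] k sq sa_sm by blast
  qed
qed

text \<open>The definition of \<open>pos\<close> provides some r. Because h is a square, every r
  from |h| upwards will do, which is what makes the norm estimates below uniform.\<close>

lemma pos_compl: "\<lbrakk>h \<in> pos; nrm A h \<le> r\<rbrakk> \<Longrightarrow> nrm A (cm (complex_of_real r) \<ominus> h) \<le> r"
  by (erule pos_ex_sqrt) (metis norm_compl_sq norm_sa_sq)

lemma pos_add:
  assumes "h \<in> pos" "g \<in> pos" shows "h \<oplus> g \<in> pos"
proof -
  obtain r s where r: "nrm A (cm (complex_of_real r) \<ominus> h) \<le> r" and s: "nrm A (cm (complex_of_real s) \<ominus> g) \<le> s"
    using assms by (auto simp: pos_def)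
  have "cm (complex_of_real (r + s)) \<ominus> (h \<oplus> g) = (cm (complex_of_real r) \<ominus> h) \<oplus> (cm (complex_of_real s) \<ominus> g)"
    using assms by (intro sep) (auto simp: alg_simps linfun_cm algebra_simps)
  then have "nrm A (cm (complex_of_real (r + s)) \<ominus> (h \<oplus> g)) \<le> r + s"
    using norm_triangle[of "cm (complex_of_real r) \<ominus> h" "cm (complex_of_real s) \<ominus> g"] r s assms by simp
  moreover have "h \<oplus> g \<in> sa" using assms by (intro sa_add pos_sa)
  ultimately show ?thesis using posI by blast
qed

lemma pos_zero [simp]: "\<zero> \<in> pos" and pos_one [simp]: "\<one> \<in> pos"
  using pos_sq[of \<zero>] pos_sq[of \<one>] by simp_all

lemma pos_cm: "r \<ge> 0 \<Longrightarrow> cm (complex_of_real r) \<in> pos"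
  unfolding cm_def by (rule pos_sm) simp_all

lemma pos_archimedean:
  assumes h: "h \<in> sa" and e: "\<And>e. e > 0 \<Longrightarrow> h \<oplus> cm (complex_of_real e) \<in> pos"
  shows "h \<in> pos"
proof -
  let ?R = "nrm A h + 1"
  have "nrm A (cm (complex_of_real ?R) \<ominus> h) \<le> ?R"
  proof (rule field_le_epsilon)
    fix d :: real assume "d > 0"
    \<comment> \<open>Capped at 1, so that h + e stays of norm at most \<open>?R\<close> = |h| + 1
      and one bound serves for all e.\<close>
    let ?e = "min d 1"
    have e0: "?e > 0" using \<open>d > 0\<close> by simp
    have ne: "nrm A (cm (complex_of_real ?e)) \<le> ?e" using norm_cm_le[of "complex_of_real ?e"] e0 by simp
    have "nrm A (h \<oplus> cm (complex_of_real ?e)) \<le> ?R"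
      using norm_triangle[of h "cm (complex_of_real ?e)"] ne h by simp
    then have "nrm A (cm (complex_of_real ?R) \<ominus> (h \<oplus> cm (complex_of_real ?e))) \<le> ?R"
      using e[OF e0] pos_compl by blast
    moreover have "cm (complex_of_real ?R) \<ominus> h =
        (cm (complex_of_real ?R) \<ominus> (h \<oplus> cm (complex_of_real ?e))) \<oplus> cm (complex_of_real ?e)"
      using h by (intro sep) (auto simp: alg_simps)
    ultimately show "nrm A (cm (complex_of_real ?R) \<ominus> h) \<le> ?R + d"
      using norm_triangle[of "cm (complex_of_real ?R) \<ominus> (h \<oplus> cm (complex_of_real ?e))" "cm (complex_of_real ?e)"] ne h
      by simp
  qed
  then show ?thesis using h posI by blast
qed

text \<open>Write h = k^2 and -h = m^2 with commuting roots. Then k^2 + m^2 = 0, and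
  \<open>norm_unitary_parts\<close> with r = 0 forces k = 0.\<close>

lemma pos_antisym:
  assumes "h \<in> pos" "\<ominus> h \<in> pos" shows "h = \<zero>"
proof -
  have hc: "h \<in> carrier A" using assms by blast
  obtain k where k: "k \<in> sa" "k \<otimes> k = h"
    using assms(1) pos_ex_sqrt by metis
  obtain m where m: "m \<in> sa" "m \<otimes> m = \<ominus> h"
      and mc: "\<And>z. \<lbrakk>z \<in> carrier A; z \<otimes> (\<ominus> h) = (\<ominus> h) \<otimes> z\<rbrakk> \<Longrightarrow> z \<otimes> m = m \<otimes> z"
    using assms(2) pos_ex_sqrt by metis
  have "k \<otimes> h = h \<otimes> k" using k by (metis m_assoc sa_carrier)
  then have "k \<otimes> m = m \<otimes> k" using hc k by (intro mc) (auto simp: l_minus r_minus)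
  moreover have "k \<otimes> k \<oplus> m \<otimes> m = cm (complex_of_real 0)"
    using k m hc by (simp add: r_neg)
  ultimately have "(nrm A k)\<^sup>2 \<le> 0" using norm_unitary_parts(1)[of k m 0] k m by simp
  then have "k = \<zero>" using k norm_eq_zero[of k] by simp
  with k show ?thesis by simp
qed

text \<open>The commutation clause for roots, used once for each factor, gives commuting roots k and
  m; the product is then the square of k m.\<close>

lemma pos_mult_comm:
  assumes "h \<in> pos" "g \<in> pos" "h \<otimes> g = g \<otimes> h" shows "h \<otimes> g \<in> pos"
proof -
  have c: "h \<in> carrier A" "g \<in> carrier A" using assms by auto
  obtain k where k: "k \<in> sa" "k \<otimes> k = h" "\<And>z. \<lbrakk>z \<in> carrier A; z \<otimes> h = h \<otimes> z\<rbrakk> \<Longrightarrow> z \<otimes> k = k \<otimes> z"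
    using assms(1) pos_ex_sqrt by metis
  obtain m where m: "m \<in> sa" "m \<otimes> m = g" "\<And>z. \<lbrakk>z \<in> carrier A; z \<otimes> g = g \<otimes> z\<rbrakk> \<Longrightarrow> z \<otimes> m = m \<otimes> z"
    using assms(2) pos_ex_sqrt by metis
  have kc: "k \<in> carrier A" "m \<in> carrier A" using k m by auto
  have "g \<otimes> k = k \<otimes> g" using k(3) c assms(3) by simp
  then have km: "k \<otimes> m = m \<otimes> k" using m(3) kc by simp
  have "h \<otimes> g = (k \<otimes> m) \<otimes> (k \<otimes> m)"
    unfolding k(2)[symmetric] m(2)[symmetric] using kc km by (metis m_assoc m_closed)
  then show ?thesis using k m km sa_mult by simp
qed

section \<open>Positivity of y* y\<close>

lemma norm_pow_le: "g \<in> carrier A \<Longrightarrow> nrm A (g [^] n) \<le> nrm A g ^ n" for n :: nat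
proof (induction n)
  case (Suc n)
  then have "nrm A (g [^] n \<otimes> g) \<le> nrm A g ^ n * nrm A g"
    by (intro order_trans[OF norm_mult] mult_mono) auto
  then show ?case by (simp add: mult.commute)
qed (use norm_one_le in simp)

lemma sa_pow: "g \<in> sa \<Longrightarrow> g [^] n \<in> sa" for n :: nat
proof (induction n)
  case (Suc n)
  then have "g [^] n \<otimes> g = g \<otimes> g [^] n"
    using nat_pow_Suc nat_pow_Suc2 by (metis sa_carrier)
  with Suc show ?case by (simp add: sa_mult)
qed simp

text \<open>Repeated squaring with the C*-identity reaches only exponents that are powers of two;
  this is the part of the spectral radius formula that is used.\<close>

lemma norm_sa_pow: "g \<in> sa \<Longrightarrow> nrm A (g [^] (2 ^ k :: nat)) = nrm A g ^ 2 ^ k"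
proof (induction k)
  case (Suc k)
  have "g [^] (2 ^ Suc k :: nat) = g [^] (2 ^ k :: nat) \<otimes> g [^] (2 ^ k :: nat)"
    using Suc.prems by (simp add: nat_pow_mult mult_2)
  then have "nrm A (g [^] (2 ^ Suc k :: nat)) = (nrm A g ^ 2 ^ k)\<^sup>2"
    using Suc norm_sa_sq sa_pow by simp
  then show ?case by (simp add: power_mult[symmetric] mult.commute)
qed simp

text \<open>The nonzero spectra of \<open>z z\<^sup>*\<close> and \<open>z\<^sup>* z\<close> agree; here this is expressed by
  comparing the growth of the powers of \<open>t - z\<^sup>* z\<close> with those of \<open>t - z z\<^sup>*\<close>.\<close>

lemma pos_flip:
  assumes z: "z \<in> carrier A" and zz: "z \<otimes> z\<^sup>\<star> \<in> pos"
  shows "z\<^sup>\<star> \<otimes> z \<in> pos"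
proof -
  define C where "C = (nrm A z)\<^sup>2"
  \<comment> \<open>Strictly larger than C = |z|^2, hence positive even for z = 0, and still an
    upper bound for |z z*|.\<close>
  define t where "t = C + 1"
  define g where "g = cm (complex_of_real t) \<ominus> z\<^sup>\<star> \<otimes> z"
  define q where "q = cm (complex_of_real t) \<ominus> z \<otimes> z\<^sup>\<star>"
  have C0: "C \<ge> 0" and t0: "t > 0" by (auto simp: C_def t_def add_nonneg_pos)
  have g: "g \<in> sa" "g \<in> carrier A" and q: "q \<in> carrier A" using z by (auto simp: g_def q_def)
  have "nrm A (z \<otimes> z\<^sup>\<star>) = C" using norm_cstar[of "z\<^sup>\<star>"] z by (simp add: C_def)
  then have qt: "nrm A q \<le> t" unfolding q_def using zz by (intro pos_compl) (auto simp: t_def)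
  have step: "q \<otimes> z = z \<otimes> g"
    using z by (intro sep) (auto simp: q_def g_def alg_simps cm_simps)
  \<comment> \<open>Moving z past a power exchanges g, formed from z* z, with q, formed from z z*,
    whose norm is under control because z z* is positive.\<close>
  have inter: "q [^] n \<otimes> z = z \<otimes> g [^] n" for n :: nat
  proof (induction n)
    case (Suc n)
    have "q [^] Suc n \<otimes> z = q [^] n \<otimes> (q \<otimes> z)" using q z by (simp add: m_assoc)
    also have "\<dots> = (q [^] n \<otimes> z) \<otimes> g" using q g z by (simp add: step m_assoc)
    also have "\<dots> = z \<otimes> g [^] Suc n" using Suc q g z by (simp add: m_assoc)
    finally show ?case .
  qed (use z in simp)
  have g_mult: "g \<otimes> w = complex_of_real t \<odot> w \<ominus> z\<^sup>\<star> \<otimes> (z \<otimes> w)" if "w \<in> carrier A" for w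
    unfolding g_def using that z by (simp add: minus_mult_l cm_mult_l m_assoc)
  \<comment> \<open>In g^(n+1) = t g^n - z* z g^n the last term equals z* q^n z, of norm at most C
    t^n. So each further power costs a factor t up to a comparatively small error.\<close>
  have bound: "nrm A (g [^] Suc n) \<le> t * nrm A (g [^] n) + C * t ^ n" for n :: nat
  proof -
    have "g [^] Suc n = complex_of_real t \<odot> g [^] n \<ominus> z\<^sup>\<star> \<otimes> (z \<otimes> g [^] n)"
    proof -
      have "g [^] Suc n = g \<otimes> g [^] n" using g(2) by (rule nat_pow_Suc2)
      also have "\<dots> = complex_of_real t \<odot> g [^] n \<ominus> z\<^sup>\<star> \<otimes> (z \<otimes> g [^] n)"
        using g by (intro g_mult) simp
      finally show ?thesis .
    qed
    also have "nrm A \<dots> \<le> t * nrm A (g [^] n) + nrm A (z\<^sup>\<star> \<otimes> (z \<otimes> g [^] n))"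
      using norm_minus_le[of "complex_of_real t \<odot> g [^] n" "z\<^sup>\<star> \<otimes> (z \<otimes> g [^] n)"] g z t0 by (simp add: norm_sm)
    also have "nrm A (z\<^sup>\<star> \<otimes> (z \<otimes> g [^] n)) \<le> nrm A z * nrm A (q [^] n \<otimes> z)"
      using norm_mult[of "z\<^sup>\<star>" "q [^] n \<otimes> z"] z q g by (simp add: inter)
    also have "\<dots> \<le> nrm A z * (nrm A (q [^] n) * nrm A z)"
      using z q by (intro mult_left_mono norm_mult) auto
    also have "\<dots> \<le> nrm A z * (t ^ n * nrm A z)"
      using z q qt by (intro mult_left_mono mult_right_mono order_trans[OF norm_pow_le] power_mono) auto
    finally show ?thesis by (simp add: C_def power2_eq_square mult_ac)
  qed
  have "nrm A g \<le> t"
  proof (rule ccontr)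
    assume "\<not> nrm A g \<le> t"
    define s where "s = nrm A g"
    have st: "s > t" using \<open>\<not> nrm A g \<le> t\<close> by (simp add: s_def)
    \<comment> \<open>With N a power of two, split g^(2N) into g^(N+1) and g^(N-1). The norm of the
      product is exactly s^(2N), which forces |g^(N+1)| >= s^(N+1); compared with
      \<open>bound\<close> this leaves no room for s > t.\<close>
    have main: "(s - t) * (s / t) ^ (2 ^ k) \<le> C" for k :: nat
    proof -
      let ?N = "2 ^ k :: nat"
      obtain N' where N': "?N = Suc N'" using not0_implies_Suc[of ?N] by auto
      have "s ^ (?N + ?N) = nrm A (g [^] (?N + ?N))"
        using norm_sa_pow[OF g(1), of "Suc k"] by (simp add: s_def mult_2)
      also have "g [^] (?N + ?N) = g [^] Suc ?N \<otimes> g [^] N'"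
        using nat_pow_mult[OF g(2), of "Suc ?N" N'] N' by simp
      also have "nrm A \<dots> \<le> nrm A (g [^] Suc ?N) * s ^ N'"
        using g by (intro order_trans[OF norm_mult] mult_left_mono) (auto simp: norm_pow_le s_def)
      finally have "s ^ Suc ?N * s ^ N' \<le> nrm A (g [^] Suc ?N) * s ^ N'"
        by (simp add: N' power_add mult_ac)
      then have "s ^ Suc ?N \<le> nrm A (g [^] Suc ?N)" using st t0 by simp
      also have "\<dots> \<le> t * s ^ ?N + C * t ^ ?N"
        using bound[of ?N] norm_sa_pow[OF g(1), of k] by (simp add: s_def del: nat_pow_Suc)
      finally have "(s - t) * s ^ ?N \<le> C * t ^ ?N" by (simp add: algebra_simps)
      then show ?thesis using t0 by (simp add: power_divide field_simps)
    qed
    obtain n where n: "C / (s - t) < (s / t) ^ n"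
      using real_arch_pow[of "s / t" "C / (s - t)"] st t0 by auto
    also have "\<dots> \<le> (s / t) ^ (2 ^ n)"
      using st t0 by (intro power_increasing less_imp_le[OF less_exp]) auto
    finally have "C < (s - t) * (s / t) ^ (2 ^ n)" using st by (simp add: field_simps)
    with main[of n] show False by simp
  qed
  then show ?thesis unfolding g_def using z by (intro posI) auto
qed

text \<open>Let a be the root of h^2, playing the absolute value of h = y* y, and n = (a - h)/2 its
  negative part. For z = y n one finds z* z = -w^2 with w = p n, where p^2 = a. With z = b + i c,
  the sum z z* + z* z is 2 (b^2 + c^2), so z z* is positive, and \<open>pos_flip\<close> makes z* z
  positive too. Hence z* z = 0, n = 0 and h = a. The bound on the norm is what admits the roots a
  and p through \<open>ex_sqrt\<close>.\<close>

lemma pos_star_mult_aux: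
  assumes y: "y \<in> carrier A" "nrm A (y\<^sup>\<star> \<otimes> y) \<le> 1"
  shows "y\<^sup>\<star> \<otimes> y \<in> pos"
proof -
  define h where "h = y\<^sup>\<star> \<otimes> y"
  have h: "h \<in> sa" "h \<in> carrier A" "nrm A h \<le> 1" using y by (auto simp: h_def)
  have hh: "h \<otimes> h \<in> sa" using h sa_mult by blast
  obtain a where a: "a \<in> sa" "a \<otimes> a = h \<otimes> h" "nrm A (\<one> \<ominus> a) \<le> 1"
      and ac: "\<And>z. \<lbrakk>z \<in> carrier A; z \<otimes> (h \<otimes> h) = (h \<otimes> h) \<otimes> z\<rbrakk> \<Longrightarrow> z \<otimes> a = a \<otimes> z"
    using ex_sqrt[OF hh norm_compl_sq_one[OF h(1,3)]] by metis
  obtain p where p: "p \<in> sa" "p \<otimes> p = a"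
      and pc: "\<And>z. \<lbrakk>z \<in> carrier A; z \<otimes> a = a \<otimes> z\<rbrakk> \<Longrightarrow> z \<otimes> p = p \<otimes> z"
    using ex_sqrt[OF a(1,3)] by metis
  have acar: "a \<in> carrier A" and pcar: "p \<in> carrier A" using a p by auto
  have apos: "a \<in> pos" using posI[of a 1] a by simp
  have ha: "h \<otimes> a = a \<otimes> h" using h by (intro ac) (auto simp: m_assoc)
  define n where "n = (1/2) \<odot> (a \<ominus> h)"
  have n: "n \<in> sa" "n \<in> carrier A" unfolding n_def using sa_sm[of "a \<ominus> h" "1/2"] a h by auto
  have an: "n \<otimes> a = a \<otimes> n" using h acar ha by (simp add: n_def mult_simps)
  have pn: "n \<otimes> p = p \<otimes> n" using pc n an by simp
  define w where "w = p \<otimes> n"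
  have w: "w \<in> sa" unfolding w_def using p n pn sa_mult by simp
  have ha': "h \<otimes> (a \<otimes> v) = a \<otimes> (h \<otimes> v)" "h \<otimes> (h \<otimes> v) = a \<otimes> (a \<otimes> v)" if "v \<in> carrier A" for v
    using that h acar ha a(2) by (metis m_assoc)+
  have nn: "n \<otimes> n = a \<otimes> n"
    using h acar by (intro sep) (auto simp: n_def alg_simps ha a(2)[symmetric] algebra_simps)
  have ww: "w \<otimes> w = a \<otimes> (n \<otimes> n)"
    unfolding w_def p(2)[symmetric] using n pcar pn by (metis m_assoc m_closed)
  define z where "z = y \<otimes> n"
  have z: "z \<in> carrier A" using y n by (simp add: z_def)
  have "z\<^sup>\<star> \<otimes> z = n \<otimes> (h \<otimes> n)"
    using y n by (simp add: z_def h_def star_simps sa_star m_assoc)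
  also have "\<dots> = \<ominus> (w \<otimes> w)"
    unfolding ww n_def using h acar
    by (intro sep) (auto simp: alg_simps ha ha' a(2)[symmetric] algebra_simps)
  finally have zz: "\<ominus> (z\<^sup>\<star> \<otimes> z) = w \<otimes> w" using w by (simp add: minus_minus)
  obtain b c where bc: "b \<in> sa" "c \<in> sa" "z = b \<oplus> \<i> \<odot> c" "z\<^sup>\<star> = b \<ominus> \<i> \<odot> c"
    using sa_parts[OF z] by metis
  have "z \<otimes> z\<^sup>\<star> = complex_of_real 2 \<odot> (b \<otimes> b \<oplus> c \<otimes> c) \<oplus> w \<otimes> w"
    unfolding zz[symmetric] bc(4) unfolding bc(3) using bc(1,2)
    by (intro sep) (auto simp: alg_simps algebra_simps)
  also have "\<dots> \<in> pos" using bc w by (intro pos_add pos_sm pos_sq) auto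
  finally have "z\<^sup>\<star> \<otimes> z \<in> pos" by (rule pos_flip[OF z])
  moreover have "\<ominus> (z\<^sup>\<star> \<otimes> z) \<in> pos" using zz w by simp
  ultimately have "z\<^sup>\<star> \<otimes> z = \<zero>" by (rule pos_antisym)
  then have "w \<otimes> w = \<zero>" using zz by simp
  \<comment> \<open>Here n^2 = a n, so the fourth power of n is n a n^2 = n w^2 = 0; two uses of the
    C*-identity then give n = 0.\<close>
  then have "(n \<otimes> n) \<otimes> (n \<otimes> n) = \<zero>"
    using ww n nn acar by (metis m_assoc m_closed l_null)
  moreover have "n \<otimes> n \<in> sa" using n sa_mult by simp
  ultimately have "nrm A (n \<otimes> n) = 0" using norm_sa_sq[of "n \<otimes> n"] by simp
  then have "n = \<zero>" using norm_sa_sq[of n] n norm_eq_zero[of n] by simp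
  moreover have "h = a \<ominus> 2 \<odot> n" using h acar by (intro sep) (auto simp: alg_simps n_def)
  ultimately have "h = a" using acar by (simp add: a_minus_def)
  then show ?thesis using apos by (simp add: h_def)
qed

lemma pos_star_mult [simp]:
  assumes y: "y \<in> carrier A"
  shows "y\<^sup>\<star> \<otimes> y \<in> pos"
proof -
  let ?N = "nrm A y + 1"
  have N: "?N > 0" using y by (simp add: add_nonneg_pos)
  let ?c = "complex_of_real (1 / ?N)"
  have *: "(?c \<odot> y)\<^sup>\<star> \<otimes> (?c \<odot> y) = complex_of_real ((1 / ?N)\<^sup>2) \<odot> (y\<^sup>\<star> \<otimes> y)"
    using y by (simp add: mult_simps star_simps power2_eq_square sm_assoc[symmetric])
  have "nrm A (?c \<odot> y) \<le> 1" using y N by (simp add: norm_sm norm_divide)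
  then have "nrm A ((?c \<odot> y)\<^sup>\<star> \<otimes> (?c \<odot> y)) \<le> 1"
    using norm_cstar[of "?c \<odot> y"] y by (simp add: power_le_one)
  then have "complex_of_real ((1 / ?N)\<^sup>2) \<odot> (y\<^sup>\<star> \<otimes> y) \<in> pos"
    using pos_star_mult_aux[of "?c \<odot> y"] y * by simp
  then have "complex_of_real (?N\<^sup>2) \<odot> (complex_of_real ((1 / ?N)\<^sup>2) \<odot> (y\<^sup>\<star> \<otimes> y)) \<in> pos"
    by (rule pos_sm) simp
  moreover have "complex_of_real (?N\<^sup>2) * complex_of_real ((1 / ?N)\<^sup>2) = 1"
    unfolding of_real_mult[symmetric] using N by (simp add: power_divide)
  ultimately show ?thesis using y by (simp flip: sm_assoc)
qed

lemma pos_iff: "x \<in> pos \<longleftrightarrow> (\<exists>y\<in>carrier A. x = y\<^sup>\<star> \<otimes> y)"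
  by (metis pos_ex_sqrt pos_star_mult sa_carrier sa_star)

lemma pos_conj:
  assumes "x \<in> pos" "y \<in> carrier A" shows "y\<^sup>\<star> \<otimes> x \<otimes> y \<in> pos"
proof -
  obtain k where "k \<in> carrier A" "x = k\<^sup>\<star> \<otimes> k" using assms(1) pos_iff by blast
  then have "y\<^sup>\<star> \<otimes> x \<otimes> y = (k \<otimes> y)\<^sup>\<star> \<otimes> (k \<otimes> y)"
    using assms by (simp add: star_simps m_assoc)
  then show ?thesis using \<open>k \<in> carrier A\<close> assms by simp
qed

text \<open>The order determines the norm, which is the model for \<open>cone_norm\<close>. For the
  converse, commuting roots of x* x and of r^2 - x* x have squares adding up to r^2, so
  \<open>norm_unitary_parts\<close> applies.\<close>

lemma norm_le_iff:
  assumes x: "x \<in> carrier A" and r: "r \<ge> 0"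
  shows "nrm A x \<le> r \<longleftrightarrow> cm (complex_of_real (r\<^sup>2)) \<ominus> x\<^sup>\<star> \<otimes> x \<in> pos"
proof
  assume "nrm A x \<le> r"
  then have "nrm A (x\<^sup>\<star> \<otimes> x) \<le> r\<^sup>2" using norm_cstar x by (simp add: power_mono)
  moreover have "cm (complex_of_real (r\<^sup>2)) \<ominus> (cm (complex_of_real (r\<^sup>2)) \<ominus> x\<^sup>\<star> \<otimes> x) = x\<^sup>\<star> \<otimes> x"
    using x by (intro sep) (auto simp: alg_simps)
  ultimately show "cm (complex_of_real (r\<^sup>2)) \<ominus> x\<^sup>\<star> \<otimes> x \<in> pos"
    using x by (intro posI[of _ "r\<^sup>2"] sa_minus cm_sa sa_square) simp_all
next
  let ?g = "x\<^sup>\<star> \<otimes> x" and ?R = "cm (complex_of_real (r\<^sup>2))"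
  assume d: "?R \<ominus> ?g \<in> pos"
  obtain k where k: "k \<in> sa" "k \<otimes> k = ?g" using pos_ex_sqrt[OF pos_star_mult[OF x]] by metis
  obtain m where m: "m \<in> sa" "m \<otimes> m = ?R \<ominus> ?g"
      and mc: "\<And>z. \<lbrakk>z \<in> carrier A; z \<otimes> (?R \<ominus> ?g) = (?R \<ominus> ?g) \<otimes> z\<rbrakk> \<Longrightarrow> z \<otimes> m = m \<otimes> z"
    using pos_ex_sqrt[OF d] by metis
  have kc: "k \<in> carrier A" using k by blast
  have "k \<otimes> m = m \<otimes> k"
    using kc by (intro mc) (auto simp flip: k(2) simp: mult_simps cm_simps)
  moreover have "k \<otimes> k \<oplus> m \<otimes> m = ?R"
    unfolding k m using x by (intro sep) (auto simp: alg_simps)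
  ultimately have "(nrm A k)\<^sup>2 \<le> r\<^sup>2" using norm_unitary_parts(1)[of k m "r\<^sup>2"] k m by simp
  then have "(nrm A x)\<^sup>2 \<le> r\<^sup>2" using norm_cstar[OF x] norm_sa_sq[OF k(1)] k(2) by simp
  then show "nrm A x \<le> r" using r power2_le_imp_le by blast
qed

end

section \<open>The norm of an order unit cone\<close>

text \<open>The formula for a C*-norm in terms of its positive cone, as in
  \<open>norm_le_iff\<close>, turned into a definition. It depends only on the algebra and the cone,
  so it can be applied before any norm exists.\<close>

definition cone_norm :: "('u, 'm) star_space_scheme \<Rightarrow> 'u set \<Rightarrow> 'u \<Rightarrow> real" where
  "cone_norm A C x =
     Inf {r. r \<ge> 0 \<and> complex_of_real (r\<^sup>2) \<odot>\<^bsub>A\<^esub> \<one>\<^bsub>A\<^esub> \<oplus>\<^bsub>A\<^esub> (-1) \<odot>\<^bsub>A\<^esub> (adj A x \<otimes>\<^bsub>A\<^esub> x) \<in> C}"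

text \<open>Properties of a positive cone that already force \<open>cone_norm\<close> to be a
  C*-seminorm. They serve for matrix algebras, where the cone is at hand before a norm is.\<close>

locale cone_alg = star_alg A for A :: "('u, 'm) star_space_scheme" (structure) +
  fixes C :: "'u set"
  assumes C_sa: "x \<in> C \<Longrightarrow> x \<in> sa"
    and C_add: "\<lbrakk>x \<in> C; y \<in> C\<rbrakk> \<Longrightarrow> x \<oplus> y \<in> C"
    and C_sm: "\<lbrakk>x \<in> C; r \<ge> 0\<rbrakk> \<Longrightarrow> complex_of_real r \<odot> x \<in> C"
    and C_conj: "\<lbrakk>x \<in> C; y \<in> carrier A\<rbrakk> \<Longrightarrow> y\<^sup>\<star> \<otimes> x \<otimes> y \<in> C"
    and C_one: "\<one> \<in> C"
    and C_arch: "\<lbrakk>x \<in> sa; \<And>e. e > 0 \<Longrightarrow> x \<oplus> cm (complex_of_real e) \<in> C\<rbrakk> \<Longrightarrow> x \<in> C"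
    and C_bdd: "x \<in> carrier A \<Longrightarrow> \<exists>r\<ge>0. cm (complex_of_real (r\<^sup>2)) \<ominus> x\<^sup>\<star> \<otimes> x \<in> C"
begin

abbreviation cn :: "'u \<Rightarrow> real" where "cn \<equiv> cone_norm A C"

definition bounded_by :: "real \<Rightarrow> 'u \<Rightarrow> bool" where
  "bounded_by r x \<longleftrightarrow> r \<ge> 0 \<and> cm (complex_of_real (r\<^sup>2)) \<ominus> x\<^sup>\<star> \<otimes> x \<in> C"

lemma C_carrier [simp]: "x \<in> C \<Longrightarrow> x \<in> carrier A"
  using C_sa by blast

lemma C_sq: "x \<in> carrier A \<Longrightarrow> x\<^sup>\<star> \<otimes> x \<in> C"
  using C_conj[OF C_one, of x] by simp

lemma C_cm: "r \<ge> 0 \<Longrightarrow> cm (complex_of_real r) \<in> C"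
  unfolding cm_def by (intro C_sm C_one)

lemma C_unscale:
  assumes "complex_of_real r \<odot> x \<in> C" "r > 0" "x \<in> carrier A"
  shows "x \<in> C"
  using C_sm[OF assms(1), of "1/r"] assms(2,3) by (simp flip: sm_assoc)

lemma cn_eq: "x \<in> carrier A \<Longrightarrow> cn x = Inf {r. bounded_by r x}"
  by (simp add: cone_norm_def bounded_by_def cm_def a_minus_def sm_minus_one)

lemma bounded_by_mono:
  assumes "bounded_by r x" "r \<le> s" "x \<in> carrier A" shows "bounded_by s x"
proof -
  have r: "r \<ge> 0" "r\<^sup>2 \<le> s\<^sup>2" using assms by (auto simp: bounded_by_def intro: power_mono)
  have "cm (complex_of_real (s\<^sup>2)) \<ominus> x\<^sup>\<star> \<otimes> x =
      (cm (complex_of_real (r\<^sup>2)) \<ominus> x\<^sup>\<star> \<otimes> x) \<oplus> cm (complex_of_real (s\<^sup>2 - r\<^sup>2))"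
    using assms(3) by (intro sep) (auto simp: alg_simps linfun_cm algebra_simps)
  also have "\<dots> \<in> C" using assms r by (intro C_add C_cm) (auto simp: bounded_by_def)
  finally show ?thesis using assms r by (simp add: bounded_by_def)
qed

lemma bdd_below_bounded_by: "bdd_below {r. bounded_by r x}"
  by (rule bdd_belowI[of _ 0]) (auto simp: bounded_by_def)

lemma cn_nonneg: "x \<in> carrier A \<Longrightarrow> 0 \<le> cn x"
  unfolding cn_eq using C_bdd[of x] by (intro cInf_greatest) (auto simp: bounded_by_def)

lemma cn_le: "\<lbrakk>bounded_by r x; x \<in> carrier A\<rbrakk> \<Longrightarrow> cn x \<le> r"
  unfolding cn_eq by (intro cInf_lower bdd_below_bounded_by) auto

lemma cn_less: "\<lbrakk>cn x < r; x \<in> carrier A\<rbrakk> \<Longrightarrow> bounded_by r x"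
proof -
  assume x: "x \<in> carrier A" and less: "cn x < r"
  have "{r. bounded_by r x} \<noteq> {}" using C_bdd[OF x] by (auto simp: bounded_by_def)
  then obtain s where "bounded_by s x" "s < r"
    using less bdd_below_bounded_by[of x] cInf_less_iff[of "{r. bounded_by r x}" r] unfolding cn_eq[OF x] by auto
  then show ?thesis using bounded_by_mono x by simp
qed

text \<open>The infimum is attained: the Archimedean axiom \<open>C_arch\<close> closes the cone
  under the small errors that an infimum leaves.\<close>

lemma cn_le_iff:
  assumes x: "x \<in> carrier A" and r: "r \<ge> 0"
  shows "cn x \<le> r \<longleftrightarrow> bounded_by r x"
proof
  assume le: "cn x \<le> r"
  have "cm (complex_of_real (r\<^sup>2)) \<ominus> x\<^sup>\<star> \<otimes> x \<in> C"
  proof (rule C_arch)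
    fix e :: real assume e: "e > 0"
    \<comment> \<open>With d <= 1, the square of r + d exceeds r^2 by at most d (2r + 1), and the
      second bound makes this at most e.\<close>
    define d where "d = min 1 (e / (2 * r + 1))"
    have "d \<le> e / (2 * r + 1)" by (simp add: d_def)
    then have "d * (2 * r + 1) \<le> e" using r by (simp add: pos_le_divide_eq)
    moreover have "d > 0" "d \<le> 1" using e r by (auto simp: d_def)
    ultimately have d: "d > 0" "d \<le> 1" "d * (2 * r + 1) \<le> e" by auto
    have "d\<^sup>2 \<le> d" using d by (simp add: power2_eq_square mult_left_le)
    then have "(r + d)\<^sup>2 \<le> r\<^sup>2 + d * (2 * r + 1)" by (simp add: power2_eq_square algebra_simps)
    then have rd: "(r + d)\<^sup>2 \<le> r\<^sup>2 + e" using d by linarith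
    have "bounded_by (r + d) x" using cn_less le d x by simp
    then have *: "cm (complex_of_real ((r + d)\<^sup>2)) \<ominus> x\<^sup>\<star> \<otimes> x \<in> C" by (simp add: bounded_by_def)
    have "cm (complex_of_real (r\<^sup>2)) \<ominus> x\<^sup>\<star> \<otimes> x \<oplus> cm (complex_of_real e) =
       (cm (complex_of_real ((r + d)\<^sup>2)) \<ominus> x\<^sup>\<star> \<otimes> x) \<oplus> cm (complex_of_real (r\<^sup>2 + e - (r + d)\<^sup>2))"
      using x by (intro sep) (auto simp: alg_simps linfun_cm algebra_simps)
    also have "\<dots> \<in> C" using * rd by (intro C_add C_cm) auto
    finally show "cm (complex_of_real (r\<^sup>2)) \<ominus> x\<^sup>\<star> \<otimes> x \<oplus> cm (complex_of_real e) \<in> C" .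
  next
    show "cm (complex_of_real (r\<^sup>2)) \<ominus> x\<^sup>\<star> \<otimes> x \<in> sa"
      using x by (intro sa_minus cm_sa sa_square)
  qed
  with r show "bounded_by r x" by (simp add: bounded_by_def)
qed (use cn_le x in simp)

text \<open>A weighted parallelogram identity: w = s x - r y is chosen so that its mixed terms are
  exactly those of -r s (x + y)* (x + y), and the rest is a combination of the two given
  bounds.\<close>

lemma bounded_by_add:
  assumes "bounded_by r x" "bounded_by s y" "x \<in> carrier A" "y \<in> carrier A" "r > 0" "s > 0"
  shows "bounded_by (r + s) (x \<oplus> y)"
proof -
  let ?r = "complex_of_real r" and ?s = "complex_of_real s"
  let ?w = "?s \<odot> x \<ominus> ?r \<odot> y"
  have "complex_of_real (r * s) \<odot> (cm (complex_of_real ((r + s)\<^sup>2)) \<ominus> (x \<oplus> y)\<^sup>\<star> \<otimes> (x \<oplus> y)) =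
     ?w\<^sup>\<star> \<otimes> ?w \<oplus> (complex_of_real (s * (r + s)) \<odot> (cm (complex_of_real (r\<^sup>2)) \<ominus> x\<^sup>\<star> \<otimes> x)
       \<oplus> complex_of_real (r * (r + s)) \<odot> (cm (complex_of_real (s\<^sup>2)) \<ominus> y\<^sup>\<star> \<otimes> y))"
    using assms(3,4) by (intro sep) (auto simp: alg_simps linfun_cm algebra_simps power2_eq_square)
  also have "\<dots> \<in> C"
    using assms by (intro C_add C_sm C_sq) (auto simp: bounded_by_def)
  finally have "cm (complex_of_real ((r + s)\<^sup>2)) \<ominus> (x \<oplus> y)\<^sup>\<star> \<otimes> (x \<oplus> y) \<in> C"
    by (rule C_unscale) (use assms in auto)
  then show ?thesis using assms by (simp add: bounded_by_def)
qed

lemma bounded_by_sm: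
  assumes "bounded_by r x" "x \<in> carrier A" shows "bounded_by (cmod c * r) (c \<odot> x)"
proof -
  have cc: "(complex_of_real (cmod c))\<^sup>2 = c * cnj c" by (metis complex_norm_square of_real_power)
  have "cm (complex_of_real ((cmod c * r)\<^sup>2)) \<ominus> (c \<odot> x)\<^sup>\<star> \<otimes> (c \<odot> x) =
    complex_of_real ((cmod c)\<^sup>2) \<odot> (cm (complex_of_real (r\<^sup>2)) \<ominus> x\<^sup>\<star> \<otimes> x)"
    using assms(2) by (intro sep) (auto simp: alg_simps linfun_cm algebra_simps power_mult_distrib cc)
  also have "\<dots> \<in> C" using assms by (intro C_sm) (auto simp: bounded_by_def)
  finally show ?thesis using assms by (simp add: bounded_by_def)
qed

lemma bounded_by_mult:
  assumes "bounded_by r x" "bounded_by s y" "x \<in> carrier A" "y \<in> carrier A"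
  shows "bounded_by (r * s) (x \<otimes> y)"
proof -
  have "cm (complex_of_real ((r * s)\<^sup>2)) \<ominus> (x \<otimes> y)\<^sup>\<star> \<otimes> (x \<otimes> y) =
    y\<^sup>\<star> \<otimes> (cm (complex_of_real (r\<^sup>2)) \<ominus> x\<^sup>\<star> \<otimes> x) \<otimes> y \<oplus>
    complex_of_real (r\<^sup>2) \<odot> (cm (complex_of_real (s\<^sup>2)) \<ominus> y\<^sup>\<star> \<otimes> y)"
    using assms(3,4) by (intro sep) (auto simp: alg_simps cm_simps algebra_simps power_mult_distrib)
  also have "\<dots> \<in> C" using assms by (intro C_add C_conj C_sm) (auto simp: bounded_by_def)
  finally show ?thesis using assms by (simp add: bounded_by_def)
qed

text \<open>Completing the square in d = r^2 - x x* expresses r^2 d through d^2 and a conjugate of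
  the given bound on x* x. This is how the order passes from x* x to x x* without spectra.\<close>

lemma bounded_by_star:
  assumes "bounded_by r x" "x \<in> carrier A" "r > 0" shows "bounded_by r (x\<^sup>\<star>)"
proof -
  let ?R = "cm (complex_of_real (r\<^sup>2))"
  let ?d = "?R \<ominus> x \<otimes> x\<^sup>\<star>"
  have "complex_of_real (r\<^sup>2) \<odot> ?d = ?d\<^sup>\<star> \<otimes> ?d \<oplus> (x\<^sup>\<star>)\<^sup>\<star> \<otimes> (?R \<ominus> x\<^sup>\<star> \<otimes> x) \<otimes> x\<^sup>\<star>"
    using assms(2) by (intro sep) (auto simp: alg_simps cm_simps algebra_simps)
  also have "\<dots> \<in> C" using assms by (intro C_add C_conj C_sq) (auto simp: bounded_by_def)
  finally have "?d \<in> C" by (rule C_unscale) (use assms in auto)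
  then show ?thesis using assms by (simp add: bounded_by_def)
qed

text \<open>From h^2 <= s^2 to h <= s without monotonicity of roots: 2s (s - h) is the sum of (s -
  h)^2 and s^2 - h^2.\<close>

lemma bounded_by_sa:
  assumes "bounded_by s h" "h \<in> sa" "s > 0" shows "cm (complex_of_real s) \<ominus> h \<in> C"
proof -
  let ?d = "cm (complex_of_real s) \<ominus> h"
  have "complex_of_real (2 * s) \<odot> ?d = ?d\<^sup>\<star> \<otimes> ?d \<oplus> (cm (complex_of_real (s\<^sup>2)) \<ominus> h\<^sup>\<star> \<otimes> h)"
    using assms(2) by (intro sep) (auto simp: alg_simps cm_simps algebra_simps sa_star power2_eq_square)
  also have "\<dots> \<in> C" using assms by (intro C_add C_sq) (auto simp: bounded_by_def)
  finally show ?thesis by (rule C_unscale) (use assms in auto)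
qed

lemma cn_mult: "\<lbrakk>x \<in> carrier A; y \<in> carrier A\<rbrakk> \<Longrightarrow> cn (x \<otimes> y) \<le> cn x * cn y"
  using bounded_by_mult[of "cn x" x "cn y" y] cn_le_iff cn_nonneg by auto

lemma cn_star_le: "x \<in> carrier A \<Longrightarrow> cn (x\<^sup>\<star>) \<le> cn x"
proof (rule field_le_epsilon)
  fix e :: real assume e: "e > 0" and x: "x \<in> carrier A"
  then have "cn x + e > 0" using cn_nonneg[OF x] by simp
  then have "bounded_by (cn x + e) (x\<^sup>\<star>)" using cn_less[of x "cn x + e"] x e bounded_by_star by simp
  then show "cn (x\<^sup>\<star>) \<le> cn x + e" using cn_le x by simp
qed

lemma cn_sm: "x \<in> carrier A \<Longrightarrow> cn (c \<odot> x) = cmod c * cn x"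
proof -
  assume x: "x \<in> carrier A"
  have le: "cn (c \<odot> y) \<le> cmod c * cn y" if "y \<in> carrier A" for c y
    using bounded_by_sm[of "cn y" y c] cn_le_iff cn_nonneg that by auto
  show ?thesis
  proof (cases "c = 0")
    case True
    then show ?thesis using le[OF x, of 0] cn_nonneg[of \<zero>] x by simp
  next
    case False
    have "cn x = cn ((1/c) \<odot> (c \<odot> x))" using x False by (simp flip: sm_assoc)
    also have "\<dots> \<le> cmod (1/c) * cn (c \<odot> x)" using x by (intro le) auto
    finally have "cmod c * cn x \<le> cn (c \<odot> x)" using False by (simp add: norm_divide field_simps)
    then show ?thesis using le[OF x, of c] by simp
  qed
qed

lemma cn_triangle:
  assumes "x \<in> carrier A" "y \<in> carrier A" shows "cn (x \<oplus> y) \<le> cn x + cn y"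
proof (rule field_le_epsilon)
  fix e :: real assume e: "e > 0"
  then have "bounded_by ((cn x + e/2) + (cn y + e/2)) (x \<oplus> y)"
    using assms cn_nonneg[of x] cn_nonneg[of y] by (intro bounded_by_add cn_less) auto
  then show "cn (x \<oplus> y) \<le> cn x + cn y + e" using cn_le assms by fastforce
qed

lemma cn_cstar:
  assumes x: "x \<in> carrier A" shows "cn (x\<^sup>\<star> \<otimes> x) = (cn x)\<^sup>2"
proof (rule antisym)
  have "cn (x\<^sup>\<star> \<otimes> x) \<le> cn (x\<^sup>\<star>) * cn x" using x cn_mult by simp
  also have "\<dots> \<le> cn x * cn x" using x cn_star_le cn_nonneg by (intro mult_right_mono) auto
  finally show "cn (x\<^sup>\<star> \<otimes> x) \<le> (cn x)\<^sup>2" by (simp add: power2_eq_square)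
  show "(cn x)\<^sup>2 \<le> cn (x\<^sup>\<star> \<otimes> x)"
  proof (rule field_le_epsilon)
    fix e :: real assume e: "e > 0"
    let ?s = "cn (x\<^sup>\<star> \<otimes> x) + e"
    have s: "?s > 0" using cn_nonneg[of "x\<^sup>\<star> \<otimes> x"] x e by simp
    \<comment> \<open>A bound on the self-adjoint element x* x itself, rather than on its square, is
      by definition a bound on x by the root of \<open>?s\<close>.\<close>
    have "cm (complex_of_real ?s) \<ominus> x\<^sup>\<star> \<otimes> x \<in> C"
      using x e s by (intro bounded_by_sa cn_less) auto
    then have "bounded_by (sqrt ?s) x" using s by (simp add: bounded_by_def)
    then have "cn x \<le> sqrt ?s" using x by (intro cn_le)
    then show "(cn x)\<^sup>2 \<le> ?s" using s cn_nonneg[OF x] real_le_rsqrt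
      by (metis less_imp_le power_mono real_sqrt_pow2)
  qed
qed

lemma cn_seminorm: "cstar_seminorm A (carrier A) cn"
  unfolding cstar_seminorm_def
  using cn_nonneg cn_triangle cn_sm cn_mult cn_cstar by auto

text \<open>This puts the cone inside the norm-defined positive elements, once \<open>cn\<close> is
  the norm of a C*-algebra. Since d = s - x commutes with x, the identity for s (s^2 - d^2) displays
  it as a sum of members of the cone.\<close>

lemma C_norm_compl:
  assumes x: "x \<in> C" shows "\<exists>s. cn (cm (complex_of_real s) \<ominus> x) \<le> s"
proof -
  have xs: "x \<in> sa" "x \<in> carrier A" using x C_sa by auto
  define s where "s = cn x + 1"
  have s: "s > 0" using cn_nonneg xs by (simp add: s_def add_nonneg_pos)
  let ?d = "cm (complex_of_real s) \<ominus> x"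
  have d: "?d \<in> C" using xs s by (intro bounded_by_sa cn_less) (auto simp: s_def)
  have "complex_of_real s \<odot> (cm (complex_of_real (s\<^sup>2)) \<ominus> ?d\<^sup>\<star> \<otimes> ?d) =
     complex_of_real (s\<^sup>2) \<odot> x \<oplus> (?d\<^sup>\<star> \<otimes> x \<otimes> ?d \<oplus> x\<^sup>\<star> \<otimes> ?d \<otimes> x)"
    using xs by (intro sep) (auto simp: alg_simps cm_simps algebra_simps sa_star power2_eq_square)
  also have "\<dots> \<in> C" using x d s xs by (intro C_add C_conj C_sm) auto
  finally have "cm (complex_of_real (s\<^sup>2)) \<ominus> ?d\<^sup>\<star> \<otimes> ?d \<in> C"
    by (rule C_unscale) (use s xs in auto)
  then have "bounded_by s ?d" using s by (simp add: bounded_by_def)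
  from cn_le[OF this] xs show ?thesis by (intro exI[of _ s]) simp
qed

end

section \<open>Matrices over a star algebra\<close>

lemma (in abelian_monoid) finsum_single:
  assumes "finite I" "i \<in> I" "x \<in> carrier G"
  shows "(\<Oplus>k\<in>I. if k = i then x else \<zero>) = x"
  using add.finprod_singleton[of i I "\<lambda>_. x"] assms by (simp add: eq_commute)

lemma (in star_alg) star_finsum:
  "\<lbrakk>finite I; g \<in> I \<rightarrow> carrier A\<rbrakk> \<Longrightarrow> (finsum A g I)\<^sup>\<star> = (\<Oplus>i\<in>I. (g i)\<^sup>\<star>)"
proof (induction I rule: finite_induct)
  case (insert i I)
  then have g: "g \<in> I \<rightarrow> carrier A" "g i \<in> carrier A" by auto
  then have "(\<lambda>i. (g i)\<^sup>\<star>) \<in> I \<rightarrow> carrier A" by auto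
  with g insert show ?case by (simp add: finsum_insert star_add)
qed simp



context star_space
begin

text \<open>Rectangular sizes matter: the columns in \<open>rm n 1\<close> are the vectors of the
  quadratic forms, and scalar compressions change the size.\<close>

definition rm :: "nat \<Rightarrow> nat \<Rightarrow> 'u mat set" where
  "rm n m = {X \<in> carrier_mat n m. \<forall>i<n. \<forall>j<m. X $$ (i, j) \<in> carrier A}"

lemma mats_eq: "mats A n = rm n n"
  unfolding mats_def rm_def by (auto dest!: elements_matD intro!: elements_matI)

lemma rm_dim: "X \<in> rm n m \<Longrightarrow> dim_row X = n" "X \<in> rm n m \<Longrightarrow> dim_col X = m"
  by (auto simp: rm_def)

lemma rm_entry: "\<lbrakk>X \<in> rm n m; i < n; j < m\<rbrakk> \<Longrightarrow> X $$ (i, j) \<in> carrier A"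
  by (auto simp: rm_def)

lemma rmI: "\<lbrakk>dim_row X = n; dim_col X = m; \<And>i j. \<lbrakk>i < n; j < m\<rbrakk> \<Longrightarrow> X $$ (i, j) \<in> carrier A\<rbrakk> \<Longrightarrow> X \<in> rm n m"
  by (auto simp: rm_def)

abbreviation mplus (infixl \<open>\<boxplus>\<close> 65) where "mplus \<equiv> mat_add A"
abbreviation mstar (\<open>_\<^sup>\<dagger>\<close> [1000] 1000) where "mstar \<equiv> mat_adj A"
abbreviation msm (infixl \<open>\<bullet>\<^sub>s\<close> 70) where "msm \<equiv> mat_smult A"

lemma mplus_index: "\<lbrakk>X \<in> rm n m; i < n; j < m\<rbrakk> \<Longrightarrow> (X \<boxplus> Y) $$ (i, j) = X $$ (i, j) \<oplus> Y $$ (i, j)"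
  by (simp add: mat_add_def rm_dim)

lemma mplus_closed [simp]: "\<lbrakk>X \<in> rm n m; Y \<in> rm n m\<rbrakk> \<Longrightarrow> X \<boxplus> Y \<in> rm n m"
  by (rule rmI) (auto simp: mat_add_def rm_dim rm_entry)

lemma msm_index: "\<lbrakk>X \<in> rm n m; i < n; j < m\<rbrakk> \<Longrightarrow> (c \<bullet>\<^sub>s X) $$ (i, j) = c \<odot> X $$ (i, j)"
  by (simp add: mat_smult_def rm_dim)

lemma msm_closed [simp]: "X \<in> rm n m \<Longrightarrow> c \<bullet>\<^sub>s X \<in> rm n m"
  by (rule rmI) (auto simp: mat_smult_def rm_dim rm_entry)

lemma mstar_index: "\<lbrakk>X \<in> rm n m; i < m; j < n\<rbrakk> \<Longrightarrow> X\<^sup>\<dagger> $$ (i, j) = (X $$ (j, i))\<^sup>\<star>"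
  by (simp add: mat_adj_def rm_dim)

lemma mstar_closed [simp]: "X \<in> rm n m \<Longrightarrow> X\<^sup>\<dagger> \<in> rm m n"
  by (rule rmI) (auto simp: mat_adj_def rm_dim rm_entry)

lemma mat_zero_index [simp]: "\<lbrakk>i < n; j < n\<rbrakk> \<Longrightarrow> mat_zero A n $$ (i, j) = \<zero>"
  by (simp add: mat_zero_def)

lemma mat_zero_closed [simp]: "mat_zero A n \<in> rm n n"
  by (rule rmI) (auto simp: mat_zero_def)

lemma rm_eqI:
  assumes "X \<in> rm n m" "Y \<in> rm n m" "\<And>i j. \<lbrakk>i < n; j < m\<rbrakk> \<Longrightarrow> X $$ (i, j) = Y $$ (i, j)"
  shows "X = Y"
  using assms by (intro eq_matI) (auto simp: rm_dim)

lemma mstar_mstar [simp]: "X \<in> rm n m \<Longrightarrow> X\<^sup>\<dagger>\<^sup>\<dagger> = X"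
  by (rule rm_eqI[of _ n m]) (auto simp: mstar_index[of _ m n] mstar_index[of _ n m] rm_entry)

lemma mstar_plus: "\<lbrakk>X \<in> rm n m; Y \<in> rm n m\<rbrakk> \<Longrightarrow> (X \<boxplus> Y)\<^sup>\<dagger> = X\<^sup>\<dagger> \<boxplus> Y\<^sup>\<dagger>"
  by (rule rm_eqI[of _ m n]) (auto simp: mstar_index[of _ n m] mplus_index[of _ m n] mplus_index[of _ n m] rm_entry star_add)

lemma mstar_sm: "X \<in> rm n m \<Longrightarrow> (c \<bullet>\<^sub>s X)\<^sup>\<dagger> = cnj c \<bullet>\<^sub>s X\<^sup>\<dagger>"
  by (rule rm_eqI[of _ m n]) (auto simp: mstar_index[of _ n m] msm_index[of _ m n] msm_index[of _ n m] rm_entry star_sm)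

end

context star_alg
begin

abbreviation mm (infixl \<open>\<bullet>\<close> 70) where "mm \<equiv> mat_mult A"

lemma mm_index:
  "\<lbrakk>X \<in> rm n k; Y \<in> rm k m; i < n; j < m\<rbrakk> \<Longrightarrow> (X \<bullet> Y) $$ (i, j) = (\<Oplus>l\<in>{..<k}. X $$ (i, l) \<otimes> Y $$ (l, j))"
  by (simp add: mat_mult_def rm_dim)

lemma mm_closed [simp]: "\<lbrakk>X \<in> rm n k; Y \<in> rm k m\<rbrakk> \<Longrightarrow> X \<bullet> Y \<in> rm n m"
  by (rule rmI) (auto simp: mm_index rm_entry mat_mult_def rm_dim intro!: finsum_closed)

lemma mat_unit_index [simp]: "\<lbrakk>i < n; j < n\<rbrakk> \<Longrightarrow> mat_unit A n $$ (i, j) = (if i = j then \<one> else \<zero>)"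
  by (simp add: mat_unit_def)

lemma mat_unit_closed [simp]: "mat_unit A n \<in> rm n n"
  by (rule rmI) (auto simp: mat_unit_def)

lemma mm_assoc:
  assumes "X \<in> rm n k" "Y \<in> rm k l" "Z \<in> rm l m"
  shows "X \<bullet> Y \<bullet> Z = X \<bullet> (Y \<bullet> Z)"
proof (rule rm_eqI[of _ n m])
  show closed: "X \<bullet> Y \<bullet> Z \<in> rm n m" "X \<bullet> (Y \<bullet> Z) \<in> rm n m"
    by (rule mm_closed[OF mm_closed[OF assms(1,2)] assms(3)] mm_closed[OF assms(1) mm_closed[OF assms(2,3)]])+
  fix i j assume ij: "i < n" "j < m"
  have c: "p < k \<Longrightarrow> q < l \<Longrightarrow> X $$ (i, p) \<otimes> Y $$ (p, q) \<in> carrier A"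
    "p < k \<Longrightarrow> q < l \<Longrightarrow> Y $$ (p, q) \<otimes> Z $$ (q, j) \<in> carrier A" "q < l \<Longrightarrow> Z $$ (q, j) \<in> carrier A"
    "p < k \<Longrightarrow> X $$ (i, p) \<in> carrier A" "p < k \<Longrightarrow> q < l \<Longrightarrow> Y $$ (p, q) \<in> carrier A" for p q
    using assms ij by (auto simp: rm_entry)
  show "(X \<bullet> Y \<bullet> Z) $$ (i, j) = (X \<bullet> (Y \<bullet> Z)) $$ (i, j)"
  \<comment> \<open>A functional turns the two nested \<open>finsum\<close>s into sums of complex
    numbers, whose order can be interchanged.\<close>
  proof (rule sep)
    fix f assume f: "linfun A f"
    have "f ((X \<bullet> Y \<bullet> Z) $$ (i, j)) = (\<Sum>q<l. \<Sum>p<k. f ((X $$ (i, p) \<otimes> Y $$ (p, q)) \<otimes> Z $$ (q, j)))"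
      using ij c
      by (simp add: mm_index[OF mm_closed[OF assms(1,2)] assms(3)] mm_index[OF assms(1,2)]
          linfun_finsum[OF f] finsum_ldistr Pi_def)
    also have "\<dots> = (\<Sum>p<k. \<Sum>q<l. f (X $$ (i, p) \<otimes> (Y $$ (p, q) \<otimes> Z $$ (q, j))))"
      using c by (subst sum.swap) (simp add: m_assoc)
    also have "\<dots> = f ((X \<bullet> (Y \<bullet> Z)) $$ (i, j))"
      using ij c
      by (simp add: mm_index[OF assms(1) mm_closed[OF assms(2,3)]] mm_index[OF assms(2,3)]
          linfun_finsum[OF f] finsum_rdistr Pi_def)
    finally show "f ((X \<bullet> Y \<bullet> Z) $$ (i, j)) = f ((X \<bullet> (Y \<bullet> Z)) $$ (i, j))" .
  qed (use ij in \<open>auto intro: rm_entry[OF closed(1)] rm_entry[OF closed(2)]\<close>)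
qed

lemma mm_ldistr:
  assumes "X \<in> rm n k" "Y \<in> rm n k" "Z \<in> rm k m"
  shows "(X \<boxplus> Y) \<bullet> Z = X \<bullet> Z \<boxplus> Y \<bullet> Z"
proof (rule rm_eqI[of _ n m])
  fix i j assume ij: "i < n" "j < m"
  show "((X \<boxplus> Y) \<bullet> Z) $$ (i, j) = (X \<bullet> Z \<boxplus> Y \<bullet> Z) $$ (i, j)"
    using ij rm_entry[OF assms(1)] rm_entry[OF assms(2)] rm_entry[OF assms(3)]
    by (intro sep) (auto simp: mm_index[OF mplus_closed[OF assms(1,2)] assms(3)] mplus_index[OF mm_closed[OF assms(1,3)]]
        mplus_index[OF assms(1)] mm_index[OF assms(1,3)] mm_index[OF assms(2,3)] l_distr linfun_finsum linfun_add sum.distrib Pi_def)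
qed (use assms in \<open>auto intro!: mm_closed[of _ n k] mplus_closed\<close>)

lemma mm_rdistr:
  assumes "X \<in> rm n k" "Y \<in> rm k m" "Z \<in> rm k m"
  shows "X \<bullet> (Y \<boxplus> Z) = X \<bullet> Y \<boxplus> X \<bullet> Z"
proof (rule rm_eqI[of _ n m])
  fix i j assume ij: "i < n" "j < m"
  show "(X \<bullet> (Y \<boxplus> Z)) $$ (i, j) = (X \<bullet> Y \<boxplus> X \<bullet> Z) $$ (i, j)"
    using ij rm_entry[OF assms(1)] rm_entry[OF assms(2)] rm_entry[OF assms(3)]
    by (intro sep) (auto simp: mm_index[OF assms(1) mplus_closed[OF assms(2,3)]] mplus_index[OF mm_closed[OF assms(1,2)]]
        mplus_index[OF assms(2)] mm_index[OF assms(1,2)] mm_index[OF assms(1,3)] r_distr linfun_finsum linfun_add sum.distrib Pi_def)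
qed (use assms in \<open>auto intro!: mm_closed[of _ n k] mplus_closed\<close>)

lemma mm_sm_l:
  assumes "X \<in> rm n k" "Y \<in> rm k m" shows "(c \<bullet>\<^sub>s X) \<bullet> Y = c \<bullet>\<^sub>s (X \<bullet> Y)"
proof (rule rm_eqI[of _ n m])
  fix i j assume ij: "i < n" "j < m"
  have c: "p < k \<Longrightarrow> X $$ (i, p) \<in> carrier A" "p < k \<Longrightarrow> Y $$ (p, j) \<in> carrier A" for p
    using assms ij by (auto simp: rm_entry)
  show "((c \<bullet>\<^sub>s X) \<bullet> Y) $$ (i, j) = (c \<bullet>\<^sub>s (X \<bullet> Y)) $$ (i, j)"
    using ij c
    by (intro sep) (auto simp: mm_index[OF msm_closed[OF assms(1)] assms(2)] msm_index[OF mm_closed[OF assms]]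
        msm_index[OF assms(1)] mm_index[OF assms] linfun_finsum linfun_sm sm_mult_l Pi_def sum_distrib_left
        intro!: finsum_closed)
qed (use assms in \<open>auto intro!: mm_closed[of _ n k] msm_closed\<close>)

lemma mm_sm_r:
  assumes "X \<in> rm n k" "Y \<in> rm k m" shows "X \<bullet> (c \<bullet>\<^sub>s Y) = c \<bullet>\<^sub>s (X \<bullet> Y)"
proof (rule rm_eqI[of _ n m])
  fix i j assume ij: "i < n" "j < m"
  have c: "p < k \<Longrightarrow> X $$ (i, p) \<in> carrier A" "p < k \<Longrightarrow> Y $$ (p, j) \<in> carrier A" for p
    using assms ij by (auto simp: rm_entry)
  show "(X \<bullet> (c \<bullet>\<^sub>s Y)) $$ (i, j) = (c \<bullet>\<^sub>s (X \<bullet> Y)) $$ (i, j)"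
    using ij c
    by (intro sep) (auto simp: mm_index[OF assms(1) msm_closed[OF assms(2)]] msm_index[OF mm_closed[OF assms]]
        msm_index[OF assms(2)] mm_index[OF assms] linfun_finsum linfun_sm sm_mult_r Pi_def sum_distrib_left
        intro!: finsum_closed)
qed (use assms in \<open>auto intro!: mm_closed[of _ n k] msm_closed\<close>)

lemma mstar_mm:
  assumes "X \<in> rm n k" "Y \<in> rm k m" shows "(X \<bullet> Y)\<^sup>\<dagger> = Y\<^sup>\<dagger> \<bullet> X\<^sup>\<dagger>"
proof (rule rm_eqI[of _ m n])
  fix i j assume ij: "i < m" "j < n"
  have c: "p < k \<Longrightarrow> X $$ (j, p) \<in> carrier A" "p < k \<Longrightarrow> Y $$ (p, i) \<in> carrier A" for p
    using assms ij by (auto simp: rm_entry)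
  show "(X \<bullet> Y)\<^sup>\<dagger> $$ (i, j) = (Y\<^sup>\<dagger> \<bullet> X\<^sup>\<dagger>) $$ (i, j)"
    using ij c
    by (intro sep) (auto simp: mstar_index[OF mm_closed[OF assms]] mm_index[OF assms]
        mm_index[OF mstar_closed[OF assms(2)] mstar_closed[OF assms(1)]]
        mstar_index[OF assms(1)] mstar_index[OF assms(2)] star_finsum star_mult linfun_finsum Pi_def)
qed (use assms in \<open>auto intro!: mm_closed[of _ m k] mstar_closed mm_closed[of _ n k]\<close>)

lemma mm_unit_l:
  assumes "X \<in> rm n m" shows "mat_unit A n \<bullet> X = X"
proof (rule rm_eqI[of _ n m])
  fix i j assume ij: "i < n" "j < m"
  have "(\<Oplus>l\<in>{..<n}. mat_unit A n $$ (i, l) \<otimes> X $$ (l, j)) = (\<Oplus>l\<in>{..<n}. if l = i then X $$ (i, j) else \<zero>)"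
    using assms ij by (intro finsum_cong') (auto simp: rm_entry)
  then show "(mat_unit A n \<bullet> X) $$ (i, j) = X $$ (i, j)"
    using assms ij by (simp add: mm_index[OF mat_unit_closed assms] finsum_single rm_entry)
qed (use assms in \<open>auto intro!: mm_closed[of _ n n]\<close>)

lemma mm_unit_r:
  assumes "X \<in> rm n m" shows "X \<bullet> mat_unit A m = X"
proof (rule rm_eqI[of _ n m])
  fix i j assume ij: "i < n" "j < m"
  have "(\<Oplus>l\<in>{..<m}. X $$ (i, l) \<otimes> mat_unit A m $$ (l, j)) = (\<Oplus>l\<in>{..<m}. if l = j then X $$ (i, j) else \<zero>)"
    using assms ij by (intro finsum_cong') (auto simp: rm_entry)
  then show "(X \<bullet> mat_unit A m) $$ (i, j) = X $$ (i, j)"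
    using assms ij by (simp add: mm_index[OF assms mat_unit_closed] finsum_single rm_entry)
qed (use assms in \<open>auto intro!: mm_closed[of _ n m]\<close>)

end

text \<open>The norm is a parameter, since the algebraic structure has to exist before
  \<open>cone_norm\<close> can be formed from it.\<close>

definition mat_alg :: "('u, 'm) star_space_scheme \<Rightarrow> nat \<Rightarrow> ('u mat \<Rightarrow> real) \<Rightarrow> 'u mat cstar" where
  "mat_alg A n N = \<lparr>carrier = mats A n, monoid.mult = mat_mult A, one = mat_unit A n, zero = mat_zero A n,
     add = mat_add A, module.smult = mat_smult A, adj = mat_adj A, nrm = N\<rparr>"

lemma mat_alg_simps [simp]:
  "carrier (mat_alg A n N) = mats A n" "monoid.mult (mat_alg A n N) = mat_mult A"
  "one (mat_alg A n N) = mat_unit A n" "zero (mat_alg A n N) = mat_zero A n"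
  "add (mat_alg A n N) = mat_add A" "module.smult (mat_alg A n N) = mat_smult A"
  "adj (mat_alg A n N) = mat_adj A" "nrm (mat_alg A n N) = N"
  by (simp_all add: mat_alg_def)

context star_alg
begin

lemma mat_alg_abelian_group: "abelian_group (mat_alg A n N)"
proof (rule abelian_groupI)
  fix X assume "X \<in> carrier (mat_alg A n N)"
  then have X: "X \<in> rm n n" by (simp add: mats_eq)
  then have "(-1) \<bullet>\<^sub>s X \<boxplus> X = mat_zero A n"
    by (intro rm_eqI[of _ n n]) (auto simp: mplus_index[of _ n n] msm_index[of _ n n] rm_entry sm_minus_one l_neg)
  then show "\<exists>Y\<in>carrier (mat_alg A n N). Y \<oplus>\<^bsub>mat_alg A n N\<^esub> X = \<zero>\<^bsub>mat_alg A n N\<^esub>"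
    using X by (intro bexI[of _ "(-1) \<bullet>\<^sub>s X"]) (auto simp: mats_eq)
qed (auto simp: mats_eq mplus_index[of _ n n] rm_entry a_ac intro!: rm_eqI[of _ n n])

lemma mat_alg_star_algebra: "star_algebra (mat_alg A n N)"
proof -
  have "ring (mat_alg A n N)"
    by (intro ringI mat_alg_abelian_group monoidI)
      (auto simp: mats_eq mm_assoc[of _ n n _ n _ n] mm_unit_l mm_unit_r mm_ldistr mm_rdistr
        intro: mm_closed)
  moreover have "complex_space (mat_alg A n N)"
    by (intro complex_spaceI mat_alg_abelian_group)
      (auto simp: mats_eq msm_index[of _ n n] mplus_index[of _ n n] rm_entry sm_ldistr sm_rdistr sm_assoc
        intro!: rm_eqI[of _ n n])
  moreover have "star_vector_space (mat_alg A n N)"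
    unfolding star_vector_space_def using calculation(2)
    by (auto simp: mats_eq mstar_plus mstar_sm)
  ultimately show ?thesis
    unfolding star_algebra_def by (auto simp: mats_eq mm_sm_l mm_sm_r mstar_mm)
qed

end

section \<open>The operator system of a C*-algebra\<close>

context cstar_alg
begin

lemma pos_finsum: "\<lbrakk>finite I; \<And>i. i \<in> I \<Longrightarrow> g i \<in> pos\<rbrakk> \<Longrightarrow> finsum A g I \<in> pos"
proof (induction I rule: finite_induct)
  case (insert i I)
  then show ?case by (subst finsum_insert) (auto intro: pos_add)
qed simp

lemma pos_le_norm:
  assumes "b \<in> sa" "nrm A b \<le> r" shows "cm (complex_of_real r) \<ominus> b \<in> pos"
proof (rule posI)
  have "cm (complex_of_real r) \<ominus> (cm (complex_of_real r) \<ominus> b) = b"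
    using assms by (intro sep) (auto simp: alg_simps)
  then show "nrm A (cm (complex_of_real r) \<ominus> (cm (complex_of_real r) \<ominus> b)) \<le> r" using assms by simp
qed (use assms in auto)

text \<open>Every positive b is dominated by a scalar, so perturbing by small multiples of b is no
  worse than perturbing by small scalars. It is applied with b = \<open>vsq v\<close>, the value of
  the quadratic form at the matrix unit.\<close>

lemma pos_archimedean_pos:
  assumes h: "h \<in> sa" and b: "b \<in> pos" and e: "\<And>e. e > 0 \<Longrightarrow> h \<oplus> complex_of_real e \<odot> b \<in> pos"
  shows "h \<in> pos"
proof (rule pos_archimedean[OF h])
  fix e :: real assume e0: "e > 0"
  let ?d = "e / (nrm A b + 1)"
  have bc: "b \<in> carrier A" "b \<in> sa" using b by auto
  then have d: "?d > 0" using e0 by (simp add: add_nonneg_pos)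
  have n: "nrm A (complex_of_real ?d \<odot> b) \<le> e"
    using bc e0 by (simp add: norm_sm norm_divide add_nonneg_pos pos_divide_le_eq mult_left_mono)
  have "h \<oplus> cm (complex_of_real e) = (h \<oplus> complex_of_real ?d \<odot> b) \<oplus> (cm (complex_of_real e) \<ominus> complex_of_real ?d \<odot> b)"
    using h bc by (intro sep) (auto simp: alg_simps)
  also have "\<dots> \<in> pos" using bc by (intro pos_add e[OF d] pos_le_norm n sa_sm)
  finally show "h \<oplus> cm (complex_of_real e) \<in> pos" .
qed

lemma pos_finsum_le:
  assumes "finite I" "\<And>i. i \<in> I \<Longrightarrow> g i \<in> pos" "x \<ominus> finsum A g I \<in> pos" "i \<in> I" "x \<in> carrier A"
  shows "x \<ominus> g i \<in> pos"
proof -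
  have c: "\<And>i. i \<in> I \<Longrightarrow> g i \<in> carrier A" using assms(2) by auto
  have "finsum A g I = g i \<oplus> finsum A g (I - {i})"
    using assms(1,4) c finsum_insert[of "I - {i}" i g] by (simp add: insert_absorb Pi_def)
  then have "x \<ominus> g i = (x \<ominus> finsum A g I) \<oplus> finsum A g (I - {i})"
    using assms(4,5) c by (intro sep) (auto simp: alg_simps Pi_def intro!: finsum_closed)
  also have "\<dots> \<in> pos" using assms by (intro pos_add pos_finsum) auto
  finally show ?thesis .
qed

text \<open>Lagrange's identity: the difference is half the sum of all (w_j - w_k)* (w_j - w_k),
  which are positive by \<open>pos_star_mult\<close>.\<close>

lemma pos_Cauchy_Schwarz:
  assumes w: "\<And>j. j < n \<Longrightarrow> w j \<in> carrier A"
  shows "of_nat n \<odot> (\<Oplus>j\<in>{..<n}. (w j)\<^sup>\<star> \<otimes> w j) \<ominus> (\<Oplus>j\<in>{..<n}. w j)\<^sup>\<star> \<otimes> (\<Oplus>j\<in>{..<n}. w j) \<in> pos"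
proof -
  have c: "w \<in> {..<n} \<rightarrow> carrier A" using w by auto
  then have sc: "(\<Oplus>j\<in>{..<n}. w j) \<in> carrier A" by (rule finsum_closed)
  have "of_nat n \<odot> (\<Oplus>j\<in>{..<n}. (w j)\<^sup>\<star> \<otimes> w j) \<ominus> (\<Oplus>j\<in>{..<n}. w j)\<^sup>\<star> \<otimes> (\<Oplus>j\<in>{..<n}. w j) =
     complex_of_real (1/2) \<odot> (\<Oplus>j\<in>{..<n}. \<Oplus>k\<in>{..<n}. (w j \<ominus> w k)\<^sup>\<star> \<otimes> (w j \<ominus> w k))" (is "?l = ?r")
  proof (rule sep)
    show "?l \<in> carrier A" "?r \<in> carrier A" using w sc by (auto intro!: finsum_closed)
    fix f assume f: "linfun A f"
    have prod: "f ((\<Oplus>j\<in>{..<n}. w j)\<^sup>\<star> \<otimes> (\<Oplus>j\<in>{..<n}. w j)) = (\<Sum>j<n. \<Sum>k<n. f ((w j)\<^sup>\<star> \<otimes> w k))"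
    proof -
      have "(\<Oplus>j\<in>{..<n}. w j)\<^sup>\<star> \<otimes> (\<Oplus>j\<in>{..<n}. w j) = (\<Oplus>j\<in>{..<n}. (w j)\<^sup>\<star> \<otimes> (\<Oplus>k\<in>{..<n}. w k))"
        using w sc by (simp add: star_finsum Pi_def finsum_ldistr)
      also have "f \<dots> = (\<Sum>j<n. f ((w j)\<^sup>\<star> \<otimes> (\<Oplus>k\<in>{..<n}. w k)))"
        using w sc by (intro linfun_finsum[OF f]) auto
      also have "\<dots> = (\<Sum>j<n. \<Sum>k<n. f ((w j)\<^sup>\<star> \<otimes> w k))"
        using w by (intro sum.cong refl) (simp add: finsum_rdistr Pi_def linfun_finsum[OF f])
      finally show ?thesis .
    qed
    have "f ?r = (1/2) * (\<Sum>j<n. \<Sum>k<n. f ((w j)\<^sup>\<star> \<otimes> w j) - f ((w j)\<^sup>\<star> \<otimes> w k) - f ((w k)\<^sup>\<star> \<otimes> w j) + f ((w k)\<^sup>\<star> \<otimes> w k))"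
      using w by (simp add: linfun_finsum[OF f] Pi_def linfun_sm[OF f] finsum_closed alg_simps f algebra_simps)
    also have "\<dots> = of_nat n * (\<Sum>j<n. f ((w j)\<^sup>\<star> \<otimes> w j)) - (\<Sum>j<n. \<Sum>k<n. f ((w j)\<^sup>\<star> \<otimes> w k))"
    proof -
      have "(\<Sum>j<n. \<Sum>k<n. f ((w k)\<^sup>\<star> \<otimes> w j)) = (\<Sum>j<n. \<Sum>k<n. f ((w j)\<^sup>\<star> \<otimes> w k))"
        by (rule sum.swap)
      then show ?thesis by (simp add: sum.distrib sum_subtractf flip: sum_distrib_left)
    qed
    also have "\<dots> = f ?l" using w sc f prod
      by (simp add: linfun_finsum[OF f] Pi_def linfun_sm[OF f] linfun_diff[OF f] finsum_closed)
    finally show "f ?l = f ?r" ..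
  qed
  also have "\<dots> \<in> pos" using w by (intro pos_sm pos_finsum pos_star_mult) auto
  finally show ?thesis .
qed

text \<open>The A-valued inner product of the column v with itself in the Hilbert module A^n;
  \<open>qf\<close> is the corresponding quadratic form of a matrix.\<close>

definition vsq :: "'u mat \<Rightarrow> 'u" where "vsq v = (v\<^sup>\<dagger> \<bullet> v) $$ (0, 0)"

definition qf :: "'u mat \<Rightarrow> 'u mat \<Rightarrow> 'u" where "qf v X = (v\<^sup>\<dagger> \<bullet> (X \<bullet> v)) $$ (0, 0)"

text \<open>A description by quadratic forms is linear in the matrix, so the cone axioms follow from
  those of \<open>pos\<close>. For matrices of the form Y* Y, even closure under sums would be
  unclear at this stage; that both descriptions agree is \<open>mcone_eq\<close>.\<close>

definition mcone :: "nat \<Rightarrow> 'u mat set" where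
  "mcone n = {X \<in> rm n n. X\<^sup>\<dagger> = X \<and> (\<forall>v\<in>rm n 1. qf v X \<in> pos)}"

lemma vsq_eq: "v \<in> rm n 1 \<Longrightarrow> vsq v = (\<Oplus>i\<in>{..<n}. (v $$ (i, 0))\<^sup>\<star> \<otimes> v $$ (i, 0))"
  unfolding vsq_def
  by (subst mm_index[of _ 1 n _ 1]) (auto simp: mstar_index[of _ n 1] rm_entry intro!: finsum_cong')

lemma vsq_pos [simp]: "v \<in> rm n 1 \<Longrightarrow> vsq v \<in> pos"
  unfolding vsq_eq by (intro pos_finsum pos_star_mult) (auto intro: rm_entry)

lemma qf_closed [simp]: "\<lbrakk>v \<in> rm n 1; X \<in> rm n n\<rbrakk> \<Longrightarrow> qf v X \<in> carrier A"
  unfolding qf_def by (rule rm_entry[OF mm_closed[OF mstar_closed mm_closed]]) auto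

lemma qf_plus:
  assumes "v \<in> rm n 1" "X \<in> rm n n" "Y \<in> rm n n" shows "qf v (X \<boxplus> Y) = qf v X \<oplus> qf v Y"
proof -
  have c: "X \<bullet> v \<in> rm n 1" "Y \<bullet> v \<in> rm n 1" "v\<^sup>\<dagger> \<bullet> (X \<bullet> v) \<in> rm 1 1"
    using assms mm_closed[OF mstar_closed[OF assms(1)] mm_closed[OF assms(2,1)]] by (auto intro: mm_closed)
  show ?thesis
    unfolding qf_def mm_ldistr[OF assms(2,3,1)] mm_rdistr[OF mstar_closed[OF assms(1)] c(1,2)]
    by (rule mplus_index[OF c(3)]) auto
qed

lemma qf_sm:
  assumes "v \<in> rm n 1" "X \<in> rm n n" shows "qf v (c \<bullet>\<^sub>s X) = c \<odot> qf v X"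
proof -
  have c: "X \<bullet> v \<in> rm n 1" "v\<^sup>\<dagger> \<bullet> (X \<bullet> v) \<in> rm 1 1"
    using assms mm_closed[OF mstar_closed[OF assms(1)] mm_closed[OF assms(2,1)]] by (auto intro: mm_closed)
  show ?thesis
    unfolding qf_def mm_sm_l[OF assms(2,1)] mm_sm_r[OF mstar_closed[OF assms(1)] c(1)]
    by (rule msm_index[OF c(2)]) auto
qed

lemma qf_unit: "v \<in> rm n 1 \<Longrightarrow> qf v (mat_unit A n) = vsq v"
  by (simp add: qf_def vsq_def mm_unit_l)

lemma qf_conj:
  assumes "v \<in> rm m 1" "X \<in> rm n n" "Y \<in> rm n m"
  shows "qf v (Y\<^sup>\<dagger> \<bullet> X \<bullet> Y) = qf (Y \<bullet> v) X"
proof -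
  note Ys = mstar_closed[OF assms(3)] and vs = mstar_closed[OF assms(1)]
  note Yv = mm_closed[OF assms(3,1)]
  have "Y\<^sup>\<dagger> \<bullet> X \<bullet> Y \<bullet> v = Y\<^sup>\<dagger> \<bullet> (X \<bullet> (Y \<bullet> v))"
    by (simp add: mm_assoc[OF mm_closed[OF Ys assms(2)] assms(3,1)] mm_assoc[OF Ys assms(2) Yv])
  then show ?thesis
    unfolding qf_def mstar_mm[OF assms(3,1)]
    by (simp add: mm_assoc[OF vs Ys mm_closed[OF assms(2) Yv]])
qed

lemma qf_sq:
  assumes "v \<in> rm m 1" "Y \<in> rm n m" shows "qf v (Y\<^sup>\<dagger> \<bullet> Y) = vsq (Y \<bullet> v)"
  using qf_conj[OF assms(1) mat_unit_closed assms(2)] mm_unit_r[OF mstar_closed[OF assms(2)]]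
    qf_unit[OF mm_closed[OF assms(2,1)]] by simp

lemma qf_sa:
  assumes "v \<in> rm n 1" "X \<in> rm n n" "X\<^sup>\<dagger> = X" shows "qf v X \<in> sa"
proof (rule saI)
  note vs = mstar_closed[OF assms(1)] and Xv = mm_closed[OF assms(2,1)]
  have c: "v\<^sup>\<dagger> \<bullet> (X \<bullet> v) \<in> rm 1 1" by (rule mm_closed[OF vs Xv])
  have "(v\<^sup>\<dagger> \<bullet> (X \<bullet> v))\<^sup>\<dagger> = v\<^sup>\<dagger> \<bullet> (X \<bullet> v)"
    using assms by (simp add: mstar_mm[OF vs Xv] mstar_mm[OF assms(2,1)] mm_assoc[OF vs assms(2,1)])
  then show "(qf v X)\<^sup>\<star> = qf v X"
    unfolding qf_def using mstar_index[OF c, of 0 0] by simp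
qed (use assms in simp)

lemma mcone_conj:
  assumes X: "X \<in> mcone n" and Y: "Y \<in> rm n m" shows "Y\<^sup>\<dagger> \<bullet> X \<bullet> Y \<in> mcone m"
proof -
  have X': "X \<in> rm n n" "X\<^sup>\<dagger> = X" using X by (auto simp: mcone_def)
  note Ys = mstar_closed[OF Y]
  have "(Y\<^sup>\<dagger> \<bullet> X \<bullet> Y)\<^sup>\<dagger> = Y\<^sup>\<dagger> \<bullet> (X \<bullet> Y)"
    using X' Y by (simp only: mstar_mm[OF mm_closed[OF Ys X'(1)] Y] mstar_mm[OF Ys X'(1)] mstar_mstar[OF Y])
  then have "(Y\<^sup>\<dagger> \<bullet> X \<bullet> Y)\<^sup>\<dagger> = Y\<^sup>\<dagger> \<bullet> X \<bullet> Y"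
    by (simp only: mm_assoc[OF Ys X'(1) Y])
  moreover have "qf v (Y\<^sup>\<dagger> \<bullet> X \<bullet> Y) \<in> pos" if "v \<in> rm m 1" for v
    using qf_conj[OF that X'(1) Y] X mm_closed[OF Y that] by (simp add: mcone_def)
  ultimately show ?thesis
    using mm_closed[OF mm_closed[OF Ys X'(1)] Y] by (simp add: mcone_def)
qed

text \<open>An operator bound from bounds on the entries: Cauchy-Schwarz costs a factor n in each
  row, each product X_ij v_j contributes at most e^2 v_j* v_j, and there are n rows; hence the
  constant n^2 e^2.\<close>

lemma vsq_bound:
  assumes X: "X \<in> rm n n" and e: "\<And>i j. \<lbrakk>i < n; j < n\<rbrakk> \<Longrightarrow> nrm A (X $$ (i, j)) \<le> e" "e \<ge> 0"
    and v: "v \<in> rm n 1"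
  shows "complex_of_real ((real n * e)\<^sup>2) \<odot> vsq v \<ominus> vsq (X \<bullet> v) \<in> pos"
proof -
  let ?v = "\<lambda>j. v $$ (j, 0)"
  define w where "w i j = X $$ (i, j) \<otimes> ?v j" for i j
  define W where "W i = (\<Oplus>j\<in>{..<n}. w i j)" for i
  have vc: "?v j \<in> carrier A" if "j < n" for j using v that by (auto simp: rm_entry)
  have xc: "X $$ (i, j) \<in> carrier A" if "i < n" "j < n" for i j using X that by (auto simp: rm_entry)
  have wc: "w i j \<in> carrier A" if "i < n" "j < n" for i j using vc xc that by (simp add: w_def)
  have Wc: "W i \<in> carrier A" if "i < n" for i using wc that by (auto simp: W_def intro!: finsum_closed)
  have Xv: "vsq (X \<bullet> v) = (\<Oplus>i\<in>{..<n}. (W i)\<^sup>\<star> \<otimes> W i)"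
    using X v by (subst vsq_eq[of _ n])
      (auto intro!: finsum_cong' mm_closed[of _ n n] simp: mm_index[of _ n n _ 1] W_def[symmetric] w_def[symmetric] Wc)
  \<comment> \<open>\<open>cs\<close> is the defect in the Cauchy-Schwarz inequality of a row and
    \<open>d\<close> the defect in the estimate of one entry. The difference to be shown positive is
    a nonnegative combination of these defects.\<close>
  define cs where "cs i = of_nat n \<odot> (\<Oplus>j\<in>{..<n}. (w i j)\<^sup>\<star> \<otimes> w i j) \<ominus> (W i)\<^sup>\<star> \<otimes> W i" for i
  define d where "d i j = (?v j)\<^sup>\<star> \<otimes> (cm (complex_of_real (e\<^sup>2)) \<ominus> (X $$ (i, j))\<^sup>\<star> \<otimes> X $$ (i, j)) \<otimes> ?v j" for i j
  have cs: "cs i \<in> pos" if "i < n" for i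
    unfolding cs_def W_def using wc that by (intro pos_Cauchy_Schwarz)
  have d: "d i j \<in> pos" if "i < n" "j < n" for i j
  proof -
    have "cm (complex_of_real (e\<^sup>2)) \<ominus> (X $$ (i, j))\<^sup>\<star> \<otimes> X $$ (i, j) \<in> pos"
      using norm_le_iff[OF xc[OF that] e(2)] e(1)[OF that] by blast
    then show ?thesis unfolding d_def by (rule pos_conj[OF _ vc[OF that(2)]])
  qed
  have fd: "f (d i j) = complex_of_real (e\<^sup>2) * f ((?v j)\<^sup>\<star> \<otimes> ?v j) - f ((w i j)\<^sup>\<star> \<otimes> w i j)"
    if "linfun A f" "i < n" "j < n" for f i j
    unfolding d_def w_def using that vc[of j] xc[of i j] by (simp add: alg_simps cm_simps)
  have fcs: "f (cs i) = of_nat n * (\<Sum>j<n. f ((w i j)\<^sup>\<star> \<otimes> w i j)) - f ((W i)\<^sup>\<star> \<otimes> W i)"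
    if "linfun A f" "i < n" for f i
    unfolding cs_def using that wc Wc by (simp add: linfun_diff linfun_sm linfun_finsum Pi_def finsum_closed)
  have "complex_of_real ((real n * e)\<^sup>2) \<odot> vsq v \<ominus> vsq (X \<bullet> v) =
    (\<Oplus>i\<in>{..<n}. cs i \<oplus> of_nat n \<odot> (\<Oplus>j\<in>{..<n}. d i j))" (is "?l = ?r")
  proof (rule sep)
    have vv: "vsq v \<in> carrier A" "vsq (X \<bullet> v) \<in> carrier A"
      by (rule pos_carrier[OF vsq_pos[OF v]] pos_carrier[OF vsq_pos[OF mm_closed[OF X v]]])+
    then show "?l \<in> carrier A" by simp
    show "?r \<in> carrier A" using cs d by (auto intro!: finsum_closed)
    fix f assume f: "linfun A f"
    have "f ?r = (\<Sum>i<n. f (cs i) + of_nat n * (\<Sum>j<n. f (d i j)))"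
      using cs d by (simp add: linfun_finsum[OF f] linfun_add[OF f] linfun_sm[OF f] Pi_def finsum_closed sum.distrib)
    also have "\<dots> = (\<Sum>i<n. of_nat n * complex_of_real (e\<^sup>2) * (\<Sum>j<n. f ((?v j)\<^sup>\<star> \<otimes> ?v j)) - f ((W i)\<^sup>\<star> \<otimes> W i))"
      by (intro sum.cong refl) (simp add: fcs[OF f] fd[OF f] sum_subtractf sum_distrib_left algebra_simps)
    also have "\<dots> = of_nat n * (of_nat n * complex_of_real (e\<^sup>2) * (\<Sum>j<n. f ((?v j)\<^sup>\<star> \<otimes> ?v j))) - (\<Sum>i<n. f ((W i)\<^sup>\<star> \<otimes> W i))"
      by (simp add: sum_subtractf)
    also have "(\<Sum>j<n. f ((?v j)\<^sup>\<star> \<otimes> ?v j)) = f (vsq v)"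
      using v vc by (simp add: vsq_eq linfun_finsum[OF f] Pi_def)
    also have "(\<Sum>i<n. f ((W i)\<^sup>\<star> \<otimes> W i)) = f (vsq (X \<bullet> v))"
      unfolding Xv using Wc by (simp add: linfun_finsum[OF f] Pi_def)
    also have "of_nat n * (of_nat n * complex_of_real (e\<^sup>2) * f (vsq v)) - f (vsq (X \<bullet> v)) = f ?l"
      using vv f by (simp add: linfun_diff linfun_sm power2_eq_square algebra_simps)
    finally show "f ?l = f ?r" ..
  qed
  also have "\<dots> \<in> pos"
  proof (intro pos_finsum pos_add)
    fix i assume i: "i \<in> {..<n}"
    then show "cs i \<in> pos" using cs by simp
    have "complex_of_real (real n) \<odot> (\<Oplus>j\<in>{..<n}. d i j) \<in> pos"
      using i d by (intro pos_sm pos_finsum) auto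
    then show "of_nat n \<odot> (\<Oplus>j\<in>{..<n}. d i j) \<in> pos" by simp
  qed simp
  finally show ?thesis .
qed

lemma mat_alg_cm: "star_alg.cm (mat_alg A n N) c = c \<bullet>\<^sub>s mat_unit A n"
  by (simp add: star_alg.cm_def[OF star_alg.intro[OF mat_alg_star_algebra]])

lemma mat_alg_sa: "star_space.sa (mat_alg A n N) = {X \<in> rm n n. X\<^sup>\<dagger> = X}"
proof -
  interpret M: star_alg "mat_alg A n N" by (intro star_alg.intro mat_alg_star_algebra)
  show ?thesis by (simp add: M.sa_def mats_eq)
qed

lemma mat_alg_minus:
  assumes "X \<in> rm n n" "Y \<in> rm n n"
  shows "X \<ominus>\<^bsub>mat_alg A n N\<^esub> Y = X \<boxplus> (-1) \<bullet>\<^sub>s Y"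
proof -
  interpret M: star_alg "mat_alg A n N" by (intro star_alg.intro mat_alg_star_algebra)
  show ?thesis using assms M.sm_minus_one[of Y] by (simp add: M.minus_eq mats_eq)
qed

lemma qf_norm_defect:
  assumes "v \<in> rm n 1" "X \<in> rm n n"
  shows "qf v (complex_of_real r \<bullet>\<^sub>s mat_unit A n \<boxplus> (-1) \<bullet>\<^sub>s (X\<^sup>\<dagger> \<bullet> X)) = complex_of_real r \<odot> vsq v \<ominus> vsq (X \<bullet> v)"
proof -
  have XX: "X\<^sup>\<dagger> \<bullet> X \<in> rm n n" using assms by (intro mm_closed[of _ n n]) auto
  have "vsq (X \<bullet> v) \<in> carrier A" using vsq_pos[OF mm_closed[OF assms(2,1)]] by simp
  then show ?thesis
    using assms XX by (simp add: qf_plus[of _ n] qf_sm[of _ n] qf_unit[of _ n] qf_sq sm_minus_one a_minus_def)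
qed

text \<open>Each axiom is tested on quadratic forms. The Archimedean axiom meets
  \<open>vsq v\<close> in place of the unit, and boundedness is \<open>vsq_bound\<close> with the
  sum of the norms of all entries as common bound.\<close>

lemma cone_alg_mat: "cone_alg (mat_alg A n N) (mcone n)"
proof -
  interpret M: star_alg "mat_alg A n N" by (intro star_alg.intro mat_alg_star_algebra)
  show ?thesis
  proof (intro cone_alg.intro cone_alg_axioms.intro)
    show "star_alg (mat_alg A n N)" by unfold_locales
    fix X assume X: "X \<in> mcone n"
    then have X': "X \<in> rm n n" "X\<^sup>\<dagger> = X" "\<And>v. v \<in> rm n 1 \<Longrightarrow> qf v X \<in> pos" by (auto simp: mcone_def)
    then show "X \<in> M.sa" by (simp add: mat_alg_sa)
    show "X \<oplus>\<^bsub>mat_alg A n N\<^esub> Y \<in> mcone n" if "Y \<in> mcone n" for Y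
      using that X' by (auto simp: mcone_def mstar_plus[of _ n n] qf_plus[of _ n] pos_add)
    show "complex_of_real r \<odot>\<^bsub>mat_alg A n N\<^esub> X \<in> mcone n" if "r \<ge> 0" for r
      using that X' by (auto simp: mcone_def mstar_sm[of _ n n] qf_sm[of _ n] pos_sm)
    show "adj (mat_alg A n N) Y \<otimes>\<^bsub>mat_alg A n N\<^esub> X \<otimes>\<^bsub>mat_alg A n N\<^esub> Y \<in> mcone n"
      if "Y \<in> carrier (mat_alg A n N)" for Y
      using that X mcone_conj by (simp add: mats_eq)
  next
    have "(mat_unit A n)\<^sup>\<dagger> = mat_unit A n" using M.star_one by simp
    then show "\<one>\<^bsub>mat_alg A n N\<^esub> \<in> mcone n"
      by (auto simp: mcone_def qf_unit)
  next
    fix X assume X: "X \<in> M.sa"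
      and e: "\<And>e. e > 0 \<Longrightarrow> X \<oplus>\<^bsub>mat_alg A n N\<^esub> M.cm (complex_of_real e) \<in> mcone n"
    have X': "X \<in> rm n n" "X\<^sup>\<dagger> = X" using X by (auto simp: mat_alg_sa)
    have "qf v X \<in> pos" if v: "v \<in> rm n 1" for v
    proof (rule pos_archimedean_pos[OF qf_sa[OF v X'] vsq_pos[OF v]])
      fix e :: real assume "e > 0"
      then have "qf v (X \<boxplus> complex_of_real e \<bullet>\<^sub>s mat_unit A n) \<in> pos"
        using e[of e] v by (simp add: mat_alg_cm mcone_def)
      then show "qf v X \<oplus> complex_of_real e \<odot> vsq v \<in> pos"
        using v X' by (simp add: qf_plus[of _ n] qf_sm[of _ n] qf_unit[of _ n])
    qed
    with X' show "X \<in> mcone n" by (simp add: mcone_def)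
  next
    fix X assume "X \<in> carrier (mat_alg A n N)"
    then have X: "X \<in> rm n n" by (simp add: mats_eq)
    define e where "e = (\<Sum>i<n. \<Sum>j<n. nrm A (X $$ (i, j)))"
    have nn: "0 \<le> nrm A (X $$ (i, j))" if "i < n" "j < n" for i j using X that by (simp add: rm_entry)
    have e: "nrm A (X $$ (i, j)) \<le> e" if "i < n" "j < n" for i j
    proof -
      have "nrm A (X $$ (i, j)) \<le> (\<Sum>j<n. nrm A (X $$ (i, j)))"
        using nn that by (intro member_le_sum) auto
      also have "\<dots> \<le> e" unfolding e_def using nn that
        by (intro member_le_sum[of i "{..<n}" "\<lambda>i. \<Sum>j<n. nrm A (X $$ (i, j))"] sum_nonneg) auto
      finally show ?thesis .
    qed
    have e0: "e \<ge> 0" unfolding e_def using nn by (intro sum_nonneg) auto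
    let ?Z = "complex_of_real ((real n * e)\<^sup>2) \<bullet>\<^sub>s mat_unit A n \<boxplus> (-1) \<bullet>\<^sub>s (X\<^sup>\<dagger> \<bullet> X)"
    have XX: "X\<^sup>\<dagger> \<bullet> X \<in> rm n n" using X by (intro mm_closed[of _ n n]) auto
    have "?Z = M.cm (complex_of_real ((real n * e)\<^sup>2)) \<ominus>\<^bsub>mat_alg A n N\<^esub> (X\<^sup>\<dagger> \<bullet> X)"
      unfolding mat_alg_cm by (rule mat_alg_minus[symmetric]) (use XX in auto)
    moreover have "\<dots> \<in> M.sa"
      using X M.sa_square[of X] by (intro M.sa_minus M.cm_sa) (simp add: mats_eq)
    ultimately have "?Z \<in> M.sa" by simp
    moreover have "qf v ?Z \<in> pos" if "v \<in> rm n 1" for v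
      unfolding qf_norm_defect[OF that X] by (rule vsq_bound[OF X e e0 that])
    ultimately have "?Z \<in> mcone n" by (simp add: mcone_def mat_alg_sa)
    then show "\<exists>r\<ge>0. M.cm (complex_of_real (r\<^sup>2)) \<ominus>\<^bsub>mat_alg A n N\<^esub> adj (mat_alg A n N) X \<otimes>\<^bsub>mat_alg A n N\<^esub> X \<in> mcone n"
      using XX e0 by (intro exI[of _ "real n * e"]) (simp add: mat_alg_cm mat_alg_minus)
  qed
qed

end

text \<open>The zero norm is a placeholder: \<open>cone_norm\<close> reads only the algebraic fields
  of the record.\<close>

definition mat_cstar :: "'u cstar \<Rightarrow> nat \<Rightarrow> 'u mat set \<Rightarrow> 'u mat cstar" where
  "mat_cstar A n C = mat_alg A n (cone_norm (mat_alg A n (\<lambda>_. 0)) C)"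

lemma cone_norm_mat_alg: "cone_norm (mat_alg A n N) C = cone_norm (mat_alg A n N') C"
  by (rule ext) (simp add: cone_norm_def)

lemma nrm_mat_cstar: "nrm (mat_cstar A n C) = cone_norm (mat_cstar A n C) C"
  unfolding mat_cstar_def mat_alg_simps by (rule cone_norm_mat_alg)

section \<open>Matrices over a C*-algebra form a C*-algebra\<close>

context cstar_alg
begin

abbreviation Mn :: "nat \<Rightarrow> 'u mat cstar" where "Mn n \<equiv> mat_cstar A n (mcone n)"

lemma Mn_cone_alg: "cone_alg (Mn n) (mcone n)"
  unfolding mat_cstar_def by (rule cone_alg_mat)

lemma Mn_simps [simp]:
  "carrier (Mn n) = rm n n" "monoid.mult (Mn n) = mat_mult A" "one (Mn n) = mat_unit A n"
  "zero (Mn n) = mat_zero A n" "add (Mn n) = mat_add A" "module.smult (Mn n) = mat_smult A"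
  "adj (Mn n) = mat_adj A"
  by (simp_all add: mat_cstar_def mats_eq)

lemma Mn_cm: "star_alg.cm (Mn n) c = c \<bullet>\<^sub>s mat_unit A n"
  unfolding mat_cstar_def by (rule mat_alg_cm)

lemma Mn_minus: "\<lbrakk>X \<in> rm n n; Y \<in> rm n n\<rbrakk> \<Longrightarrow> X \<ominus>\<^bsub>Mn n\<^esub> Y = X \<boxplus> (-1) \<bullet>\<^sub>s Y"
  unfolding mat_cstar_def by (rule mat_alg_minus)

lemma Mn_minus_index:
  "\<lbrakk>X \<in> rm n n; Y \<in> rm n n; i < n; j < n\<rbrakk> \<Longrightarrow> (X \<ominus>\<^bsub>Mn n\<^esub> Y) $$ (i, j) = X $$ (i, j) \<ominus> Y $$ (i, j)"
  by (simp add: Mn_minus mplus_index[of _ n n] msm_index[of _ n n] rm_entry sm_minus_one minus_eq)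

definition unit_vec :: "nat \<Rightarrow> nat \<Rightarrow> 'u mat" where
  "unit_vec n j = mat n 1 (\<lambda>(i, _). if i = j then \<one> else \<zero>)"

lemma unit_vec_closed [simp]: "unit_vec n j \<in> rm n 1"
  by (rule rmI) (auto simp: unit_vec_def)

lemma vsq_unit_vec: "j < n \<Longrightarrow> vsq (unit_vec n j) = \<one>"
proof -
  assume j: "j < n"
  have "vsq (unit_vec n j) = (\<Oplus>i\<in>{..<n}. if i = j then \<one> else \<zero>)"
    unfolding vsq_eq[OF unit_vec_closed] by (intro finsum_cong') (auto simp: unit_vec_def)
  then show ?thesis using j by (simp add: finsum_single)
qed

lemma mm_unit_vec:
  assumes X: "X \<in> rm n n" and "j < n" "i < n"
  shows "(X \<bullet> unit_vec n j) $$ (i, 0) = X $$ (i, j)"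
proof -
  have "(X \<bullet> unit_vec n j) $$ (i, 0) = (\<Oplus>l\<in>{..<n}. X $$ (i, l) \<otimes> unit_vec n j $$ (l, 0))"
    using assms by (intro mm_index[OF X unit_vec_closed]) auto
  also have "\<dots> = (\<Oplus>l\<in>{..<n}. if l = j then X $$ (i, j) else \<zero>)"
    using assms by (intro finsum_cong') (auto simp: unit_vec_def rm_entry)
  finally show ?thesis using assms by (simp add: finsum_single rm_entry)
qed

lemma vsq_mm_unit_vec:
  assumes X: "X \<in> rm n n" and j: "j < n"
  shows "vsq (X \<bullet> unit_vec n j) = (\<Oplus>i\<in>{..<n}. (X $$ (i, j))\<^sup>\<star> \<otimes> X $$ (i, j))"
  unfolding vsq_eq[OF mm_closed[OF X unit_vec_closed]] using assms
  by (intro finsum_cong') (auto simp: mm_unit_vec rm_entry)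

text \<open>The quadratic form at the j-th unit vector is the sum of squares over the j-th column,
  and each positive summand lies below the sum.\<close>

lemma norm_entry_le:
  assumes X: "X \<in> rm n n" and ij: "i < n" "j < n"
    and le: "cm (complex_of_real (r\<^sup>2)) \<ominus> vsq (X \<bullet> unit_vec n j) \<in> pos" and r: "r \<ge> 0"
  shows "nrm A (X $$ (i, j)) \<le> r"
proof -
  have "cm (complex_of_real (r\<^sup>2)) \<ominus> (X $$ (i, j))\<^sup>\<star> \<otimes> X $$ (i, j) \<in> pos"
    using le ij X unfolding vsq_mm_unit_vec[OF X ij(2)]
    by (intro pos_finsum_le[of "{..<n}" "\<lambda>i. (X $$ (i, j))\<^sup>\<star> \<otimes> X $$ (i, j)"]) (auto simp: rm_entry[OF X])
  then show ?thesis using norm_le_iff[OF rm_entry[OF X ij] r] by blast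
qed

lemma qf_unit_vec_bounded:
  assumes X: "X \<in> rm n n" and j: "j < n" and b: "cone_alg.bounded_by (Mn n) (mcone n) r X"
  shows "cm (complex_of_real (r\<^sup>2)) \<ominus> vsq (X \<bullet> unit_vec n j) \<in> pos"
proof -
  interpret M: cone_alg "Mn n" "mcone n" by (rule Mn_cone_alg)
  have XX: "X\<^sup>\<dagger> \<bullet> X \<in> rm n n" using X by (intro mm_closed[of _ n n]) auto
  have "complex_of_real (r\<^sup>2) \<bullet>\<^sub>s mat_unit A n \<boxplus> (-1) \<bullet>\<^sub>s (X\<^sup>\<dagger> \<bullet> X) \<in> mcone n"
    using b XX unfolding M.bounded_by_def by (simp add: Mn_cm Mn_minus)
  then have "qf (unit_vec n j) (complex_of_real (r\<^sup>2) \<bullet>\<^sub>s mat_unit A n \<boxplus> (-1) \<bullet>\<^sub>s (X\<^sup>\<dagger> \<bullet> X)) \<in> pos"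
    using unit_vec_closed[of n j] unfolding mcone_def by blast
  then show ?thesis
    unfolding qf_norm_defect[OF unit_vec_closed X] vsq_unit_vec[OF j] by (simp add: cm_def)
qed

text \<open>Together with \<open>Mn_norm_le\<close> this makes convergence of matrices the same as
  convergence of all entries, so definiteness and completeness of M_n(A) come from those of
  A.\<close>

lemma Mn_entry_le:
  assumes X: "X \<in> rm n n" and ij: "i < n" "j < n"
  shows "nrm A (X $$ (i, j)) \<le> nrm (Mn n) X"
proof -
  interpret M: cone_alg "Mn n" "mcone n" by (rule Mn_cone_alg)
  have b: "M.bounded_by (nrm (Mn n) X) X" and "0 \<le> nrm (Mn n) X"
    using X M.cn_nonneg[of X] M.cn_le_iff[of X "M.cn X"] by (simp_all add: nrm_mat_cstar)
  then show ?thesis using norm_entry_le[OF X ij qf_unit_vec_bounded[OF X ij(2) b]] by blast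
qed

lemma Mn_norm_le:
  assumes X: "X \<in> rm n n"
  shows "nrm (Mn n) X \<le> real n * (\<Sum>i<n. \<Sum>j<n. nrm A (X $$ (i, j)))"
proof -
  interpret M: cone_alg "Mn n" "mcone n" by (rule Mn_cone_alg)
  define e where "e = (\<Sum>i<n. \<Sum>j<n. nrm A (X $$ (i, j)))"
  have nn: "0 \<le> nrm A (X $$ (i, j))" if "i < n" "j < n" for i j using X that by (simp add: rm_entry)
  have e: "nrm A (X $$ (i, j)) \<le> e" if "i < n" "j < n" for i j
  proof -
    have "nrm A (X $$ (i, j)) \<le> (\<Sum>j<n. nrm A (X $$ (i, j)))"
      using nn that by (intro member_le_sum) auto
    also have "\<dots> \<le> e" unfolding e_def using nn that
      by (intro member_le_sum[of i "{..<n}" "\<lambda>i. \<Sum>j<n. nrm A (X $$ (i, j))"] sum_nonneg) auto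
    finally show ?thesis .
  qed
  have e0: "e \<ge> 0" unfolding e_def using nn by (intro sum_nonneg) auto
  let ?Z = "complex_of_real ((real n * e)\<^sup>2) \<bullet>\<^sub>s mat_unit A n \<boxplus> (-1) \<bullet>\<^sub>s (X\<^sup>\<dagger> \<bullet> X)"
  have XX: "X\<^sup>\<dagger> \<bullet> X \<in> rm n n" using X by (intro mm_closed[of _ n n]) auto
  then have Z: "?Z = M.cm (complex_of_real ((real n * e)\<^sup>2)) \<ominus>\<^bsub>Mn n\<^esub> (adj (Mn n) X \<otimes>\<^bsub>Mn n\<^esub> X)"
    by (simp add: Mn_cm Mn_minus)
  also have "\<dots> \<in> M.sa" using X M.sa_square[of X] by (intro M.sa_minus M.cm_sa) simp
  finally have "?Z\<^sup>\<dagger> = ?Z" "?Z \<in> rm n n" unfolding M.sa_def by simp_all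
  moreover have "qf v ?Z \<in> pos" if "v \<in> rm n 1" for v
    unfolding qf_norm_defect[OF that X] by (rule vsq_bound[OF X e e0 that])
  ultimately have "?Z \<in> mcone n" by (simp add: mcone_def)
  then have "M.bounded_by (real n * e) X" unfolding M.bounded_by_def Z[symmetric] using e0 by simp
  then show ?thesis using M.cn_le X by (simp add: nrm_mat_cstar e_def)
qed

lemma Mn_pre_cstar_alg: "pre_cstar_alg (Mn n)"
proof -
  interpret M: cone_alg "Mn n" "mcone n" by (rule Mn_cone_alg)
  show ?thesis
  proof (intro pre_cstar_alg.intro pre_cstar_alg_axioms.intro)
    show "star_alg (Mn n)" by unfold_locales
    show "cstar_seminorm (Mn n) (carrier (Mn n)) (nrm (Mn n))"
      using M.cn_seminorm by (simp add: nrm_mat_cstar)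
    fix X assume X: "X \<in> carrier (Mn n)" "nrm (Mn n) X = 0"
    have "X $$ (i, j) = \<zero>" if ij: "i < n" "j < n" for i j
    proof -
      have c: "X $$ (i, j) \<in> carrier A" using X ij by (simp add: rm_entry)
      have "nrm A (X $$ (i, j)) \<le> 0" using Mn_entry_le[of X n i j] X ij by simp
      then show ?thesis using norm_nonneg[OF c] norm_eq_zero[OF c] by simp
    qed
    then show "X = \<zero>\<^bsub>Mn n\<^esub>" using X by (simp, intro rm_eqI[of _ n n]) auto
  qed
qed

lemma Mn_cstar_algebra: "cstar_algebra (Mn n)"
proof -
  interpret M: pre_cstar_alg "Mn n" by (rule Mn_pre_cstar_alg)
  show ?thesis
  proof (rule M.cstar_algebraI)
    fix X :: "nat \<Rightarrow> 'u mat"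
    assume "\<And>k. X k \<in> carrier (Mn n)"
      and cau: "\<And>e. e > 0 \<Longrightarrow> \<exists>N. \<forall>k\<ge>N. \<forall>l\<ge>N. nrm (Mn n) (X k \<ominus>\<^bsub>Mn n\<^esub> X l) < e"
    then have X: "X k \<in> rm n n" for k by simp
    have "\<exists>x. tends (\<lambda>k. X k $$ (i, j)) x" if ij: "i < n" "j < n" for i j
    proof (rule complete)
      show "X k $$ (i, j) \<in> carrier A" for k using X ij by (rule rm_entry)
      fix e :: real assume "e > 0"
      then obtain N where N: "\<forall>k\<ge>N. \<forall>l\<ge>N. nrm (Mn n) (X k \<ominus>\<^bsub>Mn n\<^esub> X l) < e" using cau by blast
      have "nrm A (X k $$ (i, j) \<ominus> X l $$ (i, j)) \<le> nrm (Mn n) (X k \<ominus>\<^bsub>Mn n\<^esub> X l)" for k l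
        using Mn_entry_le[of "X k \<ominus>\<^bsub>Mn n\<^esub> X l" n i j] M.minus_closed[of "X k" "X l"] X ij
        by (simp add: Mn_minus_index)
      with N show "\<exists>N. \<forall>k\<ge>N. \<forall>l\<ge>N. nrm A (X k $$ (i, j) \<ominus> X l $$ (i, j)) < e"
        using le_less_trans by blast
    qed
    then obtain L where L: "\<And>i j. \<lbrakk>i < n; j < n\<rbrakk> \<Longrightarrow> tends (\<lambda>k. X k $$ (i, j)) (L i j)" by metis
    let ?L = "mat n n (\<lambda>(i, j). L i j)"
    have Lc: "?L \<in> rm n n" using L tends_carrier(2) by (intro rmI) auto
    have "M.tends X ?L"
    proof (rule M.tendsI_bound)
      fix k
      have "nrm (Mn n) (X k \<ominus>\<^bsub>Mn n\<^esub> ?L) \<le> real n * (\<Sum>i<n. \<Sum>j<n. nrm A ((X k \<ominus>\<^bsub>Mn n\<^esub> ?L) $$ (i, j)))"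
        using M.minus_closed[of "X k" ?L] X Lc by (intro Mn_norm_le) simp
      also have "\<dots> = real n * (\<Sum>i<n. \<Sum>j<n. nrm A (X k $$ (i, j) \<ominus> L i j))"
        using X Lc by (simp add: Mn_minus_index)
      finally show "nrm (Mn n) (X k \<ominus>\<^bsub>Mn n\<^esub> ?L) \<le> real n * (\<Sum>i<n. \<Sum>j<n. nrm A (X k $$ (i, j) \<ominus> L i j))" .
    next
      show "(\<lambda>k. real n * (\<Sum>i<n. \<Sum>j<n. nrm A (X k $$ (i, j) \<ominus> L i j))) \<longlonglongrightarrow> 0"
        using L unfolding tends_def
        by (intro tendsto_mult_right_zero tendsto_null_sum) auto
    qed (use X Lc in auto)
    then show "\<exists>x. M.tends X x" ..
  qed
qed

text \<open>A circle of inclusions: members of the cone are positive in norm by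
  \<open>C_norm_compl\<close>, positive elements of the C*-algebra M_n(A) have the form Y* Y, and
  such matrices lie in the cone by \<open>C_sq\<close>.\<close>

lemma mcone_eq: "mcone n = {Y\<^sup>\<dagger> \<bullet> Y | Y. Y \<in> rm n n}"
proof -
  interpret C: cone_alg "Mn n" "mcone n" by (rule Mn_cone_alg)
  interpret M: cstar_alg "Mn n" by (rule cstar_alg.intro[OF Mn_cstar_algebra])
  have "X \<in> M.pos" if "X \<in> mcone n" for X
    using C.C_norm_compl[OF that] C.C_sa[OF that] M.posI by (auto simp: nrm_mat_cstar)
  moreover have "M.pos = {Y\<^sup>\<dagger> \<bullet> Y | Y. Y \<in> rm n n}"
    using M.pos_iff by auto
  moreover have "Y\<^sup>\<dagger> \<bullet> Y \<in> mcone n" if "Y \<in> rm n n" for Y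
    using C.C_sq[of Y] that by simp
  ultimately show ?thesis by blast
qed

end

text \<open>Structures such as \<open>cstar_opsys A\<close> or \<open>module_of V\<close> are
  different records from their origin, but the axioms only involve fields that are shared. The
  \<open>_cong\<close> lemmas carry the axioms across.\<close>

lemma abelian_group_cong:
  assumes "carrier V = carrier W" "add V = add W" "zero V = zero W" "abelian_group W"
  shows "abelian_group V"
proof -
  interpret W: abelian_group W by fact
  show ?thesis
  proof (rule abelian_groupI)
    fix x assume "x \<in> carrier V"
    then show "\<exists>y\<in>carrier V. y \<oplus>\<^bsub>V\<^esub> x = \<zero>\<^bsub>V\<^esub>"
      using W.l_neg by (auto simp: assms(1-3))
  qed (auto simp: assms(1-3) W.a_ac)
qed

lemma complex_space_cong:
  assumes "carrier V = carrier W" "add V = add W" "zero V = zero W" "module.smult V = module.smult W"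
    and W: "complex_space W"
  shows "complex_space V"
proof -
  interpret W: cspace W by (rule cspace.intro[OF W])
  show ?thesis
    by (rule complex_spaceI[OF abelian_group_cong[OF assms(1-3) W.is_abelian_group]])
      (auto simp: assms(1-4) W.sm_ldistr W.sm_rdistr W.sm_assoc)
qed

lemma star_vector_space_cong:
  assumes "carrier V = carrier W" "add V = add W" "zero V = zero W" "module.smult V = module.smult W"
    "adj V = adj W" and W: "star_vector_space W"
  shows "star_vector_space V"
  using W complex_space_cong[OF assms(1-4)] unfolding star_vector_space_def assms by auto

lemma finsum_cong_struct:
  "\<lbrakk>carrier V = carrier W; add V = add W; zero V = zero W\<rbrakk> \<Longrightarrow> finsum V = finsum W"
  by (intro ext) (simp add: finsum_def finprod_def)

lemma cstar_opsys_simps [simp]: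
  "carrier (cstar_opsys A) = carrier A" "one (cstar_opsys A) = one A" "zero (cstar_opsys A) = zero A"
  "add (cstar_opsys A) = add A" "module.smult (cstar_opsys A) = module.smult A" "adj (cstar_opsys A) = adj A"
  "monoid.mult (cstar_opsys A) = monoid.mult A"
  by (simp_all add: cstar_opsys_def)

lemma cstar_opsys_mat [simp]:
  "mats (cstar_opsys A) = mats A" "mat_zero (cstar_opsys A) = mat_zero A" "mat_unit (cstar_opsys A) = mat_unit A"
  "mat_add (cstar_opsys A) = mat_add A" "mat_smult (cstar_opsys A) = mat_smult A" "mat_adj (cstar_opsys A) = mat_adj A"
  by (simp_all add: fun_eq_iff mats_def mat_zero_def mat_unit_def mat_add_def mat_smult_def mat_adj_def cong: if_cong)

lemma cstar_opsys_compress [simp]: "mat_compress (cstar_opsys A) = mat_compress A"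
  by (simp add: mat_compress_def[abs_def] finsum_cong_struct[of "cstar_opsys A" A])

context cstar_alg
begin

lemma pcone_eq: "pcone (cstar_opsys A) = (\<Union>n. mcone n)"
  by (auto simp: cstar_opsys_def mcone_eq mats_eq)

lemma mcone_rm: "X \<in> mcone n \<Longrightarrow> X \<in> rm n n"
  by (simp add: mcone_def)

lemma pcone_iff: "X \<in> rm n n \<Longrightarrow> X \<in> pcone (cstar_opsys A) \<longleftrightarrow> X \<in> mcone n"
  unfolding pcone_eq using rm_dim mcone_rm by blast

lemma pcone_mats: "pcone (cstar_opsys A) \<inter> mats A n = mcone n"
  unfolding mats_eq using pcone_iff mcone_rm by blast

text \<open>Compression by a scalar matrix is conjugation by the rectangular matrix of scalar
  multiples of the unit, so that \<open>mcone_conj\<close> applies.\<close>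

lemma mcone_compress:
  assumes X: "X \<in> mcone n" and \<alpha>: "\<alpha> \<in> carrier_mat n m"
  shows "mat_compress A \<alpha> X \<in> mcone m"
proof -
  let ?a = "map_mat cm \<alpha>"
  have a: "?a \<in> rm n m" using \<alpha> by (intro rmI) auto
  have X': "X \<in> rm n n" by (rule mcone_rm[OF X])
  note as = mstar_closed[OF a] and Xa = mm_closed[OF X' a]
  have asX: "?a\<^sup>\<dagger> \<bullet> X \<in> rm m n" by (rule mm_closed[OF as X'])
  have fin: "(\<lambda>(k, l). (cnj (\<alpha> $$ (k, i)) * \<alpha> $$ (l, j)) \<odot> X $$ (k, l)) \<in> {..<n} \<times> {..<n} \<rightarrow> carrier A" for i j
    using X' by (auto simp: rm_entry)
  have "mat_compress A \<alpha> X = ?a\<^sup>\<dagger> \<bullet> X \<bullet> ?a"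
  proof (rule rm_eqI[of _ m m])
    show c: "mat_compress A \<alpha> X \<in> rm m m" using \<alpha> X' fin
      by (intro rmI) (auto simp: mat_compress_def rm_dim intro!: finsum_closed)
    show d: "?a\<^sup>\<dagger> \<bullet> X \<bullet> ?a \<in> rm m m" by (rule mm_closed[OF asX a])
    fix i j assume ij: "i < m" "j < m"
    show "mat_compress A \<alpha> X $$ (i, j) = (?a\<^sup>\<dagger> \<bullet> X \<bullet> ?a) $$ (i, j)"
    proof (rule sep)
      fix f assume f: "linfun A f"
      have "f (mat_compress A \<alpha> X $$ (i, j)) = (\<Sum>k<n. \<Sum>l<n. cnj (\<alpha> $$ (k, i)) * \<alpha> $$ (l, j) * f (X $$ (k, l)))"
        using \<alpha> X' fin ij rm_entry[OF X']
        by (simp add: mat_compress_def rm_dim linfun_finsum[OF f] sum.cartesian_product)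
          (auto intro!: sum.cong simp: linfun_sm[OF f])
      also have "\<dots> = (\<Sum>l<n. \<Sum>k<n. \<alpha> $$ (l, j) * (cnj (\<alpha> $$ (k, i)) * f (X $$ (k, l))))"
        by (subst sum.swap) (simp add: mult_ac)
      also have "\<dots> = (\<Sum>l<n. f ((?a\<^sup>\<dagger> \<bullet> X) $$ (i, l) \<otimes> ?a $$ (l, j)))"
      proof (intro sum.cong refl)
        fix l assume l: "l \<in> {..<n}"
        then have "(?a\<^sup>\<dagger> \<bullet> X) $$ (i, l) \<otimes> ?a $$ (l, j) = \<alpha> $$ (l, j) \<odot> (?a\<^sup>\<dagger> \<bullet> X) $$ (i, l)"
          using \<alpha> ij rm_entry[OF asX ij(1), of l] by (simp add: cm_mult_r)
        moreover have "f ((?a\<^sup>\<dagger> \<bullet> X) $$ (i, l)) = (\<Sum>k<n. cnj (\<alpha> $$ (k, i)) * f (X $$ (k, l)))"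
          using \<alpha> ij l rm_entry[OF X'] mstar_index[OF a ij(1)]
          by (simp add: mm_index[OF as X'] linfun_finsum[OF f] cm_star cm_mult_l linfun_sm[OF f])
        ultimately show "(\<Sum>k<n. \<alpha> $$ (l, j) * (cnj (\<alpha> $$ (k, i)) * f (X $$ (k, l)))) = f ((?a\<^sup>\<dagger> \<bullet> X) $$ (i, l) \<otimes> ?a $$ (l, j))"
          using rm_entry[OF asX ij(1), of l] l by (simp add: linfun_sm[OF f] sum_distrib_left)
      qed
      also have "\<dots> = f ((?a\<^sup>\<dagger> \<bullet> X \<bullet> ?a) $$ (i, j))"
        using ij rm_entry[OF asX ij(1)] rm_entry[OF a _ ij(2)]
        by (simp add: mm_index[OF asX a] linfun_finsum[OF f])
      finally show "f (mat_compress A \<alpha> X $$ (i, j)) = f ((?a\<^sup>\<dagger> \<bullet> X \<bullet> ?a) $$ (i, j))" .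
    qed (use rm_entry[OF c ij] rm_entry[OF d ij] in auto)
  qed
  then show ?thesis using mcone_conj[OF X a] by simp
qed

text \<open>At each size the order axioms concern the single algebra \<open>Mn n\<close>, where they
  are facts about \<open>mcone n\<close> and \<open>pos\<close>. Only compression relates two
  sizes.\<close>

lemma operator_system: "operator_system (cstar_opsys A)"
  unfolding operator_system_def
proof
  note sv = star_vector_space_cong[OF _ _ _ _ _ star_vs, of "cstar_opsys A", simplified]
  show "matrix_ordered (cstar_opsys A)"
    unfolding matrix_ordered_def cstar_opsys_mat cstar_opsys_compress pcone_mats
  proof (intro conjI ballI allI impI)
    show "star_vector_space (cstar_opsys A)" by (rule sv)
    fix X assume "X \<in> pcone (cstar_opsys A)"
    then obtain n where X: "X \<in> mcone n" unfolding pcone_eq by blast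
    interpret C: cone_alg "Mn n" "mcone n" by (rule Mn_cone_alg)
    show "X \<in> mats A (dim_row X)" "X\<^sup>\<dagger> = X" using X by (auto simp: mcone_def mats_eq rm_dim)
    show "complex_of_real r \<bullet>\<^sub>s X \<in> pcone (cstar_opsys A)" if "r \<ge> 0" for r
      using C.C_sm[OF X that] unfolding pcone_eq by auto
  next
    fix n X Y assume X: "X \<in> mcone n" "Y \<in> mcone n"
    interpret C: cone_alg "Mn n" "mcone n" by (rule Mn_cone_alg)
    show "X \<boxplus> Y \<in> pcone (cstar_opsys A)" using C.C_add[OF X] unfolding pcone_eq by auto
  next
    fix n X assume X: "X \<in> mcone n" "(-1) \<bullet>\<^sub>s X \<in> pcone (cstar_opsys A)"
    interpret M: cstar_alg "Mn n" by (rule cstar_alg.intro[OF Mn_cstar_algebra])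
    have pos: "M.pos = mcone n" by (rule Set.set_eqI) (subst mcone_eq, auto simp: M.pos_iff)
    have "(-1) \<bullet>\<^sub>s X \<in> mcone n" using X mcone_rm[OF X(1)] by (simp add: pcone_iff[symmetric])
    then have "\<ominus>\<^bsub>Mn n\<^esub> X \<in> M.pos" using M.sm_minus_one[of X] mcone_rm[OF X(1)] pos by simp
    then show "X = mat_zero A n" using M.pos_antisym[of X] X pos by simp
  next
    fix n m X \<alpha> assume "X \<in> mcone n" "(\<alpha> :: complex mat) \<in> carrier_mat n m"
    then show "mat_compress A \<alpha> X \<in> pcone (cstar_opsys A)"
      using mcone_compress unfolding pcone_eq by blast
  qed
  show "archimedean_matrix_order_unit (cstar_opsys A)"
    unfolding archimedean_matrix_order_unit_def cstar_opsys_mat cstar_opsys_simps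
  proof (intro conjI allI ballI impI)
    fix n X assume "X \<in> mats A n" "X\<^sup>\<dagger> = X"
    then have X: "X \<in> rm n n" "X\<^sup>\<dagger> = X" by (auto simp: mats_eq)
    interpret C: cone_alg "Mn n" "mcone n" by (rule Mn_cone_alg)
    have Xs: "X \<in> C.sa" using X by (intro C.saI) auto
    have n0: "C.cn X + 1 > 0" using C.cn_nonneg[of X] X by simp
    then have "C.cm (complex_of_real (C.cn X + 1)) \<ominus>\<^bsub>Mn n\<^esub> X \<in> mcone n"
      using Xs X by (intro C.bounded_by_sa C.cn_less) auto
    then have "complex_of_real (C.cn X + 1) \<bullet>\<^sub>s mat_unit A n \<boxplus> (-1) \<bullet>\<^sub>s X \<in> pcone (cstar_opsys A)"
      using X unfolding pcone_eq by (auto simp: Mn_cm Mn_minus)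
    then show "\<exists>r>0. complex_of_real r \<bullet>\<^sub>s mat_unit A n \<boxplus> (-1) \<bullet>\<^sub>s X \<in> pcone (cstar_opsys A)"
      using n0 by blast
    assume a: "\<forall>r>0. complex_of_real r \<bullet>\<^sub>s mat_unit A n \<boxplus> X \<in> pcone (cstar_opsys A)"
    have "X \<in> mcone n"
    proof (rule C.C_arch[OF Xs])
      fix e :: real assume "e > 0"
      then have "complex_of_real e \<bullet>\<^sub>s mat_unit A n \<boxplus> X \<in> mcone n"
        using a X by (simp add: pcone_iff[symmetric])
      moreover have "complex_of_real e \<bullet>\<^sub>s mat_unit A n \<boxplus> X = X \<boxplus> complex_of_real e \<bullet>\<^sub>s mat_unit A n"
        using C.a_comm[of X "complex_of_real e \<bullet>\<^sub>s mat_unit A n"] X by simp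
      ultimately show "X \<oplus>\<^bsub>Mn n\<^esub> C.cm (complex_of_real e) \<in> mcone n" by (simp add: Mn_cm)
    qed
    then show "X \<in> pcone (cstar_opsys A)" unfolding pcone_eq by blast
  qed auto
qed

end

section \<open>Operator systems\<close>

lemma clinear_closed: "\<lbrakk>clinear V W f; x \<in> carrier V\<rbrakk> \<Longrightarrow> f x \<in> carrier W"
  and clinear_add: "\<lbrakk>clinear V W f; x \<in> carrier V; y \<in> carrier V\<rbrakk> \<Longrightarrow> f (x \<oplus>\<^bsub>V\<^esub> y) = f x \<oplus>\<^bsub>W\<^esub> f y"
  and clinear_sm: "\<lbrakk>clinear V W f; x \<in> carrier V\<rbrakk> \<Longrightarrow> f (c \<odot>\<^bsub>V\<^esub> x) = c \<odot>\<^bsub>W\<^esub> f x"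
  by (auto simp: clinear_def)

lemma clinear_zero:
  assumes "complex_space V" "complex_space W" "clinear V W f" shows "f \<zero>\<^bsub>V\<^esub> = \<zero>\<^bsub>W\<^esub>"
proof -
  interpret V: cspace V by (rule cspace.intro) fact
  interpret W: cspace W by (rule cspace.intro) fact
  show ?thesis using clinear_sm[OF assms(3), of "\<zero>\<^bsub>V\<^esub>" 0] clinear_closed[OF assms(3) V.zero_closed] by simp
qed

lemma clinear_minus:
  assumes "complex_space V" "complex_space W" "clinear V W f" "x \<in> carrier V" "y \<in> carrier V"
  shows "f (x \<ominus>\<^bsub>V\<^esub> y) = f x \<ominus>\<^bsub>W\<^esub> f y"
proof -
  interpret V: cspace V by (rule cspace.intro) fact
  interpret W: cspace W by (rule cspace.intro) fact
  have "x \<ominus>\<^bsub>V\<^esub> y = x \<oplus>\<^bsub>V\<^esub> (-1) \<odot>\<^bsub>V\<^esub> y" using assms by (simp add: V.minus_eq V.sm_minus_one)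
  then show ?thesis
    using assms clinear_closed[OF assms(3)] by (simp add: clinear_add clinear_sm W.minus_eq W.sm_minus_one)
qed

lemma clinear_finsum:
  assumes "complex_space V" "complex_space W" "clinear V W f" "finite I" "g \<in> I \<rightarrow> carrier V"
  shows "f (finsum V g I) = finsum W (\<lambda>i. f (g i)) I"
proof -
  interpret V: cspace V by (rule cspace.intro) fact
  interpret W: cspace W by (rule cspace.intro) fact
  show ?thesis using assms(4,5)
  proof (induction I rule: finite_induct)
    case empty
    then show ?case using clinear_zero assms by simp
  next
    case (insert i I)
    then have g: "g \<in> I \<rightarrow> carrier V" "g i \<in> carrier V" by auto
    then have "(\<lambda>i. f (g i)) \<in> I \<rightarrow> carrier W" "f (g i) \<in> carrier W"
      using clinear_closed[OF assms(3)] by auto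
    with insert g show ?case
      by (simp add: V.finsum_insert W.finsum_insert clinear_add[OF assms(3)] V.finsum_closed)
  qed
qed

lemma clinear_comp: "\<lbrakk>clinear U V f; clinear V W g\<rbrakk> \<Longrightarrow> clinear U W (g \<circ> f)"
  by (auto simp: clinear_def Pi_iff)

lemma map_mat_comp: "map_mat g (map_mat f X) = map_mat (g \<circ> f) X"
  by (rule eq_matI) auto

lemma completely_positive_comp:
  "\<lbrakk>completely_positive S R f; completely_positive R Q g\<rbrakk> \<Longrightarrow> completely_positive S Q (g \<circ> f)"
  unfolding completely_positive_def using clinear_comp by (metis map_mat_comp)

lemma ucp_comp: "\<lbrakk>ucp S R f; ucp R Q g\<rbrakk> \<Longrightarrow> ucp S Q (g \<circ> f)"
  unfolding ucp_def using completely_positive_comp by fastforce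

lemma ucp_clinear: "ucp S R f \<Longrightarrow> clinear S R f"
  by (simp add: ucp_def completely_positive_def)

lemma ucp_one: "ucp S R f \<Longrightarrow> f \<one>\<^bsub>S\<^esub> = \<one>\<^bsub>R\<^esub>"
  by (simp add: ucp_def)

lemma ucp_pcone: "\<lbrakk>ucp S R f; X \<in> pcone S\<rbrakk> \<Longrightarrow> map_mat f X \<in> pcone R"
  by (simp add: ucp_def completely_positive_def)

locale opsys =
  fixes A :: "'u opsys" (structure)
  assumes operator_system: "operator_system A"

sublocale opsys \<subseteq> star_space A
  using operator_system by (intro star_space.intro) (simp add: operator_system_def matrix_ordered_def)

context opsys
begin

abbreviation unitm :: "nat \<Rightarrow> 'u mat" where "unitm \<equiv> mat_unit A"

lemma mo: "matrix_ordered A" and au: "archimedean_matrix_order_unit A"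
  using operator_system by (simp_all add: operator_system_def)

lemma one_in [simp]: "\<one> \<in> carrier A" and one_star [simp]: "\<one>\<^sup>\<star> = \<one>"
  using au by (simp_all add: archimedean_matrix_order_unit_def)

lemma unitm_closed [simp]: "unitm n \<in> rm n n"
  by (rule rmI) (auto simp: mat_unit_def)

lemma unitm_index: "\<lbrakk>i < n; j < n\<rbrakk> \<Longrightarrow> unitm n $$ (i, j) = (if i = j then \<one> else \<zero>)"
  by (simp add: mat_unit_def)

lemma pc_rm: "X \<in> pcone A \<Longrightarrow> X \<in> rm (dim_row X) (dim_row X)"
  using mo by (simp add: matrix_ordered_def mats_eq)

lemma pc_star: "X \<in> pcone A \<Longrightarrow> X\<^sup>\<dagger> = X"
  using mo by (simp add: matrix_ordered_def)

lemma pc_add: "\<lbrakk>X \<in> pcone A; Y \<in> pcone A; X \<in> rm n n; Y \<in> rm n n\<rbrakk> \<Longrightarrow> X \<boxplus> Y \<in> pcone A"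
  using mo unfolding matrix_ordered_def mats_eq by blast

lemma pc_sm: "\<lbrakk>X \<in> pcone A; r \<ge> 0\<rbrakk> \<Longrightarrow> complex_of_real r \<bullet>\<^sub>s X \<in> pcone A"
  using mo unfolding matrix_ordered_def by blast

lemma pc_antisym: "\<lbrakk>X \<in> pcone A; (-1) \<bullet>\<^sub>s X \<in> pcone A; X \<in> rm n n\<rbrakk> \<Longrightarrow> X = mat_zero A n"
  using mo unfolding matrix_ordered_def mats_eq by blast

lemma pc_compress: "\<lbrakk>X \<in> pcone A; X \<in> rm n n; \<alpha> \<in> carrier_mat n m\<rbrakk> \<Longrightarrow> mat_compress A \<alpha> X \<in> pcone A"
  using mo unfolding matrix_ordered_def mats_eq by blast

lemma pc_order_unit:
  "\<lbrakk>X \<in> rm n n; X\<^sup>\<dagger> = X\<rbrakk> \<Longrightarrow> \<exists>r>0. complex_of_real r \<bullet>\<^sub>s unitm n \<boxplus> (-1) \<bullet>\<^sub>s X \<in> pcone A"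
  using au unfolding archimedean_matrix_order_unit_def mats_eq by blast

lemma pc_archimedean:
  "\<lbrakk>X \<in> rm n n; X\<^sup>\<dagger> = X; \<And>r. r > 0 \<Longrightarrow> complex_of_real r \<bullet>\<^sub>s unitm n \<boxplus> X \<in> pcone A\<rbrakk> \<Longrightarrow> X \<in> pcone A"
  using au unfolding archimedean_matrix_order_unit_def mats_eq by blast

text \<open>Positivity of the unit is hidden in the order unit axiom: take the zero matrix there and
  rescale.\<close>

lemma unit_pc: "r \<ge> 0 \<Longrightarrow> complex_of_real r \<bullet>\<^sub>s unitm n \<in> pcone A"
proof -
  assume r: "r \<ge> 0"
  have z: "(mat_zero A n)\<^sup>\<dagger> = mat_zero A n"
    by (rule rm_eqI[of _ n n]) (auto simp: mstar_index[of _ n n])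
  obtain s where s: "s > 0" "complex_of_real s \<bullet>\<^sub>s unitm n \<boxplus> (-1) \<bullet>\<^sub>s mat_zero A n \<in> pcone A"
    using pc_order_unit[OF mat_zero_closed z] by blast
  have "complex_of_real s \<bullet>\<^sub>s unitm n \<boxplus> (-1) \<bullet>\<^sub>s mat_zero A n = complex_of_real s \<bullet>\<^sub>s unitm n"
    by (rule rm_eqI[of _ n n]) (auto simp: mplus_index[of _ n n] msm_index[of _ n n] unitm_index)
  with s(2) have "complex_of_real s \<bullet>\<^sub>s unitm n \<in> pcone A" by simp
  then have "complex_of_real (r / s) \<bullet>\<^sub>s (complex_of_real s \<bullet>\<^sub>s unitm n) \<in> pcone A"
    by (rule pc_sm) (use r s(1) in simp)
  moreover have "complex_of_real (r / s) \<bullet>\<^sub>s (complex_of_real s \<bullet>\<^sub>s unitm n) = complex_of_real r \<bullet>\<^sub>s unitm n"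
    using s(1) by (intro rm_eqI[of _ n n])
      (auto simp: mplus_index[of _ n n] msm_index[of _ n n] unitm_index simp flip: sm_assoc)
  ultimately show ?thesis by simp
qed

lemma map_mat_rm:
  assumes "star_vector_space R" "clinear A R f" "X \<in> rm n m"
  shows "map_mat f X \<in> star_space.rm R n m"
proof -
  interpret R: star_space R by (rule star_space.intro) fact
  show ?thesis using rm_dim[OF assms(3)] rm_entry[OF assms(3)] clinear_closed[OF assms(2)]
    by (intro R.rmI) auto
qed

lemma sa_mat1:
  assumes "x \<in> sa"
  shows "mat 1 1 (\<lambda>_. x) \<in> rm 1 1" "(mat 1 1 (\<lambda>_. x))\<^sup>\<dagger> = mat 1 1 (\<lambda>_. x)"
  using assms sa_star by (auto intro!: rmI rm_eqI[of _ 1 1] simp: mat_adj_def)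

lemma sa_bound:
  assumes "x \<in> sa"
  shows "\<exists>r>0. mat 1 1 (\<lambda>_. complex_of_real r \<odot> \<one> \<ominus> x) \<in> pcone A"
proof -
  obtain r where r: "r > 0" "complex_of_real r \<bullet>\<^sub>s unitm 1 \<boxplus> (-1) \<bullet>\<^sub>s mat 1 1 (\<lambda>_. x) \<in> pcone A"
    using pc_order_unit[OF sa_mat1[OF assms]] by blast
  moreover have "complex_of_real r \<bullet>\<^sub>s unitm 1 \<boxplus> (-1) \<bullet>\<^sub>s mat 1 1 (\<lambda>_. x) = mat 1 1 (\<lambda>_. complex_of_real r \<odot> \<one> \<ominus> x)"
    using assms by (intro eq_matI) (auto simp: mat_add_def mat_smult_def mat_unit_def sm_minus_one minus_eq)
  ultimately show ?thesis by auto
qed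

lemma pc_mat1_sa:
  assumes "mat 1 1 (\<lambda>_. x) \<in> pcone A"
  shows "x \<in> sa"
proof -
  have "mat 1 1 (\<lambda>_. x) \<in> rm 1 1" "(mat 1 1 (\<lambda>_. x))\<^sup>\<dagger> = mat 1 1 (\<lambda>_. x)"
    using pc_rm[OF assms] pc_star[OF assms] by simp_all
  then have "x \<in> carrier A" "(mat 1 1 (\<lambda>_. x))\<^sup>\<dagger> $$ (0, 0) = mat 1 1 (\<lambda>_. x) $$ (0, 0)"
    using rm_entry[of "mat 1 1 (\<lambda>_. x)" 1 1 0 0] by simp_all
  then show ?thesis by (auto intro!: saI simp: mat_adj_def)
qed

end

text \<open>For self-adjoint x some r - x is positive, so its image r - f x is positive and in
  particular self-adjoint. The general case follows by splitting into real and imaginary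
  parts.\<close>

lemma ucp_star:
  assumes S: "operator_system S" and R: "operator_system R" and f: "ucp S R f" and x: "x \<in> carrier S"
  shows "f (adj S x) = adj R (f x)"
proof -
  interpret S: opsys S by (rule opsys.intro) fact
  interpret R: opsys R by (rule opsys.intro) fact
  note lin = ucp_clinear[OF f]
  note fc = clinear_closed[OF lin]
  have sa: "f x \<in> R.sa" if xs: "x \<in> S.sa" for x
  proof -
    obtain r where "r > 0" and r: "mat 1 1 (\<lambda>_. complex_of_real r \<odot>\<^bsub>S\<^esub> \<one>\<^bsub>S\<^esub> \<ominus>\<^bsub>S\<^esub> x) \<in> pcone S"
      using S.sa_bound[OF xs] by blast
    have "map_mat f (mat 1 1 (\<lambda>_. complex_of_real r \<odot>\<^bsub>S\<^esub> \<one>\<^bsub>S\<^esub> \<ominus>\<^bsub>S\<^esub> x)) \<in> pcone R"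
      using ucp_pcone[OF f r] .
    moreover have "map_mat f (mat 1 1 (\<lambda>_. complex_of_real r \<odot>\<^bsub>S\<^esub> \<one>\<^bsub>S\<^esub> \<ominus>\<^bsub>S\<^esub> x)) =
      mat 1 1 (\<lambda>_. complex_of_real r \<odot>\<^bsub>R\<^esub> \<one>\<^bsub>R\<^esub> \<ominus>\<^bsub>R\<^esub> f x)"
      using xs by (intro eq_matI)
        (auto simp: clinear_minus[OF S.complex_space R.complex_space lin] clinear_sm[OF lin] ucp_one[OF f])
    ultimately have "complex_of_real r \<odot>\<^bsub>R\<^esub> \<one>\<^bsub>R\<^esub> \<ominus>\<^bsub>R\<^esub> f x \<in> R.sa"
      using R.pc_mat1_sa by simp
    moreover have "complex_of_real r \<odot>\<^bsub>R\<^esub> \<one>\<^bsub>R\<^esub> \<in> R.sa" by (rule R.sa_sm) (auto intro: R.saI)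
    ultimately have *: "complex_of_real r \<odot>\<^bsub>R\<^esub> \<one>\<^bsub>R\<^esub> \<ominus>\<^bsub>R\<^esub> (complex_of_real r \<odot>\<^bsub>R\<^esub> \<one>\<^bsub>R\<^esub> \<ominus>\<^bsub>R\<^esub> f x) \<in> R.sa"
      by (rule R.sa_minus[rotated])
    have "complex_of_real r \<odot>\<^bsub>R\<^esub> \<one>\<^bsub>R\<^esub> \<ominus>\<^bsub>R\<^esub> (complex_of_real r \<odot>\<^bsub>R\<^esub> \<one>\<^bsub>R\<^esub> \<ominus>\<^bsub>R\<^esub> f x) = f x"
      using fc xs by (intro R.sep) (auto simp: R.linfun_simps)
    with * show ?thesis by (simp only:)
  qed
  obtain a b where ab: "a \<in> S.sa" "b \<in> S.sa" "x = a \<oplus>\<^bsub>S\<^esub> \<i> \<odot>\<^bsub>S\<^esub> b" "adj S x = a \<ominus>\<^bsub>S\<^esub> \<i> \<odot>\<^bsub>S\<^esub> b"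
    using S.sa_parts[OF x] by metis
  have c: "a \<in> carrier S" "b \<in> carrier S" using ab by auto
  have "f (adj S x) = f a \<ominus>\<^bsub>R\<^esub> \<i> \<odot>\<^bsub>R\<^esub> f b"
    unfolding ab(4) using c by (simp add: clinear_minus[OF S.complex_space R.complex_space lin] clinear_sm[OF lin])
  also have "\<dots> = adj R (f a \<oplus>\<^bsub>R\<^esub> \<i> \<odot>\<^bsub>R\<^esub> f b)"
    using sa[OF ab(1)] sa[OF ab(2)] c fc
    by (intro R.sep) (auto simp: R.star_lin_simps R.linfun_simps R.sa_star)
  also have "f a \<oplus>\<^bsub>R\<^esub> \<i> \<odot>\<^bsub>R\<^esub> f b = f x"
    unfolding ab(3) using c by (simp add: clinear_add[OF lin] clinear_sm[OF lin])
  finally show ?thesis .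
qed

lemma map_mat_mstar:
  assumes "operator_system S" "operator_system R" "ucp S R f" "X \<in> star_space.rm S n m"
  shows "map_mat f (mat_adj S X) = mat_adj R (map_mat f X)"
proof -
  interpret S: opsys S by (rule opsys.intro) fact
  show ?thesis using ucp_star[OF assms(1-3)] S.rm_dim[OF assms(4)] S.rm_entry[OF assms(4)]
    by (intro eq_matI) (auto simp: mat_adj_def)
qed

lemma map_mat_plus:
  assumes "star_vector_space S" "clinear S R f" "X \<in> star_space.rm S n m" "Y \<in> star_space.rm S n m"
  shows "map_mat f (mat_add S X Y) = mat_add R (map_mat f X) (map_mat f Y)"
proof -
  interpret S: star_space S by (rule star_space.intro) fact
  show ?thesis using S.rm_dim[OF assms(3)] S.rm_dim[OF assms(4)] S.rm_entry[OF assms(3)] S.rm_entry[OF assms(4)]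
    by (intro eq_matI) (auto simp: mat_add_def clinear_add[OF assms(2)])
qed

lemma map_mat_sm:
  assumes "star_vector_space S" "clinear S R f" "X \<in> star_space.rm S n m"
  shows "map_mat f (mat_smult S c X) = mat_smult R c (map_mat f X)"
proof -
  interpret S: star_space S by (rule star_space.intro) fact
  show ?thesis using S.rm_dim[OF assms(3)] S.rm_entry[OF assms(3)]
    by (intro eq_matI) (auto simp: mat_smult_def clinear_sm[OF assms(2)])
qed

lemma map_mat_unit:
  assumes "star_vector_space S" "star_vector_space R" "clinear S R f" "f \<one>\<^bsub>S\<^esub> = \<one>\<^bsub>R\<^esub>"
  shows "map_mat f (mat_unit S n) = mat_unit R n"
proof -
  interpret S: star_space S by (rule star_space.intro) fact
  interpret R: star_space R by (rule star_space.intro) fact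
  show ?thesis using assms(4) clinear_zero[OF S.complex_space R.complex_space assms(3)]
    by (intro eq_matI) (auto simp: mat_unit_def)
qed

section \<open>Unital complete isometries are completely positive\<close>

context opsys
begin

definition blk :: "real \<Rightarrow> 'u mat \<Rightarrow> 'u mat" where
  "blk r X = four_block_mat (complex_of_real r \<bullet>\<^sub>s unitm (dim_row X)) X (X\<^sup>\<dagger>) (complex_of_real r \<bullet>\<^sub>s unitm (dim_row X))"

lemma opsys_norm_eq: "opsys_norm A X = Inf {r. r \<ge> 0 \<and> blk r X \<in> pcone A}"
  by (simp add: opsys_norm_def blk_def)

lemma blk_index:
  assumes "X \<in> rm n n" "i < n + n" "j < n + n"
  shows "blk r X $$ (i, j) = (if i < n then if j < n then (if i = j then complex_of_real r \<odot> \<one> else \<zero>) else X $$ (i, j - n)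
     else if j < n then (X $$ (j, i - n))\<^sup>\<star> else (if i = j then complex_of_real r \<odot> \<one> else \<zero>))"
  using assms rm_dim[OF assms(1)] rm_dim[OF mstar_closed[OF assms(1)]] rm_dim[OF msm_closed[OF unitm_closed]]
    mstar_index[OF assms(1)]
  unfolding blk_def by (auto simp: msm_index[OF unitm_closed] unitm_index)

lemma blk_rm: "X \<in> rm n n \<Longrightarrow> blk r X \<in> rm (n + n) (n + n)"
proof (rule rmI)
  assume X: "X \<in> rm n n"
  show "dim_row (blk r X) = n + n" "dim_col (blk r X) = n + n"
    using rm_dim[OF X] rm_dim[OF msm_closed[OF unitm_closed]] unfolding blk_def by auto
  show "blk r X $$ (i, j) \<in> carrier A" if "i < n + n" "j < n + n" for i j
    unfolding blk_index[OF X that] using that by (auto simp: rm_entry[OF X])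
qed

lemma blk_star: "X \<in> rm n n \<Longrightarrow> (blk r X)\<^sup>\<dagger> = blk r X"
  by (rule rm_eqI[of _ "n + n" "n + n"])
    (auto simp: mstar_index[OF blk_rm] blk_index blk_rm rm_entry star_sm)

lemma blk_mono:
  assumes "blk r X \<in> pcone A" "r \<le> s" "X \<in> rm n n" shows "blk s X \<in> pcone A"
proof -
  have "blk s X = blk r X \<boxplus> complex_of_real (s - r) \<bullet>\<^sub>s unitm (n + n)"
    using assms(3) by (intro rm_eqI[of _ "n + n" "n + n"])
      (auto simp: mplus_index[OF blk_rm] blk_index blk_rm msm_index[OF unitm_closed] unitm_index rm_entry simp flip: sm_ldistr)
  also have "\<dots> \<in> pcone A"
    using assms by (intro pc_add[of _ _ "n + n"] unit_pc blk_rm) auto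
  finally show ?thesis .
qed

text \<open>Without this the infimum in \<open>opsys_norm\<close> could be over an empty set. The
  order unit of doubled size is applied to minus the off-diagonal matrix
  \<open>blk 0 X\<close>.\<close>

lemma ex_blk:
  assumes X: "X \<in> rm n n" shows "\<exists>r\<ge>0. blk r X \<in> pcone A"
proof -
  let ?Z = "(-1) \<bullet>\<^sub>s blk 0 X"
  have Z: "?Z \<in> rm (n + n) (n + n)" "?Z\<^sup>\<dagger> = ?Z"
    using blk_rm[OF X] blk_star[OF X] by (auto simp: mstar_sm[OF blk_rm[OF X]])
  obtain r where r: "r > 0" "complex_of_real r \<bullet>\<^sub>s unitm (n + n) \<boxplus> (-1) \<bullet>\<^sub>s ?Z \<in> pcone A"
    using pc_order_unit[OF Z] by blast
  have "complex_of_real r \<bullet>\<^sub>s unitm (n + n) \<boxplus> (-1) \<bullet>\<^sub>s ?Z = blk r X"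
    using X Z(1) by (intro rm_eqI[of _ "n + n" "n + n"])
      (auto simp: mplus_index[of _ "n + n" "n + n"] msm_index[of _ "n + n" "n + n"] blk_index blk_rm unitm_index rm_entry
        simp flip: sm_assoc)
  with r show ?thesis by (intro exI[of _ r]) auto
qed

lemma opsys_norm_le: "\<lbrakk>blk r X \<in> pcone A; r \<ge> 0\<rbrakk> \<Longrightarrow> opsys_norm A X \<le> r"
  unfolding opsys_norm_eq by (intro cInf_lower bdd_belowI[of _ 0]) auto

lemma blk_of_norm_less:
  assumes "opsys_norm A X < r" "X \<in> rm n n" shows "blk r X \<in> pcone A"
proof -
  have "{r. r \<ge> 0 \<and> blk r X \<in> pcone A} \<noteq> {}" using ex_blk[OF assms(2)] by auto
  moreover have "bdd_below {r. r \<ge> 0 \<and> blk r X \<in> pcone A}" by (rule bdd_belowI[of _ 0]) auto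
  ultimately obtain s where "blk s X \<in> pcone A" "s < r"
    using assms(1) cInf_less_iff unfolding opsys_norm_eq by (metis (no_types, lifting) mem_Collect_eq)
  then show ?thesis using blk_mono assms(2) by simp
qed

lemma compress_index:
  assumes "X \<in> rm n n" "\<alpha> \<in> carrier_mat n m" "i < m" "j < m" "linfun A f"
  shows "f (mat_compress A \<alpha> X $$ (i, j)) = (\<Sum>k<n. \<Sum>l<n. cnj (\<alpha> $$ (k, i)) * \<alpha> $$ (l, j) * f (X $$ (k, l)))"
proof -
  have fin: "(\<lambda>(k, l). (cnj (\<alpha> $$ (k, i)) * \<alpha> $$ (l, j)) \<odot> X $$ (k, l)) \<in> {..<n} \<times> {..<n} \<rightarrow> carrier A"
    using assms(1) by (auto simp: rm_entry)
  show ?thesis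
    using assms fin rm_entry[OF assms(1)]
    by (simp add: mat_compress_def rm_dim linfun_finsum sum.cartesian_product)
      (auto intro!: sum.cong simp: linfun_sm)
qed

lemma compress_closed:
  assumes "X \<in> rm n n" "\<alpha> \<in> carrier_mat n m" shows "mat_compress A \<alpha> X \<in> rm m m"
proof (rule rmI)
  show "dim_row (mat_compress A \<alpha> X) = m" "dim_col (mat_compress A \<alpha> X) = m"
    using assms by (auto simp: mat_compress_def)
  show "mat_compress A \<alpha> X $$ (i, j) \<in> carrier A" if "i < m" "j < m" for i j
    using assms that by (auto simp: mat_compress_def rm_dim rm_entry intro!: finsum_closed)
qed

lemma sum_delta_pair:
  fixes g :: "nat \<Rightarrow> complex"
  assumes "i < n"
  shows "(\<Sum>k<n + n. (if k = i then a else if k = n + i then b else 0) * g k) = a * g i + b * g (n + i)"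
proof -
  have "(\<Sum>k<n + n. (if k = i then a else if k = n + i then b else 0) * g k) =
    (\<Sum>k\<in>{i, n + i}. (if k = i then a else if k = n + i then b else 0) * g k)"
    using assms by (intro sum.mono_neutral_right) auto
  then show ?thesis using assms by simp
qed

text \<open>Compression by the column with blocks 1 and w. This is the numerical range side of a
  norm bound: norm at most r puts the real part of w X above -r for every unimodular w.\<close>

lemma blk_compress:
  assumes X: "X \<in> rm n n" and B: "blk r X \<in> pcone A" and w: "cmod w = 1"
  shows "complex_of_real (2 * r) \<bullet>\<^sub>s unitm n \<boxplus> (w \<bullet>\<^sub>s X \<boxplus> cnj w \<bullet>\<^sub>s X\<^sup>\<dagger>) \<in> pcone A"
proof -
  define \<alpha> where "\<alpha> = mat (n + n) n (\<lambda>(k, i). if k = i then 1 else if k = n + i then w else 0)"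
  have \<alpha>: "\<alpha> \<in> carrier_mat (n + n) n" by (simp add: \<alpha>_def)
  have \<alpha>i: "\<alpha> $$ (k, i) = (if k = i then 1 else if k = n + i then w else 0)"
      "cnj (\<alpha> $$ (k, i)) = (if k = i then 1 else if k = n + i then cnj w else 0)" if "k < n + n" "i < n" for k i
    using that by (auto simp: \<alpha>_def)
  have ww: "cnj w * w = 1" using w complex_norm_square[of w] by (simp add: mult.commute)
  have Xs: "X\<^sup>\<dagger> \<in> rm n n" using X by simp
  have "mat_compress A \<alpha> (blk r X) = complex_of_real (2 * r) \<bullet>\<^sub>s unitm n \<boxplus> (w \<bullet>\<^sub>s X \<boxplus> cnj w \<bullet>\<^sub>s X\<^sup>\<dagger>)" (is "?l = ?r")
  proof (rule rm_eqI[of _ n n])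
    show c: "?l \<in> rm n n" "?r \<in> rm n n" using compress_closed[OF blk_rm[OF X] \<alpha>] X by auto
    fix i j assume ij: "i < n" "j < n"
    show "?l $$ (i, j) = ?r $$ (i, j)"
    proof (rule sep)
      fix f assume f: "linfun A f"
      let ?B = "\<lambda>k l. f (blk r X $$ (k, l))"
      have "f (?l $$ (i, j)) = (\<Sum>k<n + n. (if k = i then 1 else if k = n + i then cnj w else 0) *
          (\<Sum>l<n + n. (if l = j then 1 else if l = n + j then w else 0) * ?B k l))"
        unfolding compress_index[OF blk_rm[OF X] \<alpha> ij f]
        by (intro sum.cong refl) (simp add: \<alpha>i ij sum_distrib_left mult.assoc)
      also have "\<dots> = ?B i j + w * ?B i (n + j) + cnj w * (?B (n + i) j + w * ?B (n + i) (n + j))"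
        unfolding sum_delta_pair[OF ij(2)] sum_delta_pair[OF ij(1)] by simp
      also have "\<dots> = f (?r $$ (i, j))"
        using ij f X Xs rm_entry[OF X ij] rm_entry[OF X ij(2,1)] ww
        by (simp add: blk_index[OF X] mplus_index[of _ n n] msm_index[of _ n n] mstar_index[of _ n n] unitm_index
            linfun_simps algebra_simps)
          (simp flip: mult.assoc)?
      finally show "f (?l $$ (i, j)) = f (?r $$ (i, j))" .
    qed (use rm_entry[OF c(1) ij] rm_entry[OF c(2) ij] in auto)
  qed
  then show ?thesis using pc_compress[OF B blk_rm[OF X] \<alpha>] by simp
qed

text \<open>If \<open>0 \<le> X \<le> c\<close>, then \<open>X\<close> lies in every disc whose boundary contains \<open>0\<close> and \<open>c\<close>:
  the block matrix is affine in \<open>X\<close>, and of rank one at \<open>X = 0\<close> and at \<open>X = c\<close>.\<close>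

lemma blk_disc:
  fixes t :: real
  assumes X: "X \<in> pcone A" "X \<in> rm n n" and cX: "complex_of_real c \<bullet>\<^sub>s unitm n \<boxplus> (-1) \<bullet>\<^sub>s X \<in> pcone A" and c: "c > 0"
  defines "\<mu> \<equiv> Complex (c / 2) t"
  shows "blk (cmod \<mu>) (X \<boxplus> (- \<mu>) \<bullet>\<^sub>s unitm n) \<in> pcone A"
proof -
  let ?R = "cmod \<mu>" and ?s = "complex_of_real (sqrt (cmod \<mu>))"
  have "\<mu> \<noteq> 0" using c by (simp add: \<mu>_def complex_eq_iff)
  then have R: "?R > 0" by simp
  have ss: "?s * ?s = complex_of_real ?R" using R by (simp flip: of_real_mult)
  have s0: "?s \<noteq> 0" using R by simp
  have mm1: "\<mu> * cnj \<mu> = complex_of_real ?R * complex_of_real ?R"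
    using complex_norm_square[of \<mu>] by (simp add: power2_eq_square)
  have "cmod (complex_of_real c - \<mu>) = ?R" using c by (simp add: \<mu>_def cmod_def power2_eq_square)
  then have mm2: "(complex_of_real c - \<mu>) * cnj (complex_of_real c - \<mu>) = complex_of_real ?R * complex_of_real ?R"
    using complex_norm_square[of "complex_of_real c - \<mu>"] by (simp add: power2_eq_square)
  \<comment> \<open>The row with blocks s and b produces a rank-one block matrix with corner s^2 =
    |\<mu>|. Below, b0 and b1 are fixed by s b0 = -\<mu> and s b1 = c - \<mu>; both have modulus s
    because 0 and c lie on the circle around \<mu>.\<close>
  define co where "co b j = (if j < n then ?s else b)" for b :: complex and j
  define ix where "ix j = (if j < n then j else j - n)" for j
  define \<alpha> where "\<alpha> b = mat n (n + n) (\<lambda>(k, j). if k = ix j then co b j else 0)" for b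
  have \<alpha>: "\<alpha> b \<in> carrier_mat n (n + n)" for b by (simp add: \<alpha>_def)
  have ixn: "ix j < n" if "j < n + n" for j using that by (auto simp: ix_def)
  have compr: "f (mat_compress A (\<alpha> b) Z $$ (i, j)) = cnj (co b i) * co b j * f (Z $$ (ix i, ix j))"
    if Z: "Z \<in> rm n n" and ij: "i < n + n" "j < n + n" and f: "linfun A f" for Z b i j f
  proof -
    have "f (mat_compress A (\<alpha> b) Z $$ (i, j)) =
      (\<Sum>k<n. \<Sum>l<n. cnj (if k = ix i then co b i else 0) * (if l = ix j then co b j else 0) * f (Z $$ (k, l)))"
      unfolding compress_index[OF Z \<alpha> ij f] using ij by (simp add: \<alpha>_def)
    also have "\<dots> = (\<Sum>k<n. if k = ix i then cnj (co b i) * co b j * f (Z $$ (k, ix j)) else 0)"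
    proof (intro sum.cong refl)
      fix k assume "k \<in> {..<n}"
      have "(\<Sum>l<n. cnj (if k = ix i then co b i else 0) * (if l = ix j then co b j else 0) * f (Z $$ (k, l))) =
        (\<Sum>l<n. if l = ix j then cnj (if k = ix i then co b i else 0) * co b j * f (Z $$ (k, l)) else 0)"
        by (intro sum.cong) auto
      also have "\<dots> = (if k = ix i then cnj (co b i) * co b j * f (Z $$ (k, ix j)) else 0)"
        using ixn[OF ij(2)] by simp
      finally show "(\<Sum>l<n. cnj (if k = ix i then co b i else 0) * (if l = ix j then co b j else 0) * f (Z $$ (k, l))) =
        (if k = ix i then cnj (co b i) * co b j * f (Z $$ (k, ix j)) else 0)" .
    qed
    also have "\<dots> = cnj (co b i) * co b j * f (Z $$ (ix i, ix j))"
      using ixn[OF ij(1)] by simp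
    finally show ?thesis .
  qed
  let ?Y = "complex_of_real c \<bullet>\<^sub>s unitm n \<boxplus> (-1) \<bullet>\<^sub>s X"
  have Y: "?Y \<in> rm n n" using X by auto
  define b0 where "b0 = - \<mu> / ?s"
  define b1 where "b1 = (complex_of_real c - \<mu>) / ?s"
  let ?W = "X \<boxplus> (- \<mu>) \<bullet>\<^sub>s unitm n"
  have W: "?W \<in> rm n n" using X by auto
  \<comment> \<open>Affine interpolation between the two rank-one matrices, with the weights X/c and
    (c - X)/c, both of which are positive.\<close>
  let ?P = "complex_of_real (1 / c) \<bullet>\<^sub>s (mat_compress A (\<alpha> b1) X \<boxplus> mat_compress A (\<alpha> b0) ?Y)"
  have "blk ?R ?W = ?P"
  proof (rule rm_eqI[of _ "n + n" "n + n"])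
    note cc = compress_closed[OF X(2) \<alpha>[of b1]] compress_closed[OF Y \<alpha>[of b0]]
    show c1: "blk ?R ?W \<in> rm (n + n) (n + n)" using blk_rm[OF W] .
    show c2: "?P \<in> rm (n + n) (n + n)" using cc by auto
    fix i j assume ij: "i < n + n" "j < n + n"
    show "blk ?R ?W $$ (i, j) = ?P $$ (i, j)"
    proof (rule sep)
      fix f assume f: "linfun A f"
      have xe: "X $$ (p, q) \<in> carrier A" if "p < n" "q < n" for p q using X that by (auto intro: rm_entry)
      have xs: "(X $$ (p, q))\<^sup>\<star> = X $$ (q, p)" if "p < n" "q < n" for p q
        using mstar_index[OF X(2) that(2,1)] pc_star[OF X(1)] by simp
      have Yi: "f (?Y $$ (p, q)) = complex_of_real c * (if p = q then f \<one> else 0) - f (X $$ (p, q))" if "p < n" "q < n" for p q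
        using that X xe[OF that] f by (auto simp: mplus_index[of _ n n] msm_index[of _ n n] unitm_index linfun_simps)
      have Wi: "f (?W $$ (p, q)) = f (X $$ (p, q)) - \<mu> * (if p = q then f \<one> else 0)" if "p < n" "q < n" for p q
        using that X xe[OF that] f by (auto simp: mplus_index[of _ n n] msm_index[of _ n n] unitm_index linfun_simps)
      have Ws: "f ((?W $$ (q, p))\<^sup>\<star>) = f (X $$ (p, q)) - cnj \<mu> * (if p = q then f \<one> else 0)" if "p < n" "q < n" for p q
        using that X xe[OF that] xe[OF that(2,1)] xs[OF that(2,1)] f
        by (auto simp: mplus_index[of _ n n] msm_index[of _ n n] unitm_index linfun_simps star_add star_sm)
      have eqs: "cnj ?s = ?s" by simp
      have b: "?s * b1 = complex_of_real c - \<mu>" "?s * b0 = - \<mu>" "cnj b1 * ?s = complex_of_real c - cnj \<mu>" "cnj b0 * ?s = - cnj \<mu>"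
        "cnj b1 * b1 = complex_of_real ?R" "cnj b0 * b0 = complex_of_real ?R"
        using s0 mm1 mm2 ss unfolding b0_def b1_def
        by (auto simp: field_simps)
      define z where "z = f (X $$ (ix i, ix j))"
      define d where "d = (if ix i = ix j then f \<one> else 0)"
      define u where "u b = cnj (co b i) * co b j" for b
      have "f (?P $$ (i, j)) = (1 / complex_of_real c) * (u b1 * z + u b0 * (complex_of_real c * d - z))"
        using ij f cc rm_entry[OF cc(1) ij] rm_entry[OF cc(2) ij]
        by (simp add: msm_index[OF mplus_closed[OF cc]] mplus_index[OF cc(1)] linfun_simps compr[OF X(2) ij f] compr[OF Y ij f]
            Yi[OF ixn[OF ij(1)] ixn[OF ij(2)]] z_def d_def u_def)
      also have "\<dots> = f (blk ?R ?W $$ (i, j))"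
      proof (cases "i < n"; cases "j < n")
        assume "i < n" "j < n"
        then show ?thesis using f c by (simp add: blk_index[OF W] u_def co_def ss d_def ix_def linfun_simps field_simps)
      next
        assume *: "i < n" "\<not> j < n"
        then have jn: "j - n < n" using ij by simp
        have ub: "u b1 = complex_of_real c - \<mu>" "u b0 = - \<mu>" using * b by (simp_all add: u_def co_def)
        have "f (blk ?R ?W $$ (i, j)) = z - \<mu> * d"
          using * ij Wi[OF *(1) jn] by (simp add: blk_index[OF W] d_def z_def ix_def)
        then show ?thesis unfolding ub using c by (simp add: field_simps)
      next
        assume *: "\<not> i < n" "j < n"
        then have "i - n < n" using ij by simp
        have ub: "u b1 = complex_of_real c - cnj \<mu>" "u b0 = - cnj \<mu>" using * b by (simp_all add: u_def co_def)
        have "f (blk ?R ?W $$ (i, j)) = z - cnj \<mu> * d"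
          using * ij Ws[OF \<open>i - n < n\<close> *(2)] by (simp add: blk_index[OF W] d_def z_def ix_def)
        then show ?thesis unfolding ub using c by (simp add: field_simps)
      next
        assume *: "\<not> i < n" "\<not> j < n"
        have "u b1 = complex_of_real ?R" "u b0 = complex_of_real ?R" using * b by (simp_all add: u_def co_def)
        moreover have "(i - n = j - n) = (i = j)" using * by auto
        ultimately show ?thesis using * f c ij
          by (simp add: blk_index[OF W] d_def z_def ix_def linfun_simps field_simps)
      qed
      finally show "f (blk ?R ?W $$ (i, j)) = f (?P $$ (i, j))" ..
    qed (use rm_entry[OF c1 ij] rm_entry[OF c2 ij] in auto)
  qed
  also have "?P \<in> pcone A"
    using c by (intro pc_sm pc_add[OF pc_compress[OF X \<alpha>] pc_compress[OF cX Y \<alpha>]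
      compress_closed[OF X(2) \<alpha>] compress_closed[OF Y \<alpha>]]) simp
  finally show ?thesis .
qed

end

text \<open>Discs through two fixed points flatten to half-planes as the centre moves off to
  infinity; the gap between radius and height of the centre tends to 0.\<close>

lemma sqrt_sum_minus_tendsto:
  assumes "d > 0" shows "\<exists>t>0. cmod (Complex a t) - t < d \<and> cmod (Complex a (- t)) - t < d"
proof -
  define t where "t = a\<^sup>2 / d + d"
  have t: "t > 0" using assms by (simp add: t_def add_nonneg_pos)
  have "a\<^sup>2 \<le> t * d" using assms by (simp add: t_def distrib_right)
  moreover have "(t + d)\<^sup>2 = t\<^sup>2 + 2 * (t * d) + d\<^sup>2" by (simp add: power2_eq_square algebra_simps)
  moreover have "t * d > 0" "d\<^sup>2 > 0" using t assms by auto
  ultimately have "a\<^sup>2 + t\<^sup>2 < (t + d)\<^sup>2" by linarith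
  then have "sqrt (a\<^sup>2 + t\<^sup>2) < t + d" using t assms by (simp add: real_less_lsqrt)
  then show ?thesis using t by (intro exI[of _ t]) (auto simp: cmod_def)
qed

text \<open>A complete isometry preserves statements about norms of X - \<mu>. For 0 <= X <= c these
  place the image Z in all discs of \<open>blk_disc\<close>, up to an arbitrarily small enlargement.
  The disc around c/2 gives that Z + Z* is positive, and centres far up and far down give that Z is
  self-adjoint.\<close>

lemma completely_isometric_ucp:
  assumes S: "operator_system S" and R: "operator_system R"
    and f: "completely_isometric S R f" and f1: "f \<one>\<^bsub>S\<^esub> = \<one>\<^bsub>R\<^esub>"
  shows "ucp S R f"
proof -
  interpret S: opsys S by (rule opsys.intro) fact
  interpret R: opsys R by (rule opsys.intro) fact
  have lin: "clinear S R f" and iso: "\<And>X n. X \<in> S.rm n n \<Longrightarrow> opsys_norm R (map_mat f X) = opsys_norm S X"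
    using f by (auto simp: completely_isometric_def S.mats_eq)
  have "map_mat f X \<in> pcone R" if X: "X \<in> pcone S" for X
  proof -
    define n where "n = dim_row X"
    have Xn: "X \<in> S.rm n n" unfolding n_def by (rule S.pc_rm[OF X])
    obtain c where c: "c > 0" and cX: "mat_add S (mat_smult S (complex_of_real c) (mat_unit S n)) (mat_smult S (-1) X) \<in> pcone S"
      using S.pc_order_unit[OF Xn S.pc_star[OF X]] by blast
    define Z where "Z = map_mat f X"
    have Z: "Z \<in> R.rm n n" unfolding Z_def by (rule S.map_mat_rm[OF R.star_vs lin Xn])
    note Zs = R.mstar_closed[OF Z]
    have disc: "R.blk (cmod (Complex (c / 2) t) + e) (mat_add R Z (mat_smult R (- Complex (c / 2) t) (mat_unit R n))) \<in> pcone R"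
      if "e > 0" for t e
    proof (rule R.blk_of_norm_less[where n = n])
      let ?W = "mat_add S X (mat_smult S (- Complex (c / 2) t) (mat_unit S n))"
      have W: "?W \<in> S.rm n n" using Xn by auto
      have "map_mat f ?W = mat_add R Z (mat_smult R (- Complex (c / 2) t) (mat_unit R n))"
        unfolding Z_def map_mat_plus[OF S.star_vs lin Xn S.msm_closed[OF S.unitm_closed]]
          map_mat_sm[OF S.star_vs lin S.unitm_closed] map_mat_unit[OF S.star_vs R.star_vs lin f1] ..
      moreover have "opsys_norm S ?W \<le> cmod (Complex (c / 2) t)"
        using S.blk_disc[OF X Xn cX c] by (intro S.opsys_norm_le) auto
      ultimately show "opsys_norm R (mat_add R Z (mat_smult R (- Complex (c / 2) t) (mat_unit R n))) < cmod (Complex (c / 2) t) + e"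
        using iso[OF W] that by simp
    qed (use Z in auto)
    \<comment> \<open>The disc condition on Z, compressed in the direction w: what remains of the
      radius is its excess over the real part of w times the centre.\<close>
    have half: "mat_add R (mat_smult R (complex_of_real (2 * (cmod (Complex (c / 2) t) + e) - 2 * Re (w * Complex (c / 2) t))) (mat_unit R n))
        (mat_add R (mat_smult R w Z) (mat_smult R (cnj w) (mat_adj R Z))) \<in> pcone R"
      if "e > 0" "cmod w = 1" for t e w
    proof -
      define m where "m = Complex (c / 2) t"
      define K where "K = Re (w * m)"
      have re: "complex_of_real K = (w * m + cnj w * cnj m) / 2"
        using complex_add_cnj[of "w * m"] by (simp add: K_def)
      let ?V = "mat_add R Z (mat_smult R (- m) (mat_unit R n))"
      have V: "?V \<in> R.rm n n" using Z by auto
      have "mat_add R (mat_smult R (complex_of_real (2 * (cmod m + e))) (mat_unit R n))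
         (mat_add R (mat_smult R w ?V) (mat_smult R (cnj w) (mat_adj R ?V))) \<in> pcone R" (is "?l \<in> _")
        using R.blk_compress[OF V disc[OF that(1), of t, folded m_def] that(2)] .
      moreover have "?l = mat_add R (mat_smult R (complex_of_real (2 * (cmod m + e) - 2 * K)) (mat_unit R n))
        (mat_add R (mat_smult R w Z) (mat_smult R (cnj w) (mat_adj R Z)))" (is "_ = ?r")
      proof (rule R.rm_eqI[of _ n n])
        show cl: "?l \<in> R.rm n n" and cr: "?r \<in> R.rm n n" using Z V by auto
        fix i j assume ij: "i < n" "j < n"
        show "?l $$ (i, j) = ?r $$ (i, j)"
          using ij Z V R.rm_entry[OF Z ij] R.rm_entry[OF Z ij(2,1)]
          by (intro R.sep)
            (auto simp: R.mplus_index[of _ n n] R.msm_index[of _ n n] R.mstar_index[of _ n n] R.unitm_index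
              R.star_lin_simps R.linfun_simps re algebra_simps)
      qed
      ultimately show ?thesis by (simp only: m_def K_def)
    qed
    have sa_w: "mat_adj R (mat_add R (mat_smult R w Z) (mat_smult R (cnj w) (mat_adj R Z))) =
        mat_add R (mat_smult R w Z) (mat_smult R (cnj w) (mat_adj R Z))" for w
      using Z R.rm_entry[OF Z] by (intro R.rm_eqI[of _ n n])
        (auto simp: R.mplus_index[of _ n n] R.msm_index[of _ n n] R.mstar_index[of _ n n] R.star_lin_simps R.a_comm)
    have posw: "mat_add R (mat_smult R w Z) (mat_smult R (cnj w) (mat_adj R Z)) \<in> pcone R"
      if w: "cmod w = 1" and small: "\<And>d. d > 0 \<Longrightarrow> \<exists>t. cmod (Complex (c / 2) t) - Re (w * Complex (c / 2) t) < d" for w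
    proof (rule R.pc_archimedean[OF _ sa_w])
      fix r :: real assume r: "r > 0"
      then obtain t where t: "cmod (Complex (c / 2) t) - Re (w * Complex (c / 2) t) < r / 2"
        using small[of "r / 2"] by auto
      define e where "e = r / 2 - (cmod (Complex (c / 2) t) - Re (w * Complex (c / 2) t))"
      have "e > 0" using t by (simp add: e_def)
      moreover have "2 * (cmod (Complex (c / 2) t) + e) - 2 * Re (w * Complex (c / 2) t) = r"
        by (simp add: e_def algebra_simps)
      ultimately show "mat_add R (mat_smult R (complex_of_real r) (mat_unit R n))
          (mat_add R (mat_smult R w Z) (mat_smult R (cnj w) (mat_adj R Z))) \<in> pcone R"
        using half[of e w t] w by simp
    qed (use Z in auto)
    have p1: "mat_add R (mat_smult R 1 Z) (mat_smult R (cnj 1) (mat_adj R Z)) \<in> pcone R"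
      using c by (intro posw) (auto intro!: exI[of _ 0] simp: cmod_def)
    have p2: "mat_add R (mat_smult R \<i> Z) (mat_smult R (cnj \<i>) (mat_adj R Z)) \<in> pcone R"
    proof (rule posw)
      fix d :: real assume "d > 0"
      then obtain t where "cmod (Complex (c / 2) (- t)) - t < d" using sqrt_sum_minus_tendsto by blast
      then show "\<exists>t. cmod (Complex (c / 2) t) - Re (\<i> * Complex (c / 2) t) < d"
        by (intro exI[of _ "- t"]) simp
    qed simp
    have p3: "mat_add R (mat_smult R (- \<i>) Z) (mat_smult R (cnj (- \<i>)) (mat_adj R Z)) \<in> pcone R"
    proof (rule posw)
      fix d :: real assume "d > 0"
      then obtain t where "cmod (Complex (c / 2) t) - t < d" using sqrt_sum_minus_tendsto by blast
      then show "\<exists>t. cmod (Complex (c / 2) t) - Re (- \<i> * Complex (c / 2) t) < d"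
        by (intro exI[of _ t]) simp
    qed simp
    let ?H = "mat_add R (mat_smult R \<i> Z) (mat_smult R (cnj \<i>) (mat_adj R Z))"
    have "mat_smult R (-1) ?H = mat_add R (mat_smult R (- \<i>) Z) (mat_smult R (cnj (- \<i>)) (mat_adj R Z))"
      using Z R.rm_entry[OF Z] by (intro R.rm_eqI[of _ n n])
        (auto simp: R.mplus_index[of _ n n] R.msm_index[of _ n n] R.mstar_index[of _ n n] R.sm_rdistr simp flip: R.sm_assoc)
    then have H0: "?H = mat_zero R n" using R.pc_antisym[OF p2] p3 Z by simp
    have ent: "Z $$ (i, j) = adj R (Z $$ (j, i))" if ij: "i < n" "j < n" for i j
    proof (rule R.sep)
      fix g assume g: "linfun R g"
      have "?H $$ (i, j) = \<zero>\<^bsub>R\<^esub>" using H0 ij by simp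
      moreover have "?H $$ (i, j) = \<i> \<odot>\<^bsub>R\<^esub> (Z $$ (i, j)) \<oplus>\<^bsub>R\<^esub> (cnj \<i>) \<odot>\<^bsub>R\<^esub> (adj R (Z $$ (j, i)))"
        using Z ij by (simp add: R.mplus_index[of _ n n] R.msm_index[of _ n n] R.mstar_index[of _ n n])
      ultimately have "g (\<i> \<odot>\<^bsub>R\<^esub> (Z $$ (i, j)) \<oplus>\<^bsub>R\<^esub> (cnj \<i>) \<odot>\<^bsub>R\<^esub> (adj R (Z $$ (j, i)))) = g \<zero>\<^bsub>R\<^esub>" by simp
      then show "g (Z $$ (i, j)) = g (adj R (Z $$ (j, i)))"
        using g R.rm_entry[OF Z ij] R.rm_entry[OF Z ij(2,1)] by (simp add: R.linfun_simps)
    qed (use R.rm_entry[OF Z ij] R.rm_entry[OF Z ij(2,1)] in auto)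
    have "mat_smult R (complex_of_real (1/2)) (mat_add R (mat_smult R 1 Z) (mat_smult R (cnj 1) (mat_adj R Z))) = Z"
      using Z R.rm_entry[OF Z] ent[symmetric] by (intro R.rm_eqI[of _ n n])
        (auto simp: R.mplus_index[of _ n n] R.msm_index[of _ n n] R.mstar_index[of _ n n] R.linfun_simps intro!: R.sep)
    then show ?thesis using R.pc_sm[OF p1, of "1/2"] by (simp add: Z_def)
  qed
  then show ?thesis using lin f1 by (auto simp: ucp_def completely_positive_def)
qed

section \<open>Star homomorphisms\<close>

lemma star_hom_clinear: "star_hom A B f \<Longrightarrow> clinear A B f"
  and star_hom_mult: "\<lbrakk>star_hom A B f; x \<in> carrier A; y \<in> carrier A\<rbrakk> \<Longrightarrow> f (x \<otimes>\<^bsub>A\<^esub> y) = f x \<otimes>\<^bsub>B\<^esub> f y"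
  and star_hom_star: "\<lbrakk>star_hom A B f; x \<in> carrier A\<rbrakk> \<Longrightarrow> f (adj A x) = adj B (f x)"
  by (auto simp: star_hom_def)

lemma clinear_cstar_opsys_right [simp]: "clinear S (cstar_opsys A) f \<longleftrightarrow> clinear S A f"
  by (simp add: clinear_def)

lemma clinear_cstar_opsys_left [simp]: "clinear (cstar_opsys A) S f \<longleftrightarrow> clinear A S f"
  by (simp add: clinear_def)

lemma star_hom_ucp:
  assumes A: "cstar_algebra A" and B: "cstar_algebra B" and f: "star_hom A B f" "f \<one>\<^bsub>A\<^esub> = \<one>\<^bsub>B\<^esub>"
  shows "ucp (cstar_opsys A) (cstar_opsys B) f"
proof -
  interpret A: cstar_alg A by (rule cstar_alg.intro) fact
  interpret B: cstar_alg B by (rule cstar_alg.intro) fact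
  note lin = star_hom_clinear[OF f(1)]
  have "map_mat f X \<in> pcone (cstar_opsys B)" if Xp: "X \<in> pcone (cstar_opsys A)" for X
  proof -
    obtain n Y where Y: "Y \<in> A.rm n n" and X: "X = mat_mult A (mat_adj A Y) Y"
    proof -
      have "X \<in> {X. \<exists>n. \<exists>Y\<in>mats A n. X = mat_mult A (mat_adj A Y) Y}"
        using Xp by (simp add: cstar_opsys_def)
      then show thesis using that A.mats_eq by blast
    qed
    have fY: "map_mat f Y \<in> B.rm n n"
      using A.rm_dim[OF Y] A.rm_entry[OF Y] clinear_closed[OF lin] by (intro B.rmI) auto
    have "map_mat f X = mat_mult B (mat_adj B (map_mat f Y)) (map_mat f Y)"
    proof (rule B.rm_eqI[of _ n n])
      have Xc: "X \<in> A.rm n n" unfolding X using Y by (intro A.mm_closed[OF A.mstar_closed])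
      show "map_mat f X \<in> B.rm n n"
        using A.rm_dim[OF Xc] A.rm_entry[OF Xc] clinear_closed[OF lin] by (intro B.rmI) auto
      show "mat_mult B (mat_adj B (map_mat f Y)) (map_mat f Y) \<in> B.rm n n"
        by (rule B.mm_closed[OF B.mstar_closed[OF fY] fY])
      fix i j assume ij: "i < n" "j < n"
      have "map_mat f X $$ (i, j) = f (finsum A (\<lambda>l. adj A (Y $$ (l, i)) \<otimes>\<^bsub>A\<^esub> Y $$ (l, j)) {..<n})"
        using A.rm_dim[OF Xc] ij Y A.rm_entry[OF Y]
        by (auto simp: X A.mm_index[OF A.mstar_closed[OF Y] Y] A.mstar_index[OF Y] intro!: arg_cong[of _ _ f] A.finsum_cong')
      also have "\<dots> = finsum B (\<lambda>l. f (adj A (Y $$ (l, i)) \<otimes>\<^bsub>A\<^esub> Y $$ (l, j))) {..<n}"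
        using ij A.rm_entry[OF Y] by (intro clinear_finsum[OF A.complex_space B.complex_space lin]) auto
      also have "\<dots> = mat_mult B (mat_adj B (map_mat f Y)) (map_mat f Y) $$ (i, j)"
        unfolding B.mm_index[OF B.mstar_closed[OF fY] fY ij]
        using ij A.rm_entry[OF Y] clinear_closed[OF lin] A.rm_dim[OF Y]
        by (intro B.finsum_cong') (auto simp: B.mstar_index[OF fY] star_hom_mult[OF f(1)] star_hom_star[OF f(1)])
      finally show "map_mat f X $$ (i, j) = mat_mult B (mat_adj B (map_mat f Y)) (map_mat f Y) $$ (i, j)" .
    qed
    then show ?thesis unfolding cstar_opsys_def using fY B.mats_eq by auto
  qed
  then show ?thesis using lin f(2) by (simp add: ucp_def completely_positive_def)
qed

text \<open>By \<open>norm_le_iff\<close> the norm is governed by an element of the form y* y, and a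
  unital star homomorphism preserves this form.\<close>

lemma star_hom_contractive:
  assumes A: "cstar_algebra A" and B: "cstar_algebra B" and f: "star_hom A B f" "f \<one>\<^bsub>A\<^esub> = \<one>\<^bsub>B\<^esub>"
    and x: "x \<in> carrier A"
  shows "nrm B (f x) \<le> nrm A x"
proof -
  interpret A: cstar_alg A by (rule cstar_alg.intro) fact
  interpret B: cstar_alg B by (rule cstar_alg.intro) fact
  note lin = star_hom_clinear[OF f(1)]
  let ?r = "nrm A x"
  have "A.cm (complex_of_real (?r\<^sup>2)) \<ominus>\<^bsub>A\<^esub> adj A x \<otimes>\<^bsub>A\<^esub> x \<in> A.pos"
    using A.norm_le_iff[OF x, of ?r] x by simp
  then obtain y where y: "y \<in> carrier A" "A.cm (complex_of_real (?r\<^sup>2)) \<ominus>\<^bsub>A\<^esub> adj A x \<otimes>\<^bsub>A\<^esub> x = adj A y \<otimes>\<^bsub>A\<^esub> y"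
    using A.pos_iff by blast
  have "f (A.cm (complex_of_real (?r\<^sup>2)) \<ominus>\<^bsub>A\<^esub> adj A x \<otimes>\<^bsub>A\<^esub> x) = B.cm (complex_of_real (?r\<^sup>2)) \<ominus>\<^bsub>B\<^esub> adj B (f x) \<otimes>\<^bsub>B\<^esub> f x"
    using x by (simp add: clinear_minus[OF A.complex_space B.complex_space lin] star_hom_mult[OF f(1)] star_hom_star[OF f(1)]
        A.cm_def B.cm_def clinear_sm[OF lin] f(2))
  moreover have "f (adj A y \<otimes>\<^bsub>A\<^esub> y) = adj B (f y) \<otimes>\<^bsub>B\<^esub> f y"
    using y by (simp add: star_hom_mult[OF f(1)] star_hom_star[OF f(1)])
  ultimately have "B.cm (complex_of_real (?r\<^sup>2)) \<ominus>\<^bsub>B\<^esub> adj B (f x) \<otimes>\<^bsub>B\<^esub> f x = adj B (f y) \<otimes>\<^bsub>B\<^esub> f y"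
    using y by simp
  then show ?thesis
    using B.norm_le_iff[of "f x" ?r] B.pos_star_mult clinear_closed[OF lin] x y by simp
qed

lemma (in pre_cstar_alg) tends_Cauchy:
  assumes "tends X x" "e > 0" shows "\<exists>N. \<forall>m\<ge>N. \<forall>n\<ge>N. nrm A (X m \<ominus> X n) < e"
proof -
  have "\<forall>\<^sub>F n in sequentially. nrm A (X n \<ominus> x) < e / 2"
    using assms unfolding tends_def by (intro order_tendstoD(2)[of _ 0]) auto
  then obtain N where N: "\<And>n. n \<ge> N \<Longrightarrow> nrm A (X n \<ominus> x) < e / 2"
    unfolding eventually_sequentially by blast
  have "nrm A (X m \<ominus> X n) < e" if "m \<ge> N" "n \<ge> N" for m n
    using norm_diff_triangle[of "X m" x "X n"] norm_minus_commute[of x "X n"] N[OF that(1)] N[OF that(2)]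
      tends_carrier[OF assms(1)] by simp
  then show ?thesis by blast
qed

text \<open>The usual extension by continuity, with sequences in the dense subalgebra: contractivity
  of F makes Cauchy sequences go to Cauchy sequences, and the target is complete.\<close>

lemma star_hom_extend:
  assumes M: "cstar_algebra M" and C: "cstar_algebra C"
    and D: "D \<subseteq> carrier M" "\<And>x y. \<lbrakk>x \<in> D; y \<in> D\<rbrakk> \<Longrightarrow> x \<oplus>\<^bsub>M\<^esub> y \<in> D" "\<And>c x. x \<in> D \<Longrightarrow> c \<odot>\<^bsub>M\<^esub> x \<in> D"
      "\<And>x y. \<lbrakk>x \<in> D; y \<in> D\<rbrakk> \<Longrightarrow> x \<otimes>\<^bsub>M\<^esub> y \<in> D" "\<And>x. x \<in> D \<Longrightarrow> adj M x \<in> D"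
      "cstar_topology M closure_of D = carrier M"
    and F: "\<And>x. x \<in> D \<Longrightarrow> F x \<in> carrier C" "\<And>x y. \<lbrakk>x \<in> D; y \<in> D\<rbrakk> \<Longrightarrow> F (x \<oplus>\<^bsub>M\<^esub> y) = F x \<oplus>\<^bsub>C\<^esub> F y"
      "\<And>c x. x \<in> D \<Longrightarrow> F (c \<odot>\<^bsub>M\<^esub> x) = c \<odot>\<^bsub>C\<^esub> F x"
      "\<And>x y. \<lbrakk>x \<in> D; y \<in> D\<rbrakk> \<Longrightarrow> F (x \<otimes>\<^bsub>M\<^esub> y) = F x \<otimes>\<^bsub>C\<^esub> F y"
      "\<And>x. x \<in> D \<Longrightarrow> F (adj M x) = adj C (F x)"
      "\<And>x. x \<in> D \<Longrightarrow> nrm C (F x) \<le> nrm M x"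
  shows "\<exists>G. star_hom M C G \<and> (\<forall>x\<in>D. G x = F x)"
proof -
  interpret M: cstar_alg M by (rule cstar_alg.intro) fact
  interpret C: cstar_alg C by (rule cstar_alg.intro) fact
  have Dc: "\<And>x. x \<in> D \<Longrightarrow> x \<in> carrier M" using D(1) by auto
  have Fdiff: "F x \<ominus>\<^bsub>C\<^esub> F y = F (x \<ominus>\<^bsub>M\<^esub> y)" "x \<ominus>\<^bsub>M\<^esub> y \<in> D" if xy: "x \<in> D" "y \<in> D" for x y
  proof -
    have *: "x \<ominus>\<^bsub>M\<^esub> y = x \<oplus>\<^bsub>M\<^esub> (-1) \<odot>\<^bsub>M\<^esub> y" using xy Dc by (simp add: M.minus_eq M.sm_minus_one)
    show "x \<ominus>\<^bsub>M\<^esub> y \<in> D" unfolding * using xy D by auto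
    show "F x \<ominus>\<^bsub>C\<^esub> F y = F (x \<ominus>\<^bsub>M\<^esub> y)"
      unfolding * using xy D F by (simp add: C.minus_eq C.sm_minus_one)
  qed
  have "\<exists>X g. range X \<subseteq> D \<and> M.tends X x \<and> C.tends (F \<circ> X) g" if x: "x \<in> carrier M" for x
  proof -
    obtain X where X: "range X \<subseteq> D" "M.tends X x" using M.closure_tends[OF D(1), of x] x D(6) by auto
    then have XD: "X n \<in> D" for n by auto
    have "\<exists>g. C.tends (F \<circ> X) g"
    proof (rule C.complete)
      fix e :: real assume "e > 0"
      then obtain N where N: "\<forall>m\<ge>N. \<forall>n\<ge>N. nrm M (X m \<ominus>\<^bsub>M\<^esub> X n) < e" using M.tends_Cauchy[OF X(2)] by blast
      have "nrm C ((F \<circ> X) m \<ominus>\<^bsub>C\<^esub> (F \<circ> X) n) \<le> nrm M (X m \<ominus>\<^bsub>M\<^esub> X n)" for m n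
        using Fdiff[OF XD XD] F(6) by simp
      with N show "\<exists>N. \<forall>m\<ge>N. \<forall>n\<ge>N. nrm C ((F \<circ> X) m \<ominus>\<^bsub>C\<^esub> (F \<circ> X) n) < e"
        using le_less_trans by blast
    qed (use XD F in simp)
    with X show ?thesis by blast
  qed
  then obtain X G where X: "\<And>x. x \<in> carrier M \<Longrightarrow> range (X x) \<subseteq> D" "\<And>x. x \<in> carrier M \<Longrightarrow> M.tends (X x) x"
    and G: "\<And>x. x \<in> carrier M \<Longrightarrow> C.tends (F \<circ> X x) (G x)" by metis
  \<comment> \<open>The value of \<open>G\<close> does not depend on the approximating sequence. All
    identities for \<open>G\<close> follow by choosing the sequence that suits them and using
    uniqueness of limits.\<close>
  have key: "C.tends (\<lambda>n. F (Z n)) (G x)" if Z: "\<And>n. Z n \<in> D" "M.tends Z x" for Z x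
  proof -
    have x: "x \<in> carrier M" using M.tends_carrier(2)[OF Z(2)] .
    have XD: "X x n \<in> D" for n using X(1)[OF x] by auto
    have dlim: "(\<lambda>n. nrm M (Z n \<ominus>\<^bsub>M\<^esub> X x n)) \<longlonglongrightarrow> 0"
      using M.tends_norm[OF M.tends_minus[OF Z(2) X(2)[OF x]]] x by simp
    have "C.tends (\<lambda>n. F (Z n) \<ominus>\<^bsub>C\<^esub> F (X x n)) \<zero>\<^bsub>C\<^esub>"
    proof (rule C.tendsI_bound[OF _ _ _ dlim])
      fix n
      have c: "F (Z n) \<in> carrier C" "F (X x n) \<in> carrier C" using Z XD F by auto
      have "nrm C (F (Z n) \<ominus>\<^bsub>C\<^esub> F (X x n)) \<le> nrm M (Z n \<ominus>\<^bsub>M\<^esub> X x n)"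
        using Fdiff[OF Z(1) XD] F(6) by simp
      then show "nrm C (F (Z n) \<ominus>\<^bsub>C\<^esub> F (X x n) \<ominus>\<^bsub>C\<^esub> \<zero>\<^bsub>C\<^esub>) \<le> nrm M (Z n \<ominus>\<^bsub>M\<^esub> X x n)"
        using c by (simp add: C.minus_eq)
      show "F (Z n) \<ominus>\<^bsub>C\<^esub> F (X x n) \<in> carrier C" using c by simp
    qed simp
    from C.tends_add[OF this G[OF x]] have "C.tends (\<lambda>n. F (Z n) \<ominus>\<^bsub>C\<^esub> F (X x n) \<oplus>\<^bsub>C\<^esub> F (X x n)) (\<zero>\<^bsub>C\<^esub> \<oplus>\<^bsub>C\<^esub> G x)"
      by (simp add: comp_def)
    moreover have "F (Z n) \<ominus>\<^bsub>C\<^esub> F (X x n) \<oplus>\<^bsub>C\<^esub> F (X x n) = F (Z n)" for n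
      using Z XD F by (simp add: C.minus_eq C.a_assoc C.l_neg)
    ultimately show ?thesis using C.tends_carrier(2)[OF G[OF x]] by simp
  qed
  have XD: "X x n \<in> D" if "x \<in> carrier M" for x n using X(1)[OF that] by auto
  have Xt: "M.tends (X x) x" if "x \<in> carrier M" for x by (rule X(2)[OF that])
  have Gt: "C.tends (\<lambda>n. F (X x n)) (G x)" if "x \<in> carrier M" for x using G[OF that] by (simp add: comp_def)
  have Gc: "G x \<in> carrier C" if "x \<in> carrier M" for x using C.tends_carrier(2)[OF Gt[OF that]] .
  have "G (x \<oplus>\<^bsub>M\<^esub> y) = G x \<oplus>\<^bsub>C\<^esub> G y" if "x \<in> carrier M" "y \<in> carrier M" for x y
  proof (rule C.tends_unique)
    show "C.tends (\<lambda>n. F (X x n \<oplus>\<^bsub>M\<^esub> X y n)) (G (x \<oplus>\<^bsub>M\<^esub> y))"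
      using that XD D by (intro key M.tends_add Xt) auto
    show "C.tends (\<lambda>n. F (X x n \<oplus>\<^bsub>M\<^esub> X y n)) (G x \<oplus>\<^bsub>C\<^esub> G y)"
      using C.tends_add[OF Gt[OF that(1)] Gt[OF that(2)]] that XD F by simp
  qed
  moreover have "G (c \<odot>\<^bsub>M\<^esub> x) = c \<odot>\<^bsub>C\<^esub> G x" if "x \<in> carrier M" for c x
  proof (rule C.tends_unique)
    show "C.tends (\<lambda>n. F (c \<odot>\<^bsub>M\<^esub> X x n)) (G (c \<odot>\<^bsub>M\<^esub> x))"
      using that XD D by (intro key M.tends_sm Xt) auto
    show "C.tends (\<lambda>n. F (c \<odot>\<^bsub>M\<^esub> X x n)) (c \<odot>\<^bsub>C\<^esub> G x)"
      using C.tends_sm[OF Gt[OF that]] that XD F by simp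
  qed
  moreover have "G (x \<otimes>\<^bsub>M\<^esub> y) = G x \<otimes>\<^bsub>C\<^esub> G y" if "x \<in> carrier M" "y \<in> carrier M" for x y
  proof (rule C.tends_unique)
    show "C.tends (\<lambda>n. F (X x n \<otimes>\<^bsub>M\<^esub> X y n)) (G (x \<otimes>\<^bsub>M\<^esub> y))"
      using that XD D by (intro key M.tends_mult Xt) auto
    show "C.tends (\<lambda>n. F (X x n \<otimes>\<^bsub>M\<^esub> X y n)) (G x \<otimes>\<^bsub>C\<^esub> G y)"
      using C.tends_mult[OF Gt[OF that(1)] Gt[OF that(2)]] that XD F by simp
  qed
  moreover have "G (adj M x) = adj C (G x)" if "x \<in> carrier M" for x
  proof (rule C.tends_unique)
    show "C.tends (\<lambda>n. F (adj M (X x n))) (G (adj M x))"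
      using that XD D by (intro key M.tends_star Xt) auto
    show "C.tends (\<lambda>n. F (adj M (X x n))) (adj C (G x))"
      using C.tends_star[OF Gt[OF that]] that XD F by simp
  qed
  ultimately have "star_hom M C G" using Gc by (simp add: star_hom_def clinear_def)
  moreover have "G x = F x" if "x \<in> D" for x
    by (rule C.tends_unique[OF key[of "\<lambda>_. x" x] C.tends_const]) (use that Dc F in auto)
  ultimately show ?thesis by blast
qed

section \<open>The maximal tensor product\<close>

context cspace
begin

lemma submodule_carrier: "submodule (carrier V) (ring_of_type_algebra :: complex ring) V"
  by (rule submoduleI') auto

lemma cspan_closed:
  assumes "X \<subseteq> carrier V"
  shows "cspan V X \<subseteq> carrier V" "X \<subseteq> cspan V X" "\<zero> \<in> cspan V X"
    "\<And>x y. \<lbrakk>x \<in> cspan V X; y \<in> cspan V X\<rbrakk> \<Longrightarrow> x \<oplus> y \<in> cspan V X"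
    "\<And>c x. x \<in> cspan V X \<Longrightarrow> c \<odot> x \<in> cspan V X"
proof -
  have mem: "x \<in> cspan V X \<longleftrightarrow> (\<forall>H. submodule H (ring_of_type_algebra :: complex ring) V \<and> X \<subseteq> H \<longrightarrow> x \<in> H)" for x
    by (simp add: cspan_def hull_def)
  show "cspan V X \<subseteq> carrier V" using mem submodule_carrier assms by blast
  show "X \<subseteq> cspan V X" "\<zero> \<in> cspan V X" using mem submoduleD(2) by auto
  show "x \<oplus> y \<in> cspan V X" if "x \<in> cspan V X" "y \<in> cspan V X" for x y
    using that submoduleD(3) unfolding mem by meson
  show "c \<odot> x \<in> cspan V X" if "x \<in> cspan V X" for c x
    using that submoduleD(4) unfolding mem by meson
qed

lemma cspan_induct:
  assumes "x \<in> cspan V X" "X \<subseteq> carrier V" "\<And>x. x \<in> X \<Longrightarrow> P x" "P \<zero>"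
    "\<And>x y. \<lbrakk>x \<in> cspan V X; y \<in> cspan V X; P x; P y\<rbrakk> \<Longrightarrow> P (x \<oplus> y)"
    "\<And>c x. \<lbrakk>x \<in> cspan V X; P x\<rbrakk> \<Longrightarrow> P (c \<odot> x)"
  shows "P x"
proof -
  note c = cspan_closed[OF assms(2)]
  have "submodule {x \<in> cspan V X. P x} (ring_of_type_algebra :: complex ring) V"
    using c assms(4-6) by (intro submoduleI') auto
  moreover have "X \<subseteq> {x \<in> cspan V X. P x}" using c(2) assms(3) by auto
  ultimately have "cspan V X \<subseteq> {x \<in> cspan V X. P x}"
    unfolding cspan_def by (intro hull_minimal)
  then show ?thesis using assms(1) by auto
qed

end

text \<open>The test objects in \<open>algebraic_tensor\<close> are plain module records; forgetting
  the further fields lets algebras and operator systems serve as targets.\<close>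

definition module_of :: "(complex, 'u, 'm) module_scheme \<Rightarrow> (complex, 'u) module" where
  "module_of V = \<lparr>carrier = carrier V, monoid.mult = monoid.mult V, one = one V, zero = zero V,
     add = add V, module.smult = module.smult V\<rparr>"

lemma module_of_simps [simp]:
  "carrier (module_of V) = carrier V" "zero (module_of V) = zero V" "add (module_of V) = add V"
  "module.smult (module_of V) = module.smult V"
  by (simp_all add: module_of_def)

lemma complex_space_module_of: "complex_space V \<Longrightarrow> complex_space (module_of V)"
  by (rule complex_space_cong) simp_all

lemma clinear_module_of [simp]: "clinear V (module_of W) f \<longleftrightarrow> clinear V W f"
  by (simp add: clinear_def)

lemma cbilinear_module_of [simp]: "cbilinear V W (module_of Z) b \<longleftrightarrow> cbilinear V W Z b"
  by (simp add: cbilinear_def)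

lemma algebraic_tensor_lift:
  fixes P :: "(complex, 'u, 'l) module_scheme" and Z :: "(complex, 'u, 'k) module_scheme"
  assumes "algebraic_tensor V W P \<theta>" "complex_space Z" "cbilinear V W Z b"
  obtains f where "clinear P Z f" "\<And>v w. \<lbrakk>v \<in> carrier V; w \<in> carrier W\<rbrakk> \<Longrightarrow> f (\<theta> v w) = b v w"
    "\<And>g x. \<lbrakk>clinear P Z g; \<And>v w. \<lbrakk>v \<in> carrier V; w \<in> carrier W\<rbrakk> \<Longrightarrow> g (\<theta> v w) = b v w; x \<in> carrier P\<rbrakk> \<Longrightarrow> g x = f x"
proof -
  have "complex_space (module_of Z) \<and> cbilinear V W (module_of Z) b"
    using assms(2,3) complex_space_module_of by simp
  from assms(1)[unfolded algebraic_tensor_def, THEN conjunct2, THEN conjunct2, THEN spec[of _ "module_of Z"],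
      THEN spec[of _ b], THEN mp, OF this]
  obtain f where "clinear P Z f" "\<forall>v\<in>carrier V. \<forall>w\<in>carrier W. f (\<theta> v w) = b v w"
    "\<forall>g. clinear P Z g \<and> (\<forall>v\<in>carrier V. \<forall>w\<in>carrier W. g (\<theta> v w) = b v w) \<longrightarrow> (\<forall>x\<in>carrier P. g x = f x)"
    unfolding clinear_module_of by blast
  then show thesis using that[of f] by blast
qed

lemma algebraic_tensor_unique:
  fixes P :: "(complex, 'u, 'l) module_scheme" and Z :: "(complex, 'u, 'k) module_scheme"
  assumes alg: "algebraic_tensor V W P \<theta>" and Z: "complex_space Z" and g: "clinear P Z g" and h: "clinear P Z h"
    and eq: "\<And>v w. \<lbrakk>v \<in> carrier V; w \<in> carrier W\<rbrakk> \<Longrightarrow> g (\<theta> v w) = h (\<theta> v w)" and x: "x \<in> carrier P"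
  shows "g x = h x"
proof -
  have bil: "cbilinear V W P \<theta>" using alg by (simp add: algebraic_tensor_def)
  have "clinear W Z (\<lambda>w. g (\<theta> v w))" if "v \<in> carrier V" for v
    using clinear_comp[of W P "\<theta> v" Z g] bil g that by (simp add: cbilinear_def comp_def)
  moreover have "clinear V Z (\<lambda>v. g (\<theta> v w))" if "w \<in> carrier W" for w
    using clinear_comp[of V P "\<lambda>v. \<theta> v w" Z g] bil g that by (simp add: cbilinear_def comp_def)
  ultimately have "cbilinear V W Z (\<lambda>v w. g (\<theta> v w))" by (simp add: cbilinear_def)
  from algebraic_tensor_lift[OF alg Z this] g h eq x show ?thesis by metis
qed

text \<open>Lift \<theta> into the span and follow it by the inclusion: by uniqueness this is the
  identity of \<open>P\<close>, so every element lies in the span.\<close>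

lemma algebraic_tensor_span:
  assumes alg: "algebraic_tensor V W P \<theta>"
  shows "carrier P = cspan P {\<theta> v w | v w. v \<in> carrier V \<and> w \<in> carrier W}"
proof -
  define E where "E = {\<theta> v w | v w. v \<in> carrier V \<and> w \<in> carrier W}"
  define D where "D = cspan P E"
  have bil: "cbilinear V W P \<theta>" and P: "complex_space P" using alg by (simp_all add: algebraic_tensor_def)
  interpret P: cspace P by (rule cspace.intro) fact
  have E: "E \<subseteq> carrier P" using bil by (auto simp: E_def cbilinear_def clinear_def)
  note Dcl = P.cspan_closed[OF E, folded D_def]
  have "submodule D (ring_of_type_algebra :: complex ring) P" using Dcl by (intro P.submoduleI') auto
  then have DP: "complex_space (P\<lparr>carrier := D\<rparr>)" using submodule.submodule_is_module P by blast
  have "\<theta> v w \<in> D" if "v \<in> carrier V" "w \<in> carrier W" for v w using Dcl(2) that by (auto simp: E_def)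
  then have "cbilinear V W (P\<lparr>carrier := D\<rparr>) \<theta>" using bil by (auto simp: cbilinear_def clinear_def)
  then obtain f where f: "clinear P (P\<lparr>carrier := D\<rparr>) f" "\<And>v w. \<lbrakk>v \<in> carrier V; w \<in> carrier W\<rbrakk> \<Longrightarrow> f (\<theta> v w) = \<theta> v w"
    using algebraic_tensor_lift[OF alg DP] by metis
  have "clinear P P f" using f(1) Dcl(1) by (auto simp: clinear_def)
  moreover have "clinear P P (\<lambda>x. x)" by (auto simp: clinear_def)
  ultimately have "f x = x" if "x \<in> carrier P" for x
    using algebraic_tensor_unique[OF alg P, of f "\<lambda>x. x"] f(2) that by blast
  then have "carrier P \<subseteq> D" using clinear_closed[OF f(1)] by fastforce
  then show ?thesis using Dcl(1) by (auto simp: D_def E_def)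
qed

text \<open>The bilinear map lifts to the algebraic tensor product, where commutation makes it
  multiplicative and compatible with adjoints. The norm of its values is then a C*-seminorm, so
  maximality yields contractivity and the map extends to the completion.\<close>

lemma maximal_tensor_extend:
  fixes M C :: "'u cstar"
  assumes max: "maximal_tensor A B M \<tau>" and A: "cstar_algebra A" and B: "cstar_algebra B" and C: "cstar_algebra C"
    and \<pi>: "star_hom A C \<pi>" and \<rho>: "star_hom B C \<rho>"
    and comm: "\<And>a b. \<lbrakk>a \<in> carrier A; b \<in> carrier B\<rbrakk> \<Longrightarrow> \<pi> a \<otimes>\<^bsub>C\<^esub> \<rho> b = \<rho> b \<otimes>\<^bsub>C\<^esub> \<pi> a"
  shows "\<exists>\<sigma>. star_hom M C \<sigma> \<and> (\<forall>a\<in>carrier A. \<forall>b\<in>carrier B. \<sigma> (\<tau> a b) = \<pi> a \<otimes>\<^bsub>C\<^esub> \<rho> b)"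
proof -
  define E where "E = {\<tau> a b | a b. a \<in> carrier A \<and> b \<in> carrier B}"
  define D where "D = cspan M E"
  have M: "cstar_algebra M" and bil: "cbilinear A B M \<tau>"
    and alg: "algebraic_tensor A B (M\<lparr>carrier := D\<rparr>) \<tau>"
    and tmult: "\<And>a b a' b'. \<lbrakk>a \<in> carrier A; b \<in> carrier B; a' \<in> carrier A; b' \<in> carrier B\<rbrakk> \<Longrightarrow>
        \<tau> a b \<otimes>\<^bsub>M\<^esub> \<tau> a' b' = \<tau> (a \<otimes>\<^bsub>A\<^esub> a') (b \<otimes>\<^bsub>B\<^esub> b')"
    and tstar: "\<And>a b. \<lbrakk>a \<in> carrier A; b \<in> carrier B\<rbrakk> \<Longrightarrow> adj M (\<tau> a b) = \<tau> (adj A a) (adj B b)"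
    and dense: "cstar_topology M closure_of D = carrier M"
    and maxp: "\<And>p x. \<lbrakk>cstar_seminorm M D p; x \<in> D\<rbrakk> \<Longrightarrow> p x \<le> nrm M x"
    using max unfolding maximal_tensor_def Let_def E_def[symmetric] D_def[symmetric] by simp_all
  interpret A: cstar_alg A by (rule cstar_alg.intro) fact
  interpret B: cstar_alg B by (rule cstar_alg.intro) fact
  interpret M: cstar_alg M by (rule cstar_alg.intro) fact
  interpret C: cstar_alg C by (rule cstar_alg.intro) fact
  note \<pi>lin = star_hom_clinear[OF \<pi>] and \<rho>lin = star_hom_clinear[OF \<rho>]
  note \<pi>c = clinear_closed[OF \<pi>lin] and \<rho>c = clinear_closed[OF \<rho>lin]
  have tc: "\<tau> a b \<in> carrier M" if "a \<in> carrier A" "b \<in> carrier B" for a b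
    using bil that by (auto simp: cbilinear_def clinear_def)
  have E: "E \<subseteq> carrier M" using tc by (auto simp: E_def)
  note Dcl = M.cspan_closed[OF E, folded D_def]
  note Dind = M.cspan_induct[OF _ E, folded D_def, consumes 1, case_names base zero add sm]
  have Dc: "x \<in> carrier M" if "x \<in> D" for x using Dcl(1) that by auto
  have Ei: "\<tau> a b \<in> E" if "a \<in> carrier A" "b \<in> carrier B" for a b using that by (auto simp: E_def)
  have ED: "x \<in> D" if "x \<in> E" for x using Dcl(2) that by auto
  have "cbilinear A B C (\<lambda>a b. \<pi> a \<otimes>\<^bsub>C\<^esub> \<rho> b)"
    unfolding cbilinear_def
    using \<pi>c \<rho>c by (auto simp: clinear_def clinear_add[OF \<pi>lin] clinear_add[OF \<rho>lin] clinear_sm[OF \<pi>lin]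
        clinear_sm[OF \<rho>lin] C.mult_simps)
  then obtain F where F: "clinear (M\<lparr>carrier := D\<rparr>) C F"
    and F\<tau>: "\<And>a b. \<lbrakk>a \<in> carrier A; b \<in> carrier B\<rbrakk> \<Longrightarrow> F (\<tau> a b) = \<pi> a \<otimes>\<^bsub>C\<^esub> \<rho> b"
    using algebraic_tensor_lift[OF alg C.complex_space] by metis
  have Fc: "F x \<in> carrier C" if "x \<in> D" for x using clinear_closed[OF F] that by simp
  have Fadd: "F (x \<oplus>\<^bsub>M\<^esub> y) = F x \<oplus>\<^bsub>C\<^esub> F y" if "x \<in> D" "y \<in> D" for x y
    using clinear_add[OF F] that by simp
  have Fsm: "F (c \<odot>\<^bsub>M\<^esub> x) = c \<odot>\<^bsub>C\<^esub> F x" if "x \<in> D" for c x using clinear_sm[OF F] that by simp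
  have F0: "F \<zero>\<^bsub>M\<^esub> = \<zero>\<^bsub>C\<^esub>" using Fsm[OF Dcl(3), of 0] Fc[OF Dcl(3)] by simp
  have Fmult_E: "x \<otimes>\<^bsub>M\<^esub> y \<in> D \<and> F (x \<otimes>\<^bsub>M\<^esub> y) = F x \<otimes>\<^bsub>C\<^esub> F y" if xy: "x \<in> E" "y \<in> E" for x y
  proof -
    obtain a b a' b' where ab: "a \<in> carrier A" "b \<in> carrier B" "x = \<tau> a b" "a' \<in> carrier A" "b' \<in> carrier B" "y = \<tau> a' b'"
      using xy by (auto simp: E_def)
    have "x \<otimes>\<^bsub>M\<^esub> y \<in> E" using ab tmult Ei by simp
    moreover have "F (x \<otimes>\<^bsub>M\<^esub> y) = \<pi> a \<otimes>\<^bsub>C\<^esub> \<pi> a' \<otimes>\<^bsub>C\<^esub> (\<rho> b \<otimes>\<^bsub>C\<^esub> \<rho> b')"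
      using ab by (simp add: tmult F\<tau> star_hom_mult[OF \<pi>] star_hom_mult[OF \<rho>])
    moreover have "\<pi> a \<otimes>\<^bsub>C\<^esub> \<pi> a' \<otimes>\<^bsub>C\<^esub> (\<rho> b \<otimes>\<^bsub>C\<^esub> \<rho> b') = \<pi> a \<otimes>\<^bsub>C\<^esub> (\<pi> a' \<otimes>\<^bsub>C\<^esub> \<rho> b) \<otimes>\<^bsub>C\<^esub> \<rho> b'"
      using ab \<pi>c \<rho>c by (simp add: C.m_assoc)
    moreover have "\<dots> = F x \<otimes>\<^bsub>C\<^esub> F y"
      using ab \<pi>c \<rho>c by (simp add: F\<tau> comm[OF ab(4,2)] C.m_assoc)
    ultimately show ?thesis using ED by simp
  qed
  \<comment> \<open>Multiplicativity spreads from elementary tensors to their span in one induction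
    for each factor; membership of the product in \<open>D\<close> is carried along.\<close>
  have Fmult1: "x \<otimes>\<^bsub>M\<^esub> y \<in> D \<and> F (x \<otimes>\<^bsub>M\<^esub> y) = F x \<otimes>\<^bsub>C\<^esub> F y" if x: "x \<in> D" and y: "y \<in> E" for x y
    using x
  proof (induction x rule: Dind)
    case zero then show ?case using y ED Dc Dcl(3) Fc by (simp add: F0)
  next
    case (add u v)
    then show ?case using y ED Dc Dcl Fc by (simp add: M.l_distr C.l_distr Fadd)
  next
    case (sm c u)
    then show ?case using y ED Dc Dcl Fc by (simp add: M.sm_mult_l C.sm_mult_l Fsm)
  qed (use Fmult_E y in auto)
  have Fmult: "x \<otimes>\<^bsub>M\<^esub> y \<in> D \<and> F (x \<otimes>\<^bsub>M\<^esub> y) = F x \<otimes>\<^bsub>C\<^esub> F y" if x: "x \<in> D" and y: "y \<in> D" for x y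
    using y
  proof (induction y rule: Dind)
    case zero then show ?case using x Dc Dcl(3) Fc by (simp add: F0)
  next
    case (add u v)
    then show ?case using x Dc Dcl Fc by (simp add: M.r_distr C.r_distr Fadd)
  next
    case (sm c u)
    then show ?case using x Dc Dcl Fc by (simp add: M.sm_mult_r C.sm_mult_r Fsm)
  qed (use Fmult1 x in auto)
  have Fstar: "adj M x \<in> D \<and> F (adj M x) = adj C (F x)" if "x \<in> D" for x
    using that
  proof (induction x rule: Dind)
    case (base x)
    then obtain a b where ab: "a \<in> carrier A" "b \<in> carrier B" "x = \<tau> a b" by (auto simp: E_def)
    have "adj M x \<in> E" using ab by (simp add: tstar Ei)
    moreover have "F (adj M x) = adj C (F x)"
      using ab \<pi>c \<rho>c comm[of "adj A a" "adj B b"]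
      by (simp add: tstar F\<tau> star_hom_star[OF \<pi>] star_hom_star[OF \<rho>] C.star_mult)
    ultimately show ?case using ED by simp
  next
    case zero then show ?case using Dcl(3) by (simp add: F0)
  next
    case (add u v)
    then show ?case using Dc Dcl Fc by (simp add: M.star_add C.star_add Fadd)
  next
    case (sm c u)
    then show ?case using Dc Dcl Fc by (simp add: M.star_sm C.star_sm Fsm)
  qed
  have "cstar_seminorm M D (\<lambda>x. nrm C (F x))"
    unfolding cstar_seminorm_def
    using Fc Fadd Fsm Fmult Fstar C.norm_triangle C.norm_sm C.norm_mult C.norm_cstar by simp
  then have "nrm C (F x) \<le> nrm M x" if "x \<in> D" for x using maxp that by blast
  then obtain G where "star_hom M C G" "\<And>x. x \<in> D \<Longrightarrow> G x = F x"
    using star_hom_extend[OF M C Dcl(1,4,5) _ _ dense Fc Fadd Fsm] Fmult Fstar by blast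
  then show ?thesis using F\<tau> ED Ei by metis
qed

section \<open>The commuting tensor product\<close>

lemma complete_order_embeddingD:
  assumes f: "complete_order_embedding S R f"
  shows "clinear S R f" "inj_on f (carrier S)" "\<And>X. X \<in> pcone S \<Longrightarrow> map_mat f X \<in> pcone R"
    "\<And>X n. \<lbrakk>X \<in> mats S n; map_mat f X \<in> pcone R\<rbrakk> \<Longrightarrow> X \<in> pcone S"
proof -
  let ?Q = "opsys_restrict R (f ` carrier S)"
  have fc: "f \<in> carrier S \<rightarrow> carrier R" and bij: "bij_betw f (carrier S) (carrier ?Q)" and lin: "clinear S ?Q f"
    and cp: "completely_positive S ?Q f" and inv: "completely_positive ?Q S (inv_into (carrier S) f)"
    using f by (auto simp: complete_order_embedding_def complete_order_isomorphism_def)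
  show "clinear S R f" using lin fc by (auto simp: clinear_def opsys_restrict_def)
  show inj: "inj_on f (carrier S)" using bij by (simp add: bij_betw_def)
  show "map_mat f X \<in> pcone R" if "X \<in> pcone S" for X
    using cp that by (auto simp: completely_positive_def opsys_restrict_def)
  show "X \<in> pcone S" if X: "X \<in> mats S n" "map_mat f X \<in> pcone R" for X n
  proof -
    have dim: "dim_row X = n" "dim_col X = n" and ent: "\<And>i j. \<lbrakk>i < n; j < n\<rbrakk> \<Longrightarrow> X $$ (i, j) \<in> carrier S"
      using X(1) unfolding mats_def by auto
    have "elements_mat (map_mat f X) \<subseteq> f ` carrier S"
      using dim ent by (auto dest!: elements_matD)
    with X(2) have "map_mat f X \<in> pcone ?Q" by (simp add: opsys_restrict_def)
    then have "map_mat (inv_into (carrier S) f) (map_mat f X) \<in> pcone S"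
      using inv by (simp add: completely_positive_def)
    moreover have "map_mat (inv_into (carrier S) f) (map_mat f X) = X"
      using dim ent inj by (intro eq_matI) auto
    ultimately show ?thesis by simp
  qed
qed

text \<open>The elements whose images commute with X form a C*-subalgebra: closed under adjoints
  because X is, and topologically closed because \<pi> is contractive. It contains the generators,
  hence everything.\<close>

lemma commutes_on_generated:
  assumes U: "cstar_algebra U" and C: "cstar_algebra C" and \<pi>: "star_hom U C \<pi>" "\<pi> \<one>\<^bsub>U\<^esub> = \<one>\<^bsub>C\<^esub>"
    and X: "X \<subseteq> carrier C" "\<And>x. x \<in> X \<Longrightarrow> adj C x \<in> X"
    and gen: "cstar_subalgebra U hull Y = carrier U"
    and comm: "\<And>y x. \<lbrakk>y \<in> Y; x \<in> X\<rbrakk> \<Longrightarrow> \<pi> y \<otimes>\<^bsub>C\<^esub> x = x \<otimes>\<^bsub>C\<^esub> \<pi> y"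
    and a: "a \<in> carrier U" and x: "x \<in> X"
  shows "\<pi> a \<otimes>\<^bsub>C\<^esub> x = x \<otimes>\<^bsub>C\<^esub> \<pi> a"
proof -
  interpret U: cstar_alg U by (rule cstar_alg.intro) fact
  interpret C: cstar_alg C by (rule cstar_alg.intro) fact
  note lin = star_hom_clinear[OF \<pi>(1)]
  note \<pi>c = clinear_closed[OF lin]
  define B where "B = {a \<in> carrier U. \<forall>x\<in>X. \<pi> a \<otimes>\<^bsub>C\<^esub> x = x \<otimes>\<^bsub>C\<^esub> \<pi> a}"
  have Xc: "\<And>x. x \<in> X \<Longrightarrow> x \<in> carrier C" using X(1) by auto
  have Y: "Y \<subseteq> carrier U" using gen hull_subset[of Y "cstar_subalgebra U"] by simp
  have sm: "c \<odot>\<^bsub>U\<^esub> b \<in> B" if "b \<in> B" for c b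
    using that \<pi>c Xc by (auto simp: B_def clinear_sm[OF lin] C.sm_mult_l C.sm_mult_r)
  have "subring B U"
  proof (rule U.subringI)
    show "B \<subseteq> carrier U" by (auto simp: B_def)
    show "\<one>\<^bsub>U\<^esub> \<in> B" using Xc \<pi>(2) by (auto simp: B_def)
    show "\<ominus>\<^bsub>U\<^esub> h \<in> B" if "h \<in> B" for h
      using sm[OF that, of "-1"] that by (simp add: U.sm_minus_one B_def)
    show "h1 \<oplus>\<^bsub>U\<^esub> h2 \<in> B" if "h1 \<in> B" "h2 \<in> B" for h1 h2
      using that \<pi>c Xc by (auto simp: B_def clinear_add[OF lin] C.l_distr C.r_distr)
    show "h1 \<otimes>\<^bsub>U\<^esub> h2 \<in> B" if h: "h1 \<in> B" "h2 \<in> B" for h1 h2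
    proof -
      have c: "h1 \<in> carrier U" "h2 \<in> carrier U" using h by (auto simp: B_def)
      have "\<pi> h1 \<otimes>\<^bsub>C\<^esub> \<pi> h2 \<otimes>\<^bsub>C\<^esub> x = x \<otimes>\<^bsub>C\<^esub> (\<pi> h1 \<otimes>\<^bsub>C\<^esub> \<pi> h2)" if x: "x \<in> X" for x
      proof -
        have k: "\<pi> h1 \<in> carrier C" "\<pi> h2 \<in> carrier C" "x \<in> carrier C" using c \<pi>c x Xc by auto
        have 1: "\<pi> h1 \<otimes>\<^bsub>C\<^esub> x = x \<otimes>\<^bsub>C\<^esub> \<pi> h1" and 2: "\<pi> h2 \<otimes>\<^bsub>C\<^esub> x = x \<otimes>\<^bsub>C\<^esub> \<pi> h2"
          using h x by (auto simp: B_def)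
        have "\<pi> h1 \<otimes>\<^bsub>C\<^esub> \<pi> h2 \<otimes>\<^bsub>C\<^esub> x = \<pi> h1 \<otimes>\<^bsub>C\<^esub> x \<otimes>\<^bsub>C\<^esub> \<pi> h2" using k by (simp add: C.m_assoc 2)
        also have "\<dots> = x \<otimes>\<^bsub>C\<^esub> (\<pi> h1 \<otimes>\<^bsub>C\<^esub> \<pi> h2)" using k by (simp add: C.m_assoc 1)
        finally show ?thesis .
      qed
      then show ?thesis using c by (simp add: B_def star_hom_mult[OF \<pi>(1)])
    qed
  qed
  moreover have "adj U b \<in> B" if b: "b \<in> B" for b
  proof -
    have bc: "b \<in> carrier U" using b by (simp add: B_def)
    have "\<pi> (adj U b) \<otimes>\<^bsub>C\<^esub> x = x \<otimes>\<^bsub>C\<^esub> \<pi> (adj U b)" if x: "x \<in> X" for x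
    proof -
      have "\<pi> b \<otimes>\<^bsub>C\<^esub> adj C x = adj C x \<otimes>\<^bsub>C\<^esub> \<pi> b" using b X(2)[OF x] by (simp add: B_def)
      then have "adj C (\<pi> b \<otimes>\<^bsub>C\<^esub> adj C x) = adj C (adj C x \<otimes>\<^bsub>C\<^esub> \<pi> b)" by simp
      then show ?thesis using bc \<pi>c Xc[OF x] by (simp add: C.star_mult star_hom_star[OF \<pi>(1)])
    qed
    then show ?thesis using bc by (simp add: B_def)
  qed
  moreover have "closedin (cstar_topology U) B"
    unfolding U.closedin_iff
  proof (intro conjI allI impI)
    show "B \<subseteq> carrier U" by (auto simp: B_def)
    fix Z z assume "range Z \<subseteq> B \<and> U.tends Z z"
    then have Z: "\<And>n. Z n \<in> B" and t: "U.tends Z z" by auto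
    have z: "z \<in> carrier U" using U.tends_carrier(2)[OF t] .
    have Zc: "Z n \<in> carrier U" for n using U.tends_carrier(1)[OF t] .
    have \<pi>t: "C.tends (\<lambda>n. \<pi> (Z n)) (\<pi> z)"
    proof (rule C.tendsI_bound)
      show "nrm C (\<pi> (Z n) \<ominus>\<^bsub>C\<^esub> \<pi> z) \<le> nrm U (Z n \<ominus>\<^bsub>U\<^esub> z)" for n
        using star_hom_contractive[OF U C \<pi>, of "Z n \<ominus>\<^bsub>U\<^esub> z"] Zc z
        by (simp add: clinear_minus[OF U.complex_space C.complex_space lin])
      show "(\<lambda>n. nrm U (Z n \<ominus>\<^bsub>U\<^esub> z)) \<longlonglongrightarrow> 0" using t by (simp add: U.tends_def)
    qed (use \<pi>c Zc z in auto)
    have "\<pi> z \<otimes>\<^bsub>C\<^esub> x = x \<otimes>\<^bsub>C\<^esub> \<pi> z" if x: "x \<in> X" for x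
    proof (rule C.tends_unique)
      show "C.tends (\<lambda>n. \<pi> (Z n) \<otimes>\<^bsub>C\<^esub> x) (\<pi> z \<otimes>\<^bsub>C\<^esub> x)"
        using \<pi>t Xc[OF x] by (intro C.tends_mult) auto
      have "C.tends (\<lambda>n. x \<otimes>\<^bsub>C\<^esub> \<pi> (Z n)) (x \<otimes>\<^bsub>C\<^esub> \<pi> z)"
        using \<pi>t Xc[OF x] by (intro C.tends_mult) auto
      then show "C.tends (\<lambda>n. \<pi> (Z n) \<otimes>\<^bsub>C\<^esub> x) (x \<otimes>\<^bsub>C\<^esub> \<pi> z)"
        using Z x by (simp add: B_def)
    qed
    then show "z \<in> B" using z by (simp add: B_def)
  qed
  ultimately have "cstar_subalgebra U B" using sm by (simp add: cstar_subalgebra_def)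
  moreover have "Y \<subseteq> B" using Y comm by (auto simp: B_def)
  ultimately have "carrier U \<subseteq> B" using hull_minimal[of Y B "cstar_subalgebra U"] gen by simp
  then show ?thesis using a x by (auto simp: B_def)
qed

text \<open>The embedding is only given as a unital complete isometry. The later arguments compose
  it as a ucp map, which is what \<open>completely_isometric_ucp\<close> provides.\<close>

lemma universal_cstar_algebraD:
  assumes "universal_cstar_algebra S U \<iota>" and S: "operator_system S"
  shows "cstar_algebra U" "ucp S (cstar_opsys U) \<iota>" "cstar_subalgebra U hull (\<iota> ` carrier S) = carrier U"
proof -
  show U: "cstar_algebra U" and "cstar_subalgebra U hull (\<iota> ` carrier S) = carrier U"
    using assms by (simp_all add: universal_cstar_algebra_def)
  interpret U: cstar_alg U by (rule cstar_alg.intro[OF U])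
  show "ucp S (cstar_opsys U) \<iota>"
    using assms completely_isometric_ucp[OF S U.operator_system]
    by (simp add: universal_cstar_algebra_def)
qed

lemma universal_cstar_algebra_lift:
  fixes U A :: "'u cstar"
  assumes U: "universal_cstar_algebra S U \<iota>" and A: "cstar_algebra A" and f: "ucp S (cstar_opsys A) f"
    and S: "operator_system S"
  obtains \<pi> where "star_hom U A \<pi>" "\<pi> \<one>\<^bsub>U\<^esub> = \<one>\<^bsub>A\<^esub>" "\<And>s. s \<in> carrier S \<Longrightarrow> \<pi> (\<iota> s) = f s"
proof -
  interpret S: opsys S by (rule opsys.intro) fact
  obtain \<pi> where \<pi>: "star_hom U A \<pi>" "\<forall>s\<in>carrier S. \<pi> (\<iota> s) = f s"
    using U A f unfolding universal_cstar_algebra_def by blast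
  have "\<iota> \<one>\<^bsub>S\<^esub> = \<one>\<^bsub>U\<^esub>" using U by (simp add: universal_cstar_algebra_def)
  then have "\<pi> \<one>\<^bsub>U\<^esub> = f \<one>\<^bsub>S\<^esub>" using \<pi>(2) S.one_in by metis
  then show thesis using that \<pi> ucp_one[OF f] by simp
qed

lemma ucp_range_star:
  assumes "operator_system S" "cstar_algebra C" "ucp S (cstar_opsys C) f" "x \<in> f ` carrier S"
  shows "x \<in> carrier C" "adj C x \<in> f ` carrier S"
proof -
  interpret S: opsys S by (rule opsys.intro) fact
  interpret C: cstar_alg C by (rule cstar_alg.intro) fact
  obtain s where s: "s \<in> carrier S" "x = f s" using assms(4) by auto
  show "x \<in> carrier C" using clinear_closed[OF ucp_clinear[OF assms(3)] s(1)] s by simp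
  have "adj C x = f (adj S s)" using ucp_star[OF assms(1) C.operator_system assms(3) s(1)] s by simp
  then show "adj C x \<in> f ` carrier S" using s by auto
qed

text \<open>Pass to the star homomorphisms of the universal C*-algebras, multiply them on the
  maximal tensor product, and restrict along the embedding of \<open>P\<close>. The work lies in
  carrying the commutation over from the operator systems.\<close>

lemma commuting_tensor_lift:
  fixes S T P :: "'u opsys" and C :: "'u cstar"
  assumes ct: "commuting_tensor S T P \<theta>" and S: "operator_system S" and T: "operator_system T"
    and C: "cstar_algebra C" and f: "ucp S (cstar_opsys C) f" and g: "ucp T (cstar_opsys C) g"
    and comm: "\<And>s t. \<lbrakk>s \<in> carrier S; t \<in> carrier T\<rbrakk> \<Longrightarrow> f s \<otimes>\<^bsub>C\<^esub> g t = g t \<otimes>\<^bsub>C\<^esub> f s"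
  obtains h where "ucp P (cstar_opsys C) h"
    "\<And>s t. \<lbrakk>s \<in> carrier S; t \<in> carrier T\<rbrakk> \<Longrightarrow> h (\<theta> s t) = f s \<otimes>\<^bsub>C\<^esub> g t"
proof -
  obtain U \<iota> W \<kappa> M \<tau> j where U: "universal_cstar_algebra S U \<iota>" and W: "universal_cstar_algebra T W \<kappa>"
    and M: "maximal_tensor U W M \<tau>" and j: "complete_order_embedding P (cstar_opsys M) j" "j \<one>\<^bsub>P\<^esub> = \<one>\<^bsub>M\<^esub>"
    and j\<theta>: "\<And>s t. \<lbrakk>s \<in> carrier S; t \<in> carrier T\<rbrakk> \<Longrightarrow> j (\<theta> s t) = \<tau> (\<iota> s) (\<kappa> t)"
    using ct unfolding commuting_tensor_def by blast
  note Ud = universal_cstar_algebraD[OF U S] and Wd = universal_cstar_algebraD[OF W T]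
  interpret U: cstar_alg U by (rule cstar_alg.intro[OF Ud(1)])
  interpret W: cstar_alg W by (rule cstar_alg.intro[OF Wd(1)])
  interpret C: cstar_alg C by (rule cstar_alg.intro[OF C])
  have Mc: "cstar_algebra M" and M1: "\<tau> \<one>\<^bsub>U\<^esub> \<one>\<^bsub>W\<^esub> = \<one>\<^bsub>M\<^esub>"
    using M by (simp_all add: maximal_tensor_def Let_def)
  obtain \<pi> where \<pi>: "star_hom U C \<pi>" "\<pi> \<one>\<^bsub>U\<^esub> = \<one>\<^bsub>C\<^esub>" "\<And>s. s \<in> carrier S \<Longrightarrow> \<pi> (\<iota> s) = f s"
    using universal_cstar_algebra_lift[OF U C f S] by blast
  obtain \<rho> where \<rho>: "star_hom W C \<rho>" "\<rho> \<one>\<^bsub>W\<^esub> = \<one>\<^bsub>C\<^esub>" "\<And>t. t \<in> carrier T \<Longrightarrow> \<rho> (\<kappa> t) = g t"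
    using universal_cstar_algebra_lift[OF W C g T] by blast
  \<comment> \<open>Commutation spreads in two rounds: first to all of \<open>U\<close> against the
    range of g, then to all of \<open>W\<close>, with the whole range of \<pi> in the role of the
    commuting set.\<close>
  have c1: "\<pi> a \<otimes>\<^bsub>C\<^esub> x = x \<otimes>\<^bsub>C\<^esub> \<pi> a" if "a \<in> carrier U" "x \<in> g ` carrier T" for a x
    by (rule commutes_on_generated[OF Ud(1) C \<pi>(1,2) _ _ Ud(3) _ that])
      (use ucp_range_star[OF T C g] comm \<pi>(3) in auto)
  have \<pi>r: "x \<in> carrier C" "adj C x \<in> \<pi> ` carrier U" if "x \<in> \<pi> ` carrier U" for x
    using that clinear_closed[OF star_hom_clinear[OF \<pi>(1)]] U.star_closed
    by (auto simp flip: star_hom_star[OF \<pi>(1)])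
  have c2: "\<rho> b \<otimes>\<^bsub>C\<^esub> x = x \<otimes>\<^bsub>C\<^esub> \<rho> b" if "b \<in> carrier W" "x \<in> \<pi> ` carrier U" for b x
    by (rule commutes_on_generated[OF Wd(1) C \<rho>(1,2) _ _ Wd(3) _ that])
      (use \<pi>r c1 \<rho>(3) in auto)
  obtain \<sigma> where \<sigma>: "star_hom M C \<sigma>" "\<And>a b. \<lbrakk>a \<in> carrier U; b \<in> carrier W\<rbrakk> \<Longrightarrow> \<sigma> (\<tau> a b) = \<pi> a \<otimes>\<^bsub>C\<^esub> \<rho> b"
    using maximal_tensor_extend[OF M Ud(1) Wd(1) C \<pi>(1) \<rho>(1)] c2 by fastforce
  have "\<sigma> \<one>\<^bsub>M\<^esub> = \<one>\<^bsub>C\<^esub>" using \<sigma>(2)[of "\<one>\<^bsub>U\<^esub>" "\<one>\<^bsub>W\<^esub>"] M1 \<pi>(2) \<rho>(2) by simp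
  then have "ucp (cstar_opsys M) (cstar_opsys C) \<sigma>" using star_hom_ucp[OF Mc C \<sigma>(1)] by simp
  moreover have "ucp P (cstar_opsys M) j"
    using complete_order_embeddingD[OF j(1)] j(2) by (auto simp: ucp_def completely_positive_def)
  ultimately have "ucp P (cstar_opsys C) (\<sigma> \<circ> j)" by (rule ucp_comp[rotated])
  moreover have "(\<sigma> \<circ> j) (\<theta> s t) = f s \<otimes>\<^bsub>C\<^esub> g t" if "s \<in> carrier S" "t \<in> carrier T" for s t
    using that j\<theta> \<sigma>(2)[of "\<iota> s" "\<kappa> t"] \<pi>(3) \<rho>(3) clinear_closed[OF ucp_clinear[OF Ud(2)]]
      clinear_closed[OF ucp_clinear[OF Wd(2)]] by simp
  ultimately show thesis using that by blast
qed

text \<open>The converse to \<open>commuting_tensor_lift\<close>: the concrete pair \<iota> s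
  \<otimes> 1 and 1 \<otimes> \<kappa> t. From here on only a commuting pair and an embedding into a
  C*-algebra are visible, and no longer the tensor product of algebras.\<close>

lemma commuting_tensor_represent:
  fixes S T P :: "'u opsys"
  assumes ct: "commuting_tensor S T P \<theta>" and S: "operator_system S" and T: "operator_system T"
  obtains M :: "'u cstar" and f g j where "cstar_algebra M" "ucp S (cstar_opsys M) f" "ucp T (cstar_opsys M) g"
    "\<And>s t. \<lbrakk>s \<in> carrier S; t \<in> carrier T\<rbrakk> \<Longrightarrow> f s \<otimes>\<^bsub>M\<^esub> g t = g t \<otimes>\<^bsub>M\<^esub> f s"
    "complete_order_embedding P (cstar_opsys M) j" "j \<one>\<^bsub>P\<^esub> = \<one>\<^bsub>M\<^esub>"
    "\<And>s t. \<lbrakk>s \<in> carrier S; t \<in> carrier T\<rbrakk> \<Longrightarrow> j (\<theta> s t) = f s \<otimes>\<^bsub>M\<^esub> g t"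
proof -
  obtain U \<iota> W \<kappa> M \<tau> j where U: "universal_cstar_algebra S U \<iota>" and W: "universal_cstar_algebra T W \<kappa>"
    and M: "maximal_tensor U W M \<tau>" and j: "complete_order_embedding P (cstar_opsys M) j" "j \<one>\<^bsub>P\<^esub> = \<one>\<^bsub>M\<^esub>"
    and j\<theta>: "\<And>s t. \<lbrakk>s \<in> carrier S; t \<in> carrier T\<rbrakk> \<Longrightarrow> j (\<theta> s t) = \<tau> (\<iota> s) (\<kappa> t)"
    using ct unfolding commuting_tensor_def by blast
  note Ud = universal_cstar_algebraD[OF U S] and Wd = universal_cstar_algebraD[OF W T]
  interpret U: cstar_alg U by (rule cstar_alg.intro[OF Ud(1)])
  interpret W: cstar_alg W by (rule cstar_alg.intro[OF Wd(1)])
  have Mc: "cstar_algebra M" and M1: "\<tau> \<one>\<^bsub>U\<^esub> \<one>\<^bsub>W\<^esub> = \<one>\<^bsub>M\<^esub>" and bil: "cbilinear U W M \<tau>"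
    and tmult: "\<And>a b a' b'. \<lbrakk>a \<in> carrier U; b \<in> carrier W; a' \<in> carrier U; b' \<in> carrier W\<rbrakk> \<Longrightarrow>
        \<tau> a b \<otimes>\<^bsub>M\<^esub> \<tau> a' b' = \<tau> (a \<otimes>\<^bsub>U\<^esub> a') (b \<otimes>\<^bsub>W\<^esub> b')"
    and tstar: "\<And>a b. \<lbrakk>a \<in> carrier U; b \<in> carrier W\<rbrakk> \<Longrightarrow> adj M (\<tau> a b) = \<tau> (adj U a) (adj W b)"
    using M by (simp_all add: maximal_tensor_def Let_def)
  have "star_hom U M (\<lambda>a. \<tau> a \<one>\<^bsub>W\<^esub>)"
    using bil by (auto simp: star_hom_def cbilinear_def tmult tstar)
  then have uf: "ucp (cstar_opsys U) (cstar_opsys M) (\<lambda>a. \<tau> a \<one>\<^bsub>W\<^esub>)"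
    using star_hom_ucp[OF Ud(1) Mc] M1 by simp
  have "star_hom W M (\<tau> \<one>\<^bsub>U\<^esub>)"
    using bil by (auto simp: star_hom_def cbilinear_def tmult tstar)
  then have ug: "ucp (cstar_opsys W) (cstar_opsys M) (\<tau> \<one>\<^bsub>U\<^esub>)"
    using star_hom_ucp[OF Wd(1) Mc] M1 by simp
  have \<iota>c: "\<iota> s \<in> carrier U" if "s \<in> carrier S" for s using clinear_closed[OF ucp_clinear[OF Ud(2)] that] by simp
  have \<kappa>c: "\<kappa> t \<in> carrier W" if "t \<in> carrier T" for t using clinear_closed[OF ucp_clinear[OF Wd(2)] that] by simp
  show thesis
  proof (rule that[of M "(\<lambda>a. \<tau> a \<one>\<^bsub>W\<^esub>) \<circ> \<iota>" "\<tau> \<one>\<^bsub>U\<^esub> \<circ> \<kappa>" j])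
    show "ucp S (cstar_opsys M) ((\<lambda>a. \<tau> a \<one>\<^bsub>W\<^esub>) \<circ> \<iota>)" by (rule ucp_comp[OF Ud(2) uf])
    show "ucp T (cstar_opsys M) (\<tau> \<one>\<^bsub>U\<^esub> \<circ> \<kappa>)" by (rule ucp_comp[OF Wd(2) ug])
  qed (use Mc j j\<theta> \<iota>c \<kappa>c tmult in auto)
qed

section \<open>Quotients by the kernel of a seminorm\<close>

text \<open>The quotient has to be carried by the type \<open>'u\<close> of the test objects in the universal properties,
  so a class is represented by the code of a chosen member.\<close>

locale star_quotient = E: star_alg E for E :: "('v, 'm) star_space_scheme" +
  fixes q :: "'v \<Rightarrow> real" and enc :: "'v \<Rightarrow> 'u"
  assumes q: "cstar_seminorm E (carrier E) q" and enc: "inj enc"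
begin

lemma q_nonneg [simp]: "x \<in> carrier E \<Longrightarrow> 0 \<le> q x"
  and q_triangle: "\<lbrakk>x \<in> carrier E; y \<in> carrier E\<rbrakk> \<Longrightarrow> q (x \<oplus>\<^bsub>E\<^esub> y) \<le> q x + q y"
  and q_sm: "x \<in> carrier E \<Longrightarrow> q (c \<odot>\<^bsub>E\<^esub> x) = cmod c * q x"
  and q_mult: "\<lbrakk>x \<in> carrier E; y \<in> carrier E\<rbrakk> \<Longrightarrow> q (x \<otimes>\<^bsub>E\<^esub> y) \<le> q x * q y"
  and q_cstar: "x \<in> carrier E \<Longrightarrow> q (adj E x \<otimes>\<^bsub>E\<^esub> x) = (q x)\<^sup>2"
  using q by (simp_all add: cstar_seminorm_def)

lemma q_uminus: "x \<in> carrier E \<Longrightarrow> q (\<ominus>\<^bsub>E\<^esub> x) = q x"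
  using q_sm[of x "-1"] by (simp add: E.sm_minus_one)

lemma q_zero: "q \<zero>\<^bsub>E\<^esub> = 0"
  using q_sm[of "\<zero>\<^bsub>E\<^esub>" 0] by simp

lemma q_star_le:
  assumes y: "y \<in> carrier E" shows "q y \<le> q (adj E y)"
proof (cases "q y = 0")
  case False
  with y have "q y > 0" using q_nonneg[of y] by linarith
  moreover have "q y * q y \<le> q (adj E y) * q y"
    using q_mult[of "adj E y" y] q_cstar[of y] y by (simp add: power2_eq_square)
  ultimately show ?thesis by simp
qed (use y in simp)

lemma q_star: "x \<in> carrier E \<Longrightarrow> q (adj E x) = q x"
  using q_star_le[of x] q_star_le[of "adj E x"] by simp

lemma q_minus_commute: "\<lbrakk>x \<in> carrier E; y \<in> carrier E\<rbrakk> \<Longrightarrow> q (x \<ominus>\<^bsub>E\<^esub> y) = q (y \<ominus>\<^bsub>E\<^esub> x)"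
  using q_uminus[of "x \<ominus>\<^bsub>E\<^esub> y"] by (simp add: E.minus_eq E.minus_add E.a_comm)

lemma q_diff_triangle:
  assumes "x \<in> carrier E" "y \<in> carrier E" "z \<in> carrier E"
  shows "q (x \<ominus>\<^bsub>E\<^esub> z) \<le> q (x \<ominus>\<^bsub>E\<^esub> y) + q (y \<ominus>\<^bsub>E\<^esub> z)"
proof -
  have "x \<ominus>\<^bsub>E\<^esub> z = (x \<ominus>\<^bsub>E\<^esub> y) \<oplus>\<^bsub>E\<^esub> (y \<ominus>\<^bsub>E\<^esub> z)" using assms by (intro E.sep) (auto simp: E.alg_simps)
  with assms show ?thesis using q_triangle[of "x \<ominus>\<^bsub>E\<^esub> y" "y \<ominus>\<^bsub>E\<^esub> z"] by simp
qed

lemma q_le_diff: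
  assumes "x \<in> carrier E" "y \<in> carrier E" shows "q x \<le> q y + q (x \<ominus>\<^bsub>E\<^esub> y)"
proof -
  have "x = y \<oplus>\<^bsub>E\<^esub> (x \<ominus>\<^bsub>E\<^esub> y)" using assms by (intro E.sep) (auto simp: E.alg_simps)
  with assms show ?thesis using q_triangle[of y "x \<ominus>\<^bsub>E\<^esub> y"] by simp
qed

text \<open>For equivalent elements the chosen predicate is literally the same, so the choice
  depends only on the class, and equality of classes becomes equality of representatives.\<close>

definition rep :: "'v \<Rightarrow> 'v" where
  "rep x = (SOME y. y \<in> carrier E \<and> q (x \<ominus>\<^bsub>E\<^esub> y) = 0)"

lemma rep: "x \<in> carrier E \<Longrightarrow> rep x \<in> carrier E \<and> q (x \<ominus>\<^bsub>E\<^esub> rep x) = 0"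
  unfolding rep_def by (rule someI[of _ x]) (simp add: E.minus_eq E.r_neg q_zero)

lemma rep_eq_iff:
  assumes x: "x \<in> carrier E" and y: "y \<in> carrier E"
  shows "rep x = rep y \<longleftrightarrow> q (x \<ominus>\<^bsub>E\<^esub> y) = 0"
proof
  assume "rep x = rep y"
  then have "q (x \<ominus>\<^bsub>E\<^esub> y) \<le> 0"
    using q_diff_triangle[of x "rep x" y] rep[OF x] rep[OF y] q_minus_commute[of y "rep y"] x y by simp
  then show "q (x \<ominus>\<^bsub>E\<^esub> y) = 0" using q_nonneg[OF E.minus_closed[OF x y]] by simp
next
  assume 0: "q (x \<ominus>\<^bsub>E\<^esub> y) = 0"
  have "q (x \<ominus>\<^bsub>E\<^esub> z) = 0 \<longleftrightarrow> q (y \<ominus>\<^bsub>E\<^esub> z) = 0" if z: "z \<in> carrier E" for z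
    using q_diff_triangle[OF x y z] q_diff_triangle[OF y x z] q_minus_commute[OF x y] 0
      q_nonneg[of "x \<ominus>\<^bsub>E\<^esub> z"] q_nonneg[of "y \<ominus>\<^bsub>E\<^esub> z"] x y z by auto
  then have "(\<lambda>z. z \<in> carrier E \<and> q (x \<ominus>\<^bsub>E\<^esub> z) = 0) = (\<lambda>z. z \<in> carrier E \<and> q (y \<ominus>\<^bsub>E\<^esub> z) = 0)" by auto
  then show "rep x = rep y" unfolding rep_def by simp
qed

lemma q_rep: "x \<in> carrier E \<Longrightarrow> q (rep x) = q x"
  using q_le_diff[of x "rep x"] q_le_diff[of "rep x" x] rep[of x] q_minus_commute[of x "rep x"] by simp

definition pr :: "'v \<Rightarrow> 'u" where "pr x = enc (rep x)"

definition dec :: "'u \<Rightarrow> 'v" where "dec = inv_into UNIV enc"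

definition quot :: "'u cstar" where
  "quot = \<lparr>carrier = pr ` carrier E, monoid.mult = (\<lambda>a b. pr (dec a \<otimes>\<^bsub>E\<^esub> dec b)), one = pr \<one>\<^bsub>E\<^esub>, zero = pr \<zero>\<^bsub>E\<^esub>,
     add = (\<lambda>a b. pr (dec a \<oplus>\<^bsub>E\<^esub> dec b)), module.smult = (\<lambda>c a. pr (c \<odot>\<^bsub>E\<^esub> dec a)),
     adj = (\<lambda>a. pr (adj E (dec a))), nrm = (\<lambda>a. q (dec a))\<rparr>"

lemma dec_pr [simp]: "dec (pr x) = rep x"
  by (simp add: dec_def pr_def enc)

lemma pr_eq_iff: "\<lbrakk>x \<in> carrier E; y \<in> carrier E\<rbrakk> \<Longrightarrow> pr x = pr y \<longleftrightarrow> q (x \<ominus>\<^bsub>E\<^esub> y) = 0"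
  using rep_eq_iff enc by (simp add: pr_def inj_eq)

lemma pr_eqI: "\<lbrakk>x \<in> carrier E; y \<in> carrier E; q (x \<ominus>\<^bsub>E\<^esub> y) \<le> 0\<rbrakk> \<Longrightarrow> pr x = pr y"
  using pr_eq_iff q_nonneg[of "x \<ominus>\<^bsub>E\<^esub> y"] by (simp add: order_antisym)

lemma quot_carrier: "carrier quot = pr ` carrier E"
  by (simp add: quot_def)

lemma quot_one: "\<one>\<^bsub>quot\<^esub> = pr \<one>\<^bsub>E\<^esub>" and quot_zero: "\<zero>\<^bsub>quot\<^esub> = pr \<zero>\<^bsub>E\<^esub>"
  by (simp_all add: quot_def)

lemma quot_norm: "x \<in> carrier E \<Longrightarrow> nrm quot (pr x) = q x"
  by (simp add: quot_def q_rep)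

lemma quot_add:
  assumes "x \<in> carrier E" "y \<in> carrier E" shows "pr x \<oplus>\<^bsub>quot\<^esub> pr y = pr (x \<oplus>\<^bsub>E\<^esub> y)"
proof -
  have c: "rep x \<in> carrier E" "rep y \<in> carrier E" using rep assms by auto
  have "(rep x \<oplus>\<^bsub>E\<^esub> rep y) \<ominus>\<^bsub>E\<^esub> (x \<oplus>\<^bsub>E\<^esub> y) = (rep x \<ominus>\<^bsub>E\<^esub> x) \<oplus>\<^bsub>E\<^esub> (rep y \<ominus>\<^bsub>E\<^esub> y)"
    using c assms by (intro E.sep) (auto simp: E.alg_simps)
  then have "q ((rep x \<oplus>\<^bsub>E\<^esub> rep y) \<ominus>\<^bsub>E\<^esub> (x \<oplus>\<^bsub>E\<^esub> y)) \<le> 0"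
    using q_triangle[of "rep x \<ominus>\<^bsub>E\<^esub> x" "rep y \<ominus>\<^bsub>E\<^esub> y"] c assms rep[OF assms(1)] rep[OF assms(2)]
      q_minus_commute[of x "rep x"] q_minus_commute[of y "rep y"] by simp
  then show ?thesis using c assms by (simp add: quot_def pr_eqI)
qed

lemma quot_sm:
  assumes "x \<in> carrier E" shows "c \<odot>\<^bsub>quot\<^esub> pr x = pr (c \<odot>\<^bsub>E\<^esub> x)"
proof -
  have r: "rep x \<in> carrier E" "q (rep x \<ominus>\<^bsub>E\<^esub> x) = 0" using rep[OF assms] q_minus_commute[of x "rep x"] assms by auto
  have "c \<odot>\<^bsub>E\<^esub> rep x \<ominus>\<^bsub>E\<^esub> c \<odot>\<^bsub>E\<^esub> x = c \<odot>\<^bsub>E\<^esub> (rep x \<ominus>\<^bsub>E\<^esub> x)"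
    using r assms by (intro E.sep) (auto simp: E.alg_simps algebra_simps)
  then have "q (c \<odot>\<^bsub>E\<^esub> rep x \<ominus>\<^bsub>E\<^esub> c \<odot>\<^bsub>E\<^esub> x) \<le> 0" using q_sm r assms by simp
  then show ?thesis using r assms by (simp add: quot_def pr_eqI)
qed

lemma quot_mult:
  assumes "x \<in> carrier E" "y \<in> carrier E" shows "pr x \<otimes>\<^bsub>quot\<^esub> pr y = pr (x \<otimes>\<^bsub>E\<^esub> y)"
proof -
  have r: "rep x \<in> carrier E" "q (rep x \<ominus>\<^bsub>E\<^esub> x) = 0" "rep y \<in> carrier E" "q (rep y \<ominus>\<^bsub>E\<^esub> y) = 0"
    using rep q_minus_commute[of x "rep x"] q_minus_commute[of y "rep y"] assms by auto
  have "(rep x \<otimes>\<^bsub>E\<^esub> rep y) \<ominus>\<^bsub>E\<^esub> (x \<otimes>\<^bsub>E\<^esub> y) = (rep x \<ominus>\<^bsub>E\<^esub> x) \<otimes>\<^bsub>E\<^esub> rep y \<oplus>\<^bsub>E\<^esub> x \<otimes>\<^bsub>E\<^esub> (rep y \<ominus>\<^bsub>E\<^esub> y)"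
    using r assms by (intro E.sep) (auto simp: E.alg_simps)
  then have "q ((rep x \<otimes>\<^bsub>E\<^esub> rep y) \<ominus>\<^bsub>E\<^esub> (x \<otimes>\<^bsub>E\<^esub> y)) \<le> 0"
    using q_triangle[of "(rep x \<ominus>\<^bsub>E\<^esub> x) \<otimes>\<^bsub>E\<^esub> rep y" "x \<otimes>\<^bsub>E\<^esub> (rep y \<ominus>\<^bsub>E\<^esub> y)"] r assms
      q_mult[of "rep x \<ominus>\<^bsub>E\<^esub> x" "rep y"] q_mult[of x "rep y \<ominus>\<^bsub>E\<^esub> y"] by simp
  then show ?thesis using r assms by (simp add: quot_def pr_eqI)
qed

lemma quot_star:
  assumes "x \<in> carrier E" shows "adj quot (pr x) = pr (adj E x)"
proof -
  have r: "rep x \<in> carrier E" "q (rep x \<ominus>\<^bsub>E\<^esub> x) = 0" using rep[OF assms] q_minus_commute[of x "rep x"] assms by auto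
  have "q (adj E (rep x) \<ominus>\<^bsub>E\<^esub> adj E x) \<le> 0" using q_star[of "rep x \<ominus>\<^bsub>E\<^esub> x"] r assms by (simp add: E.star_minus)
  then show ?thesis using r assms by (simp add: quot_def pr_eqI)
qed

lemmas quot_simps = quot_carrier quot_one quot_zero quot_add quot_sm quot_mult quot_star quot_norm

lemma quot_abelian_group: "abelian_group quot"
proof (rule abelian_groupI)
  fix a assume "a \<in> carrier quot"
  then obtain x where x: "x \<in> carrier E" "a = pr x" by (auto simp: quot_carrier)
  then show "\<exists>b\<in>carrier quot. b \<oplus>\<^bsub>quot\<^esub> a = \<zero>\<^bsub>quot\<^esub>"
    by (intro bexI[of _ "pr (\<ominus>\<^bsub>E\<^esub> x)"]) (auto simp: quot_simps E.l_neg)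
qed (auto simp: quot_simps E.a_ac)

lemma quot_star_algebra: "star_algebra quot"
proof -
  have "ring quot"
    by (intro ringI quot_abelian_group monoidI) (auto simp: quot_simps E.m_assoc E.l_distr E.r_distr)
  moreover have "complex_space quot"
    by (intro complex_spaceI quot_abelian_group) (auto simp: quot_simps E.sm_ldistr E.sm_rdistr E.sm_assoc)
  moreover have "star_vector_space quot"
    unfolding star_vector_space_def using calculation(2) by (auto simp: quot_simps E.star_add E.star_sm)
  ultimately show ?thesis
    unfolding star_algebra_def by (auto simp: quot_simps E.sm_mult_l E.sm_mult_r E.star_mult)
qed

lemma quot_minus:
  assumes "x \<in> carrier E" "y \<in> carrier E" shows "pr x \<ominus>\<^bsub>quot\<^esub> pr y = pr (x \<ominus>\<^bsub>E\<^esub> y)"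
proof -
  interpret Q: star_alg quot by (rule star_alg.intro[OF quot_star_algebra])
  have "pr y \<in> carrier quot" using assms by (simp add: quot_carrier)
  then have "\<ominus>\<^bsub>quot\<^esub> pr y = pr (\<ominus>\<^bsub>E\<^esub> y)" using Q.sm_minus_one[of "pr y"] assms by (simp add: quot_sm E.sm_minus_one)
  then show ?thesis using assms by (simp add: Q.minus_eq E.minus_eq quot_add)
qed

lemma quot_cstar_algebra:
  assumes complete: "\<And>X. \<lbrakk>\<And>n::nat. X n \<in> carrier E; \<And>e. e > 0 \<Longrightarrow> \<exists>N. \<forall>m\<ge>N. \<forall>n\<ge>N. q (X m \<ominus>\<^bsub>E\<^esub> X n) < e\<rbrakk>
    \<Longrightarrow> \<exists>x\<in>carrier E. (\<lambda>n. q (X n \<ominus>\<^bsub>E\<^esub> x)) \<longlonglongrightarrow> 0"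
  shows "cstar_algebra quot"
proof -
  have sn: "cstar_seminorm quot (carrier quot) (nrm quot)"
    unfolding cstar_seminorm_def using q_triangle q_sm q_mult q_cstar by (auto simp: quot_simps)
  have "a = \<zero>\<^bsub>quot\<^esub>" if a: "a \<in> carrier quot" "nrm quot a = 0" for a
  proof -
    obtain x where x: "x \<in> carrier E" "a = pr x" using a by (auto simp: quot_carrier)
    then show ?thesis using a(2) by (auto simp: quot_simps E.minus_eq intro!: pr_eqI)
  qed
  then interpret Q: pre_cstar_alg quot
    using sn by (intro pre_cstar_alg.intro pre_cstar_alg_axioms.intro star_alg.intro quot_star_algebra)
  show ?thesis
  proof (rule Q.cstar_algebraI)
    fix Z :: "nat \<Rightarrow> 'u" assume Z: "\<And>n. Z n \<in> carrier quot"
      and cau: "\<And>e. e > 0 \<Longrightarrow> \<exists>N. \<forall>m\<ge>N. \<forall>n\<ge>N. nrm quot (Z m \<ominus>\<^bsub>quot\<^esub> Z n) < e"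
    from Z have "\<forall>n. \<exists>x. x \<in> carrier E \<and> Z n = pr x" by (auto simp: quot_carrier)
    then obtain X where X: "\<And>n. X n \<in> carrier E" "\<And>n. Z n = pr (X n)" by metis
    have "\<exists>x\<in>carrier E. (\<lambda>n. q (X n \<ominus>\<^bsub>E\<^esub> x)) \<longlonglongrightarrow> 0"
      using cau X by (intro complete) (auto simp: quot_minus quot_norm)
    then obtain x where "x \<in> carrier E" "(\<lambda>n. q (X n \<ominus>\<^bsub>E\<^esub> x)) \<longlonglongrightarrow> 0" by blast
    then have "Q.tends Z (pr x)" using X by (simp add: Q.tends_def quot_minus quot_norm quot_carrier)
    then show "\<exists>a. Q.tends Z a" ..
  qed
qed

end

section \<open>Bounded sequences modulo null sequences\<close>

locale cstar_sequence =
  fixes M :: "nat \<Rightarrow> 'u cstar" and enc :: "(nat \<Rightarrow> 'u) \<Rightarrow> 'u"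
  assumes M: "\<And>k. cstar_algebra (M k)" and enc: "inj enc"
begin

sublocale M: cstar_alg "M k" for k
  by (rule cstar_alg.intro[OF M])

text \<open>A star algebra without a norm field: the seminorm of interest is \<open>tnorm\<close>,
  and boundedness is needed only to make that finite.\<close>

definition bseq :: "(nat \<Rightarrow> 'u) star_space" where
  "bseq = \<lparr>carrier = {x. (\<forall>k. x k \<in> carrier (M k)) \<and> (\<exists>b. \<forall>k. nrm (M k) (x k) \<le> b)},
     monoid.mult = (\<lambda>x y k. x k \<otimes>\<^bsub>M k\<^esub> y k), one = (\<lambda>k. \<one>\<^bsub>M k\<^esub>), zero = (\<lambda>k. \<zero>\<^bsub>M k\<^esub>),
     add = (\<lambda>x y k. x k \<oplus>\<^bsub>M k\<^esub> y k), module.smult = (\<lambda>c x k. c \<odot>\<^bsub>M k\<^esub> x k), adj = (\<lambda>x k. adj (M k) (x k))\<rparr>"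

lemma bseq_simps [simp]:
  "monoid.mult bseq = (\<lambda>x y k. x k \<otimes>\<^bsub>M k\<^esub> y k)" "one bseq = (\<lambda>k. \<one>\<^bsub>M k\<^esub>)" "zero bseq = (\<lambda>k. \<zero>\<^bsub>M k\<^esub>)"
  "add bseq = (\<lambda>x y k. x k \<oplus>\<^bsub>M k\<^esub> y k)" "module.smult bseq = (\<lambda>c x k. c \<odot>\<^bsub>M k\<^esub> x k)"
  "adj bseq = (\<lambda>x k. adj (M k) (x k))"
  by (simp_all add: bseq_def)

lemma bseqI: "\<lbrakk>\<And>k. x k \<in> carrier (M k); \<And>k. nrm (M k) (x k) \<le> b\<rbrakk> \<Longrightarrow> x \<in> carrier bseq"
  by (auto simp: bseq_def)

lemma bseq_in: "x \<in> carrier bseq \<Longrightarrow> x k \<in> carrier (M k)"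
  by (simp add: bseq_def)

lemma bseq_bounded: "x \<in> carrier bseq \<Longrightarrow> \<exists>b\<ge>0. \<forall>k. nrm (M k) (x k) \<le> b"
proof -
  assume x: "x \<in> carrier bseq"
  then obtain b where b: "\<forall>k. nrm (M k) (x k) \<le> b" by (auto simp: bseq_def)
  moreover have "0 \<le> b" using b M.norm_nonneg[OF bseq_in[OF x, of 0]] order_trans by blast
  ultimately show ?thesis by blast
qed

lemma bseq_closed:
  assumes x: "x \<in> carrier bseq" and y: "y \<in> carrier bseq"
  shows "(\<lambda>k. x k \<otimes>\<^bsub>M k\<^esub> y k) \<in> carrier bseq" "(\<lambda>k. x k \<oplus>\<^bsub>M k\<^esub> y k) \<in> carrier bseq"
    "(\<lambda>k. c \<odot>\<^bsub>M k\<^esub> x k) \<in> carrier bseq" "(\<lambda>k. adj (M k) (x k)) \<in> carrier bseq"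
    "(\<lambda>k. \<one>\<^bsub>M k\<^esub>) \<in> carrier bseq" "(\<lambda>k. \<zero>\<^bsub>M k\<^esub>) \<in> carrier bseq"
proof -
  obtain b d where b: "b \<ge> 0" "\<And>k. nrm (M k) (x k) \<le> b" and d: "d \<ge> 0" "\<And>k. nrm (M k) (y k) \<le> d"
    using bseq_bounded[OF x] bseq_bounded[OF y] by auto
  note xc = bseq_in[OF x] and yc = bseq_in[OF y]
  show "(\<lambda>k. x k \<otimes>\<^bsub>M k\<^esub> y k) \<in> carrier bseq"
    using b d xc yc by (intro bseqI[of _ "b * d"] order_trans[OF M.norm_mult] mult_mono) auto
  show "(\<lambda>k. x k \<oplus>\<^bsub>M k\<^esub> y k) \<in> carrier bseq"
    using b d xc yc by (intro bseqI[of _ "b + d"] order_trans[OF M.norm_triangle] add_mono) auto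
  show "(\<lambda>k. c \<odot>\<^bsub>M k\<^esub> x k) \<in> carrier bseq"
    using b xc by (intro bseqI[of _ "cmod c * b"]) (auto simp: M.norm_sm mult_left_mono)
  show "(\<lambda>k. adj (M k) (x k)) \<in> carrier bseq"
    using b xc by (intro bseqI[of _ b]) auto
  show "(\<lambda>k. \<one>\<^bsub>M k\<^esub>) \<in> carrier bseq" using M.norm_one_le by (intro bseqI[of _ 1]) auto
  show "(\<lambda>k. \<zero>\<^bsub>M k\<^esub>) \<in> carrier bseq" by (intro bseqI[of _ 0]) auto
qed

lemma bseq_const: "(\<lambda>k. \<zero>\<^bsub>M k\<^esub>) \<in> carrier bseq" "(\<lambda>k. \<one>\<^bsub>M k\<^esub>) \<in> carrier bseq"
  using M.norm_one_le by (auto intro: bseqI[of _ 0] bseqI[of _ 1])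

lemma bseq_abelian_group: "abelian_group bseq"
proof (rule abelian_groupI)
  fix x assume x: "x \<in> carrier bseq"
  show "\<exists>y\<in>carrier bseq. y \<oplus>\<^bsub>bseq\<^esub> x = \<zero>\<^bsub>bseq\<^esub>"
    using bseq_closed(3)[OF x x, of "-1"] bseq_in[OF x]
    by (intro bexI[of _ "\<lambda>k. (-1) \<odot>\<^bsub>M k\<^esub> x k"]) (auto simp: M.sm_minus_one M.l_neg)
qed (auto simp: bseq_closed bseq_const bseq_in M.a_ac)

lemma bseq_star_algebra: "star_algebra bseq"
proof -
  have "ring bseq"
    by (intro ringI bseq_abelian_group monoidI)
      (auto simp: bseq_closed bseq_const bseq_in M.m_assoc M.l_distr M.r_distr)
  moreover have "complex_space bseq"
    by (intro complex_spaceI bseq_abelian_group)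
      (auto simp: bseq_closed bseq_in M.sm_ldistr M.sm_rdistr M.sm_assoc)
  moreover have "star_vector_space bseq"
    unfolding star_vector_space_def using calculation(2)
    by (auto simp: bseq_closed bseq_in M.star_add M.star_sm)
  ultimately show ?thesis
    unfolding star_algebra_def by (auto simp: bseq_in M.sm_mult_l M.sm_mult_r M.star_mult)
qed

sublocale bseq: star_alg bseq
  by (rule star_alg.intro[OF bseq_star_algebra])

lemma bseq_minus: "\<lbrakk>x \<in> carrier bseq; y \<in> carrier bseq\<rbrakk> \<Longrightarrow> (x \<ominus>\<^bsub>bseq\<^esub> y) k = x k \<ominus>\<^bsub>M k\<^esub> y k"
  using bseq.sm_minus_one[of y] bseq_in[of y k]
  by (simp add: bseq.minus_eq M.minus_eq flip: M.sm_minus_one) (metis M.sm_minus_one)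

lemma bseq_finsum:
  "\<lbrakk>finite I; \<And>i. i \<in> I \<Longrightarrow> g i \<in> carrier bseq\<rbrakk> \<Longrightarrow> finsum bseq g I k = finsum (M k) (\<lambda>i. g i k) I"
proof (induction I rule: finite_induct)
  case (insert i I)
  then have "g \<in> I \<rightarrow> carrier bseq" "g i \<in> carrier bseq" "(\<lambda>i. g i k) \<in> I \<rightarrow> carrier (M k)" "g i k \<in> carrier (M k)"
    using bseq_in by auto
  with insert show ?case by (simp add: bseq.finsum_insert M.finsum_insert)
qed simp

text \<open>The limit superior of the norms, written as the infimum of the eventual bounds; its
  kernel consists of the null sequences.\<close>

definition tnorm :: "(nat \<Rightarrow> 'u) \<Rightarrow> real" where
  "tnorm x = Inf {r. r \<ge> 0 \<and> (\<forall>\<^sub>F k in sequentially. nrm (M k) (x k) \<le> r)}"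

lemma tnorm_le: "\<lbrakk>\<forall>\<^sub>F k in sequentially. nrm (M k) (x k) \<le> r; r \<ge> 0\<rbrakk> \<Longrightarrow> tnorm x \<le> r"
  unfolding tnorm_def by (intro cInf_lower bdd_belowI[of _ 0]) auto

lemma tnorm_ne: "x \<in> carrier bseq \<Longrightarrow> {r. r \<ge> 0 \<and> (\<forall>\<^sub>F k in sequentially. nrm (M k) (x k) \<le> r)} \<noteq> {}"
  using bseq_bounded[of x] by (auto intro: always_eventually)

lemma tnorm_nonneg: "x \<in> carrier bseq \<Longrightarrow> 0 \<le> tnorm x"
  unfolding tnorm_def by (intro cInf_greatest tnorm_ne) auto

lemma tnorm_less:
  assumes "tnorm x < r" "x \<in> carrier bseq" shows "\<forall>\<^sub>F k in sequentially. nrm (M k) (x k) \<le> r"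
proof -
  have "bdd_below {r. r \<ge> 0 \<and> (\<forall>\<^sub>F k in sequentially. nrm (M k) (x k) \<le> r)}" by (intro bdd_belowI[of _ 0]) auto
  then obtain s where "\<forall>\<^sub>F k in sequentially. nrm (M k) (x k) \<le> s" "s < r"
    using assms(1) cInf_less_iff[OF tnorm_ne[OF assms(2)]] unfolding tnorm_def by auto
  then show ?thesis by (auto elim: eventually_mono)
qed

lemma tnorm_sm_le:
  assumes x: "x \<in> carrier bseq" shows "tnorm (c \<odot>\<^bsub>bseq\<^esub> x) \<le> cmod c * tnorm x"
proof (rule field_le_epsilon)
  fix e :: real assume e: "e > 0"
  define d where "d = e / (cmod c + 1)"
  have d: "d > 0" using e by (simp add: d_def add_nonneg_pos)
  have "\<forall>\<^sub>F k in sequentially. nrm (M k) (x k) \<le> tnorm x + d" using d x by (intro tnorm_less) auto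
  then have "\<forall>\<^sub>F k in sequentially. nrm (M k) ((c \<odot>\<^bsub>bseq\<^esub> x) k) \<le> cmod c * (tnorm x + d)"
    by (rule eventually_mono) (simp add: M.norm_sm bseq_in[OF x] mult_left_mono)
  then have "tnorm (c \<odot>\<^bsub>bseq\<^esub> x) \<le> cmod c * (tnorm x + d)"
    using d tnorm_nonneg[OF x] by (intro tnorm_le) auto
  also have "\<dots> \<le> cmod c * tnorm x + (cmod c + 1) * d" using d by (simp add: algebra_simps)
  also have "(cmod c + 1) * d = e" unfolding d_def using norm_ge_zero[of c] by (simp add: add_nonneg_eq_0_iff)
  finally show "tnorm (c \<odot>\<^bsub>bseq\<^esub> x) \<le> cmod c * tnorm x + e" .
qed

lemma tnorm_sm:
  assumes x: "x \<in> carrier bseq" shows "tnorm (c \<odot>\<^bsub>bseq\<^esub> x) = cmod c * tnorm x"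
proof (cases "c = 0")
  case True
  then show ?thesis using tnorm_sm_le[OF x, of 0] tnorm_nonneg[of "0 \<odot>\<^bsub>bseq\<^esub> x"] bseq.sm_closed[OF x, of 0] by simp
next
  case False
  have "x = (1/c) \<odot>\<^bsub>bseq\<^esub> (c \<odot>\<^bsub>bseq\<^esub> x)" using bseq.sm_assoc[OF x, of "1/c" c] bseq.sm_one[OF x] False by simp
  then have "tnorm x \<le> cmod (1/c) * tnorm (c \<odot>\<^bsub>bseq\<^esub> x)"
    using tnorm_sm_le[OF bseq.sm_closed[OF x, of c], of "1/c"] by simp
  then have "cmod c * tnorm x \<le> tnorm (c \<odot>\<^bsub>bseq\<^esub> x)" using False by (simp add: norm_divide field_simps)
  then show ?thesis using tnorm_sm_le[OF x, of c] by (rule antisym[rotated])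
qed

lemma tnorm_triangle:
  assumes x: "x \<in> carrier bseq" and y: "y \<in> carrier bseq" shows "tnorm (x \<oplus>\<^bsub>bseq\<^esub> y) \<le> tnorm x + tnorm y"
proof (rule field_le_epsilon)
  fix e :: real assume e: "e > 0"
  have "\<forall>\<^sub>F k in sequentially. nrm (M k) (x k) \<le> tnorm x + e/2" "\<forall>\<^sub>F k in sequentially. nrm (M k) (y k) \<le> tnorm y + e/2"
    using e x y by (intro tnorm_less; simp)+
  then have "\<forall>\<^sub>F k in sequentially. nrm (M k) ((x \<oplus>\<^bsub>bseq\<^esub> y) k) \<le> (tnorm x + e/2) + (tnorm y + e/2)"
    by eventually_elim (use bseq_in[OF x] bseq_in[OF y] in \<open>auto intro!: order_trans[OF M.norm_triangle]\<close>)
  then have "tnorm (x \<oplus>\<^bsub>bseq\<^esub> y) \<le> (tnorm x + e/2) + (tnorm y + e/2)"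
    using e tnorm_nonneg[OF x] tnorm_nonneg[OF y] by (intro tnorm_le) auto
  then show "tnorm (x \<oplus>\<^bsub>bseq\<^esub> y) \<le> tnorm x + tnorm y + e" by simp
qed

lemma tnorm_mult:
  assumes x: "x \<in> carrier bseq" and y: "y \<in> carrier bseq" shows "tnorm (x \<otimes>\<^bsub>bseq\<^esub> y) \<le> tnorm x * tnorm y"
proof -
  have le: "tnorm (x \<otimes>\<^bsub>bseq\<^esub> y) \<le> (tnorm x + e) * (tnorm y + e)" if e: "e > 0" for e
  proof (rule tnorm_le)
    have "\<forall>\<^sub>F k in sequentially. nrm (M k) (x k) \<le> tnorm x + e" "\<forall>\<^sub>F k in sequentially. nrm (M k) (y k) \<le> tnorm y + e"
      using e x y by (intro tnorm_less; simp)+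
    then show "\<forall>\<^sub>F k in sequentially. nrm (M k) ((x \<otimes>\<^bsub>bseq\<^esub> y) k) \<le> (tnorm x + e) * (tnorm y + e)"
      by eventually_elim
        (use bseq_in[OF x] bseq_in[OF y] e tnorm_nonneg[OF x] in \<open>auto intro!: order_trans[OF M.norm_mult] mult_mono\<close>)
  qed (use e tnorm_nonneg[OF x] tnorm_nonneg[OF y] in simp)
  have "((\<lambda>e. (tnorm x + e) * (tnorm y + e)) \<longlongrightarrow> (tnorm x + 0) * (tnorm y + 0)) (at_right 0)"
    by (intro tendsto_intros)
  moreover have "\<forall>\<^sub>F e in at_right 0. tnorm (x \<otimes>\<^bsub>bseq\<^esub> y) \<le> (tnorm x + e) * (tnorm y + e)"
    using le by (auto simp: eventually_at_right_field intro!: exI[of _ 1])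
  ultimately show ?thesis using tendsto_lowerbound[of _ _ "at_right (0::real)"] by fastforce
qed

lemma tnorm_cstar:
  assumes x: "x \<in> carrier bseq" shows "tnorm (adj bseq x \<otimes>\<^bsub>bseq\<^esub> x) = (tnorm x)\<^sup>2"
proof (rule antisym)
  have xx: "adj bseq x \<otimes>\<^bsub>bseq\<^esub> x \<in> carrier bseq" using x bseq.star_closed bseq.m_closed by blast
  have "tnorm (adj bseq x) \<le> tnorm x"
  proof (rule field_le_epsilon)
    fix e :: real assume e: "e > 0"
    have "\<forall>\<^sub>F k in sequentially. nrm (M k) (x k) \<le> tnorm x + e" using e x by (intro tnorm_less) auto
    then show "tnorm (adj bseq x) \<le> tnorm x + e"
      using bseq_in[OF x] e tnorm_nonneg[OF x] by (intro tnorm_le) auto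
  qed
  then show "tnorm (adj bseq x \<otimes>\<^bsub>bseq\<^esub> x) \<le> (tnorm x)\<^sup>2"
    using tnorm_mult[OF bseq.star_closed[OF x] x] tnorm_nonneg[OF x] mult_right_mono
    unfolding power2_eq_square by (meson order_trans)
  show "(tnorm x)\<^sup>2 \<le> tnorm (adj bseq x \<otimes>\<^bsub>bseq\<^esub> x)"
  proof (rule field_le_epsilon)
    fix e :: real assume e: "e > 0"
    let ?s = "tnorm (adj bseq x \<otimes>\<^bsub>bseq\<^esub> x) + e"
    have s: "?s > 0" using tnorm_nonneg[OF xx] e by simp
    have "\<forall>\<^sub>F k in sequentially. nrm (M k) ((adj bseq x \<otimes>\<^bsub>bseq\<^esub> x) k) \<le> ?s"
      using e by (intro tnorm_less xx) simp
    then have "\<forall>\<^sub>F k in sequentially. nrm (M k) (x k) \<le> sqrt ?s"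
      by eventually_elim (use M.norm_cstar[OF bseq_in[OF x]] in \<open>auto intro: real_le_rsqrt\<close>)
    then have "tnorm x \<le> sqrt ?s" using s by (intro tnorm_le) auto
    then show "(tnorm x)\<^sup>2 \<le> ?s" using s tnorm_nonneg[OF x]
      by (metis less_imp_le power_mono real_sqrt_pow2)
  qed
qed

lemma tnorm_seminorm: "cstar_seminorm bseq (carrier bseq) tnorm"
  unfolding cstar_seminorm_def
  by (intro conjI ballI allI tnorm_nonneg tnorm_triangle tnorm_sm tnorm_mult tnorm_cstar)

sublocale Q: star_quotient bseq tnorm enc
  by (intro star_quotient.intro star_quotient_axioms.intro tnorm_seminorm enc) unfold_locales

text \<open>A diagonal sequence: the \<open>k\<close>-th entry of the limit is that of a member \<open>W (m k)\<close> whose index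
  grows so slowly with \<open>k\<close> that the entries of all previous members are already close at \<open>k\<close>.\<close>

lemma tnorm_complete:
  assumes X: "\<And>n::nat. X n \<in> carrier bseq"
    and cau: "\<And>e. e > 0 \<Longrightarrow> \<exists>N. \<forall>m\<ge>N. \<forall>n\<ge>N. tnorm (X m \<ominus>\<^bsub>bseq\<^esub> X n) < e"
  shows "\<exists>x\<in>carrier bseq. (\<lambda>n. tnorm (X n \<ominus>\<^bsub>bseq\<^esub> x)) \<longlonglongrightarrow> 0"
proof -
  define \<delta> where "\<delta> i = (1/2::real) ^ i" for i
  have \<delta>0: "\<delta> i > 0" for i by (simp add: \<delta>_def)
  have \<delta>S: "\<delta> (Suc i) = \<delta> i / 2" for i by (simp add: \<delta>_def)
  have "\<forall>i. \<exists>N. \<forall>m\<ge>N. \<forall>n\<ge>N. tnorm (X m \<ominus>\<^bsub>bseq\<^esub> X n) < \<delta> i" using cau \<delta>0 by blast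
  then obtain N where N: "\<And>i m n. \<lbrakk>m \<ge> N i; n \<ge> N i\<rbrakk> \<Longrightarrow> tnorm (X m \<ominus>\<^bsub>bseq\<^esub> X n) < \<delta> i" by metis
  \<comment> \<open>Partial sums dominate \<open>N i\<close> both at \<open>i\<close> and at the
    next index, so consecutive members of the subsequence \<open>W\<close> differ by less than
    \<delta> i.\<close>
  define s where "s i = (\<Sum>j\<le>i. N j)" for i
  have sN: "N i \<le> s i" "N i \<le> s (Suc i)" for i by (auto simp: s_def simp del: sum.atMost_Suc intro!: member_le_sum)
  define W where "W i = X (s i)" for i
  have W: "W i \<in> carrier bseq" for i by (simp add: W_def X)
  have Wd: "W (Suc i) \<ominus>\<^bsub>bseq\<^esub> W i \<in> carrier bseq" for i by (rule bseq.minus_closed[OF W W])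
  have "\<forall>i. \<exists>K. \<forall>k\<ge>K. nrm (M k) (W (Suc i) k \<ominus>\<^bsub>M k\<^esub> W i k) \<le> \<delta> i"
    using tnorm_less[OF N[OF sN(2) sN(1)] Wd[unfolded W_def]]
    unfolding eventually_sequentially bseq_minus[OF X X] W_def by blast
  then obtain K where K: "\<And>i k. k \<ge> K i \<Longrightarrow> nrm (M k) (W (Suc i) k \<ominus>\<^bsub>M k\<^esub> W i k) \<le> \<delta> i" by metis
  \<comment> \<open>The furthest member whose thresholds have all been passed at position k. The
    clause \<open>m \<le> k\<close> makes the set finite, and 0 always belongs to it.\<close>
  define m where "m k = Max {m. m \<le> k \<and> (\<forall>i<m. K i \<le> k)}" for k
  have fin: "finite {m. m \<le> k \<and> (\<forall>i<m. K i \<le> k)}" for k by (rule finite_subset[of _ "{..k}"]) auto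
  have mk: "\<forall>i<m k. K i \<le> k" for k
    using Max_in[OF fin, of k] unfolding m_def by auto
  have m_ge: "m k \<ge> i" if "k \<ge> i" "\<forall>j<i. K j \<le> k" for i k
    unfolding m_def using that by (intro Max_ge fin) auto
  define z where "z k = W (m k) k" for k
  \<comment> \<open>Summing the geometric series \<delta> from i up to i + d - 1; at position k only
    differences below \<open>m k\<close> are controlled.\<close>
  have step: "nrm (M k) (W (i + d) k \<ominus>\<^bsub>M k\<^esub> W i k) \<le> 2 * \<delta> i - 2 * \<delta> (i + d)" if "i + d \<le> m k" for i d k
    using that
  proof (induction d)
    case 0
    then show ?case using bseq_in[OF W] by simp
  next
    case (Suc d)
    have "nrm (M k) (W (Suc (i + d)) k \<ominus>\<^bsub>M k\<^esub> W i k)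
      \<le> nrm (M k) (W (Suc (i + d)) k \<ominus>\<^bsub>M k\<^esub> W (i + d) k) + nrm (M k) (W (i + d) k \<ominus>\<^bsub>M k\<^esub> W i k)"
      using bseq_in[OF W] by (intro M.norm_diff_triangle)
    also have "\<dots> \<le> \<delta> (i + d) + (2 * \<delta> i - 2 * \<delta> (i + d))"
      using Suc mk[of k] by (intro add_mono K) auto
    finally show ?case by (simp add: \<delta>S)
  qed
  have zW: "nrm (M k) (z k \<ominus>\<^bsub>M k\<^esub> W i k) \<le> 2 * \<delta> i" if "i \<le> m k" for i k
    using step[of i "m k - i" k] that \<delta>0[of "m k"] by (simp add: z_def)
  have zc: "z k \<in> carrier (M k)" for k by (simp add: z_def bseq_in[OF W])
  obtain b where b: "\<And>k. nrm (M k) (W 0 k) \<le> b" using bseq_bounded[OF W] by blast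
  have z: "z \<in> carrier bseq"
  proof (rule bseqI[of _ "b + 2"])
    show "nrm (M k) (z k) \<le> b + 2" for k
      using M.norm_le_diff[OF zc[of k] bseq_in[OF W, of 0 k]] zW[of 0 k] b[of k] by (simp add: \<delta>_def)
  qed (rule zc)
  have tz: "tnorm (W i \<ominus>\<^bsub>bseq\<^esub> z) \<le> 2 * \<delta> i" for i
  proof (rule tnorm_le)
    have "\<forall>\<^sub>F k in sequentially. k \<ge> i \<and> (\<forall>j\<in>{..<i}. K j \<le> k)"
      by (intro eventually_conj eventually_ge_at_top eventually_ball_finite ballI) auto
    then show "\<forall>\<^sub>F k in sequentially. nrm (M k) ((W i \<ominus>\<^bsub>bseq\<^esub> z) k) \<le> 2 * \<delta> i"
      by eventually_elim (use zW m_ge M.norm_minus_commute[OF zc bseq_in[OF W]] in \<open>simp add: bseq_minus[OF W z]\<close>)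
  qed (use \<delta>0[of i] in simp)
  have "(\<lambda>n. tnorm (X n \<ominus>\<^bsub>bseq\<^esub> z)) \<longlonglongrightarrow> 0"
  proof (rule LIMSEQ_I)
    fix e :: real assume e: "e > 0"
    obtain i where i: "3 * \<delta> i < e"
      using real_arch_pow_inv[of "e / 3" "1/2"] e by (auto simp: \<delta>_def field_simps)
    have "tnorm (X n \<ominus>\<^bsub>bseq\<^esub> z) < e" if "n \<ge> N i" for n
      using Q.q_diff_triangle[OF X W z, of n i] N[OF that sN(1)] tz[of i] i by (simp add: W_def)
    moreover have "0 \<le> tnorm (X n \<ominus>\<^bsub>bseq\<^esub> z)" for n by (rule tnorm_nonneg[OF bseq.minus_closed[OF X z]])
    ultimately show "\<exists>no. \<forall>n\<ge>no. norm (tnorm (X n \<ominus>\<^bsub>bseq\<^esub> z) - 0) < e" by auto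
  qed
  with z show ?thesis by blast
qed

lemma quot_cstar: "cstar_algebra Q.quot"
  by (rule Q.quot_cstar_algebra[OF tnorm_complete])

end

section \<open>Positivity in the sequence algebra\<close>

lemma (in cspace) minus_minus_add:
  "\<lbrakk>x \<in> carrier V; y \<in> carrier V; z \<in> carrier V\<rbrakk> \<Longrightarrow> (x \<ominus> (y \<ominus> z)) \<oplus> y = x \<oplus> z"
  by (intro sep) (auto simp: linfun_simps)

text \<open>The commuting positive factors r - a and r + a have the positive product r^2 - a^2,
  which bounds the norm by \<open>norm_le_iff\<close>.\<close>

lemma (in cstar_alg) norm_le_order_interval:
  assumes a: "a \<in> sa" and p: "cm (complex_of_real r) \<ominus> a \<in> pos" "cm (complex_of_real r) \<oplus> a \<in> pos" and r: "r \<ge> 0"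
  shows "nrm A a \<le> r"
proof -
  have "(cm (complex_of_real r) \<ominus> a) \<otimes> (cm (complex_of_real r) \<oplus> a) = cm (complex_of_real (r\<^sup>2)) \<ominus> a\<^sup>\<star> \<otimes> a"
    using a by (intro sep) (auto simp: alg_simps cm_simps sa_star power2_eq_square algebra_simps)
  moreover have "(cm (complex_of_real r) \<ominus> a) \<otimes> (cm (complex_of_real r) \<oplus> a) \<in> pos"
  proof (rule pos_mult_comm[OF p])
    show "(cm (complex_of_real r) \<ominus> a) \<otimes> (cm (complex_of_real r) \<oplus> a) =
        (cm (complex_of_real r) \<oplus> a) \<otimes> (cm (complex_of_real r) \<ominus> a)"
      using a by (intro sep) (auto simp: alg_simps cm_simps algebra_simps)
  qed
  ultimately show ?thesis using norm_le_iff[of a r] a r by simp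
qed

lemma (in cstar_alg) pc_mat1_pos:
  assumes "mat 1 1 (\<lambda>_. y) \<in> pcone (cstar_opsys A)" shows "y \<in> pos"
proof -
  interpret O: opsys "cstar_opsys A" by (rule opsys.intro[OF operator_system])
  have "mat 1 1 (\<lambda>_. y) \<in> rm 1 1"
    using O.pc_rm[OF assms] by (simp add: O.mats_eq[symmetric] mats_eq)
  then have "mat 1 1 (\<lambda>_. y) \<in> mcone 1" using assms pcone_iff by blast
  then obtain Y where Y: "Y \<in> rm 1 1" and eq: "mat 1 1 (\<lambda>_. y) = Y\<^sup>\<dagger> \<bullet> Y" unfolding mcone_eq by blast
  have Yc: "Y $$ (0, 0) \<in> carrier A" using rm_entry[OF Y] by simp
  have "y = (Y\<^sup>\<dagger> \<bullet> Y) $$ (0, 0)" using eq[symmetric] by simp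
  also have "\<dots> = (Y $$ (0, 0))\<^sup>\<star> \<otimes> Y $$ (0, 0)"
    using mm_index[OF mstar_closed[OF Y] Y, of 0 0] mstar_index[OF Y, of 0 0] Yc by (simp add: lessThan_Suc)
  finally show ?thesis using Yc by simp
qed

text \<open>One constant for all targets, since order bounds between multiples of the unit survive
  every ucp map. This makes sequences of images under different ucp maps bounded.\<close>

lemma ucp_norm_bound:
  fixes S :: "'v opsys"
  assumes S: "operator_system S" and s: "s \<in> carrier S"
  shows "\<exists>c\<ge>0. \<forall>(C :: 'u cstar) f. cstar_algebra C \<and> ucp S (cstar_opsys C) f \<longrightarrow> nrm C (f s) \<le> c"
proof -
  interpret S: opsys S by (rule opsys.intro[OF S])
  have main: "\<exists>c\<ge>0. \<forall>(C :: 'u cstar) f. cstar_algebra C \<and> ucp S (cstar_opsys C) f \<longrightarrow> nrm C (f a) \<le> c"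
    if a: "a \<in> S.sa" for a
  proof -
    obtain r1 where r1: "r1 > 0" "mat 1 1 (\<lambda>_. complex_of_real r1 \<odot>\<^bsub>S\<^esub> \<one>\<^bsub>S\<^esub> \<ominus>\<^bsub>S\<^esub> a) \<in> pcone S"
      using S.sa_bound[OF a] by blast
    obtain r2 where r2: "r2 > 0" "mat 1 1 (\<lambda>_. complex_of_real r2 \<odot>\<^bsub>S\<^esub> \<one>\<^bsub>S\<^esub> \<ominus>\<^bsub>S\<^esub> (\<ominus>\<^bsub>S\<^esub> a)) \<in> pcone S"
      using S.sa_bound[OF S.sa_uminus[OF a]] by blast
    have ac: "a \<in> carrier S" using a by auto
    have "nrm C (f a) \<le> max r1 r2" if C: "cstar_algebra C" and f: "ucp S (cstar_opsys C) f" for C :: "'u cstar" and f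
    proof -
      interpret C: cstar_alg C by (rule cstar_alg.intro[OF C])
      have lin: "clinear S C f" using ucp_clinear[OF f] by simp
      have f1: "f \<one>\<^bsub>S\<^esub> = \<one>\<^bsub>C\<^esub>" using ucp_one[OF f] by simp
      have fa: "f a \<in> carrier C" by (rule clinear_closed[OF lin ac])
      have fsa: "f a \<in> C.sa"
        using ucp_star[OF S C.operator_system f ac] a fa by (intro C.saI) (auto simp: S.sa_star)
      have p: "f x \<in> C.pos" if "mat 1 1 (\<lambda>_. x) \<in> pcone S" for x
      proof (rule C.pc_mat1_pos)
        have "map_mat f (mat 1 1 (\<lambda>_. x)) = mat 1 1 (\<lambda>_. f x)" by (rule eq_matI) auto
        then show "mat 1 1 (\<lambda>_. f x) \<in> pcone (cstar_opsys C)" using ucp_pcone[OF f that] by simp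
      qed
      have sub: "f (x \<ominus>\<^bsub>S\<^esub> y) = f x \<ominus>\<^bsub>C\<^esub> f y" if "x \<in> carrier S" "y \<in> carrier S" for x y
        using clinear_minus[OF S.complex_space C.complex_space lin that] .
      have p1: "C.cm (complex_of_real r1) \<ominus>\<^bsub>C\<^esub> f a \<in> C.pos"
        using p[OF r1(2)] ac by (simp add: sub clinear_sm[OF lin] f1 C.cm_def)
      have "f (\<ominus>\<^bsub>S\<^esub> a) = \<ominus>\<^bsub>C\<^esub> f a"
        using clinear_sm[OF lin ac, of "-1"] ac fa by (simp add: S.sm_minus_one C.sm_minus_one)
      then have p2: "C.cm (complex_of_real r2) \<oplus>\<^bsub>C\<^esub> f a \<in> C.pos"
        using p[OF r2(2)] ac fa by (simp add: sub clinear_sm[OF lin] f1 C.cm_def C.minus_eq C.minus_minus)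
      let ?r = "max r1 r2"
      have "C.cm (complex_of_real ?r) \<ominus>\<^bsub>C\<^esub> f a =
          (C.cm (complex_of_real r1) \<ominus>\<^bsub>C\<^esub> f a) \<oplus>\<^bsub>C\<^esub> C.cm (complex_of_real (?r - r1))"
        "C.cm (complex_of_real ?r) \<oplus>\<^bsub>C\<^esub> f a =
          (C.cm (complex_of_real r2) \<oplus>\<^bsub>C\<^esub> f a) \<oplus>\<^bsub>C\<^esub> C.cm (complex_of_real (?r - r2))"
        using fa by (intro C.sep; auto simp: C.alg_simps C.linfun_cm algebra_simps simp del: max.absorb1 max.absorb2)+
      then have "C.cm (complex_of_real ?r) \<ominus>\<^bsub>C\<^esub> f a \<in> C.pos" "C.cm (complex_of_real ?r) \<oplus>\<^bsub>C\<^esub> f a \<in> C.pos"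
        using C.pos_add[OF p1 C.pos_cm, of "?r - r1"] C.pos_add[OF p2 C.pos_cm, of "?r - r2"] by simp_all
      then show ?thesis using C.norm_le_order_interval[OF fsa] r1(1) by simp
    qed
    then show ?thesis using r1(1) by (intro exI[of _ "max r1 r2"]) auto
  qed
  obtain a b where ab: "a \<in> S.sa" "b \<in> S.sa" "s = a \<oplus>\<^bsub>S\<^esub> \<i> \<odot>\<^bsub>S\<^esub> b" using S.sa_parts[OF s] by metis
  obtain c where c: "c \<ge> 0" "\<And>(C :: 'u cstar) f. \<lbrakk>cstar_algebra C; ucp S (cstar_opsys C) f\<rbrakk> \<Longrightarrow> nrm C (f a) \<le> c"
    using main[OF ab(1)] by blast
  obtain d where d: "d \<ge> 0" "\<And>(C :: 'u cstar) f. \<lbrakk>cstar_algebra C; ucp S (cstar_opsys C) f\<rbrakk> \<Longrightarrow> nrm C (f b) \<le> d"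
    using main[OF ab(2)] by blast
  have "nrm C (f s) \<le> c + d" if C: "cstar_algebra C" and f: "ucp S (cstar_opsys C) f" for C :: "'u cstar" and f
  proof -
    interpret C: cstar_alg C by (rule cstar_alg.intro[OF C])
    have lin: "clinear S C f" using ucp_clinear[OF f] by simp
    have "f a \<in> carrier C" "f b \<in> carrier C" using clinear_closed[OF lin] ab by auto
    moreover have "f s = f a \<oplus>\<^bsub>C\<^esub> \<i> \<odot>\<^bsub>C\<^esub> f b" unfolding ab(3) using ab(1,2) by (simp add: clinear_add[OF lin] clinear_sm[OF lin])
    ultimately show ?thesis
      using C.norm_triangle[of "f a" "\<i> \<odot>\<^bsub>C\<^esub> f b"] c(2)[OF C f] d(2)[OF C f] by (simp add: C.norm_sm)
  qed
  then show ?thesis using c(1) d(1) by (intro exI[of _ "c + d"]) auto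
qed

context cstar_sequence
begin

lemma pr_eq_tail:
  assumes "x \<in> carrier bseq" "y \<in> carrier bseq" "\<And>k. k \<ge> m \<Longrightarrow> x k = y k"
  shows "Q.pr x = Q.pr y"
proof (rule Q.pr_eqI)
  have "\<forall>\<^sub>F k in sequentially. nrm (M k) ((x \<ominus>\<^bsub>bseq\<^esub> y) k) \<le> 0"
    unfolding eventually_sequentially using assms bseq_in[OF assms(2)]
    by (intro exI[of _ m]) (simp add: bseq_minus[OF assms(1,2)])
  then show "tnorm (x \<ominus>\<^bsub>bseq\<^esub> y) \<le> 0" by (rule tnorm_le) simp
qed (use assms in auto)

text \<open>Maps out of stage m exist only for indices k >= m. The zeros put in front disappear
  modulo null sequences.\<close>

definition tail_from :: "nat \<Rightarrow> (nat \<Rightarrow> 'u) \<Rightarrow> nat \<Rightarrow> 'u" where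
  "tail_from m x = (\<lambda>k. if k \<ge> m then x k else \<zero>\<^bsub>M k\<^esub>)"

lemma tail_from_closed:
  assumes "\<And>k. k \<ge> m \<Longrightarrow> x k \<in> carrier (M k)" "\<And>k. k \<ge> m \<Longrightarrow> nrm (M k) (x k) \<le> b" "b \<ge> 0"
  shows "tail_from m x \<in> carrier bseq"
  using assms by (intro bseqI[of _ b]) (auto simp: tail_from_def)

lemma quot_finsum:
  assumes "finite I" "\<And>i. i \<in> I \<Longrightarrow> g i \<in> carrier bseq"
  shows "finsum Q.quot (\<lambda>i. Q.pr (g i)) I = Q.pr (finsum bseq g I)"
proof -
  interpret B: cstar_alg Q.quot by (rule cstar_alg.intro[OF quot_cstar])
  have "clinear bseq Q.quot Q.pr" by (auto simp: clinear_def Q.quot_simps[simplified])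
  then show ?thesis
    using clinear_finsum[OF bseq.complex_space B.complex_space _ assms(1), of Q.pr g] assms(2) by auto
qed

lemma quot_gram:
  assumes y: "\<And>i j. \<lbrakk>i < n; j < n\<rbrakk> \<Longrightarrow> y i j \<in> carrier bseq" and ij: "i < n" "j < n"
  defines "Y \<equiv> mat n n (\<lambda>(i, j). Q.pr (y i j))"
  shows "Y \<in> star_space.rm Q.quot n n"
    "mat_mult Q.quot (mat_adj Q.quot Y) Y $$ (i, j) = Q.pr (finsum bseq (\<lambda>l. adj bseq (y l i) \<otimes>\<^bsub>bseq\<^esub> y l j) {..<n})"
proof -
  interpret B: cstar_alg Q.quot by (rule cstar_alg.intro[OF quot_cstar])
  show Y: "Y \<in> B.rm n n" using y by (intro B.rmI) (auto simp: Y_def Q.quot_carrier)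
  have "mat_mult Q.quot (mat_adj Q.quot Y) Y $$ (i, j) = finsum Q.quot (\<lambda>l. adj Q.quot (Y $$ (l, i)) \<otimes>\<^bsub>Q.quot\<^esub> Y $$ (l, j)) {..<n}"
    unfolding B.mm_index[OF B.mstar_closed[OF Y] Y ij]
    using ij B.rm_entry[OF Y] by (intro B.finsum_cong') (auto simp: B.mstar_index[OF Y])
  also have "\<dots> = finsum Q.quot (\<lambda>l. Q.pr (adj bseq (y l i) \<otimes>\<^bsub>bseq\<^esub> y l j)) {..<n}"
  proof (intro B.finsum_cong' refl)
    show "(\<lambda>l. Q.pr (adj bseq (y l i) \<otimes>\<^bsub>bseq\<^esub> y l j)) \<in> {..<n} \<rightarrow> carrier Q.quot"
      using y ij bseq.m_closed bseq.star_closed unfolding Q.quot_carrier by blast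
    fix l assume "l \<in> {..<n}"
    then have l: "l < n" by simp
    show "adj Q.quot (Y $$ (l, i)) \<otimes>\<^bsub>Q.quot\<^esub> Y $$ (l, j) = Q.pr (adj bseq (y l i) \<otimes>\<^bsub>bseq\<^esub> y l j)"
      using Q.quot_star[OF y[OF l ij(1)]] Q.quot_mult[OF bseq.star_closed[OF y[OF l ij(1)]] y[OF l ij(2)]] l ij
      by (simp add: Y_def)
  qed
  also have "\<dots> = Q.pr (finsum bseq (\<lambda>l. adj bseq (y l i) \<otimes>\<^bsub>bseq\<^esub> y l j) {..<n})"
    using y ij by (intro quot_finsum bseq.m_closed bseq.star_closed) auto
  finally show "mat_mult Q.quot (mat_adj Q.quot Y) Y $$ (i, j) =
    Q.pr (finsum bseq (\<lambda>l. adj bseq (y l i) \<otimes>\<^bsub>bseq\<^esub> y l j) {..<n})" .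
qed

lemma gram_index:
  fixes n :: nat
  assumes "\<And>i j. \<lbrakk>i < n; j < n\<rbrakk> \<Longrightarrow> y i j \<in> carrier bseq" "i < n" "j < n"
  shows "finsum bseq (\<lambda>l. adj bseq (y l i) \<otimes>\<^bsub>bseq\<^esub> y l j) {..<n} k =
    finsum (M k) (\<lambda>l. adj (M k) (y l i k) \<otimes>\<^bsub>M k\<^esub> y l j k) {..<n}"
  using assms bseq.m_closed[OF bseq.star_closed] by (subst bseq_finsum) auto

lemma ucp_from_closed:
  assumes S: "operator_system S" and \<psi>: "\<And>k. k \<ge> m \<Longrightarrow> ucp S (cstar_opsys (M k)) (\<psi> k)" and s: "s \<in> carrier S"
  shows "tail_from m (\<lambda>k. \<psi> k s) \<in> carrier bseq"
proof -
  obtain c where "c \<ge> 0" "\<And>k. k \<ge> m \<Longrightarrow> nrm (M k) (\<psi> k s) \<le> c"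
    using ucp_norm_bound[OF S s] M \<psi> by metis
  moreover have "\<psi> k s \<in> carrier (M k)" if "k \<ge> m" for k
    using clinear_closed[OF ucp_clinear[OF \<psi>[OF that]] s] by simp
  ultimately show ?thesis using tail_from_closed by metis
qed

text \<open>Positivity survives because each positive image has a Gram factor Y k, and these factors
  can be assembled entry by entry into a matrix over the quotient, provided their entries are
  bounded in k.\<close>

lemma ucp_sequence:
  assumes S: "operator_system S" and \<psi>: "\<And>k. k \<ge> m \<Longrightarrow> ucp S (cstar_opsys (M k)) (\<psi> k)"
  shows "ucp S (cstar_opsys Q.quot) (\<lambda>s. Q.pr (tail_from m (\<lambda>k. \<psi> k s)))"
proof -
  interpret S: opsys S by (rule opsys.intro[OF S])
  interpret B: cstar_alg Q.quot by (rule cstar_alg.intro[OF quot_cstar])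
  let ?\<Psi> = "\<lambda>s. Q.pr (tail_from m (\<lambda>k. \<psi> k s))"
  note fc = ucp_from_closed[OF S \<psi>]
  have lin: "clinear S (M k) (\<psi> k)" if "k \<ge> m" for k using ucp_clinear[OF \<psi>[OF that]] by simp
  have \<psi>c: "\<psi> k s \<in> carrier (M k)" if "k \<ge> m" "s \<in> carrier S" for k s by (rule clinear_closed[OF lin[OF that(1)] that(2)])
  have "clinear S Q.quot ?\<Psi>"
    unfolding clinear_def
  proof (intro conjI ballI allI Pi_I)
    fix s assume s: "s \<in> carrier S"
    show "?\<Psi> s \<in> carrier Q.quot" unfolding Q.quot_carrier using fc[OF _ s] by blast
    show "?\<Psi> (c \<odot>\<^bsub>S\<^esub> s) = c \<odot>\<^bsub>Q.quot\<^esub> ?\<Psi> s" for c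
    proof -
      have "tail_from m (\<lambda>k. \<psi> k (c \<odot>\<^bsub>S\<^esub> s)) = c \<odot>\<^bsub>bseq\<^esub> tail_from m (\<lambda>k. \<psi> k s)"
        using s by (auto simp: tail_from_def fun_eq_iff clinear_sm[OF lin])
      then show ?thesis using Q.quot_sm fc s by simp
    qed
    fix t assume t: "t \<in> carrier S"
    have "tail_from m (\<lambda>k. \<psi> k (s \<oplus>\<^bsub>S\<^esub> t)) = tail_from m (\<lambda>k. \<psi> k s) \<oplus>\<^bsub>bseq\<^esub> tail_from m (\<lambda>k. \<psi> k t)"
      using s t by (auto simp: tail_from_def fun_eq_iff clinear_add[OF lin])
    then show "?\<Psi> (s \<oplus>\<^bsub>S\<^esub> t) = ?\<Psi> s \<oplus>\<^bsub>Q.quot\<^esub> ?\<Psi> t"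
      using Q.quot_add fc s t by simp
  qed
  moreover have "?\<Psi> \<one>\<^bsub>S\<^esub> = \<one>\<^bsub>Q.quot\<^esub>"
    unfolding Q.quot_one
    by (rule pr_eq_tail[of _ _ m]) (use fc ucp_one[OF \<psi>] bseq_const in \<open>auto simp: tail_from_def\<close>)
  moreover have "map_mat ?\<Psi> X \<in> pcone (cstar_opsys Q.quot)" if X: "X \<in> pcone S" for X
  proof -
    define n where "n = dim_row X"
    have Xn: "X \<in> S.rm n n" unfolding n_def by (rule S.pc_rm[OF X])
    note Xe = S.rm_entry[OF Xn] and Xd = S.rm_dim[OF Xn]
    have "\<exists>Y. Y \<in> M.rm k n n \<and> map_mat (\<psi> k) X = mat_mult (M k) (mat_adj (M k) Y) Y" if k: "k \<ge> m" for k
    proof -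
      have "map_mat (\<psi> k) X \<in> M.rm k n n" by (rule S.map_mat_rm[OF M.star_vs lin[OF k] Xn])
      moreover have "map_mat (\<psi> k) X \<in> pcone (cstar_opsys (M k))" by (rule ucp_pcone[OF \<psi>[OF k] X])
      ultimately have "map_mat (\<psi> k) X \<in> M.mcone k n" using M.pcone_iff by blast
      then show ?thesis unfolding M.mcone_eq by blast
    qed
    then obtain Y where Y: "\<And>k. k \<ge> m \<Longrightarrow> Y k \<in> M.rm k n n"
      and XY: "\<And>k. k \<ge> m \<Longrightarrow> map_mat (\<psi> k) X = mat_mult (M k) (mat_adj (M k) (Y k)) (Y k)" by metis
    have ent: "\<psi> k (X $$ (i, j)) = finsum (M k) (\<lambda>l. adj (M k) (Y k $$ (l, i)) \<otimes>\<^bsub>M k\<^esub> Y k $$ (l, j)) {..<n}"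
      if k: "k \<ge> m" and ij: "i < n" "j < n" for k i j
    proof -
      have "\<psi> k (X $$ (i, j)) = mat_mult (M k) (mat_adj (M k) (Y k)) (Y k) $$ (i, j)"
        unfolding XY[OF k, symmetric] using ij Xd by simp
      also have "\<dots> = finsum (M k) (\<lambda>l. adj (M k) (Y k $$ (l, i)) \<otimes>\<^bsub>M k\<^esub> Y k $$ (l, j)) {..<n}"
        unfolding M.mm_index[OF M.mstar_closed[OF Y[OF k]] Y[OF k] ij]
        using ij M.rm_entry[OF Y[OF k]] by (intro M.finsum_cong') (auto simp: M.mstar_index[OF Y[OF k]])
      finally show ?thesis .
    qed
    define y where "y i j = tail_from m (\<lambda>k. Y k $$ (i, j))" for i j
    have y: "y i j \<in> carrier bseq" if ij: "i < n" "j < n" for i j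
    proof -
      \<comment> \<open>The diagonal entry of a Gram matrix is the sum of squares of a column of its
        factor, so a bound on the image of \<open>X $$ (j, j)\<close> bounds every entry of that
        column.\<close>
      obtain c where c: "c \<ge> 0" "\<And>k. k \<ge> m \<Longrightarrow> nrm (M k) (\<psi> k (X $$ (j, j))) \<le> c"
        using ucp_norm_bound[OF S Xe[OF ij(2) ij(2)]] M \<psi> by metis
      have "nrm (M k) (Y k $$ (i, j)) \<le> sqrt c" if k: "k \<ge> m" for k
      proof -
        have Yc: "Y k $$ (l, j) \<in> carrier (M k)" if "l < n" for l using M.rm_entry[OF Y[OF k]] that ij by blast
        let ?g = "\<lambda>l. adj (M k) (Y k $$ (l, j)) \<otimes>\<^bsub>M k\<^esub> Y k $$ (l, j)"
        have gp: "?g l \<in> M.pos k" if "l < n" for l using Yc[OF that] by simp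
        then have "finsum (M k) ?g {..<n} \<in> M.sa k" by (intro M.pos_sa M.pos_finsum) auto
        then have "M.cm k (complex_of_real c) \<ominus>\<^bsub>M k\<^esub> finsum (M k) ?g {..<n} \<in> M.pos k"
          using c(2)[OF k] ent[OF k ij(2) ij(2)] by (intro M.pos_le_norm) simp_all
        then have "M.cm k (complex_of_real c) \<ominus>\<^bsub>M k\<^esub> ?g i \<in> M.pos k"
          using gp ij(1) by (intro M.pos_finsum_le[of "{..<n}" ?g]) auto
        then show ?thesis using M.norm_le_iff[OF Yc[OF ij(1)], of "sqrt c"] c(1) by simp
      qed
      then show ?thesis unfolding y_def using M.rm_entry[OF Y] ij c(1) by (intro tail_from_closed[of _ _ "sqrt c"]) auto
    qed
    let ?Y = "mat n n (\<lambda>(i, j). Q.pr (y i j))"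
    have "map_mat ?\<Psi> X = mat_mult Q.quot (mat_adj Q.quot ?Y) ?Y"
    proof (rule eq_matI)
      show dims: "dim_row (map_mat ?\<Psi> X) = dim_row (mat_mult Q.quot (mat_adj Q.quot ?Y) ?Y)"
        "dim_col (map_mat ?\<Psi> X) = dim_col (mat_mult Q.quot (mat_adj Q.quot ?Y) ?Y)"
        using Xd by (simp_all add: mat_mult_def mat_adj_def)
      fix i j assume "i < dim_row (mat_mult Q.quot (mat_adj Q.quot ?Y) ?Y)" "j < dim_col (mat_mult Q.quot (mat_adj Q.quot ?Y) ?Y)"
      then have ij: "i < n" "j < n" by (simp_all add: mat_mult_def mat_adj_def)
      have "map_mat ?\<Psi> X $$ (i, j) = ?\<Psi> (X $$ (i, j))" using ij Xd by simp
      also have "\<dots> = Q.pr (finsum bseq (\<lambda>l. adj bseq (y l i) \<otimes>\<^bsub>bseq\<^esub> y l j) {..<n})"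
      proof (rule pr_eq_tail[of _ _ m])
        show "tail_from m (\<lambda>k. \<psi> k (X $$ (i, j))) \<in> carrier bseq" using fc Xe[OF ij] by blast
        show "finsum bseq (\<lambda>l. adj bseq (y l i) \<otimes>\<^bsub>bseq\<^esub> y l j) {..<n} \<in> carrier bseq"
          using y ij bseq.m_closed[OF bseq.star_closed] by (intro bseq.finsum_closed) blast
        fix k assume k: "k \<ge> m"
        then show "tail_from m (\<lambda>k. \<psi> k (X $$ (i, j))) k = finsum bseq (\<lambda>l. adj bseq (y l i) \<otimes>\<^bsub>bseq\<^esub> y l j) {..<n} k"
          using gram_index[where y = y and k = k, OF y ij] ent[OF k ij] by (simp add: tail_from_def y_def)
      qed
      also have "\<dots> = mat_mult Q.quot (mat_adj Q.quot ?Y) ?Y $$ (i, j)"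
        using quot_gram(2)[OF y ij] by simp
      finally show "map_mat ?\<Psi> X $$ (i, j) = mat_mult Q.quot (mat_adj Q.quot ?Y) ?Y $$ (i, j)" .
    qed
    moreover have "?Y \<in> mats Q.quot n" using y by (auto simp: B.mats_eq Q.quot_carrier intro!: B.rmI)
    ultimately show ?thesis unfolding cstar_opsys_def by auto
  qed
  ultimately show ?thesis by (simp add: ucp_def completely_positive_def)
qed

text \<open>Positivity in the quotient only says that the defect from \<open>Y\<^sup>* Y\<close> tends to \<open>0\<close>, whence the
  correction \<open>\<epsilon>\<close>.\<close>

lemma pcone_quot_eventually:
  assumes x: "\<And>i j. \<lbrakk>i < n; j < n\<rbrakk> \<Longrightarrow> x i j \<in> carrier bseq"
    and X: "mat n n (\<lambda>(i, j). Q.pr (x i j)) \<in> pcone (cstar_opsys Q.quot)"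
    and sa: "\<forall>\<^sub>F k in sequentially. mat_adj (M k) (mat n n (\<lambda>(i, j). x i j k)) = mat n n (\<lambda>(i, j). x i j k)"
    and e: "e > 0"
  shows "\<forall>\<^sub>F k in sequentially. mat_add (M k) (mat_smult (M k) (complex_of_real e) (mat_unit (M k) n))
      (mat n n (\<lambda>(i, j). x i j k)) \<in> pcone (cstar_opsys (M k))"
proof -
  interpret B: cstar_alg Q.quot by (rule cstar_alg.intro[OF quot_cstar])
  let ?X = "mat n n (\<lambda>(i, j). Q.pr (x i j))"
  let ?Xk = "\<lambda>k. mat n n (\<lambda>(i, j). x i j k)"
  have "?X \<in> B.rm n n" using x by (intro B.rmI) (auto simp: Q.quot_carrier)
  then have "?X \<in> B.mcone n" using X B.pcone_iff by blast
  then obtain Y where Y: "Y \<in> B.rm n n" and XY: "?X = mat_mult Q.quot (mat_adj Q.quot Y) Y" unfolding B.mcone_eq by blast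
  have "\<exists>y. y \<in> carrier bseq \<and> Y $$ (i, j) = Q.pr y" if "i < n" "j < n" for i j
    using B.rm_entry[OF Y that] by (auto simp: Q.quot_carrier)
  then obtain y where y: "\<And>i j. \<lbrakk>i < n; j < n\<rbrakk> \<Longrightarrow> y i j \<in> carrier bseq"
    and Yy: "\<And>i j. \<lbrakk>i < n; j < n\<rbrakk> \<Longrightarrow> Y $$ (i, j) = Q.pr (y i j)" by metis
  have Y': "Y = mat n n (\<lambda>(i, j). Q.pr (y i j))" using B.rm_dim[OF Y] Yy by (intro eq_matI) auto
  define g where "g i j = finsum bseq (\<lambda>l. adj bseq (y l i) \<otimes>\<^bsub>bseq\<^esub> y l j) {..<n}" for i j
  have g: "g i j \<in> carrier bseq" if "i < n" "j < n" for i j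
    unfolding g_def using y that bseq.m_closed[OF bseq.star_closed] by (intro bseq.finsum_closed) blast
  \<comment> \<open>The norm of a matrix is at most n times the sum of the norms of its n^2 entries,
    so entrywise error d costs n^3 d <= e. The added 1 covers n = 0.\<close>
  define d where "d = e / (real n * (real n * real n) + 1)"
  have d: "d > 0" using e by (simp add: d_def add_nonneg_pos)
  have nd: "real n * (real n * (real n * d)) \<le> e"
  proof -
    have "real n * (real n * (real n * d)) = (real n * (real n * real n)) * e / (real n * (real n * real n) + 1)" by (simp add: d_def)
    also have "\<dots> \<le> e"
    proof (rule mult_imp_div_pos_le)
      show "0 < real n * (real n * real n) + 1" by (rule add_nonneg_pos) auto
    qed (use e in \<open>simp add: algebra_simps\<close>)
    finally show ?thesis .
  qed
  have close: "\<forall>\<^sub>F k in sequentially. nrm (M k) (g i j k \<ominus>\<^bsub>M k\<^esub> x i j k) \<le> d" if ij: "i < n" "j < n" for i j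
  proof -
    have "Q.pr (x i j) = mat_mult Q.quot (mat_adj Q.quot Y) Y $$ (i, j)" unfolding XY[symmetric] using ij by simp
    also have "\<dots> = Q.pr (g i j)" unfolding Y' g_def using quot_gram(2)[OF y ij] by simp
    finally have "tnorm (g i j \<ominus>\<^bsub>bseq\<^esub> x i j) = 0" using Q.pr_eq_iff[OF g[OF ij] x[OF ij]] by simp
    then show ?thesis using tnorm_less[of "g i j \<ominus>\<^bsub>bseq\<^esub> x i j" d] d bseq.minus_closed[OF g[OF ij] x[OF ij]]
      by (simp add: bseq_minus[OF g[OF ij] x[OF ij]])
  qed
  have "\<forall>\<^sub>F k in sequentially. \<forall>i\<in>{..<n}. \<forall>j\<in>{..<n}. nrm (M k) (g i j k \<ominus>\<^bsub>M k\<^esub> x i j k) \<le> d"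
    using close by (intro eventually_ball_finite ballI) auto
  with sa show ?thesis
  proof eventually_elim
    fix k assume xsa: "mat_adj (M k) (?Xk k) = ?Xk k"
      and cl: "\<forall>i\<in>{..<n}. \<forall>j\<in>{..<n}. nrm (M k) (g i j k \<ominus>\<^bsub>M k\<^esub> x i j k) \<le> d"
    let ?Yk = "mat n n (\<lambda>(i, j). y i j k)"
    let ?N = "M.Mn k n"
    interpret N: cstar_alg ?N by (rule cstar_alg.intro[OF M.Mn_cstar_algebra])
    have pos: "N.pos = M.mcone k n" by (rule Set.set_eqI) (subst M.mcone_eq, auto simp: N.pos_iff)
    have Xk: "?Xk k \<in> M.rm k n n" using bseq_in[OF x] by (intro M.rmI) auto
    have Yk: "?Yk \<in> M.rm k n n" using bseq_in[OF y] by (intro M.rmI) auto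
    let ?G = "mat_mult (M k) (mat_adj (M k) ?Yk) ?Yk"
    have G: "?G \<in> M.rm k n n" by (rule M.mm_closed[OF M.mstar_closed[OF Yk] Yk])
    have Gi: "?G $$ (i, j) = g i j k" if ij: "i < n" "j < n" for i j
    proof -
      have "?G $$ (i, j) = finsum (M k) (\<lambda>l. adj (M k) (y l i k) \<otimes>\<^bsub>M k\<^esub> y l j k) {..<n}"
        unfolding M.mm_index[OF M.mstar_closed[OF Yk] Yk ij]
        using ij bseq_in[OF y] by (intro M.finsum_cong') (auto simp: M.mstar_index[OF Yk])
      then show ?thesis unfolding g_def using gram_index[where y = y and k = k, OF y ij] by simp
    qed
    \<comment> \<open>The defect H = G - X has norm at most e, so e - H is positive. Adding the
      positive Gram matrix G leaves e + X.\<close>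
    let ?H = "?G \<ominus>\<^bsub>?N\<^esub> ?Xk k"
    have Hc: "?H \<in> M.rm k n n" using N.minus_closed[of ?G "?Xk k"] G Xk by simp
    have Gsa: "?G \<in> N.sa" using N.sa_square[of ?Yk] Yk by simp
    have Xsa: "?Xk k \<in> N.sa" using xsa Xk by (intro N.saI) auto
    have Hi: "?H $$ (i, j) = g i j k \<ominus>\<^bsub>M k\<^esub> x i j k" if "i < n" "j < n" for i j
      using M.Mn_minus_index[OF G Xk that] Gi[OF that] that by simp
    have "nrm ?N ?H \<le> real n * (\<Sum>i<n. \<Sum>j<n. nrm (M k) (?H $$ (i, j)))" by (rule M.Mn_norm_le[OF Hc])
    also have "\<dots> \<le> real n * (\<Sum>i<n. \<Sum>j<n. d)" using cl Hi by (intro mult_left_mono sum_mono) auto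
    also have "\<dots> \<le> e" using nd by simp
    finally have "N.cm (complex_of_real e) \<ominus>\<^bsub>?N\<^esub> ?H \<in> N.pos" using Gsa Xsa by (intro N.pos_le_norm) auto
    then have "(N.cm (complex_of_real e) \<ominus>\<^bsub>?N\<^esub> ?H) \<oplus>\<^bsub>?N\<^esub> ?G \<in> N.pos"
      using N.pos_star_mult[of ?Yk] Yk by (intro N.pos_add) auto
    moreover have "(N.cm (complex_of_real e) \<ominus>\<^bsub>?N\<^esub> ?H) \<oplus>\<^bsub>?N\<^esub> ?G = N.cm (complex_of_real e) \<oplus>\<^bsub>?N\<^esub> ?Xk k"
      by (rule N.minus_minus_add[OF N.cm_closed N.sa_carrier[OF Gsa] N.sa_carrier[OF Xsa]])
    ultimately have "N.cm (complex_of_real e) \<oplus>\<^bsub>?N\<^esub> ?Xk k \<in> M.mcone k n" using pos by simp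
    then show "mat_add (M k) (mat_smult (M k) (complex_of_real e) (mat_unit (M k) n)) (?Xk k) \<in> pcone (cstar_opsys (M k))"
      unfolding M.pcone_eq by (auto simp: M.Mn_cm)
  qed
qed

end

section \<open>Inductive limits\<close>

lemma finsum_restrict:
  assumes "complex_space V" "complex_space (V\<lparr>carrier := W\<rparr>)" "W \<subseteq> carrier V" "finite I" "g \<in> I \<rightarrow> W"
  shows "finsum (V\<lparr>carrier := W\<rparr>) g I = finsum V g I"
proof -
  interpret V: cspace V by (rule cspace.intro) fact
  interpret R: cspace "V\<lparr>carrier := W\<rparr>" by (rule cspace.intro) fact
  show ?thesis using assms(4,5)
  proof (induction I rule: finite_induct)
    case (insert i I)
    then have g: "g \<in> I \<rightarrow> W" "g i \<in> W" "g \<in> I \<rightarrow> carrier V" "g i \<in> carrier V" using assms(3) by auto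
    have "finsum (V\<lparr>carrier := W\<rparr>) g (insert i I) = g i \<oplus>\<^bsub>V\<^esub> finsum (V\<lparr>carrier := W\<rparr>) g I"
      using R.finsum_insert[of I i g] insert g by simp
    also have "\<dots> = finsum V g (insert i I)" using V.finsum_insert[of I i g] insert g by simp
    finally show ?case .
  qed simp
qed

lemma mats_entries: "X \<in> mats V n \<longleftrightarrow> dim_row X = n \<and> dim_col X = n \<and> (\<forall>i<n. \<forall>j<n. X $$ (i, j) \<in> carrier V)"
  unfolding mats_def by (auto dest!: elements_matD intro!: elements_matI)

lemma elements_mat_subset: "elements_mat X \<subseteq> W \<longleftrightarrow> (\<forall>i<dim_row X. \<forall>j<dim_col X. X $$ (i, j) \<in> W)"
  by (auto dest!: elements_matD intro!: elements_matI)

lemma opsys_restrict_simps [simp]: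
  "carrier (opsys_restrict R W) = W" "one (opsys_restrict R W) = one R" "zero (opsys_restrict R W) = zero R"
  "add (opsys_restrict R W) = add R" "module.smult (opsys_restrict R W) = module.smult R"
  "adj (opsys_restrict R W) = adj R" "pcone (opsys_restrict R W) = {X \<in> pcone R. elements_mat X \<subseteq> W}"
  by (simp_all add: opsys_restrict_def)

lemma opsys_restrict_mat [simp]:
  "mat_zero (opsys_restrict R W) = mat_zero R" "mat_unit (opsys_restrict R W) = mat_unit R"
  "mat_add (opsys_restrict R W) = mat_add R" "mat_smult (opsys_restrict R W) = mat_smult R"
  "mat_adj (opsys_restrict R W) = mat_adj R"
  by (simp_all add: fun_eq_iff mat_zero_def mat_unit_def mat_add_def mat_smult_def mat_adj_def cong: if_cong)

text \<open>The delicate axiom is compression: \<open>finsum\<close> depends on the carrier, so sums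
  in the restriction first have to be identified with sums in \<open>R\<close>. The other matrix
  operations are literally the same.\<close>

lemma operator_system_restrict:
  assumes R: "operator_system R" and W: "W \<subseteq> carrier R" "\<one>\<^bsub>R\<^esub> \<in> W"
    "\<And>x y. \<lbrakk>x \<in> W; y \<in> W\<rbrakk> \<Longrightarrow> x \<oplus>\<^bsub>R\<^esub> y \<in> W" "\<And>c x. x \<in> W \<Longrightarrow> c \<odot>\<^bsub>R\<^esub> x \<in> W" "\<And>x. x \<in> W \<Longrightarrow> adj R x \<in> W"
  shows "operator_system (opsys_restrict R W)"
proof -
  interpret R: opsys R by (rule opsys.intro[OF R])
  let ?Q = "opsys_restrict R W"
  have W0: "\<zero>\<^bsub>R\<^esub> \<in> W" using W(4)[OF W(2), of 0] by simp
  have "submodule W (ring_of_type_algebra :: complex ring) R"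
    using W W0 by (intro R.submoduleI') auto
  then have RW: "complex_space (R\<lparr>carrier := W\<rparr>)" using submodule.submodule_is_module R.complex_space by blast
  then have cs: "complex_space ?Q" by (rule complex_space_cong[rotated 4]) simp_all
  have sv: "star_vector_space ?Q"
    unfolding star_vector_space_def using cs W by (auto simp: subset_iff R.star_add R.star_sm)
  interpret Q: star_space ?Q by (rule star_space.intro[OF sv])
  have sub: "Q.rm n n \<subseteq> R.rm n n" for n using W(1) by (auto simp: Q.rm_def R.rm_def)
  have el: "elements_mat X \<subseteq> W \<longleftrightarrow> X \<in> Q.rm n n" if "X \<in> R.rm n n" for X n
    using R.rm_dim[OF that] by (auto simp: elements_mat_subset Q.rm_def)
  have pc: "X \<in> pcone ?Q \<longleftrightarrow> X \<in> pcone R" if "X \<in> Q.rm n n" for X n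
    using el[of X n] sub that by auto
  have pcQ: "X \<in> pcone R \<and> X \<in> Q.rm (dim_row X) (dim_row X)" if "X \<in> pcone ?Q" for X
    using that R.pc_rm[of X] el[of X "dim_row X"] by auto
  have unitQ: "mat_unit R n \<in> Q.rm n n" for n using W(2) W0 by (intro Q.rmI) (auto simp: mat_unit_def)
  have plusQ: "mat_add R X Y \<in> Q.rm n n" if "X \<in> Q.rm n n" "Y \<in> Q.rm n n" for X Y n
    using Q.mplus_closed[OF that] by simp
  have smQ: "mat_smult R c X \<in> Q.rm n n" if "X \<in> Q.rm n n" for c X n
    using Q.msm_closed[OF that, of c] by simp
  have compr: "mat_compress ?Q \<alpha> X = mat_compress R \<alpha> X" "mat_compress R \<alpha> X \<in> Q.rm m m"
    if X: "X \<in> Q.rm n n" and \<alpha>: "\<alpha> \<in> carrier_mat n m" for \<alpha> X n m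
  proof -
    have fin: "(\<lambda>(k, l). (cnj (\<alpha> $$ (k, i)) * \<alpha> $$ (l, j)) \<odot>\<^bsub>R\<^esub> X $$ (k, l)) \<in> {..<n} \<times> {..<n} \<rightarrow> W" for i j
      using Q.rm_entry[OF X] W(4) by auto
    have eq: "finsum ?Q g I = finsum R g I" "finsum R g I \<in> W" if "finite I" "g \<in> I \<rightarrow> W" for g and I :: "(nat \<times> nat) set"
    proof -
      have "finsum ?Q g I = finsum (R\<lparr>carrier := W\<rparr>) g I"
        by (rule fun_cong[OF fun_cong[OF finsum_cong_struct]]) simp_all
      then show "finsum ?Q g I = finsum R g I" using finsum_restrict[OF R.complex_space RW W(1) that] by simp
      then show "finsum R g I \<in> W" using Q.finsum_closed[of g I] that by simp
    qed
    show "mat_compress ?Q \<alpha> X = mat_compress R \<alpha> X"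
      using Q.rm_dim[OF X] fin by (intro eq_matI) (auto simp: mat_compress_def eq)
    show "mat_compress R \<alpha> X \<in> Q.rm m m"
      using Q.rm_dim[OF X] fin \<alpha> by (intro Q.rmI) (auto simp: mat_compress_def eq)
  qed
  show ?thesis
    unfolding operator_system_def
  proof
    show "matrix_ordered ?Q"
      unfolding matrix_ordered_def Q.mats_eq
    proof (intro conjI ballI allI impI)
      show "star_vector_space ?Q" by (rule sv)
      fix X assume "X \<in> pcone ?Q"
      note X = pcQ[OF this]
      then show "X \<in> Q.rm (dim_row X) (dim_row X)" "mat_adj ?Q X = X" using R.pc_star by auto
      show "mat_smult ?Q (complex_of_real r) X \<in> pcone ?Q" if "r \<ge> 0" for r
        using R.pc_sm[OF conjunct1[OF X] that] pc[OF smQ[OF conjunct2[OF X]]]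
        by (simp del: opsys_restrict_simps(7))
    next
      fix n X Y assume "X \<in> pcone ?Q \<inter> Q.rm n n" "Y \<in> pcone ?Q \<inter> Q.rm n n"
      then have X: "X \<in> Q.rm n n" "X \<in> pcone R" and Y: "Y \<in> Q.rm n n" "Y \<in> pcone R"
        using pcQ by blast+
      have "mat_add R X Y \<in> pcone R"
        by (rule R.pc_add[OF X(2) Y(2) subsetD[OF sub X(1)] subsetD[OF sub Y(1)]])
      then show "mat_add ?Q X Y \<in> pcone ?Q"
        using pc[OF plusQ[OF X(1) Y(1)]] by (simp del: opsys_restrict_simps(7))
    next
      fix n X assume "X \<in> pcone ?Q \<inter> Q.rm n n" and neg: "mat_smult ?Q (-1) X \<in> pcone ?Q"
      then have X: "X \<in> Q.rm n n" "X \<in> pcone R" using pcQ by blast+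
      have "mat_smult R (-1) X \<in> pcone R" using pcQ[OF neg] by (simp del: opsys_restrict_simps(7))
      then show "X = mat_zero ?Q n" using R.pc_antisym[OF X(2) _ subsetD[OF sub X(1)]] by simp
    next
      fix n m X and \<alpha> :: "complex mat" assume "X \<in> pcone ?Q \<inter> Q.rm n n" and \<alpha>: "\<alpha> \<in> carrier_mat n m"
      then have X: "X \<in> Q.rm n n" "X \<in> pcone R" using pcQ by blast+
      have "mat_compress R \<alpha> X \<in> pcone R"
        by (rule R.pc_compress[OF X(2) subsetD[OF sub X(1)] \<alpha>])
      then show "mat_compress ?Q \<alpha> X \<in> pcone ?Q"
        using pc[OF compr(2)[OF X(1) \<alpha>]] compr(1)[OF X(1) \<alpha>] by (simp del: opsys_restrict_simps(7))
    qed
    show "archimedean_matrix_order_unit ?Q"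
      unfolding archimedean_matrix_order_unit_def Q.mats_eq
    proof (intro conjI allI ballI impI)
      fix n X assume X: "X \<in> Q.rm n n" "mat_adj ?Q X = X"
      then have X': "X \<in> R.rm n n" "mat_adj R X = X" using sub by auto
      obtain r where r: "r > 0" "mat_add R (mat_smult R (complex_of_real r) (mat_unit R n)) (mat_smult R (-1) X) \<in> pcone R"
        using R.pc_order_unit[OF X'] by blast
      have "mat_add R (mat_smult R (complex_of_real r) (mat_unit R n)) (mat_smult R (-1) X) \<in> Q.rm n n"
        by (intro plusQ smQ unitQ X)
      then show "\<exists>r>0. mat_add ?Q (mat_smult ?Q (complex_of_real r) (mat_unit ?Q n)) (mat_smult ?Q (-1) X) \<in> pcone ?Q"
        using r pc by (intro exI[of _ r]) (simp del: opsys_restrict_simps(7))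
      assume a: "\<forall>r>0. mat_add ?Q (mat_smult ?Q (complex_of_real r) (mat_unit ?Q n)) X \<in> pcone ?Q"
      have "X \<in> pcone R" by (rule R.pc_archimedean[OF X']) (use a in auto)
      then show "X \<in> pcone ?Q" using pc[OF X(1)] by simp
    qed (use W in auto)
  qed
qed

lemma ucp_from_restrict:
  assumes "W \<subseteq> carrier R" "ucp S (opsys_restrict R W) f" shows "ucp S R f"
  using assms by (auto simp: ucp_def completely_positive_def clinear_def)

lemma ucp_closed: "\<lbrakk>ucp S R f; s \<in> carrier S\<rbrakk> \<Longrightarrow> f s \<in> carrier R"
  by (rule clinear_closed[OF ucp_clinear])

lemma ucp_id: "ucp S S (\<lambda>x. x)"
proof -
  have "map_mat (\<lambda>x. x) X = X" for X :: "'a mat" by (rule eq_matI) auto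
  then show ?thesis by (auto simp: ucp_def completely_positive_def clinear_def)
qed

lemma inductive_limit_lift:
  assumes "inductive_limit S \<phi> L l" "compatible_maps S \<phi> R \<psi>"
  obtains \<mu> where "ucp L R \<mu>" "\<And>k s. s \<in> carrier (S k) \<Longrightarrow> \<mu> (l k s) = \<psi> k s"
    "\<And>\<nu> x. \<lbrakk>ucp L R \<nu>; \<And>k s. s \<in> carrier (S k) \<Longrightarrow> \<nu> (l k s) = \<psi> k s; x \<in> carrier L\<rbrakk> \<Longrightarrow> \<nu> x = \<mu> x"
proof -
  from assms(1)[unfolded inductive_limit_def, THEN conjunct2, THEN spec[of _ R], THEN spec[of _ \<psi>], THEN mp, OF assms(2)]
  obtain \<mu> where \<mu>: "ucp L R \<mu> \<and> (\<forall>k. \<forall>s\<in>carrier (S k). \<mu> (l k s) = \<psi> k s) \<and>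
    (\<forall>\<nu>. ucp L R \<nu> \<and> (\<forall>k. \<forall>s\<in>carrier (S k). \<nu> (l k s) = \<psi> k s) \<longrightarrow> (\<forall>x\<in>carrier L. \<nu> x = \<mu> x))" ..
  show thesis
  proof (rule that[of \<mu>])
    show "ucp L R \<mu>" "\<And>k s. s \<in> carrier (S k) \<Longrightarrow> \<mu> (l k s) = \<psi> k s" using \<mu> by simp_all
    fix \<nu> x assume "ucp L R \<nu>" "\<And>k s. s \<in> carrier (S k) \<Longrightarrow> \<nu> (l k s) = \<psi> k s" "x \<in> carrier L"
    then show "\<nu> x = \<mu> x" using \<mu>[THEN conjunct2, THEN conjunct2, THEN spec[of _ \<nu>]] by simp
  qed
qed

lemma compatible_range_mono:
  assumes S: "\<And>k. ucp (S k) (S (Suc k)) (\<phi> k)" and c: "compatible_maps S \<phi> L l" and "m \<le> n"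
  shows "l m ` carrier (S m) \<subseteq> l n ` carrier (S n)"
  using assms(3)
proof (induction n rule: dec_induct)
  case (step n)
  have "l n ` carrier (S n) \<subseteq> l (Suc n) ` carrier (S (Suc n))"
  proof
    fix x assume "x \<in> l n ` carrier (S n)"
    then obtain s where s: "s \<in> carrier (S n)" "x = l n s" by auto
    have "x = l (Suc n) (\<phi> n s)" using c s by (simp add: compatible_maps_def)
    then show "x \<in> l (Suc n) ` carrier (S (Suc n))" using ucp_closed[OF S s(1)] by auto
  qed
  with step show ?case by blast
qed simp

text \<open>The union of the ranges is itself a compatible target, so by the uniqueness in the universal
  property the identity of \<open>L\<close> takes values in it.\<close>

lemma inductive_limit_carrier:
  assumes sys: "\<And>k. operator_system (S k)" "\<And>k. ucp (S k) (S (Suc k)) (\<phi> k)" and lim: "inductive_limit S \<phi> L l"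
  shows "carrier L = (\<Union>k. l k ` carrier (S k))"
proof -
  let ?W = "\<Union>k. l k ` carrier (S k)"
  have c: "compatible_maps S \<phi> L l" using lim by (simp add: inductive_limit_def)
  then have L: "operator_system L" and ul: "\<And>k. ucp (S k) L (l k)" by (auto simp: compatible_maps_def)
  note mono = compatible_range_mono[OF sys(2) c]
  have WL: "?W \<subseteq> carrier L" using ucp_closed[OF ul] by auto
  have pair: "\<exists>k s t. s \<in> carrier (S k) \<and> t \<in> carrier (S k) \<and> x = l k s \<and> y = l k t" if "x \<in> ?W" "y \<in> ?W" for x y
  proof -
    obtain m n where "x \<in> l m ` carrier (S m)" "y \<in> l n ` carrier (S n)" using \<open>x \<in> ?W\<close> \<open>y \<in> ?W\<close> by blast
    then have "x \<in> l (max m n) ` carrier (S (max m n))" "y \<in> l (max m n) ` carrier (S (max m n))"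
      using mono[of m "max m n"] mono[of n "max m n"] by auto
    then show ?thesis by blast
  qed
  interpret S: opsys "S k" for k by (rule opsys.intro[OF sys(1)])
  have R: "operator_system (opsys_restrict L ?W)"
  proof (rule operator_system_restrict[OF L WL])
    show "\<one>\<^bsub>L\<^esub> \<in> ?W" using ucp_one[OF ul, of 0] S.one_in[of 0] by (auto intro!: image_eqI[of _ _ "\<one>\<^bsub>S 0\<^esub>"] exI[of _ 0])
    show "x \<oplus>\<^bsub>L\<^esub> y \<in> ?W" if xy: "x \<in> ?W" "y \<in> ?W" for x y
    proof -
      obtain k s t where st: "s \<in> carrier (S k)" "t \<in> carrier (S k)" "x = l k s" "y = l k t" using pair[OF xy] by blast
      then have "x \<oplus>\<^bsub>L\<^esub> y = l k (s \<oplus>\<^bsub>S k\<^esub> t)" by (simp add: clinear_add[OF ucp_clinear[OF ul]])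
      then show ?thesis using st S.add.m_closed by blast
    qed
    show "c \<odot>\<^bsub>L\<^esub> x \<in> ?W" if x: "x \<in> ?W" for c x
    proof -
      obtain k s where st: "s \<in> carrier (S k)" "x = l k s" using x by blast
      then have "c \<odot>\<^bsub>L\<^esub> x = l k (c \<odot>\<^bsub>S k\<^esub> s)" by (simp add: clinear_sm[OF ucp_clinear[OF ul]])
      then show ?thesis using st S.sm_closed by blast
    qed
    show "adj L x \<in> ?W" if x: "x \<in> ?W" for x
    proof -
      obtain k s where st: "s \<in> carrier (S k)" "x = l k s" using x by blast
      then have "adj L x = l k (adj (S k) s)" using ucp_star[OF sys(1) L ul] by simp
      then show ?thesis using st S.star_closed by blast
    qed
  qed
  have "ucp (S k) (opsys_restrict L ?W) (l k)" for k
  proof -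
    have "elements_mat (map_mat (l k) X) \<subseteq> ?W" if "X \<in> pcone (S k)" for X
      using S.rm_entry[OF S.pc_rm[OF that]] S.rm_dim[OF S.pc_rm[OF that]] unfolding elements_mat_subset by auto
    then show ?thesis using ul[of k] by (auto simp: ucp_def completely_positive_def clinear_def)
  qed
  then have "compatible_maps S \<phi> (opsys_restrict L ?W) l" using c R by (simp add: compatible_maps_def)
  obtain \<mu> where \<mu>: "ucp L (opsys_restrict L ?W) \<mu>" "\<And>k s. s \<in> carrier (S k) \<Longrightarrow> \<mu> (l k s) = l k s"
    by (rule inductive_limit_lift[OF lim \<open>compatible_maps S \<phi> (opsys_restrict L ?W) l\<close>]) (rule that)
  obtain \<mu>0 where \<mu>0: "\<And>\<nu> x. \<lbrakk>ucp L L \<nu>; \<And>k s. s \<in> carrier (S k) \<Longrightarrow> \<nu> (l k s) = l k s; x \<in> carrier L\<rbrakk> \<Longrightarrow> \<nu> x = \<mu>0 x"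
  proof (rule inductive_limit_lift[OF lim c])
    fix \<mu> assume "\<And>\<nu> x. \<lbrakk>ucp L L \<nu>; \<And>k s. s \<in> carrier (S k) \<Longrightarrow> \<nu> (l k s) = l k s; x \<in> carrier L\<rbrakk> \<Longrightarrow> \<nu> x = \<mu> x"
    then show thesis by (rule that)
  qed
  have "x \<in> ?W" if x: "x \<in> carrier L" for x
  proof -
    have "\<mu> x = \<mu>0 x" by (rule \<mu>0[OF ucp_from_restrict[OF WL \<mu>(1)] \<mu>(2) x])
    moreover have "x = \<mu>0 x" by (rule \<mu>0[OF ucp_id _ x]) simp
    ultimately show ?thesis using ucp_closed[OF \<mu>(1) x] by simp
  qed
  then show ?thesis using WL by blast
qed

section \<open>Iterated connecting maps\<close>

primrec iter_map :: "(nat \<Rightarrow> 'u \<Rightarrow> 'u) \<Rightarrow> nat \<Rightarrow> nat \<Rightarrow> 'u \<Rightarrow> 'u" where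
  "iter_map \<phi> m 0 = (\<lambda>x. x)"
| "iter_map \<phi> m (Suc d) = \<phi> (m + d) \<circ> iter_map \<phi> m d"

text \<open>The recursion adds the last map of the chain, whereas compatibility of the maps out of
  consecutive stages requires splitting off the first.\<close>

lemma iter_map_Suc_left: "iter_map \<phi> m (Suc d) x = iter_map \<phi> (Suc m) d (\<phi> m x)"
  by (induction d) auto

lemma iter_map_ucp: "(\<And>k. ucp (S k) (S (Suc k)) (\<phi> k)) \<Longrightarrow> ucp (S m) (S (m + d)) (iter_map \<phi> m d)"
  by (induction d) (auto intro: ucp_comp ucp_id)

lemma iter_map_pcone:
  assumes P: "\<And>k. operator_system (P k)" "\<And>k. ucp (P k) (P (Suc k)) (\<Phi> k)"
    and e: "\<And>k. complete_order_embedding (P k) (P (Suc k)) (\<Phi> k)"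
    and X: "X \<in> mats (P m) n" "map_mat (iter_map \<Phi> m d) X \<in> pcone (P (m + d))"
  shows "X \<in> pcone (P m)"
  using X(2)
proof (induction d)
  case 0
  have "map_mat (\<lambda>x. x) X = X" by (rule eq_matI) auto
  with 0 show ?case by simp
next
  case (Suc d)
  have "map_mat (iter_map \<Phi> m d) X \<in> mats (P (m + d)) n"
    using X(1) ucp_closed[OF iter_map_ucp[of P \<Phi>, OF P(2)]] by (auto simp: mats_entries)
  moreover have "map_mat (\<Phi> (m + d)) (map_mat (iter_map \<Phi> m d) X) \<in> pcone (P (Suc (m + d)))"
    using Suc.prems by (simp add: map_mat_comp comp_def)
  ultimately show ?case using complete_order_embeddingD(4)[OF e] Suc.IH by blast
qed

section \<open>Commuting tensor products and inductive limits\<close>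

lemma commuting_tensorD:
  assumes "commuting_tensor S T P \<theta>"
  shows "operator_system P" "algebraic_tensor S T P \<theta>" "cbilinear S T P \<theta>"
  using assms by (auto simp: commuting_tensor_def algebraic_tensor_def)

lemma cbilinear_closed: "\<lbrakk>cbilinear V W Z b; v \<in> carrier V; w \<in> carrier W\<rbrakk> \<Longrightarrow> b v w \<in> carrier Z"
  by (auto simp: cbilinear_def clinear_def)

text \<open>The map t exists algebraically. Its positivity and unitality are checked inside the
  C*-algebra containing \<open>P'\<close>: there it becomes the lift of the commuting pair g o f and
  h, and the embedding j reflects positivity and is injective.\<close>

lemma commuting_tensor_functorial:
  fixes S S' T P P' :: "'u opsys"
  assumes ct: "commuting_tensor S T P \<theta>" and ct': "commuting_tensor S' T P' \<theta>'"
    and S: "operator_system S" and S': "operator_system S'" and T: "operator_system T" and f: "ucp S S' f"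
  obtains t where "ucp P P' t" "\<And>s x. \<lbrakk>s \<in> carrier S; x \<in> carrier T\<rbrakk> \<Longrightarrow> t (\<theta> s x) = \<theta>' (f s) x"
proof -
  note P = commuting_tensorD[OF ct] and P' = commuting_tensorD[OF ct']
  interpret P: opsys P by (rule opsys.intro[OF P(1)])
  interpret P': opsys P' by (rule opsys.intro[OF P'(1)])
  obtain M :: "'u cstar" and g h j where M: "cstar_algebra M" and g: "ucp S' (cstar_opsys M) g" and h: "ucp T (cstar_opsys M) h"
    and comm: "\<And>s t. \<lbrakk>s \<in> carrier S'; t \<in> carrier T\<rbrakk> \<Longrightarrow> g s \<otimes>\<^bsub>M\<^esub> h t = h t \<otimes>\<^bsub>M\<^esub> g s"
    and j: "complete_order_embedding P' (cstar_opsys M) j" "j \<one>\<^bsub>P'\<^esub> = \<one>\<^bsub>M\<^esub>"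
    and j\<theta>: "\<And>s t. \<lbrakk>s \<in> carrier S'; t \<in> carrier T\<rbrakk> \<Longrightarrow> j (\<theta>' s t) = g s \<otimes>\<^bsub>M\<^esub> h t"
    by (rule commuting_tensor_represent[OF ct' S' T]) (rule that)
  interpret M: cstar_alg M by (rule cstar_alg.intro[OF M])
  have fc: "f s \<in> carrier S'" if "s \<in> carrier S" for s by (rule ucp_closed[OF f that])
  obtain u where u: "ucp P (cstar_opsys M) u" "\<And>s x. \<lbrakk>s \<in> carrier S; x \<in> carrier T\<rbrakk> \<Longrightarrow> u (\<theta> s x) = (g \<circ> f) s \<otimes>\<^bsub>M\<^esub> h x"
    using commuting_tensor_lift[OF ct S T M ucp_comp[OF f g] h] comm fc by (metis comp_apply)
  note lin = ucp_clinear[OF f]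
  have "cbilinear S T P' (\<lambda>s x. \<theta>' (f s) x)"
    unfolding cbilinear_def
  proof (intro conjI ballI)
    show "clinear T P' (\<theta>' (f s))" if "s \<in> carrier S" for s
      using P'(3) fc[OF that] by (simp add: cbilinear_def)
    show "clinear S P' (\<lambda>s. \<theta>' (f s) x)" if "x \<in> carrier T" for x
      using clinear_comp[OF lin, of P' "\<lambda>s. \<theta>' s x"] P'(3) that by (simp add: cbilinear_def comp_def)
  qed
  then obtain t where t: "clinear P P' t" "\<And>s x. \<lbrakk>s \<in> carrier S; x \<in> carrier T\<rbrakk> \<Longrightarrow> t (\<theta> s x) = \<theta>' (f s) x"
    using algebraic_tensor_lift[OF P(2) P'.complex_space] by metis
  note jd = complete_order_embeddingD[OF j(1)]
  have jlin: "clinear P' M j" using jd(1) by simp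
  have ulin: "clinear P M u" using ucp_clinear[OF u(1)] by simp
  \<comment> \<open>Both maps are linear and agree on elementary tensors, so they agree on all of
    \<open>P\<close>.\<close>
  have jt: "(j \<circ> t) p = u p" if p: "p \<in> carrier P" for p
    by (rule algebraic_tensor_unique[OF P(2) M.complex_space clinear_comp[OF t(1) jlin] ulin _ p])
      (simp add: t(2) u(2) j\<theta> fc)
  have "t \<one>\<^bsub>P\<^esub> = \<one>\<^bsub>P'\<^esub>"
  proof (rule inj_onD[OF jd(2)])
    show "j (t \<one>\<^bsub>P\<^esub>) = j \<one>\<^bsub>P'\<^esub>" using jt[OF P.one_in] ucp_one[OF u(1)] j(2) by simp
  qed (use clinear_closed[OF t(1)] in auto)
  moreover have "map_mat t X \<in> pcone P'" if X: "X \<in> pcone P" for X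
  proof (rule jd(4))
    note Xr = P.pc_rm[OF X]
    show "map_mat t X \<in> mats P' (dim_row X)"
      using P.rm_dim[OF Xr] P.rm_entry[OF Xr] clinear_closed[OF t(1)] by (auto simp: mats_entries)
    have "map_mat j (map_mat t X) = map_mat u X"
      using P.rm_dim[OF Xr] P.rm_entry[OF Xr] jt by (intro eq_matI) auto
    then show "map_mat j (map_mat t X) \<in> pcone (cstar_opsys M)" using ucp_pcone[OF u(1) X] by simp
  qed
  ultimately have "ucp P P' t" using t(1) by (simp add: ucp_def completely_positive_def)
  with t(2) show thesis using that by blast
qed

text \<open>Here the shape of \<open>'w univ\<close> enters: a sequence in the universe is again an
  element of it, which lets the sequence quotient be a test object of the universal
  properties.\<close>

lemma sequence_encoding: "inj (\<lambda>(x :: nat \<Rightarrow> nat \<Rightarrow> 'w) n. x (fst (prod_decode n)) (snd (prod_decode n)))"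
proof (rule injI)
  fix x y :: "nat \<Rightarrow> nat \<Rightarrow> 'w"
  assume eq: "(\<lambda>n. x (fst (prod_decode n)) (snd (prod_decode n))) = (\<lambda>n. y (fst (prod_decode n)) (snd (prod_decode n)))"
  show "x = y"
  proof (intro ext)
    fix i j show "x i j = y i j" using fun_cong[OF eq, of "prod_encode (i, j)"] by simp
  qed
qed

lemma ucp_sa:
  assumes "operator_system S" "operator_system R" "ucp S R f" "X \<in> mats S n" "mat_adj S X = X"
  shows "mat_adj R (map_mat f X) = map_mat f X"
proof -
  interpret S: opsys S by (rule opsys.intro) fact
  show ?thesis using map_mat_mstar[OF assms(1-3), of X n n] assms(4,5) by (simp add: S.mats_eq)
qed

section \<open>The system of commuting tensor products and the tensor product of the limit\<close>

locale commuting_tensor_system =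
  fixes S :: "nat \<Rightarrow> 'w univ opsys" and \<phi> :: "nat \<Rightarrow> 'w univ \<Rightarrow> 'w univ" and T :: "'w univ opsys"
    and P :: "nat \<Rightarrow> 'w univ opsys" and \<theta> :: "nat \<Rightarrow> 'w univ \<Rightarrow> 'w univ \<Rightarrow> 'w univ"
    and \<Phi> :: "nat \<Rightarrow> 'w univ \<Rightarrow> 'w univ"
    and L :: "'w univ opsys" and l :: "nat \<Rightarrow> 'w univ \<Rightarrow> 'w univ"
    and Q :: "'w univ opsys" and \<eta> :: "'w univ \<Rightarrow> 'w univ \<Rightarrow> 'w univ"
  assumes system: "inductive_system S \<phi>"
    and T: "operator_system T"
    and tensor: "\<And>k. commuting_tensor (S k) T (P k) (\<theta> k)"
    and connecting: "\<And>k. tensor_map (S k) T (P k) (\<theta> k) (P (Suc k)) (\<theta> (Suc k)) (\<phi> k) id (\<Phi> k)"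
    and tensor_embedding: "\<And>k. complete_order_embedding (P k) (P (Suc k)) (\<Phi> k)"
    and limit: "inductive_limit S \<phi> L l"
    and tensor_of_limit: "commuting_tensor L T Q \<eta>"
begin

lemma S: "operator_system (S k)" and \<phi>: "ucp (S k) (S (Suc k)) (\<phi> k)"
  using system by (simp_all add: inductive_system_def)

lemma L: "operator_system L" and l: "ucp (S k) L (l k)"
  and l_\<phi>: "s \<in> carrier (S k) \<Longrightarrow> l (Suc k) (\<phi> k s) = l k s"
  using limit by (simp_all add: inductive_limit_def compatible_maps_def)

lemmas P = commuting_tensorD[OF tensor] and Q = commuting_tensorD[OF tensor_of_limit]

lemma \<Phi>_\<theta>: "\<lbrakk>s \<in> carrier (S k); x \<in> carrier T\<rbrakk> \<Longrightarrow> \<Phi> k (\<theta> k s x) = \<theta> (Suc k) (\<phi> k s) x"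
  using connecting[of k] by (simp add: tensor_map_def)

text \<open>A complete order embedding need not preserve the unit. The functorial map t does, and it
  agrees with \<open>\<Phi> k\<close> because both are determined by their values on elementary
  tensors.\<close>

lemma connecting_ucp: "ucp (P k) (P (Suc k)) (\<Phi> k)"
proof -
  obtain t where t: "ucp (P k) (P (Suc k)) t"
    "\<And>s x. \<lbrakk>s \<in> carrier (S k); x \<in> carrier T\<rbrakk> \<Longrightarrow> t (\<theta> k s x) = \<theta> (Suc k) (\<phi> k s) x"
    by (rule commuting_tensor_functorial[OF tensor tensor S S T \<phi>]) (rule that)
  interpret P: opsys "P k" by (rule opsys.intro[OF P(1)])
  interpret P': opsys "P (Suc k)" by (rule opsys.intro[OF P(1)])
  note e = complete_order_embeddingD[OF tensor_embedding[of k]]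
  have "\<Phi> k \<one>\<^bsub>P k\<^esub> = t \<one>\<^bsub>P k\<^esub>"
    by (rule algebraic_tensor_unique[OF P(2) P'.complex_space e(1) ucp_clinear[OF t(1)] _ P.one_in])
      (simp add: \<Phi>_\<theta> t(2))
  then show ?thesis using e(1,3) ucp_one[OF t(1)] by (simp add: ucp_def completely_positive_def)
qed

lemma \<theta>_closed: "\<lbrakk>s \<in> carrier (S k); x \<in> carrier T\<rbrakk> \<Longrightarrow> \<theta> k s x \<in> carrier (P k)"
  by (rule cbilinear_closed[OF P(3)])

lemma iter_closed: "s \<in> carrier (S m) \<Longrightarrow> iter_map \<phi> m d s \<in> carrier (S (m + d))"
  by (rule ucp_closed[OF iter_map_ucp]) (rule \<phi>)

lemma iter_\<theta>:
  "\<lbrakk>s \<in> carrier (S m); x \<in> carrier T\<rbrakk> \<Longrightarrow> iter_map \<Phi> m d (\<theta> m s x) = \<theta> (m + d) (iter_map \<phi> m d s) x"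
  by (induction d) (auto simp: \<Phi>_\<theta> iter_closed)

text \<open>The map \<open>l k\<close> \<otimes> id from stage k into \<open>Q\<close>, fixed once
  by choice so that all stages can be spoken of together.\<close>

definition leg :: "nat \<Rightarrow> 'w univ \<Rightarrow> 'w univ" where
  "leg k = (SOME t. ucp (P k) Q t \<and> (\<forall>s\<in>carrier (S k). \<forall>x\<in>carrier T. t (\<theta> k s x) = \<eta> (l k s) x))"

lemma leg_ucp: "ucp (P k) Q (leg k)"
  and leg_\<theta>: "\<lbrakk>s \<in> carrier (S k); x \<in> carrier T\<rbrakk> \<Longrightarrow> leg k (\<theta> k s x) = \<eta> (l k s) x"
proof -
  have "\<exists>t. ucp (P k) Q t \<and> (\<forall>s\<in>carrier (S k). \<forall>x\<in>carrier T. t (\<theta> k s x) = \<eta> (l k s) x)"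
    by (rule commuting_tensor_functorial[OF tensor tensor_of_limit S L T l]) blast
  then have "ucp (P k) Q (leg k) \<and> (\<forall>s\<in>carrier (S k). \<forall>x\<in>carrier T. leg k (\<theta> k s x) = \<eta> (l k s) x)"
    unfolding leg_def by (rule someI_ex)
  then show "ucp (P k) Q (leg k)"
    and "\<lbrakk>s \<in> carrier (S k); x \<in> carrier T\<rbrakk> \<Longrightarrow> leg k (\<theta> k s x) = \<eta> (l k s) x" by auto
qed

sublocale Qo: opsys Q by (rule opsys.intro[OF Q(1)])
sublocale Po: opsys "P k" for k by (rule opsys.intro[OF P(1)])

lemma leg_\<Phi>: "p \<in> carrier (P k) \<Longrightarrow> leg (Suc k) (\<Phi> k p) = leg k p"
proof -
  assume p: "p \<in> carrier (P k)"
  have "(leg (Suc k) \<circ> \<Phi> k) p = leg k p"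
  proof (rule algebraic_tensor_unique[OF P(2) Qo.complex_space _ _ _ p])
    show "clinear (P k) Q (leg (Suc k) \<circ> \<Phi> k)"
      by (rule clinear_comp[OF ucp_clinear[OF connecting_ucp] ucp_clinear[OF leg_ucp]])
    show "clinear (P k) Q (leg k)" by (rule ucp_clinear[OF leg_ucp])
    fix s x assume "s \<in> carrier (S k)" "x \<in> carrier T"
    then show "(leg (Suc k) \<circ> \<Phi> k) (\<theta> k s x) = leg k (\<theta> k s x)"
      using ucp_closed[OF \<phi>] by (simp add: \<Phi>_\<theta> leg_\<theta> l_\<phi>)
  qed
  then show ?thesis by simp
qed

text \<open>The key step: \<open>Q\<close> is mapped to the algebra of bounded sequences modulo null sequences in the
  maximal tensor products belonging to the \<open>P k\<close>, and a positive image there is approximately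
  positive in some \<open>P (m + d)\<close>, hence in \<open>P m\<close>.\<close>

lemma leg_reflects_sa:
  assumes X: "X \<in> mats (P m) n" and Xsa: "mat_adj (P m) X = X" and pos: "map_mat (leg m) X \<in> pcone Q"
  shows "X \<in> pcone (P m)"
proof -
  have "\<exists>(M :: 'w univ cstar) f g j. cstar_algebra M \<and> ucp (S k) (cstar_opsys M) f \<and> ucp T (cstar_opsys M) g \<and>
      (\<forall>s\<in>carrier (S k). \<forall>x\<in>carrier T. f s \<otimes>\<^bsub>M\<^esub> g x = g x \<otimes>\<^bsub>M\<^esub> f s) \<and>
      complete_order_embedding (P k) (cstar_opsys M) j \<and> j \<one>\<^bsub>P k\<^esub> = \<one>\<^bsub>M\<^esub> \<and>
      (\<forall>s\<in>carrier (S k). \<forall>x\<in>carrier T. j (\<theta> k s x) = f s \<otimes>\<^bsub>M\<^esub> g x)" for k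
  proof (rule commuting_tensor_represent[OF tensor S T, of k], goal_cases)
    case (1 M f g j)
    show ?case by (intro exI[of _ M] exI[of _ f] exI[of _ g] exI[of _ j] conjI ballI 1)
  qed
  then obtain M :: "nat \<Rightarrow> 'w univ cstar" and f g j where M: "\<And>k. cstar_algebra (M k)"
    and f: "\<And>k. ucp (S k) (cstar_opsys (M k)) (f k)" and g: "\<And>k. ucp T (cstar_opsys (M k)) (g k)"
    and comm: "\<And>k s x. \<lbrakk>s \<in> carrier (S k); x \<in> carrier T\<rbrakk> \<Longrightarrow> f k s \<otimes>\<^bsub>M k\<^esub> g k x = g k x \<otimes>\<^bsub>M k\<^esub> f k s"
    and j: "\<And>k. complete_order_embedding (P k) (cstar_opsys (M k)) (j k)" "\<And>k. j k \<one>\<^bsub>P k\<^esub> = \<one>\<^bsub>M k\<^esub>"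
    and j\<theta>: "\<And>k s x. \<lbrakk>s \<in> carrier (S k); x \<in> carrier T\<rbrakk> \<Longrightarrow> j k (\<theta> k s x) = f k s \<otimes>\<^bsub>M k\<^esub> g k x"
    by metis
  interpret C: cstar_sequence M "\<lambda>x n. x (fst (prod_decode n)) (snd (prod_decode n))"
    by (rule cstar_sequence.intro[OF M sequence_encoding])
  let ?B = "C.Q.quot"
  interpret B: cstar_alg ?B by (rule cstar_alg.intro[OF C.quot_cstar])
  have iS: "ucp (S a) (S k) (iter_map \<phi> a (k - a))" if "k \<ge> a" for a k
    using iter_map_ucp[of S \<phi> a "k - a", OF \<phi>] that by simp
  have iP: "ucp (P a) (P k) (iter_map \<Phi> a (k - a))" if "k \<ge> a" for a k
    using iter_map_ucp[of P \<Phi> a "k - a", OF connecting_ucp] that by simp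
  have ju: "ucp (P k) (cstar_opsys (M k)) (j k)" for k
    using complete_order_embeddingD[OF j(1)] j(2) by (auto simp: ucp_def completely_positive_def)
  \<comment> \<open>The map of stage a into the algebra \<open>M k\<close>. For k < a the truncated
    difference makes it meaningless; \<open>tail_from a\<close> discards these indices.\<close>
  define f' where "f' a k = f k \<circ> iter_map \<phi> a (k - a)" for a k
  define j' where "j' a k = j k \<circ> iter_map \<Phi> a (k - a)" for a k
  have f': "ucp (S a) (cstar_opsys (M k)) (f' a k)" if "k \<ge> a" for a k
    unfolding f'_def by (rule ucp_comp[OF iS[OF that] f])
  have j': "ucp (P a) (cstar_opsys (M k)) (j' a k)" if "k \<ge> a" for a k
    unfolding j'_def by (rule ucp_comp[OF iP[OF that] ju])
  define F where "F a s = C.Q.pr (C.tail_from a (\<lambda>k. f' a k s))" for a s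
  define H where "H a p = C.Q.pr (C.tail_from a (\<lambda>k. j' a k p))" for a p
  define G where "G x = C.Q.pr (C.tail_from 0 (\<lambda>k. g k x))" for x
  have F: "ucp (S a) (cstar_opsys ?B) (F a)" for a
    unfolding F_def by (rule C.ucp_sequence[OF S f'])
  have H: "ucp (P a) (cstar_opsys ?B) (H a)" for a
    unfolding H_def by (rule C.ucp_sequence[OF P(1) j'])
  have G: "ucp T (cstar_opsys ?B) G"
    unfolding G_def by (rule C.ucp_sequence[OF T g])
  have Fc: "C.tail_from a (\<lambda>k. f' a k s) \<in> carrier C.bseq" if "s \<in> carrier (S a)" for a s
    by (rule C.ucp_from_closed[OF S f' that])
  have Hc: "C.tail_from a (\<lambda>k. j' a k p) \<in> carrier C.bseq" if "p \<in> carrier (P a)" for a p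
    by (rule C.ucp_from_closed[OF P(1) j' that])
  have Gc: "C.tail_from 0 (\<lambda>k. g k x) \<in> carrier C.bseq" if "x \<in> carrier T" for x
    by (rule C.ucp_from_closed[OF T g that])
  \<comment> \<open>Passing from stage a to the next only deletes the entry at index a, which is
    invisible modulo null sequences.\<close>
  have "compatible_maps S \<phi> (cstar_opsys ?B) F"
    unfolding compatible_maps_def
  proof (intro conjI allI ballI)
    show "operator_system (cstar_opsys ?B)" by (rule B.operator_system)
    show "ucp (S a) (cstar_opsys ?B) (F a)" for a by (rule F)
    fix a s assume s: "s \<in> carrier (S a)"
    show "F (Suc a) (\<phi> a s) = F a s"
      unfolding F_def
    proof (rule C.pr_eq_tail[OF Fc[OF ucp_closed[OF \<phi> s]] Fc[OF s]])
      fix k assume k: "k \<ge> Suc a"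
      then obtain d where d: "k = Suc a + d" using le_Suc_ex by blast
      have "iter_map \<phi> a (Suc d) s = iter_map \<phi> (Suc a) d (\<phi> a s)" by (rule iter_map_Suc_left)
      then show "C.tail_from (Suc a) (\<lambda>k. f' (Suc a) k (\<phi> a s)) k = C.tail_from a (\<lambda>k. f' a k s) k"
        by (simp add: C.tail_from_def f'_def d)
    qed
  qed
  then obtain F' where F': "ucp L (cstar_opsys ?B) F'" and F'l: "\<And>a s. s \<in> carrier (S a) \<Longrightarrow> F' (l a s) = F a s"
    by (rule inductive_limit_lift[OF limit]) (rule that)
  have FG: "F a s \<otimes>\<^bsub>?B\<^esub> G x = C.Q.pr (C.tail_from a (\<lambda>k. f' a k s) \<otimes>\<^bsub>C.bseq\<^esub> C.tail_from 0 (\<lambda>k. g k x))"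
    "G x \<otimes>\<^bsub>?B\<^esub> F a s = C.Q.pr (C.tail_from 0 (\<lambda>k. g k x) \<otimes>\<^bsub>C.bseq\<^esub> C.tail_from a (\<lambda>k. f' a k s))"
    if "s \<in> carrier (S a)" "x \<in> carrier T" for a s x
    unfolding F_def G_def by (rule C.Q.quot_mult[OF Fc[OF that(1)] Gc[OF that(2)]] C.Q.quot_mult[OF Gc[OF that(2)] Fc[OF that(1)]])+
  note closed1 = C.bseq.m_closed[OF Fc Gc] and closed2 = C.bseq.m_closed[OF Gc Fc]
  have commB: "F' s \<otimes>\<^bsub>?B\<^esub> G x = G x \<otimes>\<^bsub>?B\<^esub> F' s" if "s \<in> carrier L" "x \<in> carrier T" for s x
  proof -
    obtain a s' where s': "s' \<in> carrier (S a)" "s = l a s'"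
      using inductive_limit_carrier[OF S \<phi> limit] \<open>s \<in> carrier L\<close> by auto
    show ?thesis
      unfolding s'(2) F'l[OF s'(1)] FG[OF s'(1) that(2)]
      by (rule C.pr_eq_tail[OF closed1[OF s'(1) that(2)] closed2[OF that(2) s'(1)], of a])
        (use comm[OF ucp_closed[OF iS s'(1)] that(2)] in \<open>simp add: C.tail_from_def f'_def\<close>)
  qed
  obtain h where h: "ucp Q (cstar_opsys ?B) h" "\<And>s x. \<lbrakk>s \<in> carrier L; x \<in> carrier T\<rbrakk> \<Longrightarrow> h (\<eta> s x) = F' s \<otimes>\<^bsub>?B\<^esub> G x"
  proof (rule commuting_tensor_lift[OF tensor_of_limit L T C.quot_cstar F' G])
    show "F' s \<otimes>\<^bsub>?B\<^esub> G x = G x \<otimes>\<^bsub>?B\<^esub> F' s" if "s \<in> carrier L" "x \<in> carrier T" for s x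
      by (rule commB[OF that])
    fix h assume h: "ucp Q (cstar_opsys ?B) h"
      and h': "\<And>s x. \<lbrakk>s \<in> carrier L; x \<in> carrier T\<rbrakk> \<Longrightarrow> h (\<eta> s x) = F' s \<otimes>\<^bsub>?B\<^esub> G x"
    show thesis by (rule that[OF h h'])
  qed
  \<comment> \<open>Both maps are linear in p and agree on elementary tensors. So a positive image
    in \<open>Q\<close> yields positivity in the quotient of the sequence of images of p itself, and
    nothing of \<open>L\<close> remains in it.\<close>
  have hH: "h (leg a p) = H a p" if p: "p \<in> carrier (P a)" for a p
  proof -
    have "(h \<circ> leg a) p = H a p"
    proof (rule algebraic_tensor_unique[OF P(2) B.complex_space _ _ _ p])
      show "clinear (P a) ?B (h \<circ> leg a)"
        using clinear_comp[OF ucp_clinear[OF leg_ucp] ucp_clinear[OF h(1)]] by simp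
      show "clinear (P a) ?B (H a)" using ucp_clinear[OF H] by simp
      fix s x assume sx: "s \<in> carrier (S a)" "x \<in> carrier T"
      have "(h \<circ> leg a) (\<theta> a s x) = F a s \<otimes>\<^bsub>?B\<^esub> G x"
        using sx ucp_closed[OF l sx(1)] by (simp add: leg_\<theta> h(2) F'l)
      also have "\<dots> = H a (\<theta> a s x)"
        unfolding FG[OF sx] H_def
      proof (rule C.pr_eq_tail[OF closed1[OF sx] Hc[OF \<theta>_closed[OF sx]], of a])
        fix k assume k: "k \<ge> a"
        then have "j' a k (\<theta> a s x) = f' a k s \<otimes>\<^bsub>M k\<^esub> g k x"
          using iter_\<theta>[OF sx, of "k - a"] j\<theta>[OF ucp_closed[OF iS[OF k] sx(1)] sx(2)]
          by (simp add: j'_def f'_def)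
        then show "(C.tail_from a (\<lambda>k. f' a k s) \<otimes>\<^bsub>C.bseq\<^esub> C.tail_from 0 (\<lambda>k. g k x)) k =
            C.tail_from a (\<lambda>k. j' a k (\<theta> a s x)) k"
          using k by (simp add: C.tail_from_def)
      qed
      finally show "(h \<circ> leg a) (\<theta> a s x) = H a (\<theta> a s x)" .
    qed
    then show ?thesis by simp
  qed
  have Xr: "X \<in> Po.rm m n n" using X by (simp add: Po.mats_eq)
  note Xe = Po.rm_entry[OF Xr] and Xd = Po.rm_dim[OF Xr]
  define x where "x i i' = C.tail_from m (\<lambda>k. j' m k (X $$ (i, i')))" for i i'
  have x: "x i i' \<in> carrier C.bseq" if "i < n" "i' < n" for i i' unfolding x_def using Hc Xe that by blast
  have xk: "mat n n (\<lambda>(i, i'). x i i' k) = map_mat (j' m k) X" if "k \<ge> m" for k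
    using Xd that by (intro eq_matI) (auto simp: x_def C.tail_from_def)
  have "mat n n (\<lambda>(i, i'). C.Q.pr (x i i')) = map_mat h (map_mat (leg m) X)"
    using Xd Xe by (intro eq_matI) (auto simp: hH H_def x_def)
  then have posB: "mat n n (\<lambda>(i, i'). C.Q.pr (x i i')) \<in> pcone (cstar_opsys ?B)"
    using ucp_pcone[OF h(1) pos] by simp
  have sak: "\<forall>\<^sub>F k in sequentially. mat_adj (M k) (mat n n (\<lambda>(i, i'). x i i' k)) = mat n n (\<lambda>(i, i'). x i i' k)"
    unfolding eventually_sequentially
    using ucp_sa[OF P(1) C.M.operator_system j' X Xsa] xk by (intro exI[of _ m]) simp
  show ?thesis
  proof (rule Po.pc_archimedean[OF Xr Xsa])
    fix e :: real assume e: "e > 0"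
    have "\<forall>\<^sub>F k in sequentially. k \<ge> m \<and> mat_add (M k) (mat_smult (M k) (complex_of_real e) (mat_unit (M k) n))
        (mat n n (\<lambda>(i, i'). x i i' k)) \<in> pcone (cstar_opsys (M k))"
      by (intro eventually_conj eventually_ge_at_top C.pcone_quot_eventually[OF x posB sak e])
    then obtain k where k: "k \<ge> m" and pk: "mat_add (M k) (mat_smult (M k) (complex_of_real e) (mat_unit (M k) n))
        (map_mat (j' m k) X) \<in> pcone (cstar_opsys (M k))"
      using xk unfolding eventually_sequentially by auto
    let ?Z = "mat_add (P m) (mat_smult (P m) (complex_of_real e) (mat_unit (P m) n)) X"
    have Zr: "?Z \<in> Po.rm m n n" using Xr by auto
    note jlin = ucp_clinear[OF j'[OF k]]
    interpret Mo: opsys "cstar_opsys (M k)" by (rule opsys.intro[OF C.M.operator_system])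
    have "map_mat (j' m k) ?Z = mat_add (M k) (mat_smult (M k) (complex_of_real e) (mat_unit (M k) n)) (map_mat (j' m k) X)"
      using map_mat_plus[OF Po.star_vs jlin Po.msm_closed[OF Po.unitm_closed] Xr]
        map_mat_sm[OF Po.star_vs jlin Po.unitm_closed] map_mat_unit[where f = "j' m k", OF Po.star_vs Mo.star_vs jlin ucp_one[OF j'[OF k]]]
      by simp
    with pk have "map_mat (j k) (map_mat (iter_map \<Phi> m (k - m)) ?Z) \<in> pcone (cstar_opsys (M k))"
      by (simp add: map_mat_comp j'_def)
    moreover have "map_mat (iter_map \<Phi> m (k - m)) ?Z \<in> mats (P k) n"
      using Po.rm_dim[OF Zr] Po.rm_entry[OF Zr] ucp_closed[OF iP[OF k]] by (auto simp: mats_entries)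
    ultimately have "map_mat (iter_map \<Phi> m (k - m)) ?Z \<in> pcone (P k)"
      using complete_order_embeddingD(4)[OF j(1)] by blast
    then show "?Z \<in> pcone (P m)"
      using iter_map_pcone[of P \<Phi> ?Z m n "k - m", OF P(1) connecting_ucp tensor_embedding] Zr k by (simp add: Po.mats_eq)
  qed
qed

text \<open>If a self-adjoint a is sent to 0, then a and -a both have positive image, so both are
  positive as 1 x 1 matrices and a vanishes. The general case follows from real and imaginary
  parts.\<close>

lemma leg_inj:
  assumes p: "p \<in> carrier (P m)" and 0: "leg m p = \<zero>\<^bsub>Q\<^esub>"
  shows "p = \<zero>\<^bsub>P m\<^esub>"
proof -
  note lin = ucp_clinear[OF leg_ucp[of m]]
  have sa0: "a = \<zero>\<^bsub>P m\<^esub>" if a: "a \<in> Po.sa m" and la: "leg m a = \<zero>\<^bsub>Q\<^esub>" for a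
  proof -
    have ac: "a \<in> carrier (P m)" using a by auto
    have pc: "mat 1 1 (\<lambda>_. b) \<in> pcone (P m)" if b: "b \<in> Po.sa m" and lb: "leg m b = \<zero>\<^bsub>Q\<^esub>" for b
    proof (rule leg_reflects_sa[of _ m 1])
      show "mat 1 1 (\<lambda>_. b) \<in> mats (P m) 1" "mat_adj (P m) (mat 1 1 (\<lambda>_. b)) = mat 1 1 (\<lambda>_. b)"
        using Po.sa_mat1[OF b] by (simp_all add: Po.mats_eq)
      have "map_mat (leg m) (mat 1 1 (\<lambda>_. b)) = mat_smult Q (complex_of_real 0) (mat_unit Q 1)"
        using lb by (intro eq_matI) (auto simp: mat_smult_def mat_unit_def)
      then show "map_mat (leg m) (mat 1 1 (\<lambda>_. b)) \<in> pcone Q" using Qo.unit_pc[of 0 1] by simp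
    qed
    have "leg m (\<ominus>\<^bsub>P m\<^esub> a) = \<zero>\<^bsub>Q\<^esub>"
      using clinear_sm[OF lin ac, of "-1"] ac la by (simp add: Po.sm_minus_one)
    then have "mat 1 1 (\<lambda>_. \<ominus>\<^bsub>P m\<^esub> a) \<in> pcone (P m)" using a by (intro pc) auto
    moreover have "mat_smult (P m) (-1) (mat 1 1 (\<lambda>_. a)) = mat 1 1 (\<lambda>_. \<ominus>\<^bsub>P m\<^esub> a)"
      using ac by (intro eq_matI) (auto simp: mat_smult_def Po.sm_minus_one)
    ultimately have "mat 1 1 (\<lambda>_. a) = mat_zero (P m) 1"
      using Po.pc_antisym[OF pc[OF a la], of 1] Po.sa_mat1(1)[OF a] by simp
    then have "mat 1 1 (\<lambda>_. a) $$ (0, 0) = mat_zero (P m) 1 $$ (0, 0)" by simp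
    then show ?thesis by simp
  qed
  obtain a b where ab: "a \<in> Po.sa m" "b \<in> Po.sa m" "p = a \<oplus>\<^bsub>P m\<^esub> \<i> \<odot>\<^bsub>P m\<^esub> b" "adj (P m) p = a \<ominus>\<^bsub>P m\<^esub> \<i> \<odot>\<^bsub>P m\<^esub> b"
    using Po.sa_parts[OF p] by metis
  have c: "a \<in> carrier (P m)" "b \<in> carrier (P m)" using ab by auto
  have ps: "leg m (adj (P m) p) = \<zero>\<^bsub>Q\<^esub>" using ucp_star[OF P(1) Q(1) leg_ucp p] 0 by simp
  have a: "a = (1/2) \<odot>\<^bsub>P m\<^esub> (p \<oplus>\<^bsub>P m\<^esub> adj (P m) p)" unfolding ab(4) unfolding ab(3)
    using c by (intro Po.sep) (auto simp: Po.linfun_simps algebra_simps)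
  have b: "b = (- \<i> / 2) \<odot>\<^bsub>P m\<^esub> (p \<oplus>\<^bsub>P m\<^esub> (-1) \<odot>\<^bsub>P m\<^esub> adj (P m) p)" unfolding ab(4) unfolding ab(3)
    using c by (intro Po.sep) (auto simp: Po.linfun_simps algebra_simps)
  have "leg m a = \<zero>\<^bsub>Q\<^esub>" "leg m b = \<zero>\<^bsub>Q\<^esub>"
    unfolding a b using p 0 ps by (simp_all add: clinear_add[OF lin] clinear_sm[OF lin])
  then have "a = \<zero>\<^bsub>P m\<^esub>" "b = \<zero>\<^bsub>P m\<^esub>" using sa0 ab by auto
  then show ?thesis using ab(3) by simp
qed

lemma leg_eq_iff: "\<lbrakk>p \<in> carrier (P m); p' \<in> carrier (P m)\<rbrakk> \<Longrightarrow> leg m p = leg m p' \<longleftrightarrow> p = p'"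
proof
  assume p: "p \<in> carrier (P m)" "p' \<in> carrier (P m)" and eq: "leg m p = leg m p'"
  have "leg m (p \<ominus>\<^bsub>P m\<^esub> p') = \<zero>\<^bsub>Q\<^esub>"
    using clinear_minus[OF Po.complex_space Qo.complex_space ucp_clinear[OF leg_ucp] p] eq
      ucp_closed[OF leg_ucp p(2)] by (simp add: Qo.minus_eq Qo.r_neg)
  then have 0: "p \<ominus>\<^bsub>P m\<^esub> p' = \<zero>\<^bsub>P m\<^esub>" using leg_inj p by simp
  show "p = p'"
  proof (rule Po.sep[OF p])
    fix f assume f: "linfun (P m) f"
    show "f p = f p'" using Po.linfun_diff[OF f p] Po.linfun_zero[OF f] 0 by simp
  qed
qed simp

text \<open>A positive image is self-adjoint, and since \<open>leg m\<close> commutes with adjoints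
  and is injective, the matrix is self-adjoint too. Injectivity itself rests on the self-adjoint
  case, which is why that case comes first.\<close>

lemma leg_reflects:
  assumes X: "X \<in> mats (P m) n" and pos: "map_mat (leg m) X \<in> pcone Q"
  shows "X \<in> pcone (P m)"
proof (rule leg_reflects_sa[OF X _ pos])
  have Xr: "X \<in> Po.rm m n n" using X by (simp add: Po.mats_eq)
  have "map_mat (leg m) (mat_adj (P m) X) = map_mat (leg m) X"
    using map_mat_mstar[OF P(1) Q(1) leg_ucp Xr] Qo.pc_star[OF pos] by simp
  then have *: "leg m (mat_adj (P m) X $$ (i, i')) = leg m (X $$ (i, i'))" if "i < n" "i' < n" for i i'
    using Po.rm_dim[OF Xr] Po.rm_dim[OF Po.mstar_closed[OF Xr]] that by (metis index_map_mat(1))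
  show "mat_adj (P m) X = X"
  proof (rule Po.rm_eqI[OF Po.mstar_closed[OF Xr] Xr])
    fix i i' assume ii: "i < n" "i' < n"
    show "mat_adj (P m) X $$ (i, i') = X $$ (i, i')"
      using leg_eq_iff[OF Po.rm_entry[OF Po.mstar_closed[OF Xr] ii] Po.rm_entry[OF Xr ii]] *[OF ii] by simp
  qed
qed

end

context commuting_tensor_system
begin

text \<open>Finitely many elements of \<open>Y\<close> always come from one stage. So injectivity of
  the induced map and positivity of its inverse reduce to the corresponding properties of a single
  \<open>leg m\<close>.\<close>

theorem limit_isomorphic:
  assumes lim: "inductive_limit P \<Phi> Y \<xi>"
  shows "unitally_completely_order_isomorphic Y Q"
proof -
  have c: "compatible_maps P \<Phi> Y \<xi>" using lim by (simp add: inductive_limit_def)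
  have Y: "operator_system Y" and \<xi>: "ucp (P k) Y (\<xi> k)" for k using c by (simp_all add: compatible_maps_def)
  interpret Y: opsys Y by (rule opsys.intro[OF Y])
  have "compatible_maps P \<Phi> Q leg" using Q(1) leg_ucp leg_\<Phi> by (simp add: compatible_maps_def)
  then obtain \<mu> where \<mu>: "ucp Y Q \<mu>" and \<mu>\<xi>: "\<And>k p. p \<in> carrier (P k) \<Longrightarrow> \<mu> (\<xi> k p) = leg k p"
    by (rule inductive_limit_lift[OF lim]) (rule that)
  note lin = ucp_clinear[OF \<mu>]
  have Yc: "carrier Y = (\<Union>k. \<xi> k ` carrier (P k))" by (rule inductive_limit_carrier[OF P(1) connecting_ucp lim])
  have inj: "inj_on \<mu> (carrier Y)"
  proof (rule inj_onI)
    fix x y assume "x \<in> carrier Y" "y \<in> carrier Y" and eq: "\<mu> x = \<mu> y"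
    then obtain m n where "x \<in> \<xi> m ` carrier (P m)" "y \<in> \<xi> n ` carrier (P n)" unfolding Yc by blast
    then have "x \<in> \<xi> (max m n) ` carrier (P (max m n))" "y \<in> \<xi> (max m n) ` carrier (P (max m n))"
      using compatible_range_mono[OF connecting_ucp c, of m "max m n"] compatible_range_mono[OF connecting_ucp c, of n "max m n"]
      by auto
    then obtain p p' where p: "p \<in> carrier (P (max m n))" "p' \<in> carrier (P (max m n))"
      "x = \<xi> (max m n) p" "y = \<xi> (max m n) p'" by blast
    then show "x = y" using eq leg_eq_iff[OF p(1,2)] by (simp add: \<mu>\<xi>)
  qed
  have surj: "\<mu> ` carrier Y = carrier Q"
  proof
    show "\<mu> ` carrier Y \<subseteq> carrier Q" using clinear_closed[OF lin] by blast
    show "carrier Q \<subseteq> \<mu> ` carrier Y"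
    proof
      let ?E = "{\<eta> s x | s x. s \<in> carrier L \<and> x \<in> carrier T}"
      fix q assume "q \<in> carrier Q"
      then have q: "q \<in> cspan Q ?E" by (simp only: algebraic_tensor_span[OF Q(2), symmetric])
      show "q \<in> \<mu> ` carrier Y"
      proof (rule Qo.cspan_induct[of q ?E "\<lambda>q. q \<in> \<mu> ` carrier Y", OF q])
        show "?E \<subseteq> carrier Q" using cbilinear_closed[OF Q(3)] by blast
        fix q assume "q \<in> ?E"
        then obtain s x where sx: "q = \<eta> s x" "s \<in> carrier L" "x \<in> carrier T" by blast
        then obtain k s' where s': "s' \<in> carrier (S k)" "s = l k s'"
          using inductive_limit_carrier[OF S \<phi> limit] by auto
        have "q = \<mu> (\<xi> k (\<theta> k s' x))" using sx s' by (simp add: \<mu>\<xi> \<theta>_closed leg_\<theta>)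
        then show "q \<in> \<mu> ` carrier Y" using ucp_closed[OF \<xi> \<theta>_closed[OF s'(1) sx(3)]] by blast
      next
        have "\<mu> \<zero>\<^bsub>Y\<^esub> = \<zero>\<^bsub>Q\<^esub>" by (rule clinear_zero[OF Y.complex_space Qo.complex_space lin])
        then show "\<zero>\<^bsub>Q\<^esub> \<in> \<mu> ` carrier Y" using Y.zero_closed by force
      next
        fix q q' assume "q \<in> \<mu> ` carrier Y" "q' \<in> \<mu> ` carrier Y"
        then obtain y y' where y: "y \<in> carrier Y" "y' \<in> carrier Y" "q = \<mu> y" "q' = \<mu> y'" by blast
        then have "q \<oplus>\<^bsub>Q\<^esub> q' = \<mu> (y \<oplus>\<^bsub>Y\<^esub> y')" by (simp add: clinear_add[OF lin])
        then show "q \<oplus>\<^bsub>Q\<^esub> q' \<in> \<mu> ` carrier Y" using y by blast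
      next
        fix c q assume "q \<in> \<mu> ` carrier Y"
        then obtain y where y: "y \<in> carrier Y" "q = \<mu> y" by blast
        then have "c \<odot>\<^bsub>Q\<^esub> q = \<mu> (c \<odot>\<^bsub>Y\<^esub> y)" by (simp add: clinear_sm[OF lin])
        then show "c \<odot>\<^bsub>Q\<^esub> q \<in> \<mu> ` carrier Y" using y by blast
      qed
    qed
  qed
  let ?\<nu> = "inv_into (carrier Y) \<mu>"
  have \<nu>c: "?\<nu> q \<in> carrier Y" and \<mu>\<nu>: "\<mu> (?\<nu> q) = q" if "q \<in> carrier Q" for q
    using inv_into_into[of q \<mu> "carrier Y"] f_inv_into_f[of q \<mu> "carrier Y"] that surj by auto
  have \<nu>\<mu>: "?\<nu> (\<mu> y) = y" if "y \<in> carrier Y" for y by (rule inv_into_f_f[OF inj that])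
  have \<nu>lin: "clinear Q Y ?\<nu>"
    unfolding clinear_def
  proof (intro conjI ballI allI)
    show "?\<nu> \<in> carrier Q \<rightarrow> carrier Y" using \<nu>c by blast
    show "?\<nu> (x \<oplus>\<^bsub>Q\<^esub> y) = ?\<nu> x \<oplus>\<^bsub>Y\<^esub> ?\<nu> y" if "x \<in> carrier Q" "y \<in> carrier Q" for x y
      using \<nu>\<mu>[of "?\<nu> x \<oplus>\<^bsub>Y\<^esub> ?\<nu> y"] that by (simp add: clinear_add[OF lin] \<nu>c \<mu>\<nu>)
    show "?\<nu> (a \<odot>\<^bsub>Q\<^esub> x) = a \<odot>\<^bsub>Y\<^esub> ?\<nu> x" if "x \<in> carrier Q" for a x
      using \<nu>\<mu>[of "a \<odot>\<^bsub>Y\<^esub> ?\<nu> x"] that by (simp add: clinear_sm[OF lin] \<nu>c \<mu>\<nu>)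
  qed
  have "map_mat ?\<nu> Z \<in> pcone Y" if Z: "Z \<in> pcone Q" for Z
  proof -
    define n where "n = dim_row Z"
    have Zr: "Z \<in> Qo.rm n n" using Qo.pc_rm[OF Z] by (simp add: n_def)
    note Zd = Qo.rm_dim[OF Zr] and Ze = Qo.rm_entry[OF Zr]
    have "\<exists>k. ?\<nu> (Z $$ (i, j)) \<in> \<xi> k ` carrier (P k)" if "i < n" "j < n" for i j
      using \<nu>c[OF Ze[OF that]] unfolding Yc by blast
    then obtain K where K: "\<And>i j. \<lbrakk>i < n; j < n\<rbrakk> \<Longrightarrow> ?\<nu> (Z $$ (i, j)) \<in> \<xi> (K i j) ` carrier (P (K i j))" by metis
    \<comment> \<open>A common stage for the preimages of all entries of the matrix; the inserted 0
      keeps the maximum defined when n = 0.\<close>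
    define m where "m = Max (insert 0 ((\<lambda>(i, j). K i j) ` ({..<n} \<times> {..<n})))"
    have "?\<nu> (Z $$ (i, j)) \<in> \<xi> m ` carrier (P m)" if "i < n" "j < n" for i j
    proof -
      have "K i j \<le> m" unfolding m_def using that by (intro Max_ge) auto
      from subsetD[OF compatible_range_mono[OF connecting_ucp c this] K[OF that]] show ?thesis .
    qed
    then have "\<exists>p. p \<in> carrier (P m) \<and> ?\<nu> (Z $$ (i, j)) = \<xi> m p" if "i < n" "j < n" for i j
      using that by blast
    then obtain p where p: "\<And>i j. \<lbrakk>i < n; j < n\<rbrakk> \<Longrightarrow> p i j \<in> carrier (P m)"
      "\<And>i j. \<lbrakk>i < n; j < n\<rbrakk> \<Longrightarrow> ?\<nu> (Z $$ (i, j)) = \<xi> m (p i j)" by metis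
    let ?X = "mat n n (\<lambda>(i, j). p i j)"
    have X: "?X \<in> mats (P m) n" using p(1) by (auto simp: mats_entries)
    have leg: "leg m (p i j) = Z $$ (i, j)" if "i < n" "j < n" for i j
      using \<mu>\<xi>[OF p(1)[OF that]] p(2)[OF that] \<mu>\<nu>[OF Ze[OF that]] by simp
    have "map_mat (leg m) ?X = Z" using Zd leg by (intro eq_matI) auto
    then have "?X \<in> pcone (P m)" using leg_reflects[OF X] Z by simp
    moreover have "map_mat ?\<nu> Z = map_mat (\<xi> m) ?X" using Zd p(2) by (intro eq_matI) auto
    ultimately show ?thesis using ucp_pcone[OF \<xi>] by simp
  qed
  then have "complete_order_isomorphism Y Q \<mu>"
    using \<mu> lin \<nu>lin inj surj by (simp add: complete_order_isomorphism_def completely_positive_def ucp_def bij_betw_def)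
  then show ?thesis using ucp_one[OF \<mu>] unfolding unitally_completely_order_isomorphic_def by blast
qed

end

text \<open>Limits and tensor products enter as arbitrary objects with their defining properties,
  not as particular constructions, so the isomorphism holds for every choice of them.\<close>

theorem theorem4p39:
  fixes S :: "nat \<Rightarrow> 'w univ opsys" and \<phi> :: "nat \<Rightarrow> 'w univ \<Rightarrow> 'w univ"
    and T :: "'w univ opsys"
    and P :: "nat \<Rightarrow> 'w univ opsys" and \<theta> :: "nat \<Rightarrow> 'w univ \<Rightarrow> 'w univ \<Rightarrow> 'w univ"
    and \<Phi> :: "nat \<Rightarrow> 'w univ \<Rightarrow> 'w univ"
    and L :: "'w univ opsys" and l :: "nat \<Rightarrow> 'w univ \<Rightarrow> 'w univ"
    and Y :: "'w univ opsys" and \<xi> :: "nat \<Rightarrow> 'w univ \<Rightarrow> 'w univ"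
    and Q :: "'w univ opsys" and \<eta> :: "'w univ \<Rightarrow> 'w univ \<Rightarrow> 'w univ"
  assumes system: "inductive_system S \<phi>"
    and embedding: "\<And>k. complete_order_embedding (S k) (S (Suc k)) (\<phi> k)"
    and T: "operator_system T"
    and tensor: "\<And>k. commuting_tensor (S k) T (P k) (\<theta> k)"
    and connecting: "\<And>k. tensor_map (S k) T (P k) (\<theta> k) (P (Suc k)) (\<theta> (Suc k)) (\<phi> k) id (\<Phi> k)"
    and tensor_embedding: "\<And>k. complete_order_embedding (P k) (P (Suc k)) (\<Phi> k)"
    and limit: "inductive_limit S \<phi> L l"
    and limit_of_tensors: "inductive_limit P \<Phi> Y \<xi>"
    and tensor_of_limit: "commuting_tensor L T Q \<eta>"
  shows "unitally_completely_order_isomorphic Y Q"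
proof -
  interpret commuting_tensor_system S \<phi> T P \<theta> \<Phi> L l Q \<eta>
    by unfold_locales (fact system T tensor connecting tensor_embedding limit tensor_of_limit)+
  show ?thesis by (rule limit_isomorphic[OF limit_of_tensors])
qed

end
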